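(* Let $R$ be a commutative ring with identity and let $M$ be a $w$-module over $R$. Then the following statements are equivalent: (1) $M$ is $w$-Artinian; (2) $M$ is $w$-cofinitely generated, and for every prime $w$-ideal $\mathfrak{p}$ of $R$ with $(0:_R M)\subseteq \mathfrak{p}$ there exists a $w$-submodule $N^{\mathfrak{p}}$ of $M$ such that $(M/N^{\mathfrak{p}})_w$ is $w$-cofinitely generated and $(M[\mathfrak{p}])_w\subseteq N^{\mathfrak{p}}\subseteq (0:_M \mathfrak{p})$, where $M[\mathfrak{p}]=\bigcap_{s\in R\setminus \mathfrak{p}} s\,(0:_M\mathfrak{p})$.
   Context: All rings are commutative with identity and all modules are unitary. For an $R$-module $M$ and an ideal $I$ of $R$: $(0:_R M)=\{r\in R\mid rM=0\}$ and $(0:_M I)=\{m\in M\mid Im=0\}$. A finitely generated ideal $J$ of $R$ is a GV-ideal if the natural homomorphism $R\to \mathrm{Hom}_R(J,R)$, $r\mapsto (x\mapsto rx)$, is an isomorphism; $\mathrm{GV}(R)$ is the set of GV-ideals. For an $R$-module $M$, $\mathrm{tor}_{\mathrm{GV}}(M)=\{x\in M\mid Jx=0 \text{ for some } J\in \mathrm{GV}(R)\}$; $M$ is GV-torsion-free if $\mathrm{tor}_{\mathrm{GV}}(M)=0$. A GV-torsion-free module $M$ is a $w$-module if $\mathrm{Ext}^1_R(R/J,M)=0$ for all $J\in\mathrm{GV}(R)$. The $w$-envelope of a GV-torsion-free module $M$ is $M_w=\{x\in E(M)\mid Jx\subseteq M \text{ for some } J\in\mathrm{GV}(R)\}$, where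 $E(M)$ is the injective envelope of $M$; a GV-torsion-free module $M$ is a $w$-module iff $M_w=M$. For a submodule $N$ of a $w$-module $M$, $N_w$ is identified with the submodule $\{x\in M\mid Jx\subseteq N\text{ for some }J\in\mathrm{GV}(R)\}$ of $M$. If $N$ is a $w$-submodule of a GV-torsion-free module $M$, then $M/N$ is GV-torsion-free. A $w$-submodule is a submodule that is a $w$-module; a $w$-ideal of $R$ is an ideal that is a $w$-module; a prime $w$-ideal is a prime ideal that is a $w$-ideal. A $w$-module $M$ is $w$-Artinian if it satisfies the descending chain condition on $w$-submodules. A $w$-module $M$ is $w$-cofinitely generated if for every set $\{M_i\mid i\in\Omega\}$ of $w$-submodules of $M$ with $\bigcap_{i\in\Omega}M_i=0$ there is a finite subset $\Omega_0\subseteq\Omega$ with $\bigcap_{i\in\Omega_0}M_i=0$. *)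

theory Defs
  imports Complex_Main "HOL-Algebra.Algebra"
begin

text \<open>
  Modules are those of the locale \<^locale>\<open>module\<close>. The record type of modules extends that of
  rings, but the locale never looks at the fields \<open>mult\<close> and \<open>one\<close>, which are left undefined
  where there is no natural choice. A submodule \<open>N\<close> of \<open>M\<close> is a set, and it is regarded as a module
  in its own right as \<open>M\<lparr>carrier := N\<rparr>\<close>.
\<close>

section \<open>Homomorphisms, quotients, free modules\<close>

definition mod_hom ::
    "('a, 'r) ring_scheme \<Rightarrow> ('a, 'b, 'm) module_scheme \<Rightarrow> ('a, 'c, 'n) module_scheme \<Rightarrow> ('b \<Rightarrow> 'c) set"
  where "mod_hom R M N = {f \<in> carrier M \<rightarrow>\<^sub>E carrier N.
      (\<forall>x\<in>carrier M. \<forall>y\<in>carrier M. f (x \<oplus>\<^bsub>M\<^esub> y) = f x \<oplus>\<^bsub>N\<^esub> f y) \<and>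
      (\<forall>r\<in>carrier R. \<forall>x\<in>carrier M. f (r \<odot>\<^bsub>M\<^esub> x) = r \<odot>\<^bsub>N\<^esub> f x)}"

definition mod_iso ::
    "('a, 'r) ring_scheme \<Rightarrow> ('a, 'b, 'm) module_scheme \<Rightarrow> ('a, 'c, 'n) module_scheme \<Rightarrow> ('b \<Rightarrow> 'c) set"
  where "mod_iso R M N = {f \<in> mod_hom R M N. bij_betw f (carrier M) (carrier N)}"

definition Hom_mod ::
    "('a, 'r) ring_scheme \<Rightarrow> ('a, 'b, 'm) module_scheme \<Rightarrow> ('a, 'c, 'n) module_scheme \<Rightarrow> ('a, 'b \<Rightarrow> 'c) module"
  where "Hom_mod R M N =
    \<lparr>carrier = mod_hom R M N, monoid.mult = undefined, monoid.one = undefined,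
     ring.zero = (\<lambda>x\<in>carrier M. \<zero>\<^bsub>N\<^esub>),
     ring.add = (\<lambda>f g. \<lambda>x\<in>carrier M. f x \<oplus>\<^bsub>N\<^esub> g x),
     smult = (\<lambda>r f. \<lambda>x\<in>carrier M. r \<odot>\<^bsub>N\<^esub> f x)\<rparr>"

definition ring_mod :: "('a, 'r) ring_scheme \<Rightarrow> ('a, 'a) module"
  where "ring_mod R =
    \<lparr>carrier = carrier R, monoid.mult = monoid.mult R, monoid.one = monoid.one R,
     ring.zero = ring.zero R, ring.add = ring.add R, smult = monoid.mult R\<rparr>"

definition quot_mod ::
    "('a, 'r) ring_scheme \<Rightarrow> ('a, 'b, 'm) module_scheme \<Rightarrow> 'b set \<Rightarrow> ('a, 'b set) module"
  where "quot_mod R M N =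
    \<lparr>carrier = a_rcosets\<^bsub>M\<^esub> N, monoid.mult = undefined, monoid.one = undefined,
     ring.zero = N,
     ring.add = (\<lambda>C D. C <+>\<^bsub>M\<^esub> D),
     smult = (\<lambda>r C. \<Union>x\<in>C. N +>\<^bsub>M\<^esub> (r \<odot>\<^bsub>M\<^esub> x))\<rparr>"

text \<open>The free module on a set \<open>S\<close>: finitely supported families of coefficients.\<close>

definition free_mod :: "('a, 'r) ring_scheme \<Rightarrow> 'c set \<Rightarrow> ('a, 'c \<Rightarrow> 'a) module"
  where "free_mod R S =
    \<lparr>carrier = {f. (\<forall>x. f x \<in> carrier R) \<and> (\<forall>x. x \<notin> S \<longrightarrow> f x = \<zero>\<^bsub>R\<^esub>) \<and> finite {x. f x \<noteq> \<zero>\<^bsub>R\<^esub>}},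
     monoid.mult = undefined, monoid.one = undefined,
     ring.zero = (\<lambda>x. \<zero>\<^bsub>R\<^esub>),
     ring.add = (\<lambda>f g x. f x \<oplus>\<^bsub>R\<^esub> g x),
     smult = (\<lambda>r f x. r \<otimes>\<^bsub>R\<^esub> f x)\<rparr>"

text \<open>The evaluation map from the free module on (the elements of) \<open>N\<close> onto \<open>N\<close>.\<close>

definition free_eval ::
    "('a, 'r) ring_scheme \<Rightarrow> ('a, 'c, 'n) module_scheme \<Rightarrow> ('c \<Rightarrow> 'a) \<Rightarrow> 'c"
  where "free_eval R N f = finsum N (\<lambda>x. f x \<odot>\<^bsub>N\<^esub> x) {x. f x \<noteq> \<zero>\<^bsub>R\<^esub>}"

definition free_ker ::
    "('a, 'r) ring_scheme \<Rightarrow> ('a, 'c, 'n) module_scheme \<Rightarrow> ('c \<Rightarrow> 'a) set"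
  where "free_ker R N = {f \<in> carrier (free_mod R (carrier N)). free_eval R N f = \<zero>\<^bsub>N\<^esub>}"

section \<open>The functor Ext\<close>

text \<open>
  Every module \<open>N\<close> has the canonical free resolution \<open>\<cdots> \<rightarrow> F2 \<rightarrow> F1 \<rightarrow> F0 \<rightarrow> N \<rightarrow> 0\<close>, where
  \<open>F0\<close> is the free module on the elements of \<open>N\<close>, \<open>F1\<close> the free module on the elements of the
  kernel \<open>syz1\<close> of \<open>F0 \<rightarrow> N\<close>, and \<open>F2\<close> the free module on the elements of the kernel \<open>syz2\<close> of
  \<open>F1 \<rightarrow> F0\<close>; the maps are the evaluation maps. \<open>Ext1 R N M\<close> is the first cohomology module
  of the complex \<open>Hom(F0, M) \<rightarrow> Hom(F1, M) \<rightarrow> Hom(F2, M)\<close>.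
\<close>

definition syz1 ::
    "('a, 'r) ring_scheme \<Rightarrow> ('a, 'c, 'n) module_scheme \<Rightarrow> ('a, 'c \<Rightarrow> 'a) module"
  where "syz1 R N = (free_mod R (carrier N))\<lparr>carrier := free_ker R N\<rparr>"

definition syz2 ::
    "('a, 'r) ring_scheme \<Rightarrow> ('a, 'c, 'n) module_scheme \<Rightarrow> ('a, ('c \<Rightarrow> 'a) \<Rightarrow> 'a) module"
  where "syz2 R N = syz1 R (syz1 R N)"

definition Ext1_cocycles ::
    "('a, 'r) ring_scheme \<Rightarrow> ('a, 'c, 'n) module_scheme \<Rightarrow> ('a, 'b, 'm) module_scheme
      \<Rightarrow> ((('c \<Rightarrow> 'a) \<Rightarrow> 'a) \<Rightarrow> 'b) set"
  where "Ext1_cocycles R N M =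
    {f \<in> mod_hom R (free_mod R (carrier (syz1 R N))) M.
      \<forall>z\<in>carrier (free_mod R (carrier (syz2 R N))). f (free_eval R (syz2 R N) z) = \<zero>\<^bsub>M\<^esub>}"

definition Ext1_coboundaries ::
    "('a, 'r) ring_scheme \<Rightarrow> ('a, 'c, 'n) module_scheme \<Rightarrow> ('a, 'b, 'm) module_scheme
      \<Rightarrow> ((('c \<Rightarrow> 'a) \<Rightarrow> 'a) \<Rightarrow> 'b) set"
  where "Ext1_coboundaries R N M =
    (\<lambda>g. \<lambda>z\<in>carrier (free_mod R (carrier (syz1 R N))). g (free_eval R (syz1 R N) z))
      ` mod_hom R (free_mod R (carrier N)) M"

definition Ext1 ::
    "('a, 'r) ring_scheme \<Rightarrow> ('a, 'c, 'n) module_scheme \<Rightarrow> ('a, 'b, 'm) module_scheme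
      \<Rightarrow> ('a, ((('c \<Rightarrow> 'a) \<Rightarrow> 'a) \<Rightarrow> 'b) set) module"
  where "Ext1 R N M =
    quot_mod R
      ((Hom_mod R (free_mod R (carrier (syz1 R N))) M)\<lparr>carrier := Ext1_cocycles R N M\<rparr>)
      (Ext1_coboundaries R N M)"

section \<open>Injective envelopes\<close>

text \<open>
  Injectivity is the usual lifting property. A HOL formula cannot quantify over types, so the
  test modules \<open>B\<close> are those carried by the type \<open>'a + 'e\<close>, which contains copies of the ring
  \<open>R\<close> (over \<open>'a\<close>) and of the module \<open>E\<close> (over \<open>'e\<close>). As \<open>R\<close> is among the test modules,
  Baer's criterion shows that the lifting property then holds for test modules over any type.
\<close>

definition injective_module ::
    "('a, 'r) ring_scheme \<Rightarrow> ('a, 'e, 'm) module_scheme \<Rightarrow> bool"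
  where "injective_module R E \<longleftrightarrow> module R E \<and>
    (\<forall>(B :: ('a, 'a + 'e) module) A. module R B \<and> submodule A R B \<longrightarrow>
      (\<forall>f\<in>mod_hom R (B\<lparr>carrier := A\<rparr>) E. \<exists>g\<in>mod_hom R B E. \<forall>x\<in>A. g x = f x))"

definition injective_envelope ::
    "('a, 'r) ring_scheme \<Rightarrow> ('a, 'b, 'm) module_scheme \<Rightarrow> ('a, 'e, 'n) module_scheme
      \<Rightarrow> ('b \<Rightarrow> 'e) \<Rightarrow> bool"
  where "injective_envelope R M E i \<longleftrightarrow>
    injective_module R E \<and> i \<in> mod_hom R M E \<and> inj_on i (carrier M) \<and>
    (\<forall>K. submodule K R E \<and> K \<inter> i ` carrier M = {\<zero>\<^bsub>E\<^esub>} \<longrightarrow> K = {\<zero>\<^bsub>E\<^esub>})"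

text \<open>
  A chosen injective envelope of \<open>M\<close>. The type is large enough for every module \<open>M\<close> over
  \<open>'b\<close>: as an abelian group, \<open>M\<close> is a quotient of the free abelian group on \<open>M\<close>, hence embeds
  into a divisible quotient \<open>D\<close> of the rational vector space on \<open>M\<close>, whose elements are cosets
  of type \<open>('b \<Rightarrow> rat) set\<close>. Then \<open>M\<close> embeds into the injective module of additive maps from
  \<open>R\<close> to \<open>D\<close>, which contains an injective envelope of \<open>M\<close>.
\<close>

definition inj_env ::
    "('a, 'r) ring_scheme \<Rightarrow> ('a, 'b, 'm) module_scheme
      \<Rightarrow> ('a, 'a \<Rightarrow> ('b \<Rightarrow> rat) set) module \<times> ('b \<Rightarrow> 'a \<Rightarrow> ('b \<Rightarrow> rat) set)"
  where "inj_env R M = (SOME p. injective_envelope R M (fst p) (snd p))"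

section \<open>GV-ideals and w-modules\<close>

definition GV_ideal :: "('a, 'r) ring_scheme \<Rightarrow> 'a set \<Rightarrow> bool"
  where "GV_ideal R J \<longleftrightarrow>
    ideal J R \<and> (\<exists>S. finite S \<and> S \<subseteq> carrier R \<and> J = genideal R S) \<and>
    (\<lambda>r\<in>carrier R. \<lambda>x\<in>J. r \<otimes>\<^bsub>R\<^esub> x)
      \<in> mod_iso R (ring_mod R) (Hom_mod R ((ring_mod R)\<lparr>carrier := J\<rparr>) (ring_mod R))"

definition tor_GV :: "('a, 'r) ring_scheme \<Rightarrow> ('a, 'b, 'm) module_scheme \<Rightarrow> 'b set"
  where "tor_GV R M = {x \<in> carrier M. \<exists>J. GV_ideal R J \<and> (\<forall>j\<in>J. j \<odot>\<^bsub>M\<^esub> x = \<zero>\<^bsub>M\<^esub>)}"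

definition GV_torsion_free :: "('a, 'r) ring_scheme \<Rightarrow> ('a, 'b, 'm) module_scheme \<Rightarrow> bool"
  where "GV_torsion_free R M \<longleftrightarrow> tor_GV R M = {\<zero>\<^bsub>M\<^esub>}"

definition w_module :: "('a, 'r) ring_scheme \<Rightarrow> ('a, 'b, 'm) module_scheme \<Rightarrow> bool"
  where "w_module R M \<longleftrightarrow> module R M \<and> GV_torsion_free R M \<and>
    (\<forall>J. GV_ideal R J \<longrightarrow>
      (let E = Ext1 R (quot_mod R (ring_mod R) J) M in carrier E = {\<zero>\<^bsub>E\<^esub>}))"

definition w_envelope ::
    "('a, 'r) ring_scheme \<Rightarrow> ('a, 'b, 'm) module_scheme \<Rightarrow> ('a, 'a \<Rightarrow> ('b \<Rightarrow> rat) set) module"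
  where "w_envelope R M =
    (let E = fst (inj_env R M); i = snd (inj_env R M)
     in E\<lparr>carrier := {x \<in> carrier E. \<exists>J. GV_ideal R J \<and> (\<forall>j\<in>J. j \<odot>\<^bsub>E\<^esub> x \<in> i ` carrier M)}\<rparr>)"

text \<open>The envelope of a submodule \<open>N\<close> of a w-module \<open>M\<close>, identified with a submodule of \<open>M\<close>.\<close>

definition w_closure ::
    "('a, 'r) ring_scheme \<Rightarrow> ('a, 'b, 'm) module_scheme \<Rightarrow> 'b set \<Rightarrow> 'b set"
  where "w_closure R M N =
    {x \<in> carrier M. \<exists>J. GV_ideal R J \<and> (\<forall>j\<in>J. j \<odot>\<^bsub>M\<^esub> x \<in> N)}"

definition w_submodule :: "('a, 'r) ring_scheme \<Rightarrow> ('a, 'b, 'm) module_scheme \<Rightarrow> 'b set \<Rightarrow> bool"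
  where "w_submodule R M N \<longleftrightarrow> submodule N R M \<and> w_module R (M\<lparr>carrier := N\<rparr>)"

definition w_ideal :: "('a, 'r) ring_scheme \<Rightarrow> 'a set \<Rightarrow> bool"
  where "w_ideal R I \<longleftrightarrow> ideal I R \<and> w_module R ((ring_mod R)\<lparr>carrier := I\<rparr>)"

definition prime_w_ideal :: "('a, 'r) ring_scheme \<Rightarrow> 'a set \<Rightarrow> bool"
  where "prime_w_ideal R P \<longleftrightarrow> primeideal P R \<and> w_ideal R P"

definition w_Artinian :: "('a, 'r) ring_scheme \<Rightarrow> ('a, 'b, 'm) module_scheme \<Rightarrow> bool"
  where "w_Artinian R M \<longleftrightarrow> w_module R M \<and>
    (\<forall>N :: nat \<Rightarrow> 'b set. (\<forall>n. w_submodule R M (N n)) \<and> (\<forall>n. N (Suc n) \<subseteq> N n) \<longrightarrow>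
      (\<exists>n. \<forall>k\<ge>n. N k = N n))"

text \<open>Intersections of submodules are taken inside \<open>M\<close>: the empty one is \<open>M\<close>.\<close>

definition w_cofinitely_generated ::
    "('a, 'r) ring_scheme \<Rightarrow> ('a, 'b, 'm) module_scheme \<Rightarrow> bool"
  where "w_cofinitely_generated R M \<longleftrightarrow> w_module R M \<and>
    (\<forall>\<S>. (\<forall>N\<in>\<S>. w_submodule R M N) \<and> carrier M \<inter> \<Inter>\<S> = {\<zero>\<^bsub>M\<^esub>} \<longrightarrow>
      (\<exists>\<T>. finite \<T> \<and> \<T> \<subseteq> \<S> \<and> carrier M \<inter> \<Inter>\<T> = {\<zero>\<^bsub>M\<^esub>}))"

section \<open>Annihilators\<close>

definition ann_ring :: "('a, 'r) ring_scheme \<Rightarrow> ('a, 'b, 'm) module_scheme \<Rightarrow> 'a set"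
  where "ann_ring R M = {r \<in> carrier R. \<forall>x\<in>carrier M. r \<odot>\<^bsub>M\<^esub> x = \<zero>\<^bsub>M\<^esub>}"

definition ann_mod :: "('a, 'b, 'm) module_scheme \<Rightarrow> 'a set \<Rightarrow> 'b set"
  where "ann_mod M I = {x \<in> carrier M. \<forall>r\<in>I. r \<odot>\<^bsub>M\<^esub> x = \<zero>\<^bsub>M\<^esub>}"

text \<open>The submodule \<open>M[P]\<close>, for a prime ideal \<open>P\<close> (so that the index set is nonempty).\<close>

definition prime_part ::
    "('a, 'r) ring_scheme \<Rightarrow> ('a, 'b, 'm) module_scheme \<Rightarrow> 'a set \<Rightarrow> 'b set"
  where "prime_part R M P = (\<Inter>s \<in> carrier R - P. (\<lambda>x. s \<odot>\<^bsub>M\<^esub> x) ` ann_mod M P)"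

end

theory Submission
  imports Defs
begin

text \<open>
  Call a submodule \<open>L\<close> of the w-module \<open>M\<close> closed if \<open>J x \<subseteq> L\<close> with \<open>J\<close> a GV-ideal implies \<open>x \<in> L\<close>.
  The closed submodules are the w-submodules, and \<open>(M/N)\<^sub>w\<close> is w-cofinitely generated iff every
  family of closed submodules with intersection \<open>N\<close> has a finite subfamily with intersection \<open>N\<close>;
  hence \<open>M\<close> is w-Artinian iff this holds for every closed \<open>N\<close>, which gives (1) \<open>\<Longrightarrow>\<close> (2) with
  \<open>(0 :\<^sub>M P)\<close> as the submodule attached to \<open>P\<close>.

  For (2) \<open>\<Longrightarrow>\<close> (1), let \<open>N\<close> be minimal among the closed submodules for which \<open>M/N\<close> is bad. Then \<open>N\<close>
  satisfies the descending chain condition, \<open>p = ann N\<close> is a prime w-ideal, and \<open>s N\<close> is dense in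
  \<open>N\<close> for \<open>s \<notin> p\<close>. As \<open>M\<close> is w-cofinitely generated, the zero divisors on \<open>M\<close> lie in finitely
  many prime w-ideals, so prime avoidance makes a GV-ideal contain an element that is bijective on
  \<open>N\<close>; therefore \<open>s N = N\<close>, and \<open>N \<subseteq> M[p] \<subseteq> Q\<close> where \<open>Q\<close> is the submodule attached to \<open>p\<close>.
  It remains to see that \<open>Q/N\<close> is good, which contradicts the choice of \<open>N\<close>. If \<open>p\<close> annihilates a
  simple closed submodule, then \<open>Q\<close> is semisimple. Otherwise every element of \<open>Q\<close> is killed
  outside \<open>p\<close>, one picks \<open>a \<notin> p\<close> in all annihilators of simple closed submodules of \<open>Q\<close>, and
  Nakayama's lemma shows that the kernel of \<open>a\<close> on \<open>Q/N\<close>, which is good, is essential.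
\<close>

section \<open>GV-ideals\<close>

text \<open>Two facts that are free for ordinary modules have to be earned here. A quotient of a
  w-module by a w-submodule is only GV-torsion-free, so \<open>(M/N)\<^sub>w\<close> sits in an
  injective envelope; working with families of closed submodules of M avoids it, at the price that
  every isomorphism theorem holds only up to multiplication by a GV-ideal. And the minimality of N
  yields only that s N is dense, whereas M[p] is built from honest multiples s (0 : p); closing this
  gap is what needs the vanishing of Ext. A minimal bad N exists because the intersection of a chain
  of bad closed submodules is bad: were it good, finitely many members would already have this
  intersection, so it would be a member of the chain. The two cases for Q ask whether p behaves like
  a maximal ideal: if p annihilates a simple closed submodule exactly, each t outside p is
  invertible modulo p up to a GV-ideal. The envelope is picked by \<open>SOME\<close> and Ext comes
  from a fixed free resolution, so the existence of an envelope over the prescribed type and the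
  reading of Ext as an extension problem are proved as well.\<close>

lemma mod_homI:
  assumes "\<And>x. x \<in> carrier M \<Longrightarrow> f x \<in> carrier N" "f \<in> extensional (carrier M)"
    and "\<And>x y. x \<in> carrier M \<Longrightarrow> y \<in> carrier M \<Longrightarrow> f (x \<oplus>\<^bsub>M\<^esub> y) = f x \<oplus>\<^bsub>N\<^esub> f y"
    and "\<And>r x. r \<in> carrier R \<Longrightarrow> x \<in> carrier M \<Longrightarrow> f (r \<odot>\<^bsub>M\<^esub> x) = r \<odot>\<^bsub>N\<^esub> f x"
  shows "f \<in> mod_hom R M N"
  using assms by (auto simp: mod_hom_def PiE_def)

lemma mod_homD:
  assumes "f \<in> mod_hom R M N"
  shows "\<And>x. x \<in> carrier M \<Longrightarrow> f x \<in> carrier N" "f \<in> extensional (carrier M)"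
    and "\<And>x y. x \<in> carrier M \<Longrightarrow> y \<in> carrier M \<Longrightarrow> f (x \<oplus>\<^bsub>M\<^esub> y) = f x \<oplus>\<^bsub>N\<^esub> f y"
    and "\<And>r x. r \<in> carrier R \<Longrightarrow> x \<in> carrier M \<Longrightarrow> f (r \<odot>\<^bsub>M\<^esub> x) = r \<odot>\<^bsub>N\<^esub> f x"
  using assms by (auto simp: mod_hom_def PiE_def)

lemma mod_hom_zero:
  assumes "f \<in> mod_hom R M N" "module R M" "module R N"
  shows "f \<zero>\<^bsub>M\<^esub> = \<zero>\<^bsub>N\<^esub>"
proof -
  interpret M: module R M by fact
  interpret N: module R N by fact
  have "f (\<zero>\<^bsub>R\<^esub> \<odot>\<^bsub>M\<^esub> \<zero>\<^bsub>M\<^esub>) = \<zero>\<^bsub>R\<^esub> \<odot>\<^bsub>N\<^esub> f \<zero>\<^bsub>M\<^esub>"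
    using mod_homD(4)[OF assms(1)] by blast
  then show ?thesis using mod_homD(1)[OF assms(1)] by simp
qed

lemma mod_hom_minus:
  assumes "f \<in> mod_hom R M N" "module R M" "module R N" "x \<in> carrier M"
  shows "f (\<ominus>\<^bsub>M\<^esub> x) = \<ominus>\<^bsub>N\<^esub> f x"
proof -
  interpret M: module R M by fact
  interpret N: module R N by fact
  have "f (\<ominus>\<^bsub>M\<^esub> x) \<oplus>\<^bsub>N\<^esub> f x = \<zero>\<^bsub>N\<^esub>"
    using mod_homD(3)[OF assms(1), of "\<ominus>\<^bsub>M\<^esub> x" x] mod_hom_zero[OF assms(1-3)] assms(4)
    by (simp add: M.l_neg)
  then show ?thesis using mod_homD(1)[OF assms(1)] assms(4)
    by (metis M.a_inv_closed N.minus_equality)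
qed

lemma (in cring) ring_mod_module: "module R (ring_mod R)"
proof (rule moduleI)
  show "abelian_group (ring_mod R)"
    by (rule abelian_groupI) (auto simp: ring_mod_def a_ac intro!: bexI[of _ "\<ominus> _"] l_neg)
qed (auto simp: ring_mod_def is_cring l_distr r_distr m_assoc)

lemma ring_mod_simps [simp]:
  "carrier (ring_mod R) = carrier R" "add (ring_mod R) = add R" "\<zero>\<^bsub>ring_mod R\<^esub> = \<zero>\<^bsub>R\<^esub>"
  "smult (ring_mod R) = monoid.mult R"
  by (auto simp: ring_mod_def)

lemma a_inv_ring_mod [simp]: "\<ominus>\<^bsub>ring_mod R\<^esub> x = \<ominus>\<^bsub>R\<^esub> x"
  by (simp add: a_inv_def m_inv_def)

lemma (in cring) ideal_iff_submodule: "ideal I R \<longleftrightarrow> submodule I R (ring_mod R)"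
proof -
  interpret rm: module R "ring_mod R" by (rule ring_mod_module)
  show ?thesis
  proof
    assume "ideal I R"
    then interpret ideal I R .
    show "submodule I R (ring_mod R)"
      by (rule rm.submoduleI) (auto intro: I_l_closed)
  next
    assume I: "submodule I R (ring_mod R)"
    note E = rm.submoduleE[OF I, simplified]
    show "ideal I R"
    proof (rule idealI)
      show "subgroup I (add_monoid R)"
        by (rule add.subgroupI) (use E in auto)
      show 1: "x \<otimes> a \<in> I" if "a \<in> I" "x \<in> carrier R" for a x
        using E(4) that by blast
      show "a \<otimes> x \<in> I" if "a \<in> I" "x \<in> carrier R" for a x
        using 1[OF that] that E(1) m_comm[of a x] by auto
    qed (rule ring_axioms)
  qed
qed

context cring
begin

text \<open>The map r to multiplication by r is always a homomorphism, so only bijectivity matters: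
  injectivity says that J has zero annihilator, surjectivity that each homomorphism from J to R is a
  multiplication. All later uses of GV-ideals go through these two halves.\<close>

lemma GV_criterion:
  assumes "ideal J R"
  shows "(\<lambda>r\<in>carrier R. \<lambda>x\<in>J. r \<otimes> x)
      \<in> mod_iso R (ring_mod R) (Hom_mod R ((ring_mod R)\<lparr>carrier := J\<rparr>) (ring_mod R)) \<longleftrightarrow>
    (\<forall>r\<in>carrier R. (\<forall>x\<in>J. r \<otimes> x = \<zero>) \<longrightarrow> r = \<zero>) \<and>
    (\<forall>f\<in>mod_hom R ((ring_mod R)\<lparr>carrier := J\<rparr>) (ring_mod R). \<exists>r\<in>carrier R. \<forall>x\<in>J. f x = r \<otimes> x)"
    (is "?F \<in> _ \<longleftrightarrow> ?inj \<and> ?surj")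
proof -
  interpret J: ideal J R by fact
  let ?H = "mod_hom R ((ring_mod R)\<lparr>carrier := J\<rparr>) (ring_mod R)"
  have mem: "(\<lambda>x\<in>J. r \<otimes> x) \<in> ?H" if "r \<in> carrier R" for r
    using that by (intro mod_homI) (auto simp: r_distr m_lcomm J.I_l_closed)
  have hom: "?F \<in> mod_hom R (ring_mod R) (Hom_mod R ((ring_mod R)\<lparr>carrier := J\<rparr>) (ring_mod R))"
    by (rule mod_homI) (auto simp: Hom_mod_def mem l_distr m_assoc intro!: restrict_ext)
  have inj: "inj_on ?F (carrier R) \<longleftrightarrow> ?inj"
  proof
    assume i: "inj_on ?F (carrier R)"
    show ?inj
    proof (intro ballI impI)
      fix r assume r: "r \<in> carrier R" "\<forall>x\<in>J. r \<otimes> x = \<zero>"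
      then have "?F r = ?F \<zero>" by (auto intro!: restrict_ext)
      then show "r = \<zero>" using i r by (auto dest: inj_onD)
    qed
  next
    assume i: ?inj
    show "inj_on ?F (carrier R)"
    proof (rule inj_onI)
      fix r s assume rs: "r \<in> carrier R" "s \<in> carrier R" "?F r = ?F s"
      then have "r \<otimes> x = s \<otimes> x" if "x \<in> J" for x
        using that by (auto dest: fun_cong[of _ _ x])
      then have "\<forall>x\<in>J. (r \<ominus> s) \<otimes> x = \<zero>"
        using rs by (simp add: a_minus_def l_distr l_minus r_neg)
      then show "r = s" using i rs by (meson minus_closed r_right_minus_eq)
    qed
  qed
  have surj: "?F ` carrier R = ?H \<longleftrightarrow> ?surj"
  proof
    assume i: "?F ` carrier R = ?H"
    show ?surj
    proof
      fix f assume "f \<in> ?H"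
      then obtain r where "r \<in> carrier R" "f = ?F r" using i by blast
      then show "\<exists>r\<in>carrier R. \<forall>x\<in>J. f x = r \<otimes> x" by (intro bexI[of _ r]) auto
    qed
  next
    assume i: ?surj
    have "f \<in> ?F ` carrier R" if f: "f \<in> ?H" for f
    proof -
      obtain r where r: "r \<in> carrier R" "\<forall>x\<in>J. f x = r \<otimes> x" using i f by blast
      have "f = ?F r"
        using r mod_homD(2)[OF f] by (auto simp: extensional_def fun_eq_iff)
      then show ?thesis using r by blast
    qed
    then show "?F ` carrier R = ?H" using mem by auto
  qed
  show ?thesis
    using hom inj surj by (simp add: mod_iso_def bij_betw_def Hom_mod_def)
qed

lemma GV_idealI:
  assumes "ideal J R" "finite S" "S \<subseteq> carrier R" "J = genideal R S"
    and "\<And>r. r \<in> carrier R \<Longrightarrow> (\<And>x. x \<in> J \<Longrightarrow> r \<otimes> x = \<zero>) \<Longrightarrow> r = \<zero>"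
    and "\<And>f. f \<in> mod_hom R ((ring_mod R)\<lparr>carrier := J\<rparr>) (ring_mod R) \<Longrightarrow> \<exists>r\<in>carrier R. \<forall>x\<in>J. f x = r \<otimes> x"
  shows "GV_ideal R J"
  unfolding GV_ideal_def using assms GV_criterion[OF assms(1)] by blast

lemma GV_idealD:
  assumes "GV_ideal R J"
  shows "ideal J R" "\<exists>S. finite S \<and> S \<subseteq> carrier R \<and> J = genideal R S"
    and "\<And>r. r \<in> carrier R \<Longrightarrow> (\<And>x. x \<in> J \<Longrightarrow> r \<otimes> x = \<zero>) \<Longrightarrow> r = \<zero>"
    and "\<And>f. f \<in> mod_hom R ((ring_mod R)\<lparr>carrier := J\<rparr>) (ring_mod R) \<Longrightarrow> \<exists>r\<in>carrier R. \<forall>x\<in>J. f x = r \<otimes> x"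
  using assms GV_criterion[of J] unfolding GV_ideal_def by blast+

text \<open>The trivial GV-ideal: it makes the closure operator extensive and starts inductions over
  finite sets.\<close>

lemma GV_ideal_carrier: "GV_ideal R (carrier R)"
proof (rule GV_idealI)
  show "carrier R = Idl {\<one>}" by (simp add: genideal_one)
next
  fix f assume "f \<in> mod_hom R ((ring_mod R)\<lparr>carrier := carrier R\<rparr>) (ring_mod R)"
  note f = mod_homD[OF this, simplified]
  have "f x = f \<one> \<otimes> x" if "x \<in> carrier R" for x
    using that f(4)[of x \<one>] f(1)[of \<one>] by (simp add: m_comm)
  then show "\<exists>r\<in>carrier R. \<forall>x\<in>carrier R. f x = r \<otimes> x"
    using f(1)[of \<one>] by blast
next
  fix r assume "r \<in> carrier R" "\<And>x. x \<in> carrier R \<Longrightarrow> r \<otimes> x = \<zero>"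
  from this(2)[of \<one>] this(1) show "r = \<zero>" by simp
qed (auto intro: oneideal)

text \<open>Supplies finite generation of a product of GV-ideals. The nontrivial inclusion applies
  minimality of a generated ideal twice, once in each factor.\<close>

lemma ideal_prod_genideal:
  assumes "S \<subseteq> carrier R" "T \<subseteq> carrier R"
  shows "(Idl S) \<cdot> (Idl T) = Idl (S <#> T)"
proof
  have ST: "S <#> T \<subseteq> carrier R" using assms by (auto simp: set_mult_def)
  have I: "ideal (Idl S) R" "ideal (Idl T) R" "ideal (Idl (S <#> T)) R"
    using assms ST by (auto intro: genideal_ideal)
  interpret K: ideal "Idl (S <#> T)" R by (rule I)
  \<comment> \<open>This colon ideal is used with A = T to pass from S to \<open>Idl S\<close>, then
    with A = \<open>Idl S\<close> to pass from T to \<open>Idl T\<close>.\<close>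
  have colon: "ideal {a \<in> carrier R. \<forall>t\<in>A. a \<otimes> t \<in> Idl (S <#> T)} R" if A: "A \<subseteq> carrier R" for A
  proof (rule idealI)
    show "subgroup {a \<in> carrier R. \<forall>t\<in>A. a \<otimes> t \<in> Idl (S <#> T)} (add_monoid R)"
    proof (rule add.subgroupI)
      fix a b assume "a \<in> {a \<in> carrier R. \<forall>t\<in>A. a \<otimes> t \<in> Idl (S <#> T)}"
        "b \<in> {a \<in> carrier R. \<forall>t\<in>A. a \<otimes> t \<in> Idl (S <#> T)}"
      then show "a \<oplus> b \<in> {a \<in> carrier R. \<forall>t\<in>A. a \<otimes> t \<in> Idl (S <#> T)}"
        using A by (auto simp: l_distr subset_iff)
    next
      fix a assume "a \<in> {a \<in> carrier R. \<forall>t\<in>A. a \<otimes> t \<in> Idl (S <#> T)}"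
      then show "\<ominus> a \<in> {a \<in> carrier R. \<forall>t\<in>A. a \<otimes> t \<in> Idl (S <#> T)}"
        using A by (auto simp: l_minus subset_iff)
    qed (use A in \<open>auto intro!: exI[of _ \<zero>] simp: subset_iff\<close>)
    fix a x assume "a \<in> {a \<in> carrier R. \<forall>t\<in>A. a \<otimes> t \<in> Idl (S <#> T)}" "x \<in> carrier R"
    then show "x \<otimes> a \<in> {a \<in> carrier R. \<forall>t\<in>A. a \<otimes> t \<in> Idl (S <#> T)}"
      using A by (auto simp: m_assoc subset_iff K.I_l_closed)
    then show "a \<otimes> x \<in> {a \<in> carrier R. \<forall>t\<in>A. a \<otimes> t \<in> Idl (S <#> T)}"
      using \<open>x \<in> carrier R\<close> \<open>a \<in> _\<close> by (auto simp: m_comm)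
  qed (rule ring_axioms)
  have 1: "a \<otimes> t \<in> Idl (S <#> T)" if "a \<in> Idl S" "t \<in> T" for a t
  proof -
    have "Idl S \<subseteq> {a \<in> carrier R. \<forall>t\<in>T. a \<otimes> t \<in> Idl (S <#> T)}"
    proof (rule genideal_minimal[OF colon])
      show "S \<subseteq> {a \<in> carrier R. \<forall>t\<in>T. a \<otimes> t \<in> Idl (S <#> T)}"
        using assms genideal_self[OF ST] by (fastforce simp: set_mult_def)
    qed (use assms in auto)
    then show ?thesis using that by blast
  qed
  have 2: "a \<otimes> b \<in> Idl (S <#> T)" if "a \<in> Idl S" "b \<in> Idl T" for a b
  proof -
    have SR: "Idl S \<subseteq> carrier R" by (meson I(1) ideal.Icarr subsetI)
    have "Idl T \<subseteq> {a \<in> carrier R. \<forall>t\<in>Idl S. a \<otimes> t \<in> Idl (S <#> T)}"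
    proof (rule genideal_minimal[OF colon])
      show "T \<subseteq> {a \<in> carrier R. \<forall>t\<in>Idl S. a \<otimes> t \<in> Idl (S <#> T)}"
        using assms 1 SR by (fastforce simp: m_comm)
    qed (use SR assms genideal_ideal in auto)
    then show ?thesis using that SR by (auto simp: m_comm subset_iff)
  qed
  show "(Idl S) \<cdot> (Idl T) \<subseteq> Idl (S <#> T)"
  proof
    fix x assume "x \<in> (Idl S) \<cdot> (Idl T)"
    then show "x \<in> Idl (S <#> T)" by induct (auto simp: 2)
  qed
  show "Idl (S <#> T) \<subseteq> (Idl S) \<cdot> (Idl T)"
    using genideal_self[OF assms(1)] genideal_self[OF assms(2)]
    by (intro genideal_minimal ideal_prod_is_ideal I) (auto simp: set_mult_def intro: ideal_prod.prod)
qed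

text \<open>Currying: for fixed b in J the map a to f (a b) is a homomorphism on I, hence
  multiplication by some g b; then g is a homomorphism on J, hence multiplication by some r. The
  product lies in both factors, so two conditions that each hold up to a GV-ideal hold up to a
  common one.\<close>

lemma GV_ideal_prod:
  assumes I: "GV_ideal R I" and J: "GV_ideal R J"
  shows "GV_ideal R (I \<cdot> J)"
proof -
  note I' = GV_idealD[OF I] and J' = GV_idealD[OF J]
  interpret I: ideal I R by (rule I'(1))
  interpret J: ideal J R by (rule J'(1))
  have Icarr: "I \<subseteq> carrier R" and Jcarr: "J \<subseteq> carrier R" by auto
  obtain S T where S: "finite S" "S \<subseteq> carrier R" "I = Idl S" and T: "finite T" "T \<subseteq> carrier R" "J = Idl T"
    using I'(2) J'(2) by blast
  have IJ: "ideal (I \<cdot> J) R" by (rule ideal_prod_is_ideal[OF I'(1) J'(1)])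
  show ?thesis
  proof (rule GV_idealI[OF IJ])
    show "finite (S <#> T)" using S T by (simp add: set_mult_def)
    show "S <#> T \<subseteq> carrier R" using S(2) T(2) by (auto simp: set_mult_def)
    show "I \<cdot> J = Idl (S <#> T)" using ideal_prod_genideal S T by simp
  next
    fix r assume r: "r \<in> carrier R" "\<And>x. x \<in> I \<cdot> J \<Longrightarrow> r \<otimes> x = \<zero>"
    have "r \<otimes> b = \<zero>" if b: "b \<in> J" for b
    proof (rule I'(3))
      fix a assume a: "a \<in> I"
      have "r \<otimes> (a \<otimes> b) = \<zero>" using r ideal_prod.prod[OF a b] by blast
      then show "r \<otimes> b \<otimes> a = \<zero>" using a b r by (simp add: m_ac)
    qed (use b r in auto)
    then show "r = \<zero>" using J'(3) r by blast
  next
    fix f assume f: "f \<in> mod_hom R ((ring_mod R)\<lparr>carrier := I \<cdot> J\<rparr>) (ring_mod R)"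
    note fh = mod_homD[OF f, simplified]
    have ex: "\<exists>r\<in>carrier R. \<forall>a\<in>I. f (a \<otimes> b) = r \<otimes> a" if b: "b \<in> J" for b
    proof -
      have "(\<lambda>a\<in>I. f (a \<otimes> b)) \<in> mod_hom R ((ring_mod R)\<lparr>carrier := I\<rparr>) (ring_mod R)"
        using b fh(1,3) fh(4)[of _ "_ \<otimes> b"]
        by (intro mod_homI) (auto simp: ideal_prod.prod l_distr m_assoc I.I_l_closed)
      from I'(4)[OF this] show ?thesis by (simp cong: ball_cong)
    qed
    define g where "g = (\<lambda>b\<in>J. SOME r. r \<in> carrier R \<and> (\<forall>a\<in>I. f (a \<otimes> b) = r \<otimes> a))"
    have g: "g b \<in> carrier R" "a \<in> I \<Longrightarrow> f (a \<otimes> b) = g b \<otimes> a" if "b \<in> J" for a b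
      using someI_ex[OF ex[OF that, unfolded Bex_def]] that by (auto simp: g_def)
    \<comment> \<open>Faithfulness of I determines the chosen multipliers, and this is what makes
      the choice function g linear.\<close>
    have uniq: "r = s" if "r \<in> carrier R" "s \<in> carrier R" "\<And>a. a \<in> I \<Longrightarrow> r \<otimes> a = s \<otimes> a" for r s
    proof -
      have "(r \<ominus> s) \<otimes> a = \<zero>" if "a \<in> I" for a
      proof -
        have "a \<in> carrier R" using that by simp
        then show ?thesis
          using \<open>r \<in> carrier R\<close> \<open>s \<in> carrier R\<close> \<open>\<And>a. a \<in> I \<Longrightarrow> r \<otimes> a = s \<otimes> a\<close>[OF that]
          by (simp add: a_minus_def l_distr l_minus r_neg)
      qed
      then have "r \<ominus> s = \<zero>" using I'(3)[of "r \<ominus> s"] that(1,2) by blast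
      then show ?thesis using that(1,2) by (meson r_right_minus_eq)
    qed
    have "g \<in> mod_hom R ((ring_mod R)\<lparr>carrier := J\<rparr>) (ring_mod R)"
    proof (rule mod_homI)
      fix x y assume "x \<in> carrier ((ring_mod R)\<lparr>carrier := J\<rparr>)" "y \<in> carrier ((ring_mod R)\<lparr>carrier := J\<rparr>)"
      then have xy: "x \<in> J" "y \<in> J" by auto
      have "g (x \<oplus> y) = g x \<oplus> g y"
      proof (rule uniq)
        fix a assume a: "a \<in> I"
        have "g (x \<oplus> y) \<otimes> a = f (a \<otimes> (x \<oplus> y))" using g(2)[of "x \<oplus> y" a] xy a by simp
        also have "\<dots> = f (a \<otimes> x) \<oplus> f (a \<otimes> y)"
          using fh(3) xy a by (simp add: ideal_prod.prod r_distr)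
        also have "\<dots> = (g x \<oplus> g y) \<otimes> a" using g[of x] g[of y] xy a by (simp add: l_distr)
        finally show "g (x \<oplus> y) \<otimes> a = (g x \<oplus> g y) \<otimes> a" .
      qed (use g xy in auto)
      then show "g (x \<oplus>\<^bsub>(ring_mod R)\<lparr>carrier := J\<rparr>\<^esub> y) = g x \<oplus>\<^bsub>ring_mod R\<^esub> g y" by simp
    next
      fix r x assume "r \<in> carrier R" "x \<in> carrier ((ring_mod R)\<lparr>carrier := J\<rparr>)"
      then have rx: "r \<in> carrier R" "x \<in> J" by auto
      have "g (r \<otimes> x) = r \<otimes> g x"
      proof (rule uniq)
        fix a assume a: "a \<in> I"
        have "g (r \<otimes> x) \<otimes> a = f (a \<otimes> (r \<otimes> x))" using g(2)[of "r \<otimes> x" a] rx a by (simp add: J.I_l_closed)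
        also have "\<dots> = f (r \<otimes> (a \<otimes> x))" using rx a by (simp add: m_lcomm)
        also have "\<dots> = r \<otimes> f (a \<otimes> x)" using fh(4) rx a by (simp add: ideal_prod.prod)
        also have "\<dots> = r \<otimes> g x \<otimes> a" using g rx a by (simp add: m_assoc)
        finally show "g (r \<otimes> x) \<otimes> a = r \<otimes> g x \<otimes> a" .
      qed (use g rx in \<open>auto simp: J.I_l_closed\<close>)
      then show "g (r \<odot>\<^bsub>(ring_mod R)\<lparr>carrier := J\<rparr>\<^esub> x) = r \<odot>\<^bsub>ring_mod R\<^esub> g x" by simp
    next
      show "g \<in> extensional (carrier ((ring_mod R)\<lparr>carrier := J\<rparr>))" by (simp add: g_def)
    qed (simp add: g)
    from J'(4)[OF this] obtain r where r: "r \<in> carrier R" "\<And>b. b \<in> J \<Longrightarrow> g b = r \<otimes> b" by blast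
    have "f x = r \<otimes> x" if "x \<in> I \<cdot> J" for x
      using that
    proof induct
      case (prod a b)
      then have "f (a \<otimes> b) = (r \<otimes> b) \<otimes> a" using g(2) r(2) by simp
      then show ?case using r(1) prod by (simp add: m_ac)
    next
      case (sum s t)
      have "s \<in> carrier R" "t \<in> carrier R"
        using sum ideal_prod_in_carrier[OF I'(1) J'(1)] by auto
      then show ?case using fh(3)[of s t] sum r(1) by (simp add: r_distr)
    qed
    then show "\<exists>r\<in>carrier R. \<forall>x\<in>I \<cdot> J. f x = r \<otimes> x" using r by blast
  qed
qed

lemma GV_ideal_subset:
  assumes "GV_ideal R J"
  shows "J \<subseteq> carrier R" "\<And>j. j \<in> J \<Longrightarrow> j \<in> carrier R"
  using ideal.Icarr[OF GV_idealD(1)[OF assms]] by auto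

end

section \<open>Closed submodules\<close>

definition gv_closed :: "('a, 'r) ring_scheme \<Rightarrow> ('a, 'b, 'm) module_scheme \<Rightarrow> 'b set \<Rightarrow> bool"
  where "gv_closed R M N \<longleftrightarrow> submodule N R M \<and>
    (\<forall>x\<in>carrier M. \<forall>J. GV_ideal R J \<and> (\<forall>j\<in>J. j \<odot>\<^bsub>M\<^esub> x \<in> N) \<longrightarrow> x \<in> N)"

text \<open>\<open>(Q/N)\<^sub>w\<close> is w-cofinitely generated, in terms of closed submodules of \<open>M\<close>.\<close>

definition gv_cofg :: "('a, 'r) ring_scheme \<Rightarrow> ('a, 'b, 'm) module_scheme \<Rightarrow> 'b set \<Rightarrow> 'b set \<Rightarrow> bool"
  where "gv_cofg R M N Q \<longleftrightarrow> (\<forall>\<F>. (\<forall>V\<in>\<F>. gv_closed R M V \<and> N \<subseteq> V) \<and> Q \<inter> \<Inter>\<F> = N \<longrightarrow>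
    (\<exists>\<G>. finite \<G> \<and> \<G> \<subseteq> \<F> \<and> Q \<inter> \<Inter>\<G> = N))"

section \<open>Zorn's lemma for minimal elements and cancellation in abelian groups\<close>

lemma Zorn_Inter:
  assumes "A \<noteq> {}" and chain: "\<And>C. C \<noteq> {} \<Longrightarrow> subset.chain A C \<Longrightarrow> \<Inter>C \<in> A"
  shows "\<exists>m\<in>A. \<forall>x\<in>A. x \<subseteq> m \<longrightarrow> x = m"
proof -
  \<comment> \<open>Complementation reverses inclusion and turns the union of a chain into an
    intersection, so the maximal form of Zorn's lemma applies to the complements.\<close>
  have "\<exists>m\<in>uminus ` A. \<forall>x\<in>uminus ` A. m \<subseteq> x \<longrightarrow> x = m"
  proof (rule subset_Zorn_nonempty)
    show "uminus ` A \<noteq> {}" using assms by simp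
    fix C assume C: "C \<noteq> {}" "subset.chain (uminus ` A) C"
    have "subset.chain A (uminus ` C)"
      using C(2) unfolding subset_chain_def by (auto simp: image_subset_iff)
    then have "\<Inter>(uminus ` C) \<in> A" using chain C(1) by simp
    then have mem: "- \<Inter>(uminus ` C) \<in> uminus ` A" by (rule imageI)
    have "\<Union>C = - \<Inter>(uminus ` C)" by auto
    then show "\<Union>C \<in> uminus ` A" by (rule ssubst) (rule mem)
  qed
  then show ?thesis by (auto simp: ball_simps)
qed

lemma (in abelian_group) minus_add_cancel:
  assumes "a \<in> carrier G" "b \<in> carrier G"
  shows "(a \<ominus> b) \<oplus> b = a" "b \<oplus> (a \<ominus> b) = a" "(b \<oplus> a) \<ominus> b = a" "(a \<oplus> b) \<ominus> b = a"
proof -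
  show 1: "b \<oplus> (a \<ominus> b) = a"
    using assms a_lcomm[of b a "\<ominus> b"] by (simp add: a_minus_def r_neg)
  show "(b \<oplus> a) \<ominus> b = a" using 1 assms by (simp add: a_minus_def a_assoc)
qed (use assms in \<open>simp_all add: a_minus_def a_assoc l_neg r_neg\<close>)

text \<open>For comparing two decompositions of one element along two submodules: the common
  difference lies in both.\<close>

lemma (in abelian_group) add_eq_swap:
  assumes "a \<oplus> b = c \<oplus> d" "a \<in> carrier G" "b \<in> carrier G" "c \<in> carrier G" "d \<in> carrier G"
  shows "a \<ominus> c = d \<ominus> b"
proof -
  have "a = (c \<oplus> d) \<ominus> b" using assms minus_add_cancel(4)[of a b] by simp
  then have "a = c \<oplus> (d \<ominus> b)" using assms by (simp add: a_minus_def a_assoc)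
  then show ?thesis using minus_add_cancel(3)[of "d \<ominus> b" c] assms by simp
qed

lemma (in abelian_group) a_minus_self: "a \<in> carrier G \<Longrightarrow> a \<ominus> a = \<zero>"
  by (simp add: a_minus_def r_neg)

lemma (in abelian_group) a_minus_eq_zero_iff:
  assumes "a \<in> carrier G" "b \<in> carrier G"
  shows "a \<ominus> b = \<zero> \<longleftrightarrow> a = b"
  using assms minus_add_cancel(1)[of a b] a_minus_self[of a] by auto

section \<open>Calculus of submodules\<close>

context module
begin

lemma smult_minus_distr:
  assumes "a \<in> carrier R" "x \<in> carrier M" "y \<in> carrier M"
  shows "a \<odot>\<^bsub>M\<^esub> (x \<ominus>\<^bsub>M\<^esub> y) = a \<odot>\<^bsub>M\<^esub> x \<ominus>\<^bsub>M\<^esub> a \<odot>\<^bsub>M\<^esub> y"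
  using assms by (simp add: a_minus_def smult_r_distr smult_r_minus)

lemma smult_minus_distr_l:
  assumes "a \<in> carrier R" "b \<in> carrier R" "x \<in> carrier M"
  shows "(a \<ominus> b) \<odot>\<^bsub>M\<^esub> x = a \<odot>\<^bsub>M\<^esub> x \<ominus>\<^bsub>M\<^esub> b \<odot>\<^bsub>M\<^esub> x"
  using assms by (simp add: a_minus_def smult_l_distr smult_l_minus)

lemma smult_minus_mult:
  assumes "j \<in> carrier R" "r \<in> carrier R" "t \<in> carrier R" "x \<in> carrier M"
  shows "(j \<ominus> r \<otimes> t) \<odot>\<^bsub>M\<^esub> x = j \<odot>\<^bsub>M\<^esub> x \<ominus>\<^bsub>M\<^esub> r \<odot>\<^bsub>M\<^esub> (t \<odot>\<^bsub>M\<^esub> x)"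
  using assms by (simp add: smult_minus_distr_l smult_assoc1)

lemma smult_commute:
  assumes "a \<in> carrier R" "b \<in> carrier R" "x \<in> carrier M"
  shows "a \<odot>\<^bsub>M\<^esub> (b \<odot>\<^bsub>M\<^esub> x) = b \<odot>\<^bsub>M\<^esub> (a \<odot>\<^bsub>M\<^esub> x)"
  using assms by (metis R.m_comm smult_assoc1)

lemma submodule_zero: "submodule N R M \<Longrightarrow> \<zero>\<^bsub>M\<^esub> \<in> N"
  using submoduleE(2,4)[of N] submoduleE(1)[of N] by (metis R.zero_closed all_not_in_conv smult_l_null subsetD)

lemma submodule_minus: "submodule N R M \<Longrightarrow> x \<in> N \<Longrightarrow> y \<in> N \<Longrightarrow> x \<ominus>\<^bsub>M\<^esub> y \<in> N"
  by (simp add: a_minus_def submoduleE)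

lemma submodule_carrierD: "submodule N R M \<Longrightarrow> x \<in> N \<Longrightarrow> x \<in> carrier M"
  using submoduleE(1) by blast

lemma submodule_Inter:
  assumes "\<And>V. V \<in> \<F> \<Longrightarrow> submodule V R M"
  shows "submodule (carrier M \<inter> \<Inter>\<F>) R M"
  by (rule submoduleI) (use assms in \<open>auto simp: submoduleE submodule_zero\<close>)

lemma submodule_inter:
  assumes "submodule K R M" "submodule V R M"
  shows "submodule (K \<inter> V) R M"
proof -
  have "carrier M \<inter> \<Inter>{K, V} = K \<inter> V" using submoduleE(1) assms by auto
  then show ?thesis using submodule_Inter[of "{K, V}"] assms by auto
qed

lemma set_add_iff: "x \<in> A <+>\<^bsub>M\<^esub> B \<longleftrightarrow> (\<exists>a\<in>A. \<exists>b\<in>B. x = a \<oplus>\<^bsub>M\<^esub> b)"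
  by (auto simp: set_add_def')

lemma set_add_incr:
  assumes "submodule A R M" "submodule B R M"
  shows "A \<subseteq> A <+>\<^bsub>M\<^esub> B" "B \<subseteq> A <+>\<^bsub>M\<^esub> B"
proof -
  show "A \<subseteq> A <+>\<^bsub>M\<^esub> B"
    using submodule_zero[OF assms(2)] submodule_carrierD[OF assms(1)]
    unfolding set_add_iff subset_iff by (metis M.r_zero)
  show "B \<subseteq> A <+>\<^bsub>M\<^esub> B"
    using submodule_zero[OF assms(1)] submodule_carrierD[OF assms(2)]
    unfolding set_add_iff subset_iff by (metis M.l_zero)
qed

lemma submodule_set_add:
  assumes A: "submodule A R M" and B: "submodule B R M"
  shows "submodule (A <+>\<^bsub>M\<^esub> B) R M"
proof (rule submoduleI)
  note AE = submoduleE[OF A] and BE = submoduleE[OF B]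
  have c: "a \<in> carrier M" if "a \<in> A \<or> a \<in> B" for a using that AE(1) BE(1) by blast
  show "A <+>\<^bsub>M\<^esub> B \<subseteq> carrier M" using c by (auto simp: set_add_iff)
  show "\<zero>\<^bsub>M\<^esub> \<in> A <+>\<^bsub>M\<^esub> B" using set_add_incr[OF A B] submodule_zero[OF A] by blast
  fix x assume "x \<in> A <+>\<^bsub>M\<^esub> B"
  then obtain a b where x: "a \<in> A" "b \<in> B" "x = a \<oplus>\<^bsub>M\<^esub> b" by (auto simp: set_add_iff)
  have "\<ominus>\<^bsub>M\<^esub> x = \<ominus>\<^bsub>M\<^esub> a \<oplus>\<^bsub>M\<^esub> \<ominus>\<^bsub>M\<^esub> b" using x c by (simp add: M.minus_add)
  then show "\<ominus>\<^bsub>M\<^esub> x \<in> A <+>\<^bsub>M\<^esub> B" using x AE(3) BE(3) unfolding set_add_iff by blast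
  {
    fix y assume "y \<in> A <+>\<^bsub>M\<^esub> B"
    then obtain a' b' where y: "a' \<in> A" "b' \<in> B" "y = a' \<oplus>\<^bsub>M\<^esub> b'" by (auto simp: set_add_iff)
    have "x \<oplus>\<^bsub>M\<^esub> y = (a \<oplus>\<^bsub>M\<^esub> a') \<oplus>\<^bsub>M\<^esub> (b \<oplus>\<^bsub>M\<^esub> b')" using x y c by (simp add: M.a_ac)
    then show "x \<oplus>\<^bsub>M\<^esub> y \<in> A <+>\<^bsub>M\<^esub> B" using x y AE(5) BE(5) unfolding set_add_iff by blast
  }
  fix r assume r: "r \<in> carrier R"
  have "r \<odot>\<^bsub>M\<^esub> x = r \<odot>\<^bsub>M\<^esub> a \<oplus>\<^bsub>M\<^esub> r \<odot>\<^bsub>M\<^esub> b" using x c r by (simp add: smult_r_distr)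
  then show "r \<odot>\<^bsub>M\<^esub> x \<in> A <+>\<^bsub>M\<^esub> B" using x r AE(4) BE(4) unfolding set_add_iff by blast
qed

lemma set_add_least:
  assumes "submodule V R M" "A \<subseteq> V" "B \<subseteq> V"
  shows "A <+>\<^bsub>M\<^esub> B \<subseteq> V"
  using assms submoduleE(5)[OF assms(1)] by (auto simp: set_add_iff subset_iff)

lemma submodule_smult_image:
  assumes A: "submodule A R M" and a: "a \<in> carrier R"
  shows "submodule ((\<lambda>x. a \<odot>\<^bsub>M\<^esub> x) ` A) R M"
proof (rule submoduleI)
  note AE = submoduleE[OF A]
  have c: "x \<in> carrier M" if "x \<in> A" for x using that AE(1) by blast
  show "(\<lambda>x. a \<odot>\<^bsub>M\<^esub> x) ` A \<subseteq> carrier M" using c a by auto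
  show "\<zero>\<^bsub>M\<^esub> \<in> (\<lambda>x. a \<odot>\<^bsub>M\<^esub> x) ` A" using submodule_zero[OF A] a by force
  fix x assume "x \<in> (\<lambda>x. a \<odot>\<^bsub>M\<^esub> x) ` A"
  then obtain u where u: "u \<in> A" "x = a \<odot>\<^bsub>M\<^esub> u" by blast
  have "\<ominus>\<^bsub>M\<^esub> x = a \<odot>\<^bsub>M\<^esub> (\<ominus>\<^bsub>M\<^esub> u)" using u c a by (simp add: smult_r_minus)
  then show "\<ominus>\<^bsub>M\<^esub> x \<in> (\<lambda>x. a \<odot>\<^bsub>M\<^esub> x) ` A" using u AE by blast
  {
    fix y assume "y \<in> (\<lambda>x. a \<odot>\<^bsub>M\<^esub> x) ` A"
    then obtain v where v: "v \<in> A" "y = a \<odot>\<^bsub>M\<^esub> v" by blast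
    have "x \<oplus>\<^bsub>M\<^esub> y = a \<odot>\<^bsub>M\<^esub> (u \<oplus>\<^bsub>M\<^esub> v)" using u v c a by (simp add: smult_r_distr)
    then show "x \<oplus>\<^bsub>M\<^esub> y \<in> (\<lambda>x. a \<odot>\<^bsub>M\<^esub> x) ` A" using u v AE by blast
  }
  fix r assume r: "r \<in> carrier R"
  have "r \<odot>\<^bsub>M\<^esub> x = a \<odot>\<^bsub>M\<^esub> (r \<odot>\<^bsub>M\<^esub> u)" using u c a r by (simp add: smult_commute)
  then show "r \<odot>\<^bsub>M\<^esub> x \<in> (\<lambda>x. a \<odot>\<^bsub>M\<^esub> x) ` A" using u AE r by blast
qed

abbreviation cyclic :: "'c \<Rightarrow> 'c set"
  where "cyclic x \<equiv> (\<lambda>r. r \<odot>\<^bsub>M\<^esub> x) ` carrier R"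

lemma submodule_cyclic:
  assumes x: "x \<in> carrier M"
  shows "submodule (cyclic x) R M" "x \<in> cyclic x"
proof -
  show "submodule (cyclic x) R M"
  proof (rule submoduleI)
    show "\<zero>\<^bsub>M\<^esub> \<in> cyclic x" using x by (force intro!: image_eqI[of _ _ \<zero>])
    fix u assume "u \<in> cyclic x"
    then obtain r where r: "r \<in> carrier R" "u = r \<odot>\<^bsub>M\<^esub> x" by blast
    have "\<ominus>\<^bsub>M\<^esub> u = (\<ominus> r) \<odot>\<^bsub>M\<^esub> x" using r x by (simp add: smult_l_minus)
    then show "\<ominus>\<^bsub>M\<^esub> u \<in> cyclic x" using r by blast
    {
      fix v assume "v \<in> cyclic x"
      then obtain s where s: "s \<in> carrier R" "v = s \<odot>\<^bsub>M\<^esub> x" by blast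
      have "u \<oplus>\<^bsub>M\<^esub> v = (r \<oplus> s) \<odot>\<^bsub>M\<^esub> x" using r s x by (simp add: smult_l_distr)
      then show "u \<oplus>\<^bsub>M\<^esub> v \<in> cyclic x" using r s by blast
    }
    fix s assume s: "s \<in> carrier R"
    have "s \<odot>\<^bsub>M\<^esub> u = (s \<otimes> r) \<odot>\<^bsub>M\<^esub> x" using r s x by (simp add: smult_assoc1)
    then show "s \<odot>\<^bsub>M\<^esub> u \<in> cyclic x" using r s by blast
  qed (use x in auto)
  show "x \<in> cyclic x" using x by (force intro!: image_eqI[of _ _ \<one>])
qed

lemma cyclic_least: "submodule V R M \<Longrightarrow> x \<in> V \<Longrightarrow> cyclic x \<subseteq> V"
  by (auto simp: submoduleE)

lemma submodule_preimage:
  assumes Q: "submodule Q R M" and V: "submodule V R M" and I: "I \<subseteq> carrier R"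
  shows "submodule {x \<in> Q. \<forall>a\<in>I. a \<odot>\<^bsub>M\<^esub> x \<in> V} R M"
proof (rule submoduleI)
  note XE = submoduleE[OF Q] and LE = submoduleE[OF V]
  have c: "x \<in> carrier M" if "x \<in> Q" for x using that XE(1) by blast
  have i: "a \<in> carrier R" if "a \<in> I" for a using that I by blast
  show "{x \<in> Q. \<forall>a\<in>I. a \<odot>\<^bsub>M\<^esub> x \<in> V} \<subseteq> carrier M" using c by blast
  show "\<zero>\<^bsub>M\<^esub> \<in> {x \<in> Q. \<forall>a\<in>I. a \<odot>\<^bsub>M\<^esub> x \<in> V}"
    using submodule_zero[OF Q] submodule_zero[OF V] i by simp
  fix x assume x: "x \<in> {x \<in> Q. \<forall>a\<in>I. a \<odot>\<^bsub>M\<^esub> x \<in> V}"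
  then show "\<ominus>\<^bsub>M\<^esub> x \<in> {x \<in> Q. \<forall>a\<in>I. a \<odot>\<^bsub>M\<^esub> x \<in> V}"
    using XE LE c i by (auto simp: smult_r_minus)
  show "x \<oplus>\<^bsub>M\<^esub> y \<in> {x \<in> Q. \<forall>a\<in>I. a \<odot>\<^bsub>M\<^esub> x \<in> V}" if "y \<in> {x \<in> Q. \<forall>a\<in>I. a \<odot>\<^bsub>M\<^esub> x \<in> V}" for y
    using x that XE LE c i by (auto simp: smult_r_distr)
  show "r \<odot>\<^bsub>M\<^esub> x \<in> {x \<in> Q. \<forall>a\<in>I. a \<odot>\<^bsub>M\<^esub> x \<in> V}" if r: "r \<in> carrier R" for r
    using x r XE(4) LE(4) c i by (auto simp: smult_commute[of _ r])
qed

text \<open>Lets a condition checked on generators of a GV-ideal spread to the whole ideal; with V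
  zero it also shows that the annihilator of an element is an ideal.\<close>

lemma colon_ideal:
  assumes V: "submodule V R M" and x: "x \<in> carrier M"
  shows "ideal {a \<in> carrier R. a \<odot>\<^bsub>M\<^esub> x \<in> V} R"
proof (rule idealI)
  note LE = submoduleE[OF V]
  show "subgroup {a \<in> carrier R. a \<odot>\<^bsub>M\<^esub> x \<in> V} (add_monoid R)"
    by (rule R.add.subgroupI)
      (use x LE submodule_zero[OF V] in \<open>auto intro!: exI[of _ \<zero>] simp: smult_l_distr smult_l_minus\<close>)
  fix a r assume a: "a \<in> {a \<in> carrier R. a \<odot>\<^bsub>M\<^esub> x \<in> V}" and r: "r \<in> carrier R"
  then show "r \<otimes> a \<in> {a \<in> carrier R. a \<odot>\<^bsub>M\<^esub> x \<in> V}" using x LE(4) by (auto simp: smult_assoc1)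
  then show "a \<otimes> r \<in> {a \<in> carrier R. a \<odot>\<^bsub>M\<^esub> x \<in> V}" using a r by (simp add: R.m_comm)
qed (rule R.ring_axioms)

section \<open>The closure operator and closed submodules\<close>

lemma w_closure_iff: "x \<in> w_closure R M N \<longleftrightarrow> x \<in> carrier M \<and> (\<exists>J. GV_ideal R J \<and> (\<forall>j\<in>J. j \<odot>\<^bsub>M\<^esub> x \<in> N))"
  by (auto simp: w_closure_def)

lemma w_closureE:
  assumes "x \<in> w_closure R M N"
  obtains J where "x \<in> carrier M" "GV_ideal R J" "\<And>j. j \<in> J \<Longrightarrow> j \<in> carrier R" "\<And>j. j \<in> J \<Longrightarrow> j \<odot>\<^bsub>M\<^esub> x \<in> N"
proof -
  obtain J where J: "x \<in> carrier M" "GV_ideal R J" "\<forall>j\<in>J. j \<odot>\<^bsub>M\<^esub> x \<in> N"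
    using assms unfolding w_closure_iff by (elim conjE exE)
  show ?thesis by (rule that[OF J(1,2)]) (use J(3) GV_ideal_subset(2)[OF J(2)] in auto)
qed

lemma w_closureE':
  assumes "x \<in> w_closure R M N"
  obtains J where "GV_ideal R J" "\<And>j. j \<in> J \<Longrightarrow> j \<in> carrier R" "\<And>j. j \<in> J \<Longrightarrow> j \<odot>\<^bsub>M\<^esub> x \<in> N"
  using assms by (rule w_closureE) (rule that)

lemma w_closure_incr:
  assumes "submodule N R M" shows "N \<subseteq> w_closure R M N"
  using assms GV_ideal_carrier by (fastforce simp: w_closure_iff submoduleE submodule_carrierD)

lemma w_closure_mono: "N \<subseteq> V \<Longrightarrow> w_closure R M N \<subseteq> w_closure R M V"
  by (fastforce simp: w_closure_iff)

lemma w_closure_submodule: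
  assumes N: "submodule N R M"
  shows "submodule (w_closure R M N) R M"
proof (rule submoduleI)
  note NE = submoduleE[OF N]
  show "w_closure R M N \<subseteq> carrier M" by (auto simp: w_closure_iff)
  show "\<zero>\<^bsub>M\<^esub> \<in> w_closure R M N" using w_closure_incr[OF N] submodule_zero[OF N] by blast
  fix x assume "x \<in> w_closure R M N"
  then obtain I where x: "x \<in> carrier M" and I: "GV_ideal R I" "\<And>i. i \<in> I \<Longrightarrow> i \<odot>\<^bsub>M\<^esub> x \<in> N"
    unfolding w_closure_iff by blast
  note Ic = GV_ideal_subset(2)[OF I(1)]
  have "i \<odot>\<^bsub>M\<^esub> (\<ominus>\<^bsub>M\<^esub> x) \<in> N" if "i \<in> I" for i using that I Ic x NE by (simp add: smult_r_minus)
  then show "\<ominus>\<^bsub>M\<^esub> x \<in> w_closure R M N" using x I by (auto simp: w_closure_iff)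
  show "x \<oplus>\<^bsub>M\<^esub> y \<in> w_closure R M N" if y': "y \<in> w_closure R M N" for y
  proof -
    obtain J where y: "y \<in> carrier M" and J: "GV_ideal R J" "\<And>i. i \<in> J \<Longrightarrow> i \<odot>\<^bsub>M\<^esub> y \<in> N"
      using y' unfolding w_closure_iff by blast
    \<comment> \<open>One GV-ideal must serve both summands; the product does, since it lies in each
      factor.\<close>
    have IJ: "I \<cdot> J \<subseteq> I \<inter> J" using ideal_prod_inter GV_idealD(1) I J by blast
    have "i \<odot>\<^bsub>M\<^esub> (x \<oplus>\<^bsub>M\<^esub> y) \<in> N" if "i \<in> I \<cdot> J" for i
    proof -
      have "i \<in> I" "i \<in> J" using that IJ by auto
      then show ?thesis using I(2) J(2) Ic x y NE(5) by (simp add: smult_r_distr)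
    qed
    then show ?thesis using x y GV_ideal_prod[OF I(1) J(1)] by (auto simp: w_closure_iff)
  qed
  show "r \<odot>\<^bsub>M\<^esub> x \<in> w_closure R M N" if r: "r \<in> carrier R" for r
  proof -
    have "i \<odot>\<^bsub>M\<^esub> (r \<odot>\<^bsub>M\<^esub> x) \<in> N" if "i \<in> I" for i
      using that I(2) Ic x r NE by (simp add: smult_commute[of _ r])
    then show ?thesis using x r I(1) by (auto simp: w_closure_iff)
  qed
qed

lemma gv_closedI:
  assumes "submodule N R M"
    and "\<And>x J. x \<in> carrier M \<Longrightarrow> GV_ideal R J \<Longrightarrow> (\<And>j. j \<in> J \<Longrightarrow> j \<odot>\<^bsub>M\<^esub> x \<in> N) \<Longrightarrow> x \<in> N"
  shows "gv_closed R M N"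
  using assms by (auto simp: gv_closed_def)

lemma gv_closedD:
  assumes "gv_closed R M N"
  shows "submodule N R M" "\<And>x. x \<in> N \<Longrightarrow> x \<in> carrier M"
    and "\<And>x J. x \<in> carrier M \<Longrightarrow> GV_ideal R J \<Longrightarrow> (\<And>j. j \<in> J \<Longrightarrow> j \<odot>\<^bsub>M\<^esub> x \<in> N) \<Longrightarrow> x \<in> N"
  using assms submodule_carrierD[of N] unfolding gv_closed_def by blast+

lemma GV_common:
  assumes N: "submodule N R M" and "finite S" "S \<subseteq> carrier M" "S \<subseteq> w_closure R M N"
  shows "\<exists>I. GV_ideal R I \<and> (\<forall>x\<in>S. \<forall>i\<in>I. i \<odot>\<^bsub>M\<^esub> x \<in> N)"
  using assms(2-)
proof (induct S)
  case empty
  then show ?case using GV_ideal_carrier by auto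
next
  case (insert x S)
  then obtain I where I: "GV_ideal R I" "\<forall>x\<in>S. \<forall>i\<in>I. i \<odot>\<^bsub>M\<^esub> x \<in> N" by auto
  obtain J where J: "GV_ideal R J" "\<forall>j\<in>J. j \<odot>\<^bsub>M\<^esub> x \<in> N" using insert by (auto simp: w_closure_iff)
  have "I \<cdot> J \<subseteq> I \<inter> J" using ideal_prod_inter GV_idealD(1) I J by blast
  then show ?case using GV_ideal_prod[OF I(1) J(1)] I J by blast
qed

text \<open>Idempotence of the closure, and the place where finite generation of GV-ideals is
  essential: a single I multiplies s x into N for each of the finitely many generators s of J, so
  the GV-ideal I J multiplies x into N.\<close>

lemma w_closure_closed:
  assumes N: "submodule N R M"
  shows "gv_closed R M (w_closure R M N)"
proof (rule gv_closedI)
  show "submodule (w_closure R M N) R M" by (rule w_closure_submodule[OF N])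
  fix x J assume x: "x \<in> carrier M" and J: "GV_ideal R J" and Jx: "\<And>j. j \<in> J \<Longrightarrow> j \<odot>\<^bsub>M\<^esub> x \<in> w_closure R M N"
  obtain S where S: "finite S" "S \<subseteq> carrier R" "J = Idl S" using GV_idealD(2)[OF J] by blast
  have "S \<subseteq> J" using S genideal_self by simp
  then obtain I where I: "GV_ideal R I" "\<forall>s\<in>S. \<forall>i\<in>I. i \<odot>\<^bsub>M\<^esub> (s \<odot>\<^bsub>M\<^esub> x) \<in> N"
    using GV_common[OF N, of "(\<lambda>s. s \<odot>\<^bsub>M\<^esub> x) ` S"] S(1,2) x Jx by auto
  note Ic = GV_ideal_subset[OF I(1)]
  let ?V = "{y \<in> carrier M. \<forall>i\<in>I. i \<odot>\<^bsub>M\<^esub> y \<in> N}"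
  \<comment> \<open>The elements carried into N by I form a submodule, so its colon ideal at x
    contains J as soon as it contains the generators.\<close>
  have V: "submodule ?V R M" by (rule submodule_preimage[OF carrier_is_submodule N Ic(1)])
  have "S \<subseteq> {a \<in> carrier R. a \<odot>\<^bsub>M\<^esub> x \<in> ?V}" using S(2) I(2) x by auto
  then have JL: "J \<subseteq> {a \<in> carrier R. a \<odot>\<^bsub>M\<^esub> x \<in> ?V}"
    unfolding S(3) by (rule genideal_minimal[OF colon_ideal[OF V x]])
  have "a \<odot>\<^bsub>M\<^esub> x \<in> N" if "a \<in> I \<cdot> J" for a
    using that
  proof induct
    case (prod i j)
    then have "j \<in> carrier R" "i \<in> carrier R" "i \<odot>\<^bsub>M\<^esub> (j \<odot>\<^bsub>M\<^esub> x) \<in> N" using JL Ic by auto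
    then show ?case using x by (simp add: smult_assoc1)
  next
    case (sum s t)
    then have "s \<in> carrier R" "t \<in> carrier R"
      using ideal_prod_in_carrier[OF GV_idealD(1)[OF I(1)] GV_idealD(1)[OF J]] by auto
    then show ?case using sum x submoduleE(5)[OF N] by (simp add: smult_l_distr)
  qed
  then show "x \<in> w_closure R M N" using x GV_ideal_prod[OF I(1) J] by (auto simp: w_closure_iff)
qed

lemma w_closure_least:
  assumes "gv_closed R M V" "N \<subseteq> V"
  shows "w_closure R M N \<subseteq> V"
  using assms gv_closedD(3)[OF assms(1)] by (fastforce simp: w_closure_iff)

lemma gv_closed_carrier: "gv_closed R M (carrier M)"
  by (rule gv_closedI[OF carrier_is_submodule])

lemma gv_closed_Inter:
  assumes "\<And>V. V \<in> \<F> \<Longrightarrow> gv_closed R M V"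
  shows "gv_closed R M (carrier M \<inter> \<Inter>\<F>)"
proof (rule gv_closedI)
  show "submodule (carrier M \<inter> \<Inter>\<F>) R M" using submodule_Inter gv_closedD(1)[OF assms] by blast
qed (use gv_closedD(3)[OF assms] in blast)

lemma gv_closed_inter:
  assumes "gv_closed R M K" "gv_closed R M V"
  shows "gv_closed R M (K \<inter> V)"
proof (rule gv_closedI)
  show "submodule (K \<inter> V) R M" using submodule_inter gv_closedD(1) assms by blast
qed (use gv_closedD(3)[OF assms(1)] gv_closedD(3)[OF assms(2)] in blast)

lemma gv_closed_Inter_in:
  assumes "gv_closed R M Q" "\<And>V. V \<in> \<F> \<Longrightarrow> gv_closed R M V"
  shows "gv_closed R M (Q \<inter> \<Inter>\<F>)"
proof -
  have "Q \<inter> \<Inter>\<F> = Q \<inter> (carrier M \<inter> \<Inter>\<F>)" using gv_closedD(2)[OF assms(1)] by blast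
  then show ?thesis using gv_closed_inter[OF assms(1) gv_closed_Inter[OF assms(2)]] by auto
qed

text \<open>Covers, by the choice of I and V, kernels of scalars, annihilated parts and preimages
  under multiplication. It holds because scalars commute: J a x = a J x.\<close>

lemma gv_closed_preimage:
  assumes Q: "gv_closed R M Q" and V: "gv_closed R M V" and I: "I \<subseteq> carrier R"
  shows "gv_closed R M {x \<in> Q. \<forall>a\<in>I. a \<odot>\<^bsub>M\<^esub> x \<in> V}"
proof (rule gv_closedI)
  show "submodule {x \<in> Q. \<forall>a\<in>I. a \<odot>\<^bsub>M\<^esub> x \<in> V} R M" using submodule_preimage gv_closedD(1) assms by blast
  fix x J assume x: "x \<in> carrier M" and J: "GV_ideal R J"
    and Jx: "\<And>j. j \<in> J \<Longrightarrow> j \<odot>\<^bsub>M\<^esub> x \<in> {x \<in> Q. \<forall>a\<in>I. a \<odot>\<^bsub>M\<^esub> x \<in> V}"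
  have "x \<in> Q" using gv_closedD(3)[OF Q x J] Jx by blast
  moreover have "a \<odot>\<^bsub>M\<^esub> x \<in> V" if a: "a \<in> I" for a
  proof (rule gv_closedD(3)[OF V _ J])
    show "a \<odot>\<^bsub>M\<^esub> x \<in> carrier M" using a I x by blast
    fix j assume "j \<in> J"
    then have "a \<odot>\<^bsub>M\<^esub> (j \<odot>\<^bsub>M\<^esub> x) \<in> V" "j \<in> carrier R" "a \<in> carrier R"
      using Jx a I GV_ideal_subset[OF J] by auto
    then show "j \<odot>\<^bsub>M\<^esub> (a \<odot>\<^bsub>M\<^esub> x) \<in> V" using x by (simp add: smult_commute[of _ a])
  qed
  ultimately show "x \<in> {x \<in> Q. \<forall>a\<in>I. a \<odot>\<^bsub>M\<^esub> x \<in> V}" by blast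
qed

lemma gv_closed_preimage1:
  assumes Q: "gv_closed R M Q" and V: "gv_closed R M V" and a: "a \<in> carrier R"
  shows "gv_closed R M {x \<in> Q. a \<odot>\<^bsub>M\<^esub> x \<in> V}"
  using gv_closed_preimage[OF Q V, of "{a}"] a by simp

end

section \<open>Relative cofinite generation\<close>

context module
begin

lemma gv_cofgI:
  assumes "\<And>\<F>. (\<And>V. V \<in> \<F> \<Longrightarrow> gv_closed R M V) \<Longrightarrow> (\<And>V. V \<in> \<F> \<Longrightarrow> N \<subseteq> V) \<Longrightarrow> Q \<inter> \<Inter>\<F> = N
    \<Longrightarrow> \<exists>\<G>. finite \<G> \<and> \<G> \<subseteq> \<F> \<and> Q \<inter> \<Inter>\<G> = N"
  shows "gv_cofg R M N Q"
  using assms unfolding gv_cofg_def by (metis (no_types, lifting))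

lemma gv_cofgD:
  assumes "gv_cofg R M N Q" "\<And>V. V \<in> \<F> \<Longrightarrow> gv_closed R M V" "\<And>V. V \<in> \<F> \<Longrightarrow> N \<subseteq> V" "Q \<inter> \<Inter>\<F> = N"
  obtains \<G> where "finite \<G>" "\<G> \<subseteq> \<F>" "Q \<inter> \<Inter>\<G> = N"
  using assms unfolding gv_cofg_def by (metis (no_types, lifting))

text \<open>Y is added to the family, which turns an intersection inside Y into one inside Q, and is
  removed again from the finite subfamily.\<close>

lemma gv_cofg_subset:
  assumes cof: "gv_cofg R M N Q" and Y: "gv_closed R M Y" and "N \<subseteq> Y" "Y \<subseteq> Q"
  shows "gv_cofg R M N Y"
proof (rule gv_cofgI)
  fix \<F> assume S: "\<And>V. V \<in> \<F> \<Longrightarrow> gv_closed R M V" "\<And>V. V \<in> \<F> \<Longrightarrow> N \<subseteq> V" "Y \<inter> \<Inter>\<F> = N"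
  have "Q \<inter> \<Inter>(insert Y \<F>) = N" using S(3) assms(4) by auto
  then obtain \<G> where T: "finite \<G>" "\<G> \<subseteq> insert Y \<F>" "Q \<inter> \<Inter>\<G> = N"
    using gv_cofgD[OF cof, of "insert Y \<F>"] S Y assms(3) by (metis insert_iff)
  have "Y \<inter> \<Inter>(\<G> - {Y}) = N" using T assms(3,4) S(2) by blast
  then show "\<exists>\<G>. finite \<G> \<and> \<G> \<subseteq> \<F> \<and> Y \<inter> \<Inter>\<G> = N" using T by (intro exI[of _ "\<G> - {Y}"]) auto
qed

text \<open>Closure under extensions. Finitely many members cut Y down to N, so their intersection
  L0 with Q satisfies L0 \<inter> Y = N and embeds into Q/Y modulo N. The remaining members are
  compared with their images there.\<close>

lemma gv_cofg_trans:
  assumes N: "gv_closed R M N" and Y: "gv_closed R M Y" and Q: "gv_closed R M Q"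
    and sub: "N \<subseteq> Y" "Y \<subseteq> Q" and NY: "gv_cofg R M N Y" and YX: "gv_cofg R M Y Q"
  shows "gv_cofg R M N Q"
proof (rule gv_cofgI)
  fix \<F> assume S: "\<And>V. V \<in> \<F> \<Longrightarrow> gv_closed R M V" "\<And>V. V \<in> \<F> \<Longrightarrow> N \<subseteq> V" "Q \<inter> \<Inter>\<F> = N"
  show "\<exists>\<G>. finite \<G> \<and> \<G> \<subseteq> \<F> \<and> Q \<inter> \<Inter>\<G> = N"
  \<comment> \<open>An empty family means Q = N. Otherwise a member L1 is available, which later
    provides a decomposition of elements along L0 and Y.\<close>
  proof (cases "\<F> = {}")
    case True
    then show ?thesis using S by auto
  next
    case False
    then obtain L1 where L1: "L1 \<in> \<F>" by blast
    have "Y \<inter> \<Inter>\<F> = N" using S sub by blast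
    then obtain \<G>1 where T1: "finite \<G>1" "\<G>1 \<subseteq> \<F>" "Y \<inter> \<Inter>\<G>1 = N"
      using gv_cofgD[OF NY S(1,2)] by blast
    define L0 where "L0 = Q \<inter> \<Inter>\<G>1"
    have L0: "gv_closed R M L0" unfolding L0_def using Q S(1) T1(2) by (intro gv_closed_Inter_in) auto
    \<comment> \<open>The preimage in M of the image of L0 \<inter> V modulo Y, made closed.\<close>
    define F where "F V = w_closure R M ((L0 \<inter> V) <+>\<^bsub>M\<^esub> Y)" for V
    have sm: "submodule (L0 \<inter> V) R M" if "V \<in> \<F>" for V
      using gv_closed_inter[OF L0 S(1)[OF that]] gv_closedD(1) by blast
    have sum: "submodule ((L0 \<inter> V) <+>\<^bsub>M\<^esub> Y) R M" if "V \<in> \<F>" for V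
      using submodule_set_add[OF sm[OF that] gv_closedD(1)[OF Y]] .
    have F: "gv_closed R M (F V)" "L0 \<inter> V \<subseteq> F V" "Y \<subseteq> F V" if "V \<in> \<F>" for V
    proof -
      show "gv_closed R M (F V)" unfolding F_def by (rule w_closure_closed[OF sum[OF that]])
      show "L0 \<inter> V \<subseteq> F V" "Y \<subseteq> F V" unfolding F_def
        using w_closure_incr[OF sum[OF that]] set_add_incr[OF sm[OF that] gv_closedD(1)[OF Y]] by blast+
    qed
    have "z \<in> Y" if z: "z \<in> Q \<inter> \<Inter>(F ` \<F>)" for z
    proof -
      have zM: "z \<in> carrier M" using z gv_closedD(2)[OF Q] by blast
      obtain J where J: "GV_ideal R J" "\<And>j. j \<in> J \<Longrightarrow> j \<odot>\<^bsub>M\<^esub> z \<in> (L0 \<inter> L1) <+>\<^bsub>M\<^esub> Y"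
        using z L1 by (auto simp: F_def w_closure_iff)
      have "j \<odot>\<^bsub>M\<^esub> z \<in> Y" if j: "j \<in> J" for j
      proof -
        obtain l a where la: "l \<in> L0" "a \<in> Y" "j \<odot>\<^bsub>M\<^esub> z = l \<oplus>\<^bsub>M\<^esub> a"
          using J(2)[OF j] by (auto simp: set_add_iff)
        have jR: "j \<in> carrier R" using GV_ideal_subset(2)[OF J(1) j] .
        have lM: "l \<in> carrier M" "a \<in> carrier M" using la gv_closedD(2)[OF L0] gv_closedD(2)[OF Y] by auto
        \<comment> \<open>The component l was obtained from L1 alone. For another V compare j z = l
          + a with i z = l' + a': then i l - j l' = j a' - i a lies in L0 \<inter> Y = N, hence in
          V, and j l' is in V already.\<close>
        have "l \<in> V" if V: "V \<in> \<F>" for V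
        proof -
          obtain J' where J': "GV_ideal R J'" "\<And>j. j \<in> J' \<Longrightarrow> j \<odot>\<^bsub>M\<^esub> z \<in> (L0 \<inter> V) <+>\<^bsub>M\<^esub> Y"
            using z V by (auto simp: F_def w_closure_iff)
          show ?thesis
          proof (rule gv_closedD(3)[OF S(1)[OF V] lM(1) J'(1)])
            fix i assume i: "i \<in> J'"
            obtain l' a' where la': "l' \<in> L0" "l' \<in> V" "a' \<in> Y" "i \<odot>\<^bsub>M\<^esub> z = l' \<oplus>\<^bsub>M\<^esub> a'"
              using J'(2)[OF i] by (auto simp: set_add_iff)
            have iR: "i \<in> carrier R" using GV_ideal_subset(2)[OF J'(1) i] .
            have l'M: "l' \<in> carrier M" "a' \<in> carrier M" using la' gv_closedD(2)[OF L0] gv_closedD(2)[OF Y] by auto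
            have "i \<odot>\<^bsub>M\<^esub> l \<oplus>\<^bsub>M\<^esub> i \<odot>\<^bsub>M\<^esub> a = i \<odot>\<^bsub>M\<^esub> (j \<odot>\<^bsub>M\<^esub> z)"
              using la lM iR by (simp add: smult_r_distr)
            also have "\<dots> = j \<odot>\<^bsub>M\<^esub> (i \<odot>\<^bsub>M\<^esub> z)" using iR jR zM by (rule smult_commute)
            also have "\<dots> = j \<odot>\<^bsub>M\<^esub> l' \<oplus>\<^bsub>M\<^esub> j \<odot>\<^bsub>M\<^esub> a'" using la' l'M jR by (simp add: smult_r_distr)
            finally have eq: "i \<odot>\<^bsub>M\<^esub> l \<ominus>\<^bsub>M\<^esub> j \<odot>\<^bsub>M\<^esub> l' = j \<odot>\<^bsub>M\<^esub> a' \<ominus>\<^bsub>M\<^esub> i \<odot>\<^bsub>M\<^esub> a"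
              using lM l'M iR jR by (intro M.add_eq_swap) auto
            have "i \<odot>\<^bsub>M\<^esub> l \<ominus>\<^bsub>M\<^esub> j \<odot>\<^bsub>M\<^esub> l' \<in> L0"
              using la la' iR jR gv_closedD(1)[OF L0] by (intro submodule_minus submoduleE) auto
            moreover have "j \<odot>\<^bsub>M\<^esub> a' \<ominus>\<^bsub>M\<^esub> i \<odot>\<^bsub>M\<^esub> a \<in> Y"
              using la la' iR jR gv_closedD(1)[OF Y] by (intro submodule_minus submoduleE) auto
            ultimately have "i \<odot>\<^bsub>M\<^esub> l \<ominus>\<^bsub>M\<^esub> j \<odot>\<^bsub>M\<^esub> l' \<in> V"
              using eq T1(3) S(2)[OF V] unfolding L0_def by auto
            moreover have "j \<odot>\<^bsub>M\<^esub> l' \<in> V" using la' jR gv_closedD(1)[OF S(1)[OF V]] by (intro submoduleE) auto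
            ultimately have "(i \<odot>\<^bsub>M\<^esub> l \<ominus>\<^bsub>M\<^esub> j \<odot>\<^bsub>M\<^esub> l') \<oplus>\<^bsub>M\<^esub> j \<odot>\<^bsub>M\<^esub> l' \<in> V"
              by (rule submoduleE(5)[OF gv_closedD(1)[OF S(1)[OF V]]])
            then show "i \<odot>\<^bsub>M\<^esub> l \<in> V" using iR jR lM l'M by (simp add: M.minus_add_cancel)
          qed
        qed
        then have "l \<in> N" using la(1) S(3) unfolding L0_def by blast
        then show ?thesis using la sub gv_closedD(1)[OF Y] by (auto simp: submoduleE)
      qed
      then show ?thesis using gv_closedD(3)[OF Y zM J(1)] by blast
    qed
    then have "Q \<inter> \<Inter>(F ` \<F>) = Y" using sub F(3) by blast
    then obtain \<G>' where T': "finite \<G>'" "\<G>' \<subseteq> F ` \<F>" "Q \<inter> \<Inter>\<G>' = Y"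
      using gv_cofgD[OF YX, of "F ` \<F>"] F(1,3) by (metis (no_types, lifting) imageE)
    then obtain \<G>2 where T2: "\<G>2 \<subseteq> \<F>" "finite \<G>2" "\<G>' = F ` \<G>2" by (meson finite_subset_image)
    \<comment> \<open>\<G>1 puts z into L0, then \<G>2 puts it into Y, and L0 \<inter> Y =
      N.\<close>
    have "Q \<inter> \<Inter>(\<G>1 \<union> \<G>2) \<subseteq> N"
    proof
      fix z assume z: "z \<in> Q \<inter> \<Inter>(\<G>1 \<union> \<G>2)"
      then have "z \<in> Q \<inter> \<Inter>\<G>'" using F(2) T2 unfolding L0_def by blast
      then show "z \<in> N" using z T'(3) T1(3) by blast
    qed
    moreover have "N \<subseteq> Q \<inter> \<Inter>(\<G>1 \<union> \<G>2)" using T1(2) T2(1) S(2) sub by blast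
    ultimately show ?thesis using T1 T2 by (intro exI[of _ "\<G>1 \<union> \<G>2"]) auto
  qed
qed

text \<open>The second isomorphism theorem up to closure: (N + K)/N against K/(N \<inter> K). If j z
  = n + k with z in some V containing N, then k = j z - n lies in V too.\<close>

lemma gv_cofg_add:
  assumes N: "gv_closed R M N" and K: "gv_closed R M K" and cof: "gv_cofg R M (N \<inter> K) K"
  shows "gv_cofg R M N (w_closure R M (N <+>\<^bsub>M\<^esub> K))"
proof (rule gv_cofgI)
  let ?Q = "w_closure R M (N <+>\<^bsub>M\<^esub> K)"
  fix \<F> assume S: "\<And>V. V \<in> \<F> \<Longrightarrow> gv_closed R M V" "\<And>V. V \<in> \<F> \<Longrightarrow> N \<subseteq> V" "?Q \<inter> \<Inter>\<F> = N"
  note NK = submodule_set_add[OF gv_closedD(1)[OF N] gv_closedD(1)[OF K]]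
  have inc: "N \<subseteq> ?Q" "K \<subseteq> ?Q"
    using w_closure_incr[OF NK] set_add_incr[OF gv_closedD(1)[OF N] gv_closedD(1)[OF K]] by blast+
  have "K \<inter> \<Inter>\<F> = N \<inter> K" using S inc by blast
  then obtain \<G> where T: "finite \<G>" "\<G> \<subseteq> \<F>" "K \<inter> \<Inter>\<G> = N \<inter> K"
    using gv_cofgD[OF cof S(1)] S(2) by (metis (no_types, lifting) inf.coboundedI1)
  have "z \<in> N" if z: "z \<in> ?Q \<inter> \<Inter>\<G>" for z
  proof -
    obtain J where zM: "z \<in> carrier M" and J: "GV_ideal R J" "\<And>j. j \<in> J \<Longrightarrow> j \<odot>\<^bsub>M\<^esub> z \<in> N <+>\<^bsub>M\<^esub> K"
      using z by (auto simp: w_closure_iff)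
    show ?thesis
    proof (rule gv_closedD(3)[OF N zM J(1)])
      fix j assume j: "j \<in> J"
      have jR: "j \<in> carrier R" using GV_ideal_subset(2)[OF J(1) j] .
      obtain n k where nk: "n \<in> N" "k \<in> K" "j \<odot>\<^bsub>M\<^esub> z = n \<oplus>\<^bsub>M\<^esub> k" using J(2)[OF j] by (auto simp: set_add_iff)
      have M: "n \<in> carrier M" "k \<in> carrier M" using nk gv_closedD(2)[OF N] gv_closedD(2)[OF K] by auto
      have k: "k = j \<odot>\<^bsub>M\<^esub> z \<ominus>\<^bsub>M\<^esub> n" using nk M by (simp add: M.minus_add_cancel)
      have "k \<in> V" if "V \<in> \<G>" for V
      proof -
        have V: "submodule V R M" "N \<subseteq> V" using that T(2) S(1,2) gv_closedD(1) by blast+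
        have "z \<in> V" using that z by blast
        then show ?thesis unfolding k using V nk(1) jR by (intro submodule_minus submoduleE) auto
      qed
      then have "k \<in> N" using nk T(3) by blast
      then show "j \<odot>\<^bsub>M\<^esub> z \<in> N" using nk gv_closedD(1)[OF N] by (simp add: submoduleE)
    qed
  qed
  then have "?Q \<inter> \<Inter>\<G> = N" using inc S(2) T(2) by blast
  then show "\<exists>\<G>. finite \<G> \<and> \<G> \<subseteq> \<F> \<and> ?Q \<inter> \<Inter>\<G> = N" using T by blast
qed

text \<open>Multiplication by a induces an embedding of M/P into M/Z, where Z is the closure of a N
  and P its preimage, and goodness passes to submodules. Families above P are transported to
  closures of a V.\<close>

lemma gv_cofg_preimage:
  assumes N: "gv_closed R M N" and a: "a \<in> carrier R"
    and cof: "gv_cofg R M (w_closure R M ((\<lambda>x. a \<odot>\<^bsub>M\<^esub> x) ` N)) (carrier M)"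
  shows "gv_cofg R M {x \<in> carrier M. a \<odot>\<^bsub>M\<^esub> x \<in> w_closure R M ((\<lambda>x. a \<odot>\<^bsub>M\<^esub> x) ` N)} (carrier M)"
    (is "gv_cofg R M ?P _")
proof (rule gv_cofgI)
  let ?f = "\<lambda>x. a \<odot>\<^bsub>M\<^esub> x"
  let ?Z = "w_closure R M (?f ` N)"
  fix \<F> assume S: "\<And>V. V \<in> \<F> \<Longrightarrow> gv_closed R M V" "\<And>V. V \<in> \<F> \<Longrightarrow> ?P \<subseteq> V" "carrier M \<inter> \<Inter>\<F> = ?P"
  have im: "submodule (?f ` V) R M" if "gv_closed R M V" for V
    using submodule_smult_image[OF gv_closedD(1)[OF that] a] .
  have Z: "gv_closed R M ?Z" using w_closure_closed[OF im[OF N]] .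
  have NP: "N \<subseteq> ?P" using w_closure_incr[OF im[OF N]] gv_closedD(2)[OF N] by blast
  define Q where "Q = w_closure R M (?f ` carrier M)"
  have Q: "gv_closed R M Q" unfolding Q_def using w_closure_closed[OF im[OF gv_closed_carrier]] .
  have NM: "N \<subseteq> carrier M" using gv_closedD(2)[OF N] by blast
  have ZX: "?Z \<subseteq> Q" unfolding Q_def using NM by (intro w_closure_mono image_mono)
  have cofX: "gv_cofg R M ?Z Q"
    using gv_cofg_subset[OF cof Q ZX] gv_closedD(2)[OF Q] by blast
  define F where "F V = w_closure R M (?f ` V)" for V
  have F: "gv_closed R M (F V)" "?f ` V \<subseteq> F V" "?Z \<subseteq> F V" if "V \<in> \<F>" for V
  proof -
    show "gv_closed R M (F V)" unfolding F_def by (rule w_closure_closed[OF im[OF S(1)[OF that]]])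
    show "?f ` V \<subseteq> F V" unfolding F_def by (rule w_closure_incr[OF im[OF S(1)[OF that]]])
    show "?Z \<subseteq> F V" unfolding F_def using NP S(2)[OF that] by (intro w_closure_mono image_mono) blast
  qed
  have "w \<in> ?Z" if w: "w \<in> Q \<inter> \<Inter>(F ` \<F>)" for w
  proof -
    obtain J where wM: "w \<in> carrier M" and J: "GV_ideal R J" "\<And>j. j \<in> J \<Longrightarrow> j \<odot>\<^bsub>M\<^esub> w \<in> ?f ` carrier M"
      using w by (auto simp: Q_def w_closure_iff)
    show ?thesis
    proof (rule gv_closedD(3)[OF Z wM J(1)])
      fix j assume j: "j \<in> J"
      have jR: "j \<in> carrier R" using GV_ideal_subset(2)[OF J(1) j] .
      obtain x where x: "x \<in> carrier M" "j \<odot>\<^bsub>M\<^esub> w = a \<odot>\<^bsub>M\<^esub> x" using J(2)[OF j] by blast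
      \<comment> \<open>From j w = a x and i w = a l with l in V, the scalar a kills i x - j l; the
        kernel of a lies in P, hence in V.\<close>
      have "x \<in> V" if V: "V \<in> \<F>" for V
      proof -
        obtain I where I: "GV_ideal R I" "\<And>i. i \<in> I \<Longrightarrow> i \<odot>\<^bsub>M\<^esub> w \<in> ?f ` V"
          using w V by (auto simp: F_def w_closure_iff)
        note LE = submoduleE[OF gv_closedD(1)[OF S(1)[OF V]]]
        show ?thesis
        proof (rule gv_closedD(3)[OF S(1)[OF V] x(1) I(1)])
          fix i assume i: "i \<in> I"
          have iR: "i \<in> carrier R" using GV_ideal_subset(2)[OF I(1) i] .
          obtain l where l: "l \<in> V" "i \<odot>\<^bsub>M\<^esub> w = a \<odot>\<^bsub>M\<^esub> l" using I(2)[OF i] by blast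
          have lM: "l \<in> carrier M" using l LE(1) by blast
          have "a \<odot>\<^bsub>M\<^esub> (i \<odot>\<^bsub>M\<^esub> x) = i \<odot>\<^bsub>M\<^esub> (j \<odot>\<^bsub>M\<^esub> w)" using x a iR by (simp add: smult_commute[of a i])
          also have "\<dots> = j \<odot>\<^bsub>M\<^esub> (i \<odot>\<^bsub>M\<^esub> w)" using iR jR wM by (rule smult_commute)
          also have "\<dots> = a \<odot>\<^bsub>M\<^esub> (j \<odot>\<^bsub>M\<^esub> l)" using l a jR lM by (simp add: smult_commute[of a j])
          finally have "a \<odot>\<^bsub>M\<^esub> (i \<odot>\<^bsub>M\<^esub> x \<ominus>\<^bsub>M\<^esub> j \<odot>\<^bsub>M\<^esub> l) = \<zero>\<^bsub>M\<^esub>"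
            using a iR jR x lM by (simp add: smult_minus_distr M.r_neg a_minus_def smult_r_minus smult_r_distr)
          moreover have "\<zero>\<^bsub>M\<^esub> \<in> ?Z" using submodule_zero gv_closedD(1)[OF Z] by blast
          ultimately have "i \<odot>\<^bsub>M\<^esub> x \<ominus>\<^bsub>M\<^esub> j \<odot>\<^bsub>M\<^esub> l \<in> V"
            using S(2)[OF V] iR jR x lM by (auto simp: subset_iff)
          then have "(i \<odot>\<^bsub>M\<^esub> x \<ominus>\<^bsub>M\<^esub> j \<odot>\<^bsub>M\<^esub> l) \<oplus>\<^bsub>M\<^esub> j \<odot>\<^bsub>M\<^esub> l \<in> V" using LE l jR by blast
          then show "i \<odot>\<^bsub>M\<^esub> x \<in> V" using iR jR lM x by (simp add: M.minus_add_cancel)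
        qed
      qed
      then have "x \<in> ?P" using x(1) S(3) by blast
      then show "j \<odot>\<^bsub>M\<^esub> w \<in> ?Z" using x by simp
    qed
  qed
  then have "Q \<inter> \<Inter>(F ` \<F>) = ?Z" using ZX F(3) by blast
  then obtain \<G>' where T': "finite \<G>'" "\<G>' \<subseteq> F ` \<F>" "Q \<inter> \<Inter>\<G>' = ?Z"
    using gv_cofgD[OF cofX, of "F ` \<F>"] F(1,3) by (metis (no_types, lifting) imageE)
  then obtain \<G> where T: "\<G> \<subseteq> \<F>" "finite \<G>" "\<G>' = F ` \<G>" by (meson finite_subset_image)
  have "x \<in> ?P" if x: "x \<in> carrier M \<inter> \<Inter>\<G>" for x
  proof -
    have "?f x \<in> Q" unfolding Q_def using x w_closure_incr[OF im[OF gv_closed_carrier]] by blast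
    moreover have "?f x \<in> \<Inter>\<G>'" using x T F(2) by blast
    ultimately show ?thesis using T'(3) x by blast
  qed
  then have "carrier M \<inter> \<Inter>\<G> = ?P" using S(2) T(1) by blast
  then show "\<exists>\<G>. finite \<G> \<and> \<G> \<subseteq> \<F> \<and> carrier M \<inter> \<Inter>\<G> = ?P" using T by blast
qed

end

section \<open>Prime ideals and simple closed submodules\<close>

text \<open>A product of elements, one from each ideal and outside p; primality keeps it
  outside.\<close>

lemma (in cring) ex_mem_notin_prime:
  assumes p: "primeideal p R" and "finite F" "\<And>q. q \<in> F \<Longrightarrow> ideal q R" "\<And>q. q \<in> F \<Longrightarrow> \<not> q \<subseteq> p"
  shows "\<exists>c\<in>carrier R - p. \<forall>q\<in>F. c \<in> q"
  using assms(2-)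
proof (induct F)
  case empty
  interpret primeideal p R by (rule p)
  show ?case using I_notcarr one_imp_carrier by blast
next
  case (insert q F)
  interpret primeideal p R by (rule p)
  obtain c where c: "c \<in> carrier R - p" "\<forall>q\<in>F. c \<in> q" using insert by auto
  obtain d where d: "d \<in> q" "d \<notin> p" using insert(5)[of q] by auto
  have I: "ideal q R" "\<And>q'. q' \<in> F \<Longrightarrow> ideal q' R" using insert(4) by auto
  have dR: "d \<in> carrier R" using ideal.Icarr[OF I(1) d(1)] .
  have "c \<otimes> d \<notin> p" using I_prime[of c d] c d dR by auto
  moreover have "c \<otimes> d \<in> q'" if "q' \<in> insert q F" for q'
    using that c d dR I ideal.I_l_closed[OF I(1)] ideal.I_r_closed[OF I(2)] by auto
  ultimately show ?case using c dR by blast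
qed

text \<open>Induction on the number of primes. After discarding a prime contained in another one
  they are pairwise incomparable, and an element avoiding all but p can be corrected at p without
  spoiling the rest.\<close>

lemma (in cring) prime_avoidance:
  assumes J: "ideal J R" and "finite F" "\<And>p. p \<in> F \<Longrightarrow> primeideal p R" "\<And>p. p \<in> F \<Longrightarrow> \<not> J \<subseteq> p"
  shows "\<exists>j\<in>J. \<forall>p\<in>F. j \<notin> p"
  using assms(2-)
proof (induct "card F" arbitrary: F rule: less_induct)
  case less
  interpret J: ideal J R by (rule J)
  show ?case
  proof (cases "\<exists>p\<in>F. \<exists>q\<in>F. p \<noteq> q \<and> p \<subseteq> q")
    case True
    then obtain p q where pq: "p \<in> F" "q \<in> F" "p \<noteq> q" "p \<subseteq> q" by blast
    have "card (F - {p}) < card F" using pq less(2) by (metis card_Diff1_less)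
    then obtain j where "j \<in> J" "\<forall>p\<in>F - {p}. j \<notin> p" using less(1)[of "F - {p}"] less(2-4) by auto
    then show ?thesis using pq by blast
  next
    case False
    show ?thesis
    proof (cases "F = {}")
      case True
      then show ?thesis using J.zero_closed by blast
    next
      case ne: False
      then obtain p where p: "p \<in> F" by blast
      interpret p: primeideal p R using less(3) p by blast
      have "card (F - {p}) < card F" using p less(2) by (metis card_Diff1_less)
      then obtain j where j: "j \<in> J" "\<forall>q\<in>F - {p}. j \<notin> q" using less(1)[of "F - {p}"] less(2-4) by auto
      show ?thesis
      proof (cases "j \<in> p")
        case False
        then show ?thesis using j by blast
      next
        case jp: True
        have I: "\<And>q. q \<in> F \<Longrightarrow> ideal q R" using less(3) by (simp add: primeideal.axioms(1))
        have "\<exists>c\<in>carrier R - p. \<forall>q\<in>F - {p}. c \<in> q"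
        proof (rule ex_mem_notin_prime[OF p.primeideal_axioms])
          show "\<not> q \<subseteq> p" if "q \<in> F - {p}" for q using that False p by blast
        qed (use less(2) I in auto)
        then obtain c where c: "c \<in> carrier R" "c \<notin> p" "\<forall>q\<in>F - {p}. c \<in> q" by blast
        obtain u where u: "u \<in> J" "u \<notin> p" using less(4)[OF p] by blast
        have uR: "u \<in> carrier R" and jR: "j \<in> carrier R" using u j by auto
        \<comment> \<open>The correction term: in J through u, in every prime other than p through
          c, and outside p because both factors are.\<close>
        define k where "k = u \<otimes> c"
        have kR: "k \<in> carrier R" using uR c unfolding k_def by simp
        have kJ: "k \<in> J" unfolding k_def using u c J.I_r_closed by blast
        have kp: "k \<notin> p" unfolding k_def using p.I_prime[of u c] uR c u by blast
        have "j \<oplus> k \<notin> p"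
        proof
          assume "j \<oplus> k \<in> p"
          then have "(j \<oplus> k) \<ominus> j \<in> p" using jp by (simp add: a_minus_def)
          then show False using kp kR jR by (simp add: minus_add_cancel)
        qed
        moreover have "j \<oplus> k \<notin> q" if q: "q \<in> F - {p}" for q
        proof
          assume jk: "j \<oplus> k \<in> q"
          interpret q: ideal q R using I q by blast
          have "k \<in> q" unfolding k_def using c q uR q.I_l_closed by blast
          then have "(j \<oplus> k) \<ominus> k \<in> q" using jk by (simp add: a_minus_def)
          then show False using j q kR jR by (simp add: minus_add_cancel)
        qed
        ultimately show ?thesis using J.a_closed[OF j(1) kJ] by blast
      qed
    qed
  qed
qed

section \<open>Complements, annihilators and w-simple subquotients\<close>

context module
begin

lemma submodule_chain_Union:
  assumes C: "C \<noteq> {}" "subset.chain {K. submodule K R M} C"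
  shows "submodule (\<Union>C) R M"
proof (rule submoduleI)
  have sub: "submodule K R M" if "K \<in> C" for K using that C(2) by (auto simp: subset_chain_def)
  show "\<Union>C \<subseteq> carrier M" using submoduleE(1)[OF sub] by blast
  show "\<zero>\<^bsub>M\<^esub> \<in> \<Union>C" using C(1) submodule_zero[OF sub] by blast
  fix a assume a: "a \<in> \<Union>C"
  show "\<ominus>\<^bsub>M\<^esub> a \<in> \<Union>C" using a submoduleE(3)[OF sub] by blast
  show "r \<odot>\<^bsub>M\<^esub> a \<in> \<Union>C" if "r \<in> carrier R" for r using a that submoduleE(4)[OF sub] by blast
  show "a \<oplus>\<^bsub>M\<^esub> b \<in> \<Union>C" if b: "b \<in> \<Union>C" for b
  proof -
    obtain K K' where K: "K \<in> C" "K' \<in> C" "a \<in> K" "b \<in> K'" using a b by blast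
    then consider "a \<in> K'" | "b \<in> K" using C(2) unfolding subset_chain_def by blast
    then show ?thesis using K submoduleE(5)[OF sub] by cases blast+
  qed
qed

text \<open>Serves three times: for complements of simple submodules, for a complement of the
  minimal bad submodule in Q, and in building injective hulls.\<close>

lemma ex_max_complement:
  assumes S: "submodule S R M" and Q: "submodule Q R M"
  obtains K where "submodule K R M" "K \<subseteq> Q" "K \<inter> S = {\<zero>\<^bsub>M\<^esub>}"
    "\<And>K'. submodule K' R M \<Longrightarrow> K' \<subseteq> Q \<Longrightarrow> K \<subseteq> K' \<Longrightarrow> K' \<inter> S = {\<zero>\<^bsub>M\<^esub>} \<Longrightarrow> K' = K"
proof -
  let ?A = "{K. submodule K R M \<and> K \<subseteq> Q \<and> K \<inter> S = {\<zero>\<^bsub>M\<^esub>}}"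
  have "\<exists>K\<in>?A. \<forall>K'\<in>?A. K \<subseteq> K' \<longrightarrow> K' = K"
  proof (rule subset_Zorn_nonempty)
    have "submodule {\<zero>\<^bsub>M\<^esub>} R M" by (rule submoduleI) auto
    then have "{\<zero>\<^bsub>M\<^esub>} \<in> ?A" using submodule_zero[OF S] submodule_zero[OF Q] by auto
    then show "?A \<noteq> {}" by blast
    fix C assume C: "C \<noteq> {}" "subset.chain ?A C"
    have "subset.chain {K. submodule K R M} C" using C(2) by (auto simp: subset_chain_def)
    then have "submodule (\<Union>C) R M" by (rule submodule_chain_Union[OF C(1)])
    moreover have "\<Union>C \<subseteq> Q" "\<Union>C \<inter> S = {\<zero>\<^bsub>M\<^esub>}" using C unfolding subset_chain_def by blast+
    ultimately show "\<Union>C \<in> ?A" by blast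
  qed
  then obtain K where K: "K \<in> ?A" "\<forall>K'\<in>?A. K \<subseteq> K' \<longrightarrow> K' = K" by (elim bexE)
  show ?thesis by (rule that[of K]) (use K in auto)
qed

abbreviation annih :: "'c set \<Rightarrow> 'a set"
  where "annih S \<equiv> {r \<in> carrier R. \<forall>x\<in>S. r \<odot>\<^bsub>M\<^esub> x = \<zero>\<^bsub>M\<^esub>}"

lemma annih_ideal:
  assumes "S \<subseteq> carrier M"
  shows "ideal (annih S) R"
proof (rule idealI)
  have c: "x \<in> carrier M" if "x \<in> S" for x using that assms by blast
  show "subgroup (annih S) (add_monoid R)"
    by (rule R.add.subgroupI) (use c in \<open>auto intro!: exI[of _ \<zero>] simp: smult_l_distr smult_l_minus\<close>)
  fix a r assume a: "a \<in> annih S" and r: "r \<in> carrier R"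
  then show "r \<otimes> a \<in> annih S" using c by (auto simp: smult_assoc1)
  then show "a \<otimes> r \<in> annih S" using a r by (simp add: R.m_comm)
qed (rule R.ring_axioms)

text \<open>\<open>(S/N)\<^sub>w\<close> is w-simple.\<close>

definition gv_cover :: "'c set \<Rightarrow> 'c set \<Rightarrow> bool"
  where "gv_cover N S \<longleftrightarrow> gv_closed R M S \<and> N \<subset> S \<and> (\<forall>K. gv_closed R M K \<and> N \<subseteq> K \<and> K \<subseteq> S \<longrightarrow> K = N \<or> K = S)"

definition gv_dcc :: "'c set \<Rightarrow> bool"
  where "gv_dcc N \<longleftrightarrow> (\<forall>A :: nat \<Rightarrow> 'c set. (\<forall>n. gv_closed R M (A n) \<and> A n \<subseteq> N \<and> A (Suc n) \<subseteq> A n) \<longrightarrow>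
    (\<exists>n. \<forall>k\<ge>n. A k = A n))"

text \<open>The analogue of an essential socle: above N every larger closed submodule contains a
  w-simple step. In Zorn's lemma a chain cannot shrink to N, because finitely many of its members,
  hence one of them, would already equal N.\<close>

lemma ex_gv_cover:
  assumes cof: "gv_cofg R M N Q" and V: "gv_closed R M V" "N \<subset> V" "V \<subseteq> Q"
  obtains S where "gv_cover N S" "S \<subseteq> V"
proof -
  let ?A = "{K. gv_closed R M K \<and> N \<subset> K \<and> K \<subseteq> V}"
  have "\<exists>S\<in>?A. \<forall>K\<in>?A. K \<subseteq> S \<longrightarrow> K = S"
  proof (rule Zorn_Inter)
    show "?A \<noteq> {}" using V by blast
    fix C assume C: "C \<noteq> {}" "subset.chain ?A C"
    have CA: "gv_closed R M K" "N \<subset> K" "K \<subseteq> V" if "K \<in> C" for K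
      using that C(2) by (auto simp: subset_chain_def)
    have eq: "V \<inter> \<Inter>C = \<Inter>C" using C(1) CA(3) by blast
    have cl: "gv_closed R M (\<Inter>C)" using gv_closed_Inter_in[OF V(1) CA(1), of C] unfolding eq by simp
    have "\<Inter>C \<noteq> N"
    proof
      assume N: "\<Inter>C = N"
      have "Q \<inter> \<Inter>C = N" using V N by blast
      then obtain T where T: "finite T" "T \<subseteq> C" "Q \<inter> \<Inter>T = N"
        using gv_cofgD[OF cof CA(1)] CA(2) by blast
      \<comment> \<open>An empty T would force Q = N, but V lies strictly above N and inside
        Q.\<close>
      have "T \<noteq> {}" using T V by auto
      moreover have "subset.chain ?A T" using T(2) C(2) unfolding subset_chain_def by blast
      ultimately have "\<Inter>T \<in> T" using Inter_in_chain[OF T(1)] by blast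
      then show False using T(2,3) CA(2,3) V(3) by blast
    qed
    then show "\<Inter>C \<in> ?A" using cl CA C(1) by blast
  qed
  then obtain S where S: "S \<in> ?A" "\<forall>K\<in>?A. K \<subseteq> S \<longrightarrow> K = S" by (elim bexE)
  have "gv_cover N S" unfolding gv_cover_def
  proof (intro conjI allI impI)
    fix K assume K: "gv_closed R M K \<and> N \<subseteq> K \<and> K \<subseteq> S"
    show "K = N \<or> K = S"
    proof (cases "K = N")
      case False
      then have "K \<in> ?A" using K S(1) by auto
      then show ?thesis using S(2) K by simp
    qed simp
  qed (use S(1) in auto)
  then show ?thesis by (rule that) (use S(1) in auto)
qed

text \<open>Finitely many terms already give the intersection of the chain, so the last of these
  terms equals it.\<close>

lemma gv_chain_stable:
  fixes A :: "nat \<Rightarrow> 'c set"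
  assumes A: "\<And>n. gv_closed R M (A n)" "\<And>n. A (Suc n) \<subseteq> A n"
    and cof: "gv_cofg R M (\<Inter>(range A)) (carrier M)"
  shows "\<exists>n. \<forall>k\<ge>n. A k = A n"
proof -
  have anti: "A k \<subseteq> A n" if "n \<le> k" for n k using lift_Suc_antimono_le[of A] A(2) that by blast
  have "carrier M \<inter> \<Inter>(range A) = \<Inter>(range A)" using gv_closedD(2)[OF A(1)] by blast
  then obtain T where T: "finite T" "T \<subseteq> range A" "carrier M \<inter> \<Inter>T = \<Inter>(range A)"
    using gv_cofgD[OF cof, of "range A"] A(1) by blast
  obtain I where I: "finite I" "T = A ` I" using finite_subset_image[OF T(1,2)] by blast
  \<comment> \<open>The inserted 0 keeps the maximum defined when the finite subfamily is empty,
    that is, when the chain is constantly M.\<close>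
  define n where "n = Max (insert 0 I)"
  have "A n \<subseteq> A i" if "i \<in> I" for i using that I(1) by (intro anti) (simp add: n_def)
  then have "A n \<subseteq> \<Inter>(range A)" using T(3) I(2) gv_closedD(2)[OF A(1)] by blast
  then have "A k = A n" if "k \<ge> n" for k using anti[OF that] by blast
  then show ?thesis by blast
qed

text \<open>A finite subfamily that works inside P leaves in Q a closed submodule meeting P only in
  N; if P is essential over N it is N.\<close>

lemma gv_cofg_essential:
  assumes N: "gv_closed R M N" and Q: "gv_closed R M Q" and "N \<subseteq> P" "P \<subseteq> Q"
    and cof: "gv_cofg R M N P"
    and ess: "\<And>V. gv_closed R M V \<Longrightarrow> N \<subset> V \<Longrightarrow> V \<subseteq> Q \<Longrightarrow> V \<inter> P \<noteq> N"
  shows "gv_cofg R M N Q"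
proof (rule gv_cofgI)
  fix \<F> assume S: "\<And>V. V \<in> \<F> \<Longrightarrow> gv_closed R M V" "\<And>V. V \<in> \<F> \<Longrightarrow> N \<subseteq> V" "Q \<inter> \<Inter>\<F> = N"
  have "P \<inter> \<Inter>\<F> = N" using S(3) assms(3,4) S(2) by blast
  then obtain T where T: "finite T" "T \<subseteq> \<F>" "P \<inter> \<Inter>T = N" using gv_cofgD[OF cof S(1,2)] by blast
  have "gv_closed R M (Q \<inter> \<Inter>T)" using T(2) S(1) by (intro gv_closed_Inter_in[OF Q]) blast
  moreover have "(Q \<inter> \<Inter>T) \<inter> P = N" using T(3) assms(4) by blast
  moreover have "N \<subseteq> Q \<inter> \<Inter>T" using T(2) S(2) assms(3,4) by blast
  ultimately have "Q \<inter> \<Inter>T = N" using ess by blast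
  then show "\<exists>T. finite T \<and> T \<subseteq> \<F> \<and> Q \<inter> \<Inter>T = N" using T by blast
qed

end

text \<open>The working form of a w-module: the vanishing of Ext is replaced by the extension of
  homomorphisms from GV-ideals. \<open>w_module_iff\<close> below proves the equivalence with the
  original definition.\<close>

locale w_mod = module +
  assumes torsion_free: "\<And>x J. x \<in> carrier M \<Longrightarrow> GV_ideal R J \<Longrightarrow> (\<And>j. j \<in> J \<Longrightarrow> j \<odot>\<^bsub>M\<^esub> x = \<zero>\<^bsub>M\<^esub>) \<Longrightarrow> x = \<zero>\<^bsub>M\<^esub>"
    and hom_extends: "\<And>J f. GV_ideal R J \<Longrightarrow> f \<in> mod_hom R ((ring_mod R)\<lparr>carrier := J\<rparr>) M \<Longrightarrow>
      \<exists>x\<in>carrier M. \<forall>j\<in>J. f j = j \<odot>\<^bsub>M\<^esub> x"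
begin

lemma gv_closed_zero: "gv_closed R M {\<zero>\<^bsub>M\<^esub>}"
proof (rule gv_closedI)
  show "submodule {\<zero>\<^bsub>M\<^esub>} R M" by (rule submoduleI) auto
qed (use torsion_free in auto)

lemma zero_in_gv_closed: "gv_closed R M V \<Longrightarrow> \<zero>\<^bsub>M\<^esub> \<in> V"
  using submodule_zero gv_closedD(1) by blast

lemma gv_closed_kernel:
  assumes "gv_closed R M Q" "a \<in> carrier R"
  shows "gv_closed R M {x \<in> Q. a \<odot>\<^bsub>M\<^esub> x = \<zero>\<^bsub>M\<^esub>}"
  using gv_closed_preimage1[OF assms(1) gv_closed_zero assms(2)] by simp

lemma gv_closed_ann_mod:
  assumes "I \<subseteq> carrier R"
  shows "gv_closed R M (ann_mod M I)"
  using gv_closed_preimage[OF gv_closed_carrier gv_closed_zero assms] by (simp add: ann_mod_def)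

text \<open>Schur's lemma in w-form. The kernel of a scalar on S is closed, so it is 0 or S, and all
  nonzero elements have the same annihilator. The last two claims say that it behaves like a maximal
  w-ideal: it contains no GV-ideal, but together with any further t it does.\<close>

lemma cover_annih:
  assumes S: "gv_cover {\<zero>\<^bsub>M\<^esub>} S"
  shows "\<And>r x. r \<in> carrier R \<Longrightarrow> x \<in> S \<Longrightarrow> x \<noteq> \<zero>\<^bsub>M\<^esub> \<Longrightarrow> r \<odot>\<^bsub>M\<^esub> x = \<zero>\<^bsub>M\<^esub> \<Longrightarrow> r \<in> annih S"
    and "primeideal (annih S) R"
    and "\<And>J. GV_ideal R J \<Longrightarrow> \<not> J \<subseteq> annih S"
    and "\<And>t. t \<in> carrier R \<Longrightarrow> t \<notin> annih S \<Longrightarrow>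
      \<exists>J. GV_ideal R J \<and> (\<forall>j\<in>J. \<exists>r\<in>carrier R. j \<ominus> r \<otimes> t \<in> annih S)"
proof -
  have cl: "gv_closed R M S" and ne: "{\<zero>\<^bsub>M\<^esub>} \<subset> S"
    and min: "\<And>K. gv_closed R M K \<Longrightarrow> K \<subseteq> S \<Longrightarrow> K = {\<zero>\<^bsub>M\<^esub>} \<or> K = S"
    using S zero_in_gv_closed unfolding gv_cover_def by blast+
  have SM: "S \<subseteq> carrier M" using gv_closedD(2)[OF cl] by blast
  obtain x0 where x0: "x0 \<in> S" "x0 \<noteq> \<zero>\<^bsub>M\<^esub>" using ne by blast
  show 1: "r \<in> annih S" if "r \<in> carrier R" "x \<in> S" "x \<noteq> \<zero>\<^bsub>M\<^esub>" "r \<odot>\<^bsub>M\<^esub> x = \<zero>\<^bsub>M\<^esub>" for r x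
    using min[OF gv_closed_kernel[OF cl that(1)]] that by blast
  show "primeideal (annih S) R"
  proof (rule primeidealI)
    show "ideal (annih S) R" by (rule annih_ideal[OF SM])
    show "carrier R \<noteq> annih S"
    proof
      assume "carrier R = annih S"
      then have "\<one> \<odot>\<^bsub>M\<^esub> x0 = \<zero>\<^bsub>M\<^esub>" using x0(1) R.one_closed by auto
      then show False using x0 SM by auto
    qed
    fix a b assume ab: "a \<in> carrier R" "b \<in> carrier R" "a \<otimes> b \<in> annih S"
    have "a \<odot>\<^bsub>M\<^esub> (b \<odot>\<^bsub>M\<^esub> x0) = \<zero>\<^bsub>M\<^esub>" using ab x0 SM by (simp add: smult_assoc1[symmetric] subset_iff)
    moreover have "b \<odot>\<^bsub>M\<^esub> x0 \<in> S" using ab x0 gv_closedD(1)[OF cl] by (simp add: submoduleE)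
    ultimately show "a \<in> annih S \<or> b \<in> annih S" using 1 ab x0 by blast
  qed (rule is_cring)
  show "\<not> J \<subseteq> annih S" if J: "GV_ideal R J" for J
  proof
    assume "J \<subseteq> annih S"
    then have "j \<odot>\<^bsub>M\<^esub> x0 = \<zero>\<^bsub>M\<^esub>" if "j \<in> J" for j using that x0(1) by auto
    then have "x0 = \<zero>\<^bsub>M\<^esub>" using torsion_free[OF _ J, of x0] x0(1) SM by auto
    then show False using x0(2) by simp
  qed
  show "\<exists>J. GV_ideal R J \<and> (\<forall>j\<in>J. \<exists>r\<in>carrier R. j \<ominus> r \<otimes> t \<in> annih S)"
    if t: "t \<in> carrier R" "t \<notin> annih S" for t
  proof -
    have x0M: "x0 \<in> carrier M" using x0 SM by blast
    let ?y = "t \<odot>\<^bsub>M\<^esub> x0"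
    have y: "?y \<in> S" "?y \<noteq> \<zero>\<^bsub>M\<^esub>" using x0 t 1[of t x0] gv_closedD(1)[OF cl] by (auto simp: submoduleE)
    have yM: "?y \<in> carrier M" using y SM by blast
    let ?K = "w_closure R M (cyclic ?y)"
    have "gv_closed R M ?K" by (rule w_closure_closed[OF submodule_cyclic(1)[OF yM]])
    moreover have "?K \<subseteq> S" by (rule w_closure_least[OF cl cyclic_least[OF gv_closedD(1)[OF cl] y(1)]])
    moreover have "?y \<in> ?K" using w_closure_incr[OF submodule_cyclic(1)[OF yM]] submodule_cyclic(2)[OF yM] by blast
    \<comment> \<open>The closure of the cyclic submodule of t x0 is nonzero, hence all of S, so
      some GV-ideal carries x0 into R t x0.\<close>
    ultimately have "x0 \<in> ?K" using min y x0 by blast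
    then obtain J where J: "GV_ideal R J" "\<forall>j\<in>J. j \<odot>\<^bsub>M\<^esub> x0 \<in> cyclic ?y" unfolding w_closure_iff by blast
    have "\<exists>r\<in>carrier R. j \<ominus> r \<otimes> t \<in> annih S" if j: "j \<in> J" for j
    proof -
      obtain r where r: "r \<in> carrier R" "j \<odot>\<^bsub>M\<^esub> x0 = r \<odot>\<^bsub>M\<^esub> ?y" using J(2) j by blast
      have jR: "j \<in> carrier R" using GV_ideal_subset(2)[OF J(1) j] .
      have "(j \<ominus> r \<otimes> t) \<odot>\<^bsub>M\<^esub> x0 = \<zero>\<^bsub>M\<^esub>"
        using r jR t x0M by (simp add: smult_minus_mult M.a_minus_self)
      then show ?thesis using 1[of "j \<ominus> r \<otimes> t" x0] r jR t x0 by blast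
    qed
    then show ?thesis using J(1) by blast
  qed
qed

text \<open>Choose for each w-simple S in Q a maximal complement. The complements intersect in 0, so
  finitely many do; the corresponding annihilators contain all scalars with a nonzero kernel on
  Q.\<close>

lemma finite_zero_divisor_types:
  assumes cof: "gv_cofg R M {\<zero>\<^bsub>M\<^esub>} Q" and Q: "gv_closed R M Q"
  obtains F where "finite F" "\<And>S. S \<in> F \<Longrightarrow> gv_cover {\<zero>\<^bsub>M\<^esub>} S" "\<And>S. S \<in> F \<Longrightarrow> S \<subseteq> Q"
    "\<And>t x. t \<in> carrier R \<Longrightarrow> \<forall>S\<in>F. t \<notin> annih S \<Longrightarrow> x \<in> Q \<Longrightarrow> t \<odot>\<^bsub>M\<^esub> x = \<zero>\<^bsub>M\<^esub> \<Longrightarrow> x = \<zero>\<^bsub>M\<^esub>"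
proof -
  define Min where "Min = {S. gv_cover {\<zero>\<^bsub>M\<^esub>} S \<and> S \<subseteq> Q}"
  have Min: "gv_closed R M S" "{\<zero>\<^bsub>M\<^esub>} \<subset> S" "S \<subseteq> Q" "\<And>K. gv_closed R M K \<Longrightarrow> K \<subseteq> S \<Longrightarrow> K = {\<zero>\<^bsub>M\<^esub>} \<or> K = S"
    if "S \<in> Min" for S
    using that zero_in_gv_closed unfolding Min_def gv_cover_def by blast+
  have "\<exists>K. gv_closed R M K \<and> K \<subseteq> Q \<and> K \<inter> S = {\<zero>\<^bsub>M\<^esub>} \<and>
      (\<forall>K'. submodule K' R M \<and> K' \<subseteq> Q \<and> K \<subseteq> K' \<and> K' \<inter> S = {\<zero>\<^bsub>M\<^esub>} \<longrightarrow> K' = K)" if S: "S \<in> Min" for S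
  proof -
    obtain K where K: "submodule K R M" "K \<subseteq> Q" "K \<inter> S = {\<zero>\<^bsub>M\<^esub>}"
      "\<And>K'. submodule K' R M \<Longrightarrow> K' \<subseteq> Q \<Longrightarrow> K \<subseteq> K' \<Longrightarrow> K' \<inter> S = {\<zero>\<^bsub>M\<^esub>} \<Longrightarrow> K' = K"
      using ex_max_complement[OF gv_closedD(1)[OF Min(1)[OF S]] gv_closedD(1)[OF Q]] by blast
    \<comment> \<open>Taking the closure creates no intersection with S, by torsion-freeness, so
      maximality makes the complement closed.\<close>
    have "w_closure R M K = K"
    proof (rule K(4))
      show "submodule (w_closure R M K) R M" by (rule w_closure_submodule[OF K(1)])
      show "w_closure R M K \<subseteq> Q" by (rule w_closure_least[OF Q K(2)])
      show "K \<subseteq> w_closure R M K" by (rule w_closure_incr[OF K(1)])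
      have "x = \<zero>\<^bsub>M\<^esub>" if x': "x \<in> w_closure R M K \<inter> S" for x
      proof -
        obtain J where J: "x \<in> carrier M" "GV_ideal R J" "\<forall>j\<in>J. j \<odot>\<^bsub>M\<^esub> x \<in> K" "x \<in> S"
          using x' unfolding Int_iff w_closure_iff by blast
        show ?thesis
        proof (rule torsion_free[OF J(1,2)])
          fix j assume j: "j \<in> J"
          have "j \<odot>\<^bsub>M\<^esub> x \<in> S" using GV_ideal_subset(2)[OF J(2) j] J(4) gv_closedD(1)[OF Min(1)[OF S]]
            by (simp add: submoduleE)
          then show "j \<odot>\<^bsub>M\<^esub> x = \<zero>\<^bsub>M\<^esub>" using K(3) J(3) j by blast
        qed
      qed
      then show "w_closure R M K \<inter> S = {\<zero>\<^bsub>M\<^esub>}"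
        using zero_in_gv_closed[OF Min(1)[OF S]] submodule_zero[OF w_closure_submodule[OF K(1)]] by blast
    qed
    then show ?thesis using K w_closure_closed[OF K(1)] by metis
  qed
  then obtain k where k: "\<And>S. S \<in> Min \<Longrightarrow> gv_closed R M (k S) \<and> k S \<subseteq> Q \<and> k S \<inter> S = {\<zero>\<^bsub>M\<^esub>} \<and>
      (\<forall>K'. submodule K' R M \<and> K' \<subseteq> Q \<and> k S \<subseteq> K' \<and> K' \<inter> S = {\<zero>\<^bsub>M\<^esub>} \<longrightarrow> K' = k S)" by metis
  have kc: "gv_closed R M (Q \<inter> \<Inter>(k ` Min))" using k by (intro gv_closed_Inter_in[OF Q]) blast
  \<comment> \<open>A nonzero intersection would contain some w-simple S, which would then lie in
    its own complement.\<close>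
  have "Q \<inter> \<Inter>(k ` Min) = {\<zero>\<^bsub>M\<^esub>}"
  proof (rule ccontr)
    assume "Q \<inter> \<Inter>(k ` Min) \<noteq> {\<zero>\<^bsub>M\<^esub>}"
    then have "{\<zero>\<^bsub>M\<^esub>} \<subset> Q \<inter> \<Inter>(k ` Min)" using zero_in_gv_closed[OF kc] by blast
    then obtain S where S: "gv_cover {\<zero>\<^bsub>M\<^esub>} S" "S \<subseteq> Q \<inter> \<Inter>(k ` Min)"
      using ex_gv_cover[OF cof kc] by blast
    then have "S \<in> Min" unfolding Min_def by blast
    then show False using S(2) k[of S] Min(2)[of S] by blast
  qed
  then obtain T where T: "finite T" "T \<subseteq> k ` Min" "Q \<inter> \<Inter>T = {\<zero>\<^bsub>M\<^esub>}"
    using gv_cofgD[OF cof, of "k ` Min"] k zero_in_gv_closed by (metis (no_types, lifting) empty_subsetI imageE insert_subset)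
  then obtain F where F: "F \<subseteq> Min" "finite F" "T = k ` F" by (meson finite_subset_image)
  have inj: "x = \<zero>\<^bsub>M\<^esub>" if t: "t \<in> carrier R" "\<forall>S\<in>F. t \<notin> annih S" and x: "x \<in> Q" "t \<odot>\<^bsub>M\<^esub> x = \<zero>\<^bsub>M\<^esub>" for t x
  proof (rule ccontr)
    assume "x \<noteq> \<zero>\<^bsub>M\<^esub>"
    let ?V = "{x \<in> Q. t \<odot>\<^bsub>M\<^esub> x = \<zero>\<^bsub>M\<^esub>}"
    have V: "gv_closed R M ?V" by (rule gv_closed_kernel[OF Q t(1)])
    then have "{\<zero>\<^bsub>M\<^esub>} \<subset> ?V" using zero_in_gv_closed[OF V] x \<open>x \<noteq> \<zero>\<^bsub>M\<^esub>\<close> by blast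
    then obtain S' where S': "gv_cover {\<zero>\<^bsub>M\<^esub>} S'" "S' \<subseteq> ?V" using ex_gv_cover[OF cof V] by blast
    then have S'M: "S' \<in> Min" unfolding Min_def by blast
    have "\<not> S' \<subseteq> Q \<inter> \<Inter>T" using T(3) Min(2)[OF S'M] by blast
    \<comment> \<open>The simple part S' of the kernel of t escapes one of the finitely many
      complements. Adding it to that complement produces a nonzero z = u + v in S with v in S', and
      t z = t u lies in both S and its complement, so t z = 0.\<close>
    then obtain S where S: "S \<in> F" "\<not> S' \<subseteq> k S" using F(3) Min(3)[OF S'M] by blast
    have SM: "S \<in> Min" using S F by blast
    note kS = k[OF SM]
    have ks: "submodule (k S) R M" and s's: "submodule S' R M"
      using kS gv_closedD(1) Min(1)[OF S'M] by blast+
    let ?K' = "k S <+>\<^bsub>M\<^esub> S'"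
    have K': "submodule ?K' R M" "k S \<subseteq> ?K'" "S' \<subseteq> ?K'"
      using submodule_set_add[OF ks s's] set_add_incr[OF ks s's] by blast+
    have K'Q: "?K' \<subseteq> Q" using kS Min(3)[OF S'M] by (intro set_add_least[OF gv_closedD(1)[OF Q]]) auto
    have "?K' \<inter> S \<noteq> {\<zero>\<^bsub>M\<^esub>}"
    proof
      assume "?K' \<inter> S = {\<zero>\<^bsub>M\<^esub>}"
      then have "?K' = k S" using kS K' K'Q by simp
      then show False using K'(3) S(2) by simp
    qed
    moreover have "\<zero>\<^bsub>M\<^esub> \<in> ?K' \<inter> S" using submodule_zero[OF K'(1)] zero_in_gv_closed[OF Min(1)[OF SM]] by blast
    ultimately obtain z where z: "z \<in> ?K'" "z \<in> S" "z \<noteq> \<zero>\<^bsub>M\<^esub>" by blast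
    then obtain u v where uv: "u \<in> k S" "v \<in> S'" "z = u \<oplus>\<^bsub>M\<^esub> v" unfolding set_add_iff by blast
    have uvM: "u \<in> carrier M" "v \<in> carrier M" using uv ks s's submodule_carrierD by blast+
    have "t \<odot>\<^bsub>M\<^esub> v = \<zero>\<^bsub>M\<^esub>" using uv(2) S'(2) by blast
    then have "t \<odot>\<^bsub>M\<^esub> z = t \<odot>\<^bsub>M\<^esub> u" using uv(3) uvM t(1) by (simp add: smult_r_distr)
    moreover have "t \<odot>\<^bsub>M\<^esub> u \<in> k S" using submoduleE(4)[OF ks t(1) uv(1)] .
    moreover have "t \<odot>\<^bsub>M\<^esub> z \<in> S" using submoduleE(4)[OF gv_closedD(1)[OF Min(1)[OF SM]] t(1) z(2)] .
    ultimately have "t \<odot>\<^bsub>M\<^esub> z = \<zero>\<^bsub>M\<^esub>" using kS by auto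
    then have "t \<in> annih S" using cover_annih(1)[of S t z] SM t(1) z unfolding Min_def by blast
    then show False using t(2) S(1) by blast
  qed
  show ?thesis
  proof (rule that[OF F(2)])
    show "gv_cover {\<zero>\<^bsub>M\<^esub>} S" "S \<subseteq> Q" if "S \<in> F" for S using that F(1) unfolding Min_def by blast+
  qed (rule inj)
qed

text \<open>Prime avoidance for the annihilators of finitely many w-simple modules, none of which
  contains a GV-ideal. With F from \<open>finite_zero_divisor_types\<close> the element j acts
  injectively.\<close>

lemma ex_GV_regular:
  assumes J: "GV_ideal R J" and F: "finite F" "\<And>S. S \<in> F \<Longrightarrow> gv_cover {\<zero>\<^bsub>M\<^esub>} S"
  shows "\<exists>j\<in>J. \<forall>S\<in>F. j \<notin> annih S"
proof -
  have "\<exists>j\<in>J. \<forall>p\<in>annih ` F. j \<notin> p"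
    using F cover_annih(2,3)[OF F(2)] by (intro prime_avoidance[OF GV_idealD(1)[OF J]]) (use J in blast)+
  then obtain j where j: "j \<in> J" "\<forall>p\<in>annih ` F. j \<notin> p" by (elim bexE)
  have "\<forall>S\<in>F. j \<notin> annih S" using j(2) by (simp only: ball_simps)
  then show ?thesis using j(1) by (rule bexI)
qed

end

section \<open>A minimal submodule with non-cofinitely generated quotient\<close>

context w_mod
begin

text \<open>The classical fact that an injective endomorphism of an Artinian module is onto. The
  powers give a stable chain of closures, which after cancelling yields J y \<subseteq> t N; the
  vanishing of Ext then removes J.\<close>

lemma gv_dcc_regular_surj:
  assumes N: "gv_closed R M N" and dcc: "gv_dcc N" and t: "t \<in> carrier R"
    and inj: "\<And>x. x \<in> N \<Longrightarrow> t \<odot>\<^bsub>M\<^esub> x = \<zero>\<^bsub>M\<^esub> \<Longrightarrow> x = \<zero>\<^bsub>M\<^esub>" and y: "y \<in> N"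
  shows "\<exists>x\<in>N. y = t \<odot>\<^bsub>M\<^esub> x"
proof -
  note Ns = gv_closedD(1)[OF N]
  have c: "x \<in> carrier M" if "x \<in> N" for x using gv_closedD(2)[OF N that] .
  have tk: "t [^] k \<in> carrier R" for k :: nat using t by simp
  have sub: "submodule ((\<lambda>x. t [^] k \<odot>\<^bsub>M\<^esub> x) ` N) R M" for k :: nat by (rule submodule_smult_image[OF Ns tk])
  have injk: "x = \<zero>\<^bsub>M\<^esub>" if "x \<in> N" "t [^] k \<odot>\<^bsub>M\<^esub> x = \<zero>\<^bsub>M\<^esub>" for k :: nat and x
    using that
  proof (induct k arbitrary: x)
    case 0
    then show ?case using c by simp
  next
    case (Suc k)
    have "t [^] k \<odot>\<^bsub>M\<^esub> (t \<odot>\<^bsub>M\<^esub> x) = \<zero>\<^bsub>M\<^esub>" using Suc(2,3) c tk[of k] t by (simp add: smult_assoc1)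
    then have "t \<odot>\<^bsub>M\<^esub> x = \<zero>\<^bsub>M\<^esub>" using Suc(1)[of "t \<odot>\<^bsub>M\<^esub> x"] submoduleE(4)[OF Ns t Suc(2)] by simp
    then show ?case using inj Suc(2) by simp
  qed
  have step: "t [^] Suc k \<odot>\<^bsub>M\<^esub> x = t [^] k \<odot>\<^bsub>M\<^esub> (t \<odot>\<^bsub>M\<^esub> x)" if "x \<in> N" for k :: nat and x
    using that c tk[of k] t by (simp add: smult_assoc1)
  define A where "A k = w_closure R M ((\<lambda>x. t [^] k \<odot>\<^bsub>M\<^esub> x) ` N)" for k :: nat
  have "\<exists>n. \<forall>k\<ge>n. A k = A n"
  proof (rule dcc[unfolded gv_dcc_def, rule_format])
    fix k :: nat
    have "(\<lambda>x. t [^] k \<odot>\<^bsub>M\<^esub> x) ` N \<subseteq> N" using submoduleE(4)[OF Ns tk] by blast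
    moreover have "(\<lambda>x. t [^] Suc k \<odot>\<^bsub>M\<^esub> x) ` N \<subseteq> (\<lambda>x. t [^] k \<odot>\<^bsub>M\<^esub> x) ` N"
    proof
      fix z assume "z \<in> (\<lambda>x. t [^] Suc k \<odot>\<^bsub>M\<^esub> x) ` N"
      then obtain x where x: "x \<in> N" "z = t [^] Suc k \<odot>\<^bsub>M\<^esub> x" by (elim imageE)
      then show "z \<in> (\<lambda>x. t [^] k \<odot>\<^bsub>M\<^esub> x) ` N"
        using step[OF x(1)] submoduleE(4)[OF Ns t x(1)] by simp
    qed
    ultimately show "gv_closed R M (A k) \<and> A k \<subseteq> N \<and> A (Suc k) \<subseteq> A k" unfolding A_def
      using w_closure_closed[OF sub] w_closure_least[OF N] w_closure_mono by simp
  qed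
  then obtain n where n: "\<forall>k\<ge>n. A k = A n" by (elim exE)
  have "t [^] n \<odot>\<^bsub>M\<^esub> y \<in> A n" unfolding A_def using w_closure_incr[OF sub[of n]] y by auto
  then have "t [^] n \<odot>\<^bsub>M\<^esub> y \<in> A (Suc n)" using n[rule_format, of "Suc n"] by (simp del: nat_pow_Suc)
  then obtain J where J: "GV_ideal R J" "\<And>j. j \<in> J \<Longrightarrow> j \<in> carrier R"
    "\<And>j. j \<in> J \<Longrightarrow> j \<odot>\<^bsub>M\<^esub> (t [^] n \<odot>\<^bsub>M\<^esub> y) \<in> (\<lambda>x. t [^] Suc n \<odot>\<^bsub>M\<^esub> x) ` N"
    unfolding A_def by (rule w_closureE') (rule that)
  have ex: "\<exists>x. x \<in> N \<and> t \<odot>\<^bsub>M\<^esub> x = j \<odot>\<^bsub>M\<^esub> y" if j: "j \<in> J" for j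
  proof -
    obtain x where x: "x \<in> N" "j \<odot>\<^bsub>M\<^esub> (t [^] n \<odot>\<^bsub>M\<^esub> y) = t [^] Suc n \<odot>\<^bsub>M\<^esub> x" using J(3)[OF j] by (elim imageE)
    have "t [^] n \<odot>\<^bsub>M\<^esub> (t \<odot>\<^bsub>M\<^esub> x \<ominus>\<^bsub>M\<^esub> j \<odot>\<^bsub>M\<^esub> y) = \<zero>\<^bsub>M\<^esub>"
      using x(2) step[OF x(1)] x(1) y c J(2)[OF j] t tk[of n]
      by (simp add: smult_minus_distr smult_commute[of j] M.a_minus_self)
    then have "t \<odot>\<^bsub>M\<^esub> x \<ominus>\<^bsub>M\<^esub> j \<odot>\<^bsub>M\<^esub> y = \<zero>\<^bsub>M\<^esub>"
      by (rule injk[rotated])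
        (rule submodule_minus[OF Ns submoduleE(4)[OF Ns t x(1)] submoduleE(4)[OF Ns J(2)[OF j] y]])
    then have "t \<odot>\<^bsub>M\<^esub> x = j \<odot>\<^bsub>M\<^esub> y" using x(1) y c J(2)[OF j] t by (simp add: M.a_minus_eq_zero_iff)
    then show ?thesis using x(1) by blast
  qed
  \<comment> \<open>Division of j y by t inside N. Injectivity of t makes f linear, so that it is
    multiplication on J by some x, the candidate for y divided by t.\<close>
  define f where "f = (\<lambda>j\<in>J. SOME x. x \<in> N \<and> t \<odot>\<^bsub>M\<^esub> x = j \<odot>\<^bsub>M\<^esub> y)"
  have f: "f j \<in> N" "t \<odot>\<^bsub>M\<^esub> f j = j \<odot>\<^bsub>M\<^esub> y" if "j \<in> J" for j
    using someI_ex[OF ex[OF that]] that by (simp_all add: f_def)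
  have uniq: "u = v" if "u \<in> N" "v \<in> N" "t \<odot>\<^bsub>M\<^esub> u = t \<odot>\<^bsub>M\<^esub> v" for u v
  proof -
    have "u \<ominus>\<^bsub>M\<^esub> v = \<zero>\<^bsub>M\<^esub>"
      using that t c by (intro inj[OF submodule_minus[OF Ns that(1,2)]]) (simp add: smult_minus_distr M.a_minus_self)
    then show ?thesis using that c by (simp add: M.a_minus_eq_zero_iff)
  qed
  interpret J: ideal J R by (rule GV_idealD(1)[OF J(1)])
  have "f \<in> mod_hom R ((ring_mod R)\<lparr>carrier := J\<rparr>) M"
  proof (rule mod_homI)
    show "f \<in> extensional (carrier ((ring_mod R)\<lparr>carrier := J\<rparr>))" by (simp add: f_def)
    show "f j \<in> carrier M" if "j \<in> carrier ((ring_mod R)\<lparr>carrier := J\<rparr>)" for j using that f c by simp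
    fix i assume "i \<in> carrier ((ring_mod R)\<lparr>carrier := J\<rparr>)"
    then have i: "i \<in> J" by simp
    show "f (i \<oplus>\<^bsub>(ring_mod R)\<lparr>carrier := J\<rparr>\<^esub> j) = f i \<oplus>\<^bsub>M\<^esub> f j" if "j \<in> carrier ((ring_mod R)\<lparr>carrier := J\<rparr>)" for j
    proof -
      have j: "j \<in> J" using that by simp
      have ij: "i \<oplus> j \<in> J" using i j by simp
      have "f (i \<oplus> j) = f i \<oplus>\<^bsub>M\<^esub> f j"
      proof (rule uniq[OF f(1)[OF ij] submoduleE(5)[OF Ns f(1)[OF i] f(1)[OF j]]])
        show "t \<odot>\<^bsub>M\<^esub> f (i \<oplus> j) = t \<odot>\<^bsub>M\<^esub> (f i \<oplus>\<^bsub>M\<^esub> f j)"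
          using f(2)[OF i] f(2)[OF j] f(2)[OF ij] c[OF f(1)[OF i]] c[OF f(1)[OF j]] c[OF y] J(2)[OF i] J(2)[OF j] t
          by (simp add: smult_r_distr smult_l_distr)
      qed
      then show ?thesis by simp
    qed
    show "f (r \<odot>\<^bsub>(ring_mod R)\<lparr>carrier := J\<rparr>\<^esub> i) = r \<odot>\<^bsub>M\<^esub> f i" if r: "r \<in> carrier R" for r
    proof -
      have ri: "r \<otimes> i \<in> J" using i r by (rule J.I_l_closed)
      have "f (r \<otimes> i) = r \<odot>\<^bsub>M\<^esub> f i"
      proof (rule uniq[OF f(1)[OF ri] submoduleE(4)[OF Ns r f(1)[OF i]]])
        show "t \<odot>\<^bsub>M\<^esub> f (r \<otimes> i) = t \<odot>\<^bsub>M\<^esub> (r \<odot>\<^bsub>M\<^esub> f i)"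
          using f(2)[OF i] f(2)[OF ri] c[OF f(1)[OF i]] c[OF y] J(2)[OF i] t r
          by (simp add: smult_commute[of t r] smult_assoc1)
      qed
      then show ?thesis by simp
    qed
  qed
  from hom_extends[OF J(1) this] obtain x where x: "x \<in> carrier M" "\<forall>j\<in>J. f j = j \<odot>\<^bsub>M\<^esub> x" by (elim bexE)
  have xN: "x \<in> N" by (rule gv_closedD(3)[OF N x(1) J(1)]) (use x(2) f(1) in auto)
  \<comment> \<open>Every j in J kills y - t x, so torsion-freeness turns equality up to J into
    equality.\<close>
  have "y \<ominus>\<^bsub>M\<^esub> t \<odot>\<^bsub>M\<^esub> x = \<zero>\<^bsub>M\<^esub>"
  proof (rule torsion_free[OF _ J(1)])
    fix j assume j: "j \<in> J"
    have "j \<odot>\<^bsub>M\<^esub> (t \<odot>\<^bsub>M\<^esub> x) = j \<odot>\<^bsub>M\<^esub> y" using f(2)[OF j] x j J(2) t by (simp add: smult_commute[of j t])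
    then show "j \<odot>\<^bsub>M\<^esub> (y \<ominus>\<^bsub>M\<^esub> t \<odot>\<^bsub>M\<^esub> x) = \<zero>\<^bsub>M\<^esub>"
      using J(2)[OF j] x(1) y c t by (simp add: smult_minus_distr M.a_minus_self)
  qed (use x y c t in auto)
  then show ?thesis using xN x(1) y c t by (intro bexI[of _ x]) (simp_all add: M.a_minus_eq_zero_iff)
qed

end

text \<open>The situation of the proof by contradiction; \<open>ex_minimal_bad\<close> produces such
  an N when the descending chain condition fails.\<close>

locale minimal_bad = w_mod +
  fixes N :: "'c set"
  assumes cof0: "gv_cofg R M {\<zero>\<^bsub>M\<^esub>} (carrier M)"
    and N: "gv_closed R M N" and bad: "\<not> gv_cofg R M N (carrier M)"
    and minimal: "\<And>N'. gv_closed R M N' \<Longrightarrow> N' \<subset> N \<Longrightarrow> gv_cofg R M N' (carrier M)"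
begin

definition p :: "'a set" where "p = annih N"

lemma NM: "x \<in> N \<Longrightarrow> x \<in> carrier M" using gv_closedD(2)[OF N] .
lemma Ns: "submodule N R M" using gv_closedD(1)[OF N] .

lemma carr: "gv_closed R M Q \<Longrightarrow> Q \<subseteq> carrier M" using gv_closedD(2)[of Q] by auto

lemma ker_psubset:
  assumes s: "s \<in> carrier R - p"
  shows "\<exists>x\<in>N. s \<odot>\<^bsub>M\<^esub> x \<noteq> \<zero>\<^bsub>M\<^esub>"
  using s by (auto simp: p_def)

text \<open>The way in which minimality is exploited throughout: N \<inter> K is strictly below N,
  so M modulo it is good, and so is its submodule K/(N \<inter> K), which is (N + K)/N up to
  closure.\<close>

lemma not_subset_cofg_add:
  assumes K: "gv_closed R M K" and nsub: "\<not> N \<subseteq> K"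
  shows "gv_cofg R M N (w_closure R M (N <+>\<^bsub>M\<^esub> K))"
proof (rule gv_cofg_add[OF N K])
  have NK: "gv_closed R M (N \<inter> K)" by (rule gv_closed_inter[OF N K])
  have "N \<inter> K \<subset> N" using nsub by blast
  from gv_cofg_subset[OF minimal[OF NK this] K] show "gv_cofg R M (N \<inter> K) K" using carr[OF K] by simp
qed

text \<open>If the closure Z of s N were smaller than N, then M/Z would be good, hence M/P with P
  the preimage of Z under s. Since P lies in the closure of N plus the kernel of s, P/N is good as
  well, and M/N would be an extension of good by good.\<close>

lemma smult_dense:
  assumes s: "s \<in> carrier R - p"
  shows "w_closure R M ((\<lambda>x. s \<odot>\<^bsub>M\<^esub> x) ` N) = N"
proof (rule ccontr)
  let ?Z = "w_closure R M ((\<lambda>x. s \<odot>\<^bsub>M\<^esub> x) ` N)"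
  have sR: "s \<in> carrier R" using s by simp
  have sN: "submodule ((\<lambda>x. s \<odot>\<^bsub>M\<^esub> x) ` N) R M" by (rule submodule_smult_image[OF Ns sR])
  have Z: "gv_closed R M ?Z" by (rule w_closure_closed[OF sN])
  have ZN: "?Z \<subseteq> N" using submoduleE(4)[OF Ns sR] by (intro w_closure_least[OF N]) blast
  assume "?Z \<noteq> N"
  then have "?Z \<subset> N" using ZN by blast
  from gv_cofg_preimage[OF N sR minimal[OF Z this]]
  have cofP: "gv_cofg R M {x \<in> carrier M. s \<odot>\<^bsub>M\<^esub> x \<in> ?Z} (carrier M)" (is "gv_cofg R M ?P _") .
  have P: "gv_closed R M ?P" by (rule gv_closed_preimage1[OF gv_closed_carrier Z sR])
  let ?K = "{x \<in> carrier M. s \<odot>\<^bsub>M\<^esub> x = \<zero>\<^bsub>M\<^esub>}"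
  have K: "gv_closed R M ?K" by (rule gv_closed_kernel[OF gv_closed_carrier sR])
  have "\<not> N \<subseteq> ?K" using ker_psubset[OF s] by blast
  then have cofN: "gv_cofg R M N (w_closure R M (N <+>\<^bsub>M\<^esub> ?K))" by (rule not_subset_cofg_add[OF K])
  have NK: "submodule (N <+>\<^bsub>M\<^esub> ?K) R M" by (rule submodule_set_add[OF Ns gv_closedD(1)[OF K]])
  have NP: "N \<subseteq> ?P" using w_closure_incr[OF sN] NM by auto
  have "?P \<subseteq> w_closure R M (N <+>\<^bsub>M\<^esub> ?K)"
  proof
    fix x assume "x \<in> ?P"
    then have x: "x \<in> carrier M" "s \<odot>\<^bsub>M\<^esub> x \<in> ?Z" by simp_all
    from x(2) obtain J where J: "GV_ideal R J" "\<And>j. j \<in> J \<Longrightarrow> j \<in> carrier R"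
      "\<And>j. j \<in> J \<Longrightarrow> j \<odot>\<^bsub>M\<^esub> (s \<odot>\<^bsub>M\<^esub> x) \<in> (\<lambda>x. s \<odot>\<^bsub>M\<^esub> x) ` N" by (rule w_closureE') (rule that)
    have "j \<odot>\<^bsub>M\<^esub> x \<in> N <+>\<^bsub>M\<^esub> ?K" if j: "j \<in> J" for j
    proof -
      obtain n where n: "n \<in> N" "j \<odot>\<^bsub>M\<^esub> (s \<odot>\<^bsub>M\<^esub> x) = s \<odot>\<^bsub>M\<^esub> n" using J(3)[OF j] by (elim imageE)
      have "j \<odot>\<^bsub>M\<^esub> x \<ominus>\<^bsub>M\<^esub> n \<in> ?K"
        using n x NM J(2)[OF j] sR by (simp add: smult_minus_distr smult_commute[of s j] M.a_minus_self)
      moreover have "j \<odot>\<^bsub>M\<^esub> x = n \<oplus>\<^bsub>M\<^esub> (j \<odot>\<^bsub>M\<^esub> x \<ominus>\<^bsub>M\<^esub> n)"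
        using n x NM J(2)[OF j] by (simp add: M.minus_add_cancel)
      ultimately show ?thesis unfolding set_add_iff using n(1) by blast
    qed
    then show "x \<in> w_closure R M (N <+>\<^bsub>M\<^esub> ?K)" unfolding w_closure_iff using x(1) J(1) by blast
  qed
  then have "gv_cofg R M N ?P" using gv_cofg_subset[OF cofN P NP] by simp
  then have "gv_cofg R M N (carrier M)"
    using gv_cofg_trans[OF N P gv_closed_carrier NP _ _ cofP] by simp
  then show False using bad by simp
qed

lemma N_nonzero: "\<exists>x\<in>N. x \<noteq> \<zero>\<^bsub>M\<^esub>"
proof (rule ccontr)
  assume "\<not> (\<exists>x\<in>N. x \<noteq> \<zero>\<^bsub>M\<^esub>)"
  then have "N \<subseteq> {\<zero>\<^bsub>M\<^esub>}" by blast
  then have eq: "N = {\<zero>\<^bsub>M\<^esub>}" using zero_in_gv_closed[OF N] by (intro subset_antisym) simp_all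
  show False using bad cof0 unfolding eq by (rule notE)
qed

lemma p_ideal: "ideal p R"
  unfolding p_def by (rule annih_ideal) (use NM in auto)

text \<open>If a b kills N, then a N lies in the closed kernel of b; for a outside p density extends
  this to N, so b is in p.\<close>

lemma p_prime: "primeideal p R"
proof (rule primeidealI[OF p_ideal is_cring])
  obtain x where x: "x \<in> N" "x \<noteq> \<zero>\<^bsub>M\<^esub>" using N_nonzero by (elim bexE)
  show "carrier R \<noteq> p"
  proof
    assume "carrier R = p"
    then have "\<one> \<odot>\<^bsub>M\<^esub> x = \<zero>\<^bsub>M\<^esub>" using x(1) R.one_closed by (auto simp: p_def)
    then show False using x NM by simp
  qed
  fix a b assume ab: "a \<in> carrier R" "b \<in> carrier R" "a \<otimes> b \<in> p"
  show "a \<in> p \<or> b \<in> p"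
  proof (rule ccontr)
    assume n: "\<not> (a \<in> p \<or> b \<in> p)"
    let ?K = "{x \<in> N. b \<odot>\<^bsub>M\<^esub> x = \<zero>\<^bsub>M\<^esub>}"
    have K: "gv_closed R M ?K" by (rule gv_closed_kernel[OF N ab(2)])
    have "b \<odot>\<^bsub>M\<^esub> (a \<odot>\<^bsub>M\<^esub> x) = \<zero>\<^bsub>M\<^esub>" if "x \<in> N" for x
    proof -
      have "(a \<otimes> b) \<odot>\<^bsub>M\<^esub> x = \<zero>\<^bsub>M\<^esub>" using ab(3) that by (simp add: p_def)
      then show ?thesis using ab(1,2) NM[OF that] by (simp add: smult_assoc1 smult_commute[of b a])
    qed
    then have "(\<lambda>x. a \<odot>\<^bsub>M\<^esub> x) ` N \<subseteq> ?K" using submoduleE(4)[OF Ns ab(1)] by auto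
    then have "N \<subseteq> ?K" using w_closure_least[OF K] smult_dense[of a] n ab(1) by auto
    moreover obtain x where "x \<in> N" "b \<odot>\<^bsub>M\<^esub> x \<noteq> \<zero>\<^bsub>M\<^esub>" using ker_psubset[of b] n ab(2) by auto
    ultimately show False by auto
  qed
qed

lemma p_closed:
  assumes r: "r \<in> carrier R" and J: "GV_ideal R J" "\<And>j. j \<in> J \<Longrightarrow> j \<otimes> r \<in> p"
  shows "r \<in> p"
proof -
  have "r \<odot>\<^bsub>M\<^esub> x = \<zero>\<^bsub>M\<^esub>" if x: "x \<in> N" for x
  proof (rule torsion_free[OF _ J(1)])
    fix j assume j: "j \<in> J"
    have "(j \<otimes> r) \<odot>\<^bsub>M\<^esub> x = \<zero>\<^bsub>M\<^esub>" using J(2)[OF j] x by (simp add: p_def)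
    then show "j \<odot>\<^bsub>M\<^esub> (r \<odot>\<^bsub>M\<^esub> x) = \<zero>\<^bsub>M\<^esub>" using GV_ideal_subset(2)[OF J(1) j] r NM[OF x] by (simp add: smult_assoc1)
  qed (use r NM x in simp)
  then show ?thesis using r by (simp add: p_def)
qed

text \<open>A chain below N either is constantly N or has an intersection strictly below N, which is
  good by minimality and forces stability.\<close>

lemma N_dcc: "gv_dcc N"
  unfolding gv_dcc_def
proof (intro allI impI)
  fix A :: "nat \<Rightarrow> 'c set"
  assume A: "\<forall>n. gv_closed R M (A n) \<and> A n \<subseteq> N \<and> A (Suc n) \<subseteq> A n"
  show "\<exists>n. \<forall>k\<ge>n. A k = A n"
  proof (cases "\<Inter>(range A) = N")
    case True
    then have "A k = N" for k using A by blast
    then show ?thesis by simp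
  next
    case False
    have "\<Inter>(range A) \<subset> N" using A False by blast
    moreover have "gv_closed R M (\<Inter>(range A))"
    proof -
      have "carrier M \<inter> \<Inter>(range A) = \<Inter>(range A)" using A NM by blast
      then show ?thesis using gv_closed_Inter[of "range A"] A by auto
    qed
    ultimately have "gv_cofg R M (\<Inter>(range A)) (carrier M)" by (intro minimal)
    then show ?thesis using A by (intro gv_chain_stable) auto
  qed
qed

text \<open>Density only gives J y \<subseteq> s N. Choosing j in J that is bijective on N gives j y
  = s z and z = j z', and j can be cancelled.\<close>

lemma divisible:
  assumes s: "s \<in> carrier R - p" and y: "y \<in> N"
  shows "\<exists>x\<in>N. y = s \<odot>\<^bsub>M\<^esub> x"
proof -
  have sR: "s \<in> carrier R" using s by simp
  obtain F where F: "finite F" "\<And>S. S \<in> F \<Longrightarrow> gv_cover {\<zero>\<^bsub>M\<^esub>} S" "\<And>S. S \<in> F \<Longrightarrow> S \<subseteq> carrier M"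
    "\<And>t x. t \<in> carrier R \<Longrightarrow> \<forall>S\<in>F. t \<notin> annih S \<Longrightarrow> x \<in> carrier M \<Longrightarrow> t \<odot>\<^bsub>M\<^esub> x = \<zero>\<^bsub>M\<^esub> \<Longrightarrow> x = \<zero>\<^bsub>M\<^esub>"
    by (rule finite_zero_divisor_types[OF cof0 gv_closed_carrier]) (rule that)
  have "y \<in> w_closure R M ((\<lambda>x. s \<odot>\<^bsub>M\<^esub> x) ` N)" using smult_dense[OF s] y by simp
  then obtain J where J: "GV_ideal R J" "\<And>j. j \<in> J \<Longrightarrow> j \<in> carrier R"
      "\<And>j. j \<in> J \<Longrightarrow> j \<odot>\<^bsub>M\<^esub> y \<in> (\<lambda>x. s \<odot>\<^bsub>M\<^esub> x) ` N" by (rule w_closureE') (rule that)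
  have "\<exists>j\<in>J. \<forall>S\<in>F. j \<notin> annih S" by (rule ex_GV_regular[OF J(1) F(1)]) (rule F(2))
  then obtain j where j: "j \<in> J" "\<forall>S\<in>F. j \<notin> annih S" by (elim bexE)
  have jR: "j \<in> carrier R" using J(2) j(1) .
  have inj: "x = \<zero>\<^bsub>M\<^esub>" if "x \<in> N" "j \<odot>\<^bsub>M\<^esub> x = \<zero>\<^bsub>M\<^esub>" for x
    by (rule F(4)[OF jR j(2) NM[OF that(1)] that(2)])
  obtain z where z: "z \<in> N" "j \<odot>\<^bsub>M\<^esub> y = s \<odot>\<^bsub>M\<^esub> z" using J(3)[OF j(1)] by (elim imageE)
  have "\<exists>z'\<in>N. z = j \<odot>\<^bsub>M\<^esub> z'" by (rule gv_dcc_regular_surj[OF N N_dcc jR _ z(1)]) (rule inj)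
  then obtain z' where z': "z' \<in> N" "z = j \<odot>\<^bsub>M\<^esub> z'" by (elim bexE)
  have "j \<odot>\<^bsub>M\<^esub> (y \<ominus>\<^bsub>M\<^esub> s \<odot>\<^bsub>M\<^esub> z') = \<zero>\<^bsub>M\<^esub>"
    using z z' NM y jR sR by (simp add: smult_minus_distr smult_commute[of s j] M.a_minus_self)
  then have "y \<ominus>\<^bsub>M\<^esub> s \<odot>\<^bsub>M\<^esub> z' = \<zero>\<^bsub>M\<^esub>"
    by (rule inj[OF submodule_minus[OF Ns y submoduleE(4)[OF Ns sR z'(1)]]])
  then show ?thesis using z'(1) y NM sR by (intro bexI[of _ z']) (simp_all add: M.a_minus_eq_zero_iff)
qed

lemma N_subset_prime_part: "N \<subseteq> prime_part R M p"
proof -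
  have Nann: "N \<subseteq> ann_mod M p" using NM by (auto simp: ann_mod_def p_def)
  show ?thesis unfolding prime_part_def
  proof (intro INT_greatest subsetI)
    fix s y assume s: "s \<in> carrier R - p" and y: "y \<in> N"
    obtain x where "x \<in> N" "y = s \<odot>\<^bsub>M\<^esub> x" using divisible[OF s y] by (elim bexE)
    then show "y \<in> (\<lambda>x. s \<odot>\<^bsub>M\<^esub> x) ` ann_mod M p" using Nann by auto
  qed
qed

text \<open>Exact divisibility b N = N splits the preimage of N under b as N plus the kernel of b,
  and this kernel does not contain N.\<close>

lemma cofg_preimage_smult:
  assumes Q: "gv_closed R M Q" "N \<subseteq> Q" and b: "b \<in> carrier R - p"
  shows "gv_cofg R M N {x \<in> Q. b \<odot>\<^bsub>M\<^esub> x \<in> N}"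
proof -
  let ?P = "{x \<in> Q. b \<odot>\<^bsub>M\<^esub> x \<in> N}"
  let ?K = "{x \<in> Q. b \<odot>\<^bsub>M\<^esub> x = \<zero>\<^bsub>M\<^esub>}"
  have bR: "b \<in> carrier R" using b by simp
  have K: "gv_closed R M ?K" by (rule gv_closed_kernel[OF Q(1) bR])
  have P: "gv_closed R M ?P" by (rule gv_closed_preimage1[OF Q(1) N bR])
  have QM: "x \<in> carrier M" if "x \<in> Q" for x using gv_closedD(2)[OF Q(1) that] .
  have "\<not> N \<subseteq> ?K" using ker_psubset[OF b] by blast
  then have cof: "gv_cofg R M N (w_closure R M (N <+>\<^bsub>M\<^esub> ?K))" by (rule not_subset_cofg_add[OF K])
  have NP: "N \<subseteq> ?P" using Q(2) submoduleE(4)[OF Ns bR] by auto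
  have "?P \<subseteq> N <+>\<^bsub>M\<^esub> ?K"
  proof
    fix x assume "x \<in> ?P"
    then have x: "x \<in> Q" "b \<odot>\<^bsub>M\<^esub> x \<in> N" by simp_all
    obtain n where n: "n \<in> N" "b \<odot>\<^bsub>M\<^esub> x = b \<odot>\<^bsub>M\<^esub> n" using divisible[OF b x(2)] by (elim bexE)
    have "x \<ominus>\<^bsub>M\<^esub> n \<in> Q" using x(1) n(1) Q by (intro submodule_minus gv_closedD(1)) auto
    then have "x \<ominus>\<^bsub>M\<^esub> n \<in> ?K"
      using n x QM NM bR by (simp add: smult_minus_distr M.a_minus_self)
    moreover have "x = n \<oplus>\<^bsub>M\<^esub> (x \<ominus>\<^bsub>M\<^esub> n)" using n x NM QM by (simp add: M.minus_add_cancel)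
    ultimately show "x \<in> N <+>\<^bsub>M\<^esub> ?K" unfolding set_add_iff using n(1) by blast
  qed
  then have "?P \<subseteq> w_closure R M (N <+>\<^bsub>M\<^esub> ?K)"
    using w_closure_incr[OF submodule_set_add[OF Ns gv_closedD(1)[OF K]]] by blast
  then show ?thesis using gv_cofg_subset[OF cof P NP] by simp
qed

text \<open>Scalars outside p are invertible on Q up to a GV-ideal, so Q behaves like a vector space
  and N has a complement K there, with N + K dense. Minimality then applies to the closure of
  K.\<close>

lemma cofg_socle_case:
  assumes Q: "gv_closed R M Q" "N \<subseteq> Q" "\<And>r x. r \<in> p \<Longrightarrow> x \<in> Q \<Longrightarrow> r \<odot>\<^bsub>M\<^esub> x = \<zero>\<^bsub>M\<^esub>"
    and S: "gv_cover {\<zero>\<^bsub>M\<^esub>} S" "annih S = p"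
  shows "gv_cofg R M N Q"
proof -
  have QM: "x \<in> carrier M" if "x \<in> Q" for x using gv_closedD(2)[OF Q(1) that] .
  obtain K where K: "submodule K R M" "K \<subseteq> Q" "K \<inter> N = {\<zero>\<^bsub>M\<^esub>}"
    "\<And>K'. submodule K' R M \<Longrightarrow> K' \<subseteq> Q \<Longrightarrow> K \<subseteq> K' \<Longrightarrow> K' \<inter> N = {\<zero>\<^bsub>M\<^esub>} \<Longrightarrow> K' = K"
    by (rule ex_max_complement[OF Ns gv_closedD(1)[OF Q(1)]]) (rule that)
  let ?K = "w_closure R M K"
  have Kc: "gv_closed R M ?K" by (rule w_closure_closed[OF K(1)])
  \<comment> \<open>A nonzero x of N in the closure of K would have J x \<subseteq> K \<inter> N =
    0.\<close>
  have "\<not> N \<subseteq> ?K"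
  proof
    assume NK: "N \<subseteq> ?K"
    obtain x where x: "x \<in> N" "x \<noteq> \<zero>\<^bsub>M\<^esub>" using N_nonzero by (elim bexE)
    have "x \<in> ?K" using x NK by auto
    then obtain J where J: "x \<in> carrier M" "GV_ideal R J" "\<And>j. j \<in> J \<Longrightarrow> j \<in> carrier R" "\<And>j. j \<in> J \<Longrightarrow> j \<odot>\<^bsub>M\<^esub> x \<in> K"
      by (rule w_closureE) (rule that)
    have "x = \<zero>\<^bsub>M\<^esub>"
      by (rule torsion_free[OF J(1,2)]) (use J(3,4) K(3) submoduleE(4)[OF Ns _ x(1)] in auto)
    then show False using x by simp
  qed
  then have cof: "gv_cofg R M N (w_closure R M (N <+>\<^bsub>M\<^esub> ?K))" by (rule not_subset_cofg_add[OF Kc])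
  have NKs: "submodule (N <+>\<^bsub>M\<^esub> K) R M" by (rule submodule_set_add[OF Ns K(1)])
  have "Q \<subseteq> w_closure R M (N <+>\<^bsub>M\<^esub> K)"
  proof
    fix x assume x: "x \<in> Q"
    show "x \<in> w_closure R M (N <+>\<^bsub>M\<^esub> K)"
    proof (cases "x \<in> K")
      case True
      then show ?thesis using w_closure_incr[OF NKs] set_add_incr(2)[OF Ns K(1)] by auto
    next
      case False
      note cyc = submodule_cyclic[OF QM[OF x]]
      let ?K' = "K <+>\<^bsub>M\<^esub> cyclic x"
      have K': "submodule ?K' R M" "K \<subseteq> ?K'" "cyclic x \<subseteq> ?K'"
        using submodule_set_add[OF K(1) cyc(1)] set_add_incr[OF K(1) cyc(1)] by auto
      have "?K' \<subseteq> Q" by (rule set_add_least[OF gv_closedD(1)[OF Q(1)] K(2) cyclic_least[OF gv_closedD(1)[OF Q(1)] x]])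
      then have "?K' \<inter> N \<noteq> {\<zero>\<^bsub>M\<^esub>}" using K(4)[OF K'(1) _ K'(2)] K'(3) cyc(2) False by auto
      moreover have "\<zero>\<^bsub>M\<^esub> \<in> ?K' \<inter> N" using submodule_zero[OF K'(1)] submodule_zero[OF Ns] by simp
      ultimately obtain n where n: "n \<in> ?K'" "n \<in> N" "n \<noteq> \<zero>\<^bsub>M\<^esub>" by auto
      then obtain u v where uv: "u \<in> K" "v \<in> cyclic x" "n = u \<oplus>\<^bsub>M\<^esub> v" unfolding set_add_iff by (elim bexE)
      obtain r where r: "r \<in> carrier R" "v = r \<odot>\<^bsub>M\<^esub> x" using uv(2) by (elim imageE)
      have M: "u \<in> carrier M" "v \<in> carrier M" "n \<in> carrier M"
        using uv(1) submodule_carrierD[OF K(1)] r QM[OF x] n NM by auto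
      \<comment> \<open>Otherwise r x = 0, since p kills Q, and n would lie in K \<inter> N.\<close>
      have rp: "r \<notin> p"
      proof
        assume "r \<in> p"
        then have "v = \<zero>\<^bsub>M\<^esub>" using Q(3) x r by simp
        then have "n = u" using uv M by simp
        then have "n \<in> K \<inter> N" using n uv by simp
        then show False using K(3) n(3) by simp
      qed
      have "v = n \<ominus>\<^bsub>M\<^esub> u" using uv(3) M by (simp add: M.minus_add_cancel)
      also have "\<dots> = n \<oplus>\<^bsub>M\<^esub> \<ominus>\<^bsub>M\<^esub> u" by (simp add: a_minus_def)
      finally have v: "r \<odot>\<^bsub>M\<^esub> x \<in> N <+>\<^bsub>M\<^esub> K"
        unfolding r(2)[symmetric] set_add_iff using n(2) submoduleE(3)[OF K(1) uv(1)] by blast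
      \<comment> \<open>S serves only to make r invertible modulo p up to J; p kills x, so r x in N
        + K gives J x \<subseteq> N + K.\<close>
      obtain J where J: "GV_ideal R J" "\<forall>j\<in>J. \<exists>s\<in>carrier R. j \<ominus> s \<otimes> r \<in> p"
        using cover_annih(4)[OF S(1) r(1), unfolded S(2), OF rp] by (elim exE conjE)
      have "j \<odot>\<^bsub>M\<^esub> x \<in> N <+>\<^bsub>M\<^esub> K" if j: "j \<in> J" for j
      proof -
        obtain s where s: "s \<in> carrier R" "j \<ominus> s \<otimes> r \<in> p" using J(2) j by blast
        have "j \<in> carrier R" using GV_ideal_subset(2)[OF J(1) j] .
        then have "j \<odot>\<^bsub>M\<^esub> x \<ominus>\<^bsub>M\<^esub> s \<odot>\<^bsub>M\<^esub> (r \<odot>\<^bsub>M\<^esub> x) = \<zero>\<^bsub>M\<^esub>"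
          using Q(3)[OF s(2) x] s(1) r(1) QM[OF x] by (simp add: smult_minus_mult)
        then have "j \<odot>\<^bsub>M\<^esub> x = s \<odot>\<^bsub>M\<^esub> (r \<odot>\<^bsub>M\<^esub> x)"
          using \<open>j \<in> carrier R\<close> s(1) r(1) QM[OF x] by (simp add: M.a_minus_eq_zero_iff)
        then show ?thesis using submoduleE(4)[OF NKs s(1) v] by simp
      qed
      then show ?thesis unfolding w_closure_iff using QM[OF x] J(1) by blast
    qed
  qed
  also have "\<dots> \<subseteq> w_closure R M (N <+>\<^bsub>M\<^esub> ?K)"
    using w_closure_incr[OF K(1)] by (intro w_closure_mono subsetI) (auto simp: set_add_iff)
  finally show ?thesis using gv_cofg_subset[OF cof Q(1,2)] by simp
qed

text \<open>It suffices that the preimage of N under a suitable a outside p is essential over N. A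
  counterexample V makes a injective modulo N on V, and a w-simple step inside V contradicts this by
  a Nakayama argument.\<close>

lemma cofg_torsion_case:
  assumes Q: "gv_closed R M Q" "N \<subseteq> Q" "\<And>r x. r \<in> p \<Longrightarrow> x \<in> Q \<Longrightarrow> r \<odot>\<^bsub>M\<^esub> x = \<zero>\<^bsub>M\<^esub>"
    and ntype: "\<And>S. gv_cover {\<zero>\<^bsub>M\<^esub>} S \<Longrightarrow> S \<subseteq> Q \<Longrightarrow> annih S \<noteq> p"
  shows "gv_cofg R M N Q"
proof -
  note Qs = gv_closedD(1)[OF Q(1)]
  interpret p: primeideal p R by (rule p_prime)
  have QM: "x \<in> carrier M" if "x \<in> Q" for x using gv_closedD(2)[OF Q(1) that] .
  have cofQ: "gv_cofg R M {\<zero>\<^bsub>M\<^esub>} Q"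
    by (rule gv_cofg_subset[OF cof0 Q(1)]) (use zero_in_gv_closed[OF Q(1)] QM in auto)
  have above: "\<not> annih S \<subseteq> p" if S: "gv_cover {\<zero>\<^bsub>M\<^esub>} S" "S \<subseteq> Q" for S
  proof
    assume "annih S \<subseteq> p"
    \<comment> \<open>p kills Q, so the annihilators of simple closed submodules of Q contain p; by
      assumption they contain it strictly.\<close>
    moreover have "p \<subseteq> annih S" using Q(3) S(2) p.Icarr by auto
    ultimately show False using ntype[OF S] by blast
  qed
  obtain F where F: "finite F" "\<And>S. S \<in> F \<Longrightarrow> gv_cover {\<zero>\<^bsub>M\<^esub>} S" "\<And>S. S \<in> F \<Longrightarrow> S \<subseteq> Q"
    "\<And>t x. t \<in> carrier R \<Longrightarrow> \<forall>S\<in>F. t \<notin> annih S \<Longrightarrow> x \<in> Q \<Longrightarrow> t \<odot>\<^bsub>M\<^esub> x = \<zero>\<^bsub>M\<^esub> \<Longrightarrow> x = \<zero>\<^bsub>M\<^esub>"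
    by (rule finite_zero_divisor_types[OF cofQ Q(1)]) (rule that)
  have "\<exists>c\<in>carrier R - p. \<forall>q\<in>annih ` F. c \<in> q"
  proof (rule ex_mem_notin_prime[OF p_prime])
    fix q assume "q \<in> annih ` F"
    then obtain S where S: "S \<in> F" "q = annih S" by (rule imageE)
    show "ideal q R" unfolding S(2) using cover_annih(2)[OF F(2)[OF S(1)]] by (rule primeideal.axioms(1))
    show "\<not> q \<subseteq> p" unfolding S(2) by (rule above[OF F(2,3)[OF S(1)]])
  qed (use F(1) in simp)
  \<comment> \<open>This a plays the role of an element of the Jacobson radical: subtracting a
    multiple of a from j cannot move j into any of the primes \<open>annih S\<close> with S in
    F.\<close>
  then obtain a where a: "a \<in> carrier R - p" "\<forall>q\<in>annih ` F. a \<in> q" by (elim bexE)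
  have aR: "a \<in> carrier R" using a(1) by simp
  have aF: "a \<in> annih S" if "S \<in> F" for S by (rule bspec[OF a(2) imageI[OF that]])
  let ?P = "\<lambda>b. {x \<in> Q. b \<odot>\<^bsub>M\<^esub> x \<in> N}"
  show ?thesis
  proof (rule gv_cofg_essential[OF N Q(1) _ _ cofg_preimage_smult[OF Q(1,2) a(1)]])
    show "N \<subseteq> ?P a" using Q(2) submoduleE(4)[OF Ns aR] by auto
    show "?P a \<subseteq> Q" by auto
    fix V assume V: "gv_closed R M V" "N \<subset> V" "V \<subseteq> Q"
    show "V \<inter> ?P a \<noteq> N"
    proof
      assume VP: "V \<inter> ?P a = N"
      have step: "a \<odot>\<^bsub>M\<^esub> x \<in> V - N" if "x \<in> V - N" for x
      proof -
        have "a \<odot>\<^bsub>M\<^esub> x \<in> V" using that submoduleE(4)[OF gv_closedD(1)[OF V(1)] aR] by simp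
        moreover have "a \<odot>\<^bsub>M\<^esub> x \<notin> N" using that VP V(3) by blast
        ultimately show ?thesis by simp
      qed
      obtain x where x: "x \<in> V" "x \<notin> N" using V(2) by blast
      have xQ: "x \<in> Q" using x V(3) by blast
      note xM = QM[OF xQ]
      \<comment> \<open>The closure of R x contains a w-simple S, killed by some b0 outside p. A
        nonzero multiple j z = r x with z in S has r outside p, and b0 r kills x.\<close>
      have "\<exists>b\<in>carrier R - p. b \<odot>\<^bsub>M\<^esub> x = \<zero>\<^bsub>M\<^esub>"
      proof -
        let ?C = "w_closure R M (cyclic x)"
        have C: "gv_closed R M ?C" by (rule w_closure_closed[OF submodule_cyclic(1)[OF xM]])
        have CQ: "?C \<subseteq> Q" by (rule w_closure_least[OF Q(1) cyclic_least[OF Qs xQ]])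
        have "x \<noteq> \<zero>\<^bsub>M\<^esub>" using x(2) zero_in_gv_closed[OF N] by blast
        moreover have "x \<in> ?C" using w_closure_incr[OF submodule_cyclic(1)[OF xM]] submodule_cyclic(2)[OF xM] by blast
        ultimately have "{\<zero>\<^bsub>M\<^esub>} \<subset> ?C" using zero_in_gv_closed[OF C] by blast
        then obtain S where S: "gv_cover {\<zero>\<^bsub>M\<^esub>} S" "S \<subseteq> ?C" by (rule ex_gv_cover[OF cofQ C _ CQ])
        then obtain b0 where b0: "b0 \<in> annih S" "b0 \<notin> p" using above[OF S(1)] CQ by blast
        obtain z where z: "z \<in> S" "z \<noteq> \<zero>\<^bsub>M\<^esub>" using S(1) unfolding gv_cover_def by blast
        have "z \<in> ?C" using z S by blast
        then obtain J where J: "z \<in> carrier M" "GV_ideal R J" "\<And>j. j \<in> J \<Longrightarrow> j \<in> carrier R" "\<And>j. j \<in> J \<Longrightarrow> j \<odot>\<^bsub>M\<^esub> z \<in> cyclic x"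
          by (rule w_closureE) (rule that)
        have "\<exists>j\<in>J. j \<odot>\<^bsub>M\<^esub> z \<noteq> \<zero>\<^bsub>M\<^esub>" using torsion_free[OF J(1,2)] z(2) by blast
        then obtain j where j: "j \<in> J" "j \<odot>\<^bsub>M\<^esub> z \<noteq> \<zero>\<^bsub>M\<^esub>" by (elim bexE)
        obtain r where r: "r \<in> carrier R" "j \<odot>\<^bsub>M\<^esub> z = r \<odot>\<^bsub>M\<^esub> x" using J(4)[OF j(1)] by (elim imageE)
        have "r \<notin> p" using Q(3)[OF _ xQ, of r] r j by auto
        moreover have b0R: "b0 \<in> carrier R" using b0 by simp
        ultimately have "b0 \<otimes> r \<notin> p" using p.I_prime[of b0 r] b0(2) r(1) by blast
        moreover have "(b0 \<otimes> r) \<odot>\<^bsub>M\<^esub> x = \<zero>\<^bsub>M\<^esub>"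
        proof -
          have "b0 \<odot>\<^bsub>M\<^esub> z = \<zero>\<^bsub>M\<^esub>" using b0 z by simp
          then have "b0 \<odot>\<^bsub>M\<^esub> (j \<odot>\<^bsub>M\<^esub> z) = \<zero>\<^bsub>M\<^esub>"
            using smult_commute[of b0 j z] b0R J(1) J(3)[OF j(1)] by simp
          then show ?thesis using r b0R xM by (simp add: smult_assoc1)
        qed
        ultimately show ?thesis using b0R r(1) by (intro bexI[of _ "b0 \<otimes> r"]) auto
      qed
      then obtain b where b: "b \<in> carrier R - p" "b \<odot>\<^bsub>M\<^esub> x = \<zero>\<^bsub>M\<^esub>" by (elim bexE)
      have bR: "b \<in> carrier R" using b(1) by simp
      have Pb: "gv_closed R M (?P b)" by (rule gv_closed_preimage1[OF Q(1) N bR])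
      have V': "gv_closed R M (V \<inter> ?P b)" by (rule gv_closed_inter[OF V(1) Pb])
      have "N \<subseteq> ?P b" using Q(2) submoduleE(4)[OF Ns bR] by auto
      moreover have "x \<in> V \<inter> ?P b" using x xQ b(2) zero_in_gv_closed[OF N] by simp
      ultimately have "N \<subset> V \<inter> ?P b" using V(2) x(2) by blast
      \<comment> \<open>V modulo N is not known to be good, so the w-simple step is taken inside its
        part carried into N by b, which is.\<close>
      then obtain S where S: "gv_cover N S" "S \<subseteq> V \<inter> ?P b"
        by (rule ex_gv_cover[OF cofg_preimage_smult[OF Q(1,2) b(1)] V' _ Int_lower2])
      have Sc: "gv_closed R M S" "N \<subset> S" and Smin: "\<And>K. gv_closed R M K \<Longrightarrow> N \<subseteq> K \<Longrightarrow> K \<subseteq> S \<Longrightarrow> K = N \<or> K = S"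
        using S(1) unfolding gv_cover_def by auto
      note Ss = gv_closedD(1)[OF Sc(1)]
      obtain y where y: "y \<in> S" "y \<notin> N" using Sc(2) by blast
      \<comment> \<open>The orbit of y under a never enters N, because a maps V outside N to
        itself.\<close>
      define z where "z k = a [^] k \<odot>\<^bsub>M\<^esub> y" for k :: nat
      have yM: "y \<in> carrier M" using y(1) submodule_carrierD[OF Ss] by blast
      have zSuc: "z (Suc k) = a \<odot>\<^bsub>M\<^esub> z k" for k
        using yM aR by (simp add: z_def smult_assoc1 smult_commute[of a "a [^] k"])
      have z: "z k \<in> S" "z k \<notin> N" for k
      proof (induct k)
        case 0
        show "z 0 \<in> S" "z 0 \<notin> N" using y yM by (simp_all add: z_def)
      next
        case (Suc k)
        show "z (Suc k) \<in> S" unfolding zSuc using submoduleE(4)[OF Ss aR Suc(1)] .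
        have "z k \<in> V - N" using Suc S(2) by blast
        then show "z (Suc k) \<notin> N" unfolding zSuc using step by blast
      qed
      have zM: "z k \<in> carrier M" for k using z(1) submodule_carrierD[OF Ss] by blast
      define C where "C k = w_closure R M (cyclic (z k))" for k
      have cyc: "submodule (cyclic (z k)) R M" "z k \<in> cyclic (z k)" for k
        using submodule_cyclic[OF zM] by auto
      have C: "gv_closed R M (C k)" "cyclic (z k) \<subseteq> C k" "C k \<subseteq> S" for k
        unfolding C_def using w_closure_closed[OF cyc(1)] w_closure_incr[OF cyc(1)]
          w_closure_least[OF Sc(1) cyclic_least[OF Ss z(1)]] by simp_all
      have Cdec: "C (Suc k) \<subseteq> C k" for k
      proof -
        have "z (Suc k) \<in> C k" unfolding zSuc
          using submoduleE(4)[OF gv_closedD(1)[OF C(1)] aR] C(2)[of k] cyc(2)[of k] by blast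
        then show ?thesis unfolding C_def[of "Suc k"]
          by (intro w_closure_least[OF C(1)] cyclic_least[OF gv_closedD(1)[OF C(1)]])
      qed
      \<comment> \<open>Chain stability is known only inside N; n is chosen so that passing from
        \<open>z n\<close> to \<open>z (Suc n)\<close> loses nothing there.\<close>
      have "\<exists>n. \<forall>k\<ge>n. C k \<inter> N = C n \<inter> N"
      proof (rule N_dcc[unfolded gv_dcc_def, rule_format])
        fix n
        show "gv_closed R M (C n \<inter> N) \<and> C n \<inter> N \<subseteq> N \<and> C (Suc n) \<inter> N \<subseteq> C n \<inter> N"
          using gv_closed_inter[OF C(1) N] Cdec[of n] by blast
      qed
      then obtain n where n: "\<forall>k\<ge>n. C k \<inter> N = C n \<inter> N" by (elim exE)
      have sumS: "w_closure R M (cyclic (z (Suc n)) <+>\<^bsub>M\<^esub> N) = S"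
      proof -
        let ?T = "cyclic (z (Suc n)) <+>\<^bsub>M\<^esub> N"
        have T: "submodule ?T R M" "cyclic (z (Suc n)) \<subseteq> ?T" "N \<subseteq> ?T"
          using submodule_set_add[OF cyc(1) Ns] set_add_incr[OF cyc(1) Ns] by blast+
        have "?T \<subseteq> S" using Sc(2) by (intro set_add_least[OF Ss cyclic_least[OF Ss z(1)]]) blast
        then have "w_closure R M ?T \<subseteq> S" by (rule w_closure_least[OF Sc(1)])
        moreover have "N \<subseteq> w_closure R M ?T" "z (Suc n) \<in> w_closure R M ?T"
          using w_closure_incr[OF T(1)] T(2,3) cyc(2)[of "Suc n"] by blast+
        ultimately show ?thesis using Smin[OF w_closure_closed[OF T(1)]] z(2)[of "Suc n"] by blast
      qed
      \<comment> \<open>By simplicity of S modulo N, j z_n = u + v with u a multiple of z_(n+1) and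
        v in N. As v also lies in C n, the choice of n moves it into C (n+1).\<close>
      have "z n \<in> C (Suc n)"
      proof -
        have "z n \<in> w_closure R M (cyclic (z (Suc n)) <+>\<^bsub>M\<^esub> N)" using sumS z(1) by simp
        then obtain J where J: "GV_ideal R J" "\<And>j. j \<in> J \<Longrightarrow> j \<in> carrier R"
          "\<And>j. j \<in> J \<Longrightarrow> j \<odot>\<^bsub>M\<^esub> z n \<in> cyclic (z (Suc n)) <+>\<^bsub>M\<^esub> N" by (rule w_closureE') (rule that)
        show ?thesis
        proof (rule gv_closedD(3)[OF C(1) zM J(1)])
          fix j assume j: "j \<in> J"
          obtain u v where uv: "u \<in> cyclic (z (Suc n))" "v \<in> N" "j \<odot>\<^bsub>M\<^esub> z n = u \<oplus>\<^bsub>M\<^esub> v"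
            using J(3)[OF j] unfolding set_add_iff by (elim bexE)
          have uC: "u \<in> C (Suc n)" using uv(1) C(2) by blast
          have M: "u \<in> carrier M" "v \<in> carrier M" using uC gv_closedD(2)[OF C(1)] uv(2) NM by auto
          have "j \<odot>\<^bsub>M\<^esub> z n \<in> C n" using C(2)[of n] J(2)[OF j] by blast
          moreover have "v = j \<odot>\<^bsub>M\<^esub> z n \<ominus>\<^bsub>M\<^esub> u" using uv(3) M by (simp add: M.minus_add_cancel)
          ultimately have "v \<in> C n" using uC Cdec[of n] submodule_minus[OF gv_closedD(1)[OF C(1)[of n]]] by blast
          then have "v \<in> C (Suc n)" using n uv(2) le_SucI[OF order_refl] by blast
          then show "j \<odot>\<^bsub>M\<^esub> z n \<in> C (Suc n)" unfolding uv(3)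
            using uC submoduleE(5)[OF gv_closedD(1)[OF C(1)]] by simp
        qed
      qed
      then obtain J where J: "GV_ideal R J" "\<And>j. j \<in> J \<Longrightarrow> j \<in> carrier R"
        "\<And>j. j \<in> J \<Longrightarrow> j \<odot>\<^bsub>M\<^esub> z n \<in> cyclic (z (Suc n))" unfolding C_def by (rule w_closureE') (rule that)
      have "\<exists>j\<in>J. \<forall>S\<in>F. j \<notin> annih S" by (rule ex_GV_regular[OF J(1) F(1)]) (rule F(2))
  then obtain j where j: "j \<in> J" "\<forall>S\<in>F. j \<notin> annih S" by (elim bexE)
      have jR: "j \<in> carrier R" using J(2)[OF j(1)] .
      obtain r where r: "r \<in> carrier R" "j \<odot>\<^bsub>M\<^esub> z n = r \<odot>\<^bsub>M\<^esub> z (Suc n)" using J(3)[OF j(1)] by (elim imageE)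
      \<comment> \<open>Nakayama: j - r a kills z_n, yet it lies outside all annihilators of F
        because j does and a belongs to each of them.\<close>
      have "z n = \<zero>\<^bsub>M\<^esub>"
      proof (rule F(4))
        show "j \<ominus> r \<otimes> a \<in> carrier R" using jR r aR by simp
        show "z n \<in> Q" using z(1)[of n] S(2) by blast
        show "(j \<ominus> r \<otimes> a) \<odot>\<^bsub>M\<^esub> z n = \<zero>\<^bsub>M\<^esub>"
          using r jR aR zM by (simp add: smult_minus_mult zSuc M.a_minus_self)
      next
        show "\<forall>T\<in>F. j \<ominus> r \<otimes> a \<notin> annih T"
        proof
          fix T assume T: "T \<in> F"
          interpret T: ideal "annih T" R by (rule primeideal.axioms(1)[OF cover_annih(2)[OF F(2)[OF T]]])
          have ra: "r \<otimes> a \<in> annih T" by (rule T.I_l_closed[OF aF[OF T] r(1)])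
          show "j \<ominus> r \<otimes> a \<notin> annih T"
          proof
            assume "j \<ominus> r \<otimes> a \<in> annih T"
            then have "(j \<ominus> r \<otimes> a) \<oplus> r \<otimes> a \<in> annih T" using ra by (rule T.a_closed)
            moreover have "(j \<ominus> r \<otimes> a) \<oplus> r \<otimes> a = j" by (rule R.minus_add_cancel(1)[OF jR R.m_closed[OF r(1) aR]])
            ultimately have "j \<in> annih T" by (simp only:)
            then show False using j(2) T by blast
          qed
        qed
      qed
      then show False using z(2)[of n] zero_in_gv_closed[OF N] by simp
    qed
  qed
qed

lemma cofg_between:
  assumes Q: "gv_closed R M Q" "N \<subseteq> Q" "Q \<subseteq> ann_mod M p"
  shows "gv_cofg R M N Q"
proof -
  have pQ: "r \<odot>\<^bsub>M\<^esub> x = \<zero>\<^bsub>M\<^esub>" if "r \<in> p" "x \<in> Q" for r x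
  proof -
    have "x \<in> ann_mod M p" using that(2) Q(3) by (rule rev_subsetD)
    then show ?thesis using that(1) by (simp add: ann_mod_def)
  qed
  show ?thesis
  proof (cases "\<exists>S. gv_cover {\<zero>\<^bsub>M\<^esub>} S \<and> annih S = p")
    case True
    then obtain S where S: "gv_cover {\<zero>\<^bsub>M\<^esub>} S" "annih S = p" by (elim exE conjE)
    show ?thesis by (rule cofg_socle_case[OF Q(1,2) _ S]) (rule pQ)
  next
    case False
    show ?thesis
    proof (rule cofg_torsion_case[OF Q(1,2)])
      show "annih S \<noteq> p" if "gv_cover {\<zero>\<^bsub>M\<^esub>} S" for S
        by (rule notI, rule notE[OF False], intro exI conjI) (rule that)
    qed (rule pQ)
  qed
qed

text \<open>N lies in M[p] and hence in Q, and Q/N is good; were M/Q good too, M/N would be an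
  extension of good by good. This is what contradicts the assumption on p.\<close>

lemma not_cofg_above:
  assumes Q: "gv_closed R M Q" "w_closure R M (prime_part R M p) \<subseteq> Q" "Q \<subseteq> ann_mod M p"
  shows "\<not> gv_cofg R M Q (carrier M)"
proof
  assume cof: "gv_cofg R M Q (carrier M)"
  have "x \<in> w_closure R M N" if "x \<in> N" for x using w_closure_incr[OF Ns] that by blast
  then have NQ: "N \<subseteq> Q" using w_closure_mono[OF N_subset_prime_part] Q(2) by blast
  show False
    using gv_cofg_trans[OF N Q(1) gv_closed_carrier NQ carr[OF Q(1)] cofg_between[OF Q(1) NQ Q(3)] cof] bad by simp
qed

end

section \<open>Free modules and the functor Ext\<close>

lemma (in module) abelian_subgroup_submodule:
  assumes "submodule N R M"
  shows "abelian_subgroup N M"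
  using assms by (intro abelian_subgroupI3 additive_subgroupI M.abelian_group_axioms)
    (auto simp: submodule_def)

text \<open>Computation with representatives. The scalar action is encoded as a union over a coset,
  and all members of the union coincide.\<close>

lemma (in module) quot_mod_coset:
  assumes N: "submodule N R M"
  shows "carrier (quot_mod R M N) = (\<lambda>x. N +>\<^bsub>M\<^esub> x) ` carrier M"
    and "\<And>x y. x \<in> carrier M \<Longrightarrow> y \<in> carrier M \<Longrightarrow>
      (N +>\<^bsub>M\<^esub> x) \<oplus>\<^bsub>quot_mod R M N\<^esub> (N +>\<^bsub>M\<^esub> y) = N +>\<^bsub>M\<^esub> (x \<oplus>\<^bsub>M\<^esub> y)"
    and "\<And>r x. r \<in> carrier R \<Longrightarrow> x \<in> carrier M \<Longrightarrow>
      r \<odot>\<^bsub>quot_mod R M N\<^esub> (N +>\<^bsub>M\<^esub> x) = N +>\<^bsub>M\<^esub> (r \<odot>\<^bsub>M\<^esub> x)"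
    and "\<zero>\<^bsub>quot_mod R M N\<^esub> = N +>\<^bsub>M\<^esub> \<zero>\<^bsub>M\<^esub>"
    and "\<And>x y. x \<in> carrier M \<Longrightarrow> y \<in> carrier M \<Longrightarrow> N +>\<^bsub>M\<^esub> x = N +>\<^bsub>M\<^esub> y \<longleftrightarrow> x \<ominus>\<^bsub>M\<^esub> y \<in> N"
proof -
  interpret N: abelian_subgroup N M by (rule abelian_subgroup_submodule[OF N])
  have zero: "N +>\<^bsub>M\<^esub> \<zero>\<^bsub>M\<^esub> = N" by (rule N.a_rcos_const[OF N.zero_closed])
  show "carrier (quot_mod R M N) = (\<lambda>x. N +>\<^bsub>M\<^esub> x) ` carrier M"
    by (auto simp: quot_mod_def A_RCOSETS_def')
  show "(N +>\<^bsub>M\<^esub> x) \<oplus>\<^bsub>quot_mod R M N\<^esub> (N +>\<^bsub>M\<^esub> y) = N +>\<^bsub>M\<^esub> (x \<oplus>\<^bsub>M\<^esub> y)"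
    if "x \<in> carrier M" "y \<in> carrier M" for x y
    using that by (simp add: quot_mod_def N.a_rcos_sum)
  show "\<zero>\<^bsub>quot_mod R M N\<^esub> = N +>\<^bsub>M\<^esub> \<zero>\<^bsub>M\<^esub>" by (simp add: quot_mod_def zero)
  show eq: "N +>\<^bsub>M\<^esub> x = N +>\<^bsub>M\<^esub> y \<longleftrightarrow> x \<ominus>\<^bsub>M\<^esub> y \<in> N" if "x \<in> carrier M" "y \<in> carrier M" for x y
    using that N.a_rcos_module[of y x] N.a_repr_independence'[of x y] N.a_rcos_self[of x]
    by (auto simp: a_minus_def)
  show "r \<odot>\<^bsub>quot_mod R M N\<^esub> (N +>\<^bsub>M\<^esub> x) = N +>\<^bsub>M\<^esub> (r \<odot>\<^bsub>M\<^esub> x)"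
    if r: "r \<in> carrier R" and x: "x \<in> carrier M" for r x
  proof -
    have "N +>\<^bsub>M\<^esub> (r \<odot>\<^bsub>M\<^esub> y) = N +>\<^bsub>M\<^esub> (r \<odot>\<^bsub>M\<^esub> x)" if "y \<in> N +>\<^bsub>M\<^esub> x" for y
    proof -
      have y: "y \<in> carrier M" using N.a_elemrcos_carrier[OF x that] .
      have "y \<ominus>\<^bsub>M\<^esub> x \<in> N" using N.a_rcos_module_imp[OF x that] by (simp add: a_minus_def)
      then have "r \<odot>\<^bsub>M\<^esub> (y \<ominus>\<^bsub>M\<^esub> x) \<in> N" using submoduleE(4)[OF N r] by simp
      then show ?thesis using r x y eq[of "r \<odot>\<^bsub>M\<^esub> y" "r \<odot>\<^bsub>M\<^esub> x"] by (simp add: smult_minus_distr)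
    qed
    moreover have "N +>\<^bsub>M\<^esub> x \<noteq> {}" using N.a_rcos_self[OF x] by blast
    ultimately have "(\<Union>y\<in>N +>\<^bsub>M\<^esub> x. N +>\<^bsub>M\<^esub> (r \<odot>\<^bsub>M\<^esub> y)) = N +>\<^bsub>M\<^esub> (r \<odot>\<^bsub>M\<^esub> x)"
      by (rule SUP_eq_const[rotated])
    then show ?thesis by (simp add: quot_mod_def)
  qed
qed

lemma (in module) quot_mod_module:
  assumes N: "submodule N R M"
  shows "module R (quot_mod R M N)"
proof -
  note q = quot_mod_coset[OF N]
  have rep: "\<exists>x\<in>carrier M. c = N +>\<^bsub>M\<^esub> x" if "c \<in> carrier (quot_mod R M N)" for c
    using that q(1) by auto
  have mem: "N +>\<^bsub>M\<^esub> x \<in> carrier (quot_mod R M N)" if "x \<in> carrier M" for x using that q(1) by auto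
  show ?thesis
  proof (rule moduleI)
    show "abelian_group (quot_mod R M N)"
    proof (rule abelian_groupI)
      show "\<zero>\<^bsub>quot_mod R M N\<^esub> \<in> carrier (quot_mod R M N)" using q(4) mem by simp
    next
      fix c assume "c \<in> carrier (quot_mod R M N)"
      then obtain x where x: "x \<in> carrier M" "c = N +>\<^bsub>M\<^esub> x" using rep by blast
      show "\<zero>\<^bsub>quot_mod R M N\<^esub> \<oplus>\<^bsub>quot_mod R M N\<^esub> c = c" using x q(2,4) by simp
      have "(N +>\<^bsub>M\<^esub> (\<ominus>\<^bsub>M\<^esub> x)) \<oplus>\<^bsub>quot_mod R M N\<^esub> c = \<zero>\<^bsub>quot_mod R M N\<^esub>"
        using x q(2,4) by (simp add: M.l_neg)
      then show "\<exists>y\<in>carrier (quot_mod R M N). y \<oplus>\<^bsub>quot_mod R M N\<^esub> c = \<zero>\<^bsub>quot_mod R M N\<^esub>"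
        using mem x by blast
      fix d assume "d \<in> carrier (quot_mod R M N)"
      then obtain y where y: "y \<in> carrier M" "d = N +>\<^bsub>M\<^esub> y" using rep by blast
      show "c \<oplus>\<^bsub>quot_mod R M N\<^esub> d \<in> carrier (quot_mod R M N)" using x y q(2) mem by simp
      show "c \<oplus>\<^bsub>quot_mod R M N\<^esub> d = d \<oplus>\<^bsub>quot_mod R M N\<^esub> c" using x y q(2) by (simp add: M.a_comm)
      fix e assume "e \<in> carrier (quot_mod R M N)"
      then obtain z where z: "z \<in> carrier M" "e = N +>\<^bsub>M\<^esub> z" using rep by blast
      show "c \<oplus>\<^bsub>quot_mod R M N\<^esub> d \<oplus>\<^bsub>quot_mod R M N\<^esub> e = c \<oplus>\<^bsub>quot_mod R M N\<^esub> (d \<oplus>\<^bsub>quot_mod R M N\<^esub> e)"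
        using x y z q(2) by (simp add: M.a_assoc)
    qed
  next
    fix r c assume r: "r \<in> carrier R" and "c \<in> carrier (quot_mod R M N)"
    then obtain x where x: "x \<in> carrier M" "c = N +>\<^bsub>M\<^esub> x" using rep by blast
    show "r \<odot>\<^bsub>quot_mod R M N\<^esub> c \<in> carrier (quot_mod R M N)" using r x q(3) mem by simp
    show "r \<odot>\<^bsub>quot_mod R M N\<^esub> (c \<oplus>\<^bsub>quot_mod R M N\<^esub> d) = r \<odot>\<^bsub>quot_mod R M N\<^esub> c \<oplus>\<^bsub>quot_mod R M N\<^esub> r \<odot>\<^bsub>quot_mod R M N\<^esub> d"
      if "d \<in> carrier (quot_mod R M N)" for d
      using rep[OF that] r x q(2,3) by (auto simp: smult_r_distr)
    fix s assume s: "s \<in> carrier R"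
    show "(r \<oplus> s) \<odot>\<^bsub>quot_mod R M N\<^esub> c = r \<odot>\<^bsub>quot_mod R M N\<^esub> c \<oplus>\<^bsub>quot_mod R M N\<^esub> s \<odot>\<^bsub>quot_mod R M N\<^esub> c"
      using r s x q(2,3) by (simp add: smult_l_distr)
    show "(r \<otimes> s) \<odot>\<^bsub>quot_mod R M N\<^esub> c = r \<odot>\<^bsub>quot_mod R M N\<^esub> (s \<odot>\<^bsub>quot_mod R M N\<^esub> c)"
      using r s x q(3) by (simp add: smult_assoc1)
  next
    fix c assume "c \<in> carrier (quot_mod R M N)"
    then obtain x where x: "x \<in> carrier M" "c = N +>\<^bsub>M\<^esub> x" using rep by blast
    show "\<one> \<odot>\<^bsub>quot_mod R M N\<^esub> c = c" using x q(3) by simp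
  qed (rule is_cring)
qed

section \<open>Free modules and linear extension from a basis\<close>

lemma free_mod_simps [simp]:
  "f \<oplus>\<^bsub>free_mod R S\<^esub> g = (\<lambda>x. f x \<oplus>\<^bsub>R\<^esub> g x)" "r \<odot>\<^bsub>free_mod R S\<^esub> f = (\<lambda>x. r \<otimes>\<^bsub>R\<^esub> f x)"
  "\<zero>\<^bsub>free_mod R S\<^esub> = (\<lambda>x. \<zero>\<^bsub>R\<^esub>)"
  by (auto simp: free_mod_def)

lemma free_mod_carrierI:
  assumes "\<And>x. f x \<in> carrier R" "\<And>x. x \<notin> S \<Longrightarrow> f x = \<zero>\<^bsub>R\<^esub>" "finite {x. f x \<noteq> \<zero>\<^bsub>R\<^esub>}"
  shows "f \<in> carrier (free_mod R S)"
  using assms by (auto simp: free_mod_def)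

lemma free_mod_carrierD:
  assumes "f \<in> carrier (free_mod R S)"
  shows "\<And>x. f x \<in> carrier R" "\<And>x. x \<notin> S \<Longrightarrow> f x = \<zero>\<^bsub>R\<^esub>" "finite {x. f x \<noteq> \<zero>\<^bsub>R\<^esub>}" "{x. f x \<noteq> \<zero>\<^bsub>R\<^esub>} \<subseteq> S"
  using assms by (auto simp: free_mod_def)

lemma (in cring) free_mod_module: "module R (free_mod R S)"
proof (rule moduleI)
  have add: "(\<lambda>x. f x \<oplus> g x) \<in> carrier (free_mod R S)"
    if "f \<in> carrier (free_mod R S)" "g \<in> carrier (free_mod R S)" for f g
  proof (rule free_mod_carrierI)
    show "finite {x. f x \<oplus> g x \<noteq> \<zero>}"
      by (rule finite_subset[OF _ finite_UnI[OF free_mod_carrierD(3)[OF that(1)] free_mod_carrierD(3)[OF that(2)]]]) auto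
  qed (use free_mod_carrierD(1,2)[OF that(1)] free_mod_carrierD(1,2)[OF that(2)] in auto)
  have smult: "(\<lambda>x. r \<otimes> f x) \<in> carrier (free_mod R S)"
    if "r \<in> carrier R" "f \<in> carrier (free_mod R S)" for r f
  proof (rule free_mod_carrierI)
    show "finite {x. r \<otimes> f x \<noteq> \<zero>}"
      by (rule finite_subset[OF _ free_mod_carrierD(3)[OF that(2)]]) (use that(1) in auto)
  qed (use that(1) free_mod_carrierD(1,2)[OF that(2)] in auto)
  show "abelian_group (free_mod R S)"
  proof (rule abelian_groupI)
    show "\<zero>\<^bsub>free_mod R S\<^esub> \<in> carrier (free_mod R S)" by (auto intro: free_mod_carrierI)
    fix f assume f: "f \<in> carrier (free_mod R S)"
    show "\<zero>\<^bsub>free_mod R S\<^esub> \<oplus>\<^bsub>free_mod R S\<^esub> f = f" using free_mod_carrierD(1)[OF f] by simp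
    have "(\<lambda>x. \<ominus> \<one> \<otimes> f x) \<in> carrier (free_mod R S)" using smult[OF _ f, of "\<ominus> \<one>"] by simp
    moreover have "(\<lambda>x. \<ominus> \<one> \<otimes> f x) \<oplus>\<^bsub>free_mod R S\<^esub> f = \<zero>\<^bsub>free_mod R S\<^esub>"
      using free_mod_carrierD(1)[OF f] by (simp add: l_minus l_neg)
    ultimately show "\<exists>g\<in>carrier (free_mod R S). g \<oplus>\<^bsub>free_mod R S\<^esub> f = \<zero>\<^bsub>free_mod R S\<^esub>" by - (rule bexI)
    fix g assume g: "g \<in> carrier (free_mod R S)"
    show "f \<oplus>\<^bsub>free_mod R S\<^esub> g \<in> carrier (free_mod R S)" using add[OF f g] by simp
    show "f \<oplus>\<^bsub>free_mod R S\<^esub> g = g \<oplus>\<^bsub>free_mod R S\<^esub> f"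
      using free_mod_carrierD(1)[OF f] free_mod_carrierD(1)[OF g] by (simp add: a_comm)
    fix h assume h: "h \<in> carrier (free_mod R S)"
    show "f \<oplus>\<^bsub>free_mod R S\<^esub> g \<oplus>\<^bsub>free_mod R S\<^esub> h = f \<oplus>\<^bsub>free_mod R S\<^esub> (g \<oplus>\<^bsub>free_mod R S\<^esub> h)"
      using free_mod_carrierD(1)[OF f] free_mod_carrierD(1)[OF g] free_mod_carrierD(1)[OF h] by (simp add: a_assoc)
  qed
  fix r f assume r: "r \<in> carrier R" and f: "f \<in> carrier (free_mod R S)"
  note fc = free_mod_carrierD(1)[OF f]
  show "r \<odot>\<^bsub>free_mod R S\<^esub> f \<in> carrier (free_mod R S)" using smult[OF r f] by simp
  show "r \<odot>\<^bsub>free_mod R S\<^esub> (f \<oplus>\<^bsub>free_mod R S\<^esub> g) = r \<odot>\<^bsub>free_mod R S\<^esub> f \<oplus>\<^bsub>free_mod R S\<^esub> r \<odot>\<^bsub>free_mod R S\<^esub> g"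
    if g: "g \<in> carrier (free_mod R S)" for g
    using fc r free_mod_carrierD(1)[OF g] by (simp add: r_distr)
  fix s assume s: "s \<in> carrier R"
  show "(r \<oplus> s) \<odot>\<^bsub>free_mod R S\<^esub> f = r \<odot>\<^bsub>free_mod R S\<^esub> f \<oplus>\<^bsub>free_mod R S\<^esub> s \<odot>\<^bsub>free_mod R S\<^esub> f"
    using fc r s by (simp add: l_distr)
  show "(r \<otimes> s) \<odot>\<^bsub>free_mod R S\<^esub> f = r \<odot>\<^bsub>free_mod R S\<^esub> (s \<odot>\<^bsub>free_mod R S\<^esub> f)"
    using fc r s by (simp add: m_assoc)
next
  fix f assume "f \<in> carrier (free_mod R S)"
  then show "\<one> \<odot>\<^bsub>free_mod R S\<^esub> f = f" using free_mod_carrierD(1)[of f R S] by simp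
qed (rule is_cring)

definition free_single :: "('a, 'r) ring_scheme \<Rightarrow> 'c \<Rightarrow> 'a \<Rightarrow> 'c \<Rightarrow> 'a"
  where "free_single R c r = (\<lambda>x. if x = c then r else \<zero>\<^bsub>R\<^esub>)"

lemma (in cring) free_single_carrier:
  "c \<in> S \<Longrightarrow> r \<in> carrier R \<Longrightarrow> free_single R c r \<in> carrier (free_mod R S)"
  by (rule free_mod_carrierI) (auto simp: free_single_def)

text \<open>The universal property of the free module, with \<open>free_eval\<close> as the case of
  the identity on the basis. The sum runs over the support, which varies with f;
  \<open>lin_ext_support\<close> replaces it by a larger finite set.\<close>

definition lin_ext ::
    "('a, 'r) ring_scheme \<Rightarrow> ('a, 'd, 'm) module_scheme \<Rightarrow> ('c \<Rightarrow> 'd) \<Rightarrow> ('c \<Rightarrow> 'a) \<Rightarrow> 'd"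
  where "lin_ext R M h f = finsum M (\<lambda>c. f c \<odot>\<^bsub>M\<^esub> h c) {c. f c \<noteq> \<zero>\<^bsub>R\<^esub>}"

lemma free_eval_lin_ext: "free_eval R N = lin_ext R N (\<lambda>x. x)"
  by (simp add: free_eval_def lin_ext_def fun_eq_iff)

context module
begin

lemma lin_ext_support:
  assumes f: "f \<in> carrier (free_mod R S)" and h: "\<And>c. c \<in> S \<Longrightarrow> h c \<in> carrier M"
    and A: "finite A" "{c. f c \<noteq> \<zero>} \<subseteq> A" "A \<subseteq> S"
  shows "lin_ext R M h f = finsum M (\<lambda>c. f c \<odot>\<^bsub>M\<^esub> h c) A"
  unfolding lin_ext_def
  by (rule M.add.finprod_mono_neutral_cong_left)
    (use A h free_mod_carrierD(1)[OF f] in \<open>auto simp: subset_iff\<close>)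

lemma lin_ext_closed:
  assumes f: "f \<in> carrier (free_mod R S)" and h: "\<And>c. c \<in> S \<Longrightarrow> h c \<in> carrier M"
  shows "lin_ext R M h f \<in> carrier M"
  unfolding lin_ext_def using h free_mod_carrierD(1,4)[OF f] by (intro M.finsum_closed) auto

lemma lin_ext_add:
  assumes f: "f \<in> carrier (free_mod R S)" and g: "g \<in> carrier (free_mod R S)"
    and h: "\<And>c. c \<in> S \<Longrightarrow> h c \<in> carrier M"
  shows "lin_ext R M h (\<lambda>x. f x \<oplus> g x) = lin_ext R M h f \<oplus>\<^bsub>M\<^esub> lin_ext R M h g"
proof -
  interpret F: module R "free_mod R S" by (rule free_mod_module)
  note fD = free_mod_carrierD[OF f] and gD = free_mod_carrierD[OF g]
  obtain A where A: "finite A" "A \<subseteq> S" "{c. f c \<noteq> \<zero>} \<subseteq> A" "{c. g c \<noteq> \<zero>} \<subseteq> A"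
    by (rule that[of "{c. f c \<noteq> \<zero>} \<union> {c. g c \<noteq> \<zero>}"]) (use fD(3,4) gD(3,4) in auto)
  have fg: "(\<lambda>x. f x \<oplus> g x) \<in> carrier (free_mod R S)" using F.M.a_closed[OF f g] by simp
  have sub: "{c. f c \<oplus> g c \<noteq> \<zero>} \<subseteq> A"
  proof
    fix c assume "c \<in> {c. f c \<oplus> g c \<noteq> \<zero>}"
    then have "f c \<noteq> \<zero> \<or> g c \<noteq> \<zero>" by auto
    then show "c \<in> A" using A(3,4) by blast
  qed
  have hA: "h c \<in> carrier M" if "c \<in> A" for c using h A(2) that by blast
  have "lin_ext R M h (\<lambda>x. f x \<oplus> g x) = finsum M (\<lambda>c. (f c \<oplus> g c) \<odot>\<^bsub>M\<^esub> h c) A"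
    by (rule lin_ext_support[OF fg h A(1) sub A(2)])
  also have "\<dots> = finsum M (\<lambda>c. f c \<odot>\<^bsub>M\<^esub> h c \<oplus>\<^bsub>M\<^esub> g c \<odot>\<^bsub>M\<^esub> h c) A"
    by (rule M.finsum_cong') (use fD(1) gD(1) hA in \<open>auto simp: smult_l_distr\<close>)
  also have "\<dots> = finsum M (\<lambda>c. f c \<odot>\<^bsub>M\<^esub> h c) A \<oplus>\<^bsub>M\<^esub> finsum M (\<lambda>c. g c \<odot>\<^bsub>M\<^esub> h c) A"
    by (rule M.finsum_addf) (use fD(1) gD(1) hA in \<open>auto\<close>)
  also have "finsum M (\<lambda>c. f c \<odot>\<^bsub>M\<^esub> h c) A = lin_ext R M h f"
    by (rule lin_ext_support[OF f h A(1,3,2), symmetric])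
  also have "finsum M (\<lambda>c. g c \<odot>\<^bsub>M\<^esub> h c) A = lin_ext R M h g"
    by (rule lin_ext_support[OF g h A(1,4,2), symmetric])
  finally show ?thesis .
qed

lemma lin_ext_smult:
  assumes f: "f \<in> carrier (free_mod R S)" and r: "r \<in> carrier R"
    and h: "\<And>c. c \<in> S \<Longrightarrow> h c \<in> carrier M"
  shows "lin_ext R M h (\<lambda>x. r \<otimes> f x) = r \<odot>\<^bsub>M\<^esub> lin_ext R M h f"
proof -
  let ?A = "{c. f c \<noteq> \<zero>}"
  interpret F: module R "free_mod R S" by (rule free_mod_module)
  note fD = free_mod_carrierD[OF f]
  have hA: "h c \<in> carrier M" if "c \<in> ?A" for c using h fD(4) that by blast
  have rf: "(\<lambda>x. r \<otimes> f x) \<in> carrier (free_mod R S)" using F.smult_closed[OF r f] by simp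
  have sub: "{c. r \<otimes> f c \<noteq> \<zero>} \<subseteq> ?A" using r by auto
  have "lin_ext R M h (\<lambda>x. r \<otimes> f x) = finsum M (\<lambda>c. (r \<otimes> f c) \<odot>\<^bsub>M\<^esub> h c) ?A"
    by (rule lin_ext_support[OF rf h fD(3) sub fD(4)])
  also have "\<dots> = finsum M (\<lambda>c. r \<odot>\<^bsub>M\<^esub> (f c \<odot>\<^bsub>M\<^esub> h c)) ?A"
    by (rule M.finsum_cong') (use fD(1) hA r in \<open>auto simp: smult_assoc1\<close>)
  also have "\<dots> = r \<odot>\<^bsub>M\<^esub> lin_ext R M h f" unfolding lin_ext_def
    by (rule finsum_smult_ldistr[symmetric]) (use fD(1,3) hA r in auto)
  finally show ?thesis .
qed

lemma lin_ext_single: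
  assumes "c \<in> S" "r \<in> carrier R" "\<And>c. c \<in> S \<Longrightarrow> h c \<in> carrier M"
  shows "lin_ext R M h (free_single R c r) = r \<odot>\<^bsub>M\<^esub> h c"
proof -
  have "lin_ext R M h (free_single R c r) = finsum M (\<lambda>x. free_single R c r x \<odot>\<^bsub>M\<^esub> h x) {c}"
    by (rule lin_ext_support[OF free_single_carrier[OF assms(1,2)] assms(3)])
      (use assms in \<open>auto simp: free_single_def\<close>)
  also have "\<dots> = r \<odot>\<^bsub>M\<^esub> h c" using assms by (simp add: free_single_def)
  finally show ?thesis .
qed

lemma lin_ext_hom:
  assumes "\<And>c. c \<in> S \<Longrightarrow> h c \<in> carrier M"
  shows "(\<lambda>f\<in>carrier (free_mod R S). lin_ext R M h f) \<in> mod_hom R (free_mod R S) M"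
proof -
  interpret F: module R "free_mod R S" by (rule free_mod_module)
  show ?thesis
  proof (rule mod_homI)
    fix f assume f: "f \<in> carrier (free_mod R S)"
    then show "(\<lambda>f\<in>carrier (free_mod R S). lin_ext R M h f) f \<in> carrier M"
      using lin_ext_closed[OF f assms] by simp
    show "(\<lambda>f\<in>carrier (free_mod R S). lin_ext R M h f) (f \<oplus>\<^bsub>free_mod R S\<^esub> g) =
      (\<lambda>f\<in>carrier (free_mod R S). lin_ext R M h f) f \<oplus>\<^bsub>M\<^esub> (\<lambda>f\<in>carrier (free_mod R S). lin_ext R M h f) g"
      if g: "g \<in> carrier (free_mod R S)" for g
      using F.M.a_closed[OF f g] f g lin_ext_add[OF f g assms] by simp
    show "(\<lambda>f\<in>carrier (free_mod R S). lin_ext R M h f) (r \<odot>\<^bsub>free_mod R S\<^esub> f) =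
      r \<odot>\<^bsub>M\<^esub> (\<lambda>f\<in>carrier (free_mod R S). lin_ext R M h f) f" if r: "r \<in> carrier R" for r
      using F.smult_closed[OF r f] f lin_ext_smult[OF f r assms] by simp
  qed simp
qed

lemma free_ker_submodule: "submodule (free_ker R M) R (free_mod R (carrier M))"
proof -
  interpret F: module R "free_mod R (carrier M)" by (rule free_mod_module)
  have id: "\<And>c. c \<in> carrier M \<Longrightarrow> c \<in> carrier M" .
  have K: "f \<in> carrier (free_mod R (carrier M))" "free_eval R M f = \<zero>\<^bsub>M\<^esub>" if "f \<in> free_ker R M" for f
    using that by (auto simp: free_ker_def)
  have smult: "r \<odot>\<^bsub>free_mod R (carrier M)\<^esub> f \<in> free_ker R M" if "r \<in> carrier R" "f \<in> free_ker R M" for r f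
    using F.smult_closed[OF that(1) K(1)[OF that(2)]] lin_ext_smult[OF K(1)[OF that(2)] that(1) id] K(2)[OF that(2)] that(1)
    by (simp add: free_ker_def free_eval_lin_ext)
  show ?thesis
  proof (rule F.submoduleI)
    show "free_ker R M \<subseteq> carrier (free_mod R (carrier M))" by (auto simp: free_ker_def)
    show "\<zero>\<^bsub>free_mod R (carrier M)\<^esub> \<in> free_ker R M"
      using F.M.zero_closed by (simp add: free_ker_def free_eval_def)
    fix f assume f: "f \<in> free_ker R M"
    \<comment> \<open>Negation is written as a scalar multiple, so that closure under scalars covers
      it.\<close>
    have "\<ominus>\<^bsub>free_mod R (carrier M)\<^esub> f = (\<ominus> \<one>) \<odot>\<^bsub>free_mod R (carrier M)\<^esub> f"
      using K(1)[OF f] F.smult_one by (simp only: F.smult_l_minus R.one_closed)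
    then show "\<ominus>\<^bsub>free_mod R (carrier M)\<^esub> f \<in> free_ker R M" using smult[OF _ f, of "\<ominus> \<one>"] by simp
    show "f \<oplus>\<^bsub>free_mod R (carrier M)\<^esub> g \<in> free_ker R M" if g: "g \<in> free_ker R M" for g
      using F.M.a_closed[OF K(1)[OF f] K(1)[OF g]] lin_ext_add[OF K(1)[OF f] K(1)[OF g] id] K(2)[OF f] K(2)[OF g]
      by (simp add: free_ker_def free_eval_lin_ext)
  qed (rule smult)
qed

lemma syz1_module: "module R (syz1 R M)"
proof -
  interpret F: module R "free_mod R (carrier M)" by (rule free_mod_module)
  show ?thesis unfolding syz1_def
    by (rule submodule.submodule_is_module[OF free_ker_submodule F.module_axioms])
qed

lemma syz1_simps:
  "carrier (syz1 R M) = free_ker R M" "f \<oplus>\<^bsub>syz1 R M\<^esub> g = (\<lambda>x. f x \<oplus> g x)" "r \<odot>\<^bsub>syz1 R M\<^esub> f = (\<lambda>x. r \<otimes> f x)"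
  "\<zero>\<^bsub>syz1 R M\<^esub> = (\<lambda>x. \<zero>)"
  by (simp_all add: syz1_def free_mod_def)

end

section \<open>Operations on homomorphisms\<close>

lemma mod_hom_add:
  assumes f: "f \<in> mod_hom R M N" and g: "g \<in> mod_hom R M N" and M: "module R M" and N: "module R N"
  shows "(\<lambda>x\<in>carrier M. f x \<oplus>\<^bsub>N\<^esub> g x) \<in> mod_hom R M N"
proof -
  interpret M: module R M by fact
  interpret N: module R N by fact
  note fD = mod_homD[OF f] and gD = mod_homD[OF g]
  show ?thesis
    by (rule mod_homI) (use fD(1,3,4) gD(1,3,4) in \<open>auto simp: N.smult_r_distr N.M.a_ac\<close>)
qed

lemma mod_hom_diff:
  assumes f: "f \<in> mod_hom R M N" and g: "g \<in> mod_hom R M N" and M: "module R M" and N: "module R N"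
  shows "(\<lambda>x\<in>carrier M. f x \<ominus>\<^bsub>N\<^esub> g x) \<in> mod_hom R M N"
proof -
  interpret M: module R M by fact
  interpret N: module R N by fact
  note fD = mod_homD[OF f] and gD = mod_homD[OF g]
  show ?thesis
    by (rule mod_homI)
      (use fD(1,3,4) gD(1,3,4) in \<open>auto simp: N.smult_r_distr N.smult_r_minus a_minus_def N.M.minus_add N.M.a_ac\<close>)
qed

lemma mod_hom_zero_map:
  assumes M: "module R M" and N: "module R N"
  shows "(\<lambda>x\<in>carrier M. \<zero>\<^bsub>N\<^esub>) \<in> mod_hom R M N"
proof -
  interpret M: module R M by fact
  interpret N: module R N by fact
  show ?thesis by (rule mod_homI) auto
qed

lemma mod_hom_compose:
  assumes f: "f \<in> mod_hom R M N" and g: "g \<in> mod_hom R N Q" and M: "module R M"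
  shows "(\<lambda>x\<in>carrier M. g (f x)) \<in> mod_hom R M Q"
proof -
  interpret M: module R M by fact
  note fD = mod_homD[OF f] and gD = mod_homD[OF g]
  show ?thesis by (rule mod_homI) (use fD(1,3,4) gD(1,3,4) in auto)
qed

lemma mod_hom_lin_ext:
  assumes u: "u \<in> mod_hom R M N" and M: "module R M" and N: "module R N"
    and f: "f \<in> carrier (free_mod R S)" and h: "\<And>c. c \<in> S \<Longrightarrow> h c \<in> carrier M"
  shows "u (lin_ext R M h f) = lin_ext R N (\<lambda>c. u (h c)) f"
proof -
  interpret M: module R M by fact
  interpret N: module R N by fact
  note uD = mod_homD[OF u] and fD = free_mod_carrierD[OF f]
  have "u (finsum M (\<lambda>c. f c \<odot>\<^bsub>M\<^esub> h c) A) = finsum N (\<lambda>c. f c \<odot>\<^bsub>N\<^esub> u (h c)) A" if "finite A" "A \<subseteq> S" for A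
    using that
  proof induct
    case empty
    then show ?case using mod_hom_zero[OF u M N] by simp
  next
    case (insert a A)
    have h': "h a \<in> carrier M" "\<And>c. c \<in> A \<Longrightarrow> h c \<in> carrier M" using h insert(4) by auto
    have 1: "(\<lambda>c. f c \<odot>\<^bsub>M\<^esub> h c) \<in> A \<rightarrow> carrier M" using h' fD(1) by auto
    have 2: "(\<lambda>c. f c \<odot>\<^bsub>N\<^esub> u (h c)) \<in> A \<rightarrow> carrier N" using h' fD(1) uD(1) by auto
    have "u (finsum M (\<lambda>c. f c \<odot>\<^bsub>M\<^esub> h c) (insert a A)) = u (f a \<odot>\<^bsub>M\<^esub> h a \<oplus>\<^bsub>M\<^esub> finsum M (\<lambda>c. f c \<odot>\<^bsub>M\<^esub> h c) A)"
      using insert(1,2) 1 h'(1) fD(1) by (simp add: M.M.finsum_insert)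
    also have "\<dots> = f a \<odot>\<^bsub>N\<^esub> u (h a) \<oplus>\<^bsub>N\<^esub> u (finsum M (\<lambda>c. f c \<odot>\<^bsub>M\<^esub> h c) A)"
      using uD(3,4) h'(1) fD(1) M.M.finsum_closed[OF 1] by simp
    also have "\<dots> = finsum N (\<lambda>c. f c \<odot>\<^bsub>N\<^esub> u (h c)) (insert a A)"
      using insert 2 h'(1) fD(1) uD(1) by (simp add: N.M.finsum_insert)
    finally show ?case .
  qed
  then show ?thesis unfolding lin_ext_def using fD(3,4) by blast
qed

section \<open>Ext as an extension problem\<close>

context module
begin

lemma free_eval_syz1_hom:
  "(\<lambda>z\<in>carrier (free_mod R (carrier (syz1 R M))). free_eval R (syz1 R M) z)
    \<in> mod_hom R (free_mod R (carrier (syz1 R M))) (syz1 R M)"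
  unfolding free_eval_lin_ext
  by (rule module.lin_ext_hom[OF syz1_module])

lemma free_eval_single:
  assumes "x \<in> carrier M"
  shows "free_eval R M (free_single R x \<one>) = x" "free_single R x \<one> \<in> carrier (free_mod R (carrier M))"
  using assms lin_ext_single[of x "carrier M" \<one> "\<lambda>x. x"] free_single_carrier[of x "carrier M" \<one>]
  by (simp_all add: free_eval_lin_ext)

text \<open>Exactness of the canonical resolution at F1: a cocycle vanishes on the image of F2,
  which is the kernel of F1 onto the first syzygy, so it factors through that syzygy.\<close>

lemma Ext1_cocycles_iff:
  assumes V: "module R V"
  shows "Ext1_cocycles R M V =
    (\<lambda>c. \<lambda>z\<in>carrier (free_mod R (carrier (syz1 R M))). c (free_eval R (syz1 R M) z)) ` mod_hom R (syz1 R M) V"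
    (is "_ = ?B")
proof
  let ?S = "syz1 R M"
  let ?F = "free_mod R (carrier ?S)"
  let ?e = "free_eval R ?S"
  interpret V: module R V by fact
  interpret S: module R ?S by (rule syz1_module)
  interpret F: module R ?F by (rule free_mod_module)
  interpret S2: module R "syz1 R ?S" by (rule S.syz1_module)
  have e: "(\<lambda>z\<in>carrier ?F. ?e z) \<in> mod_hom R ?F ?S" by (rule free_eval_syz1_hom)
  have e_add: "?e (z \<oplus>\<^bsub>?F\<^esub> z') = ?e z \<oplus>\<^bsub>?S\<^esub> ?e z'" "?e z \<in> carrier ?S" if "z \<in> carrier ?F" "z' \<in> carrier ?F" for z z'
    using mod_homD(1)[OF e that(1)] mod_homD(3)[OF e that] F.M.a_closed[OF that] that by (simp_all del: free_mod_simps)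
  have e_smult: "?e (r \<odot>\<^bsub>?F\<^esub> z) = r \<odot>\<^bsub>?S\<^esub> ?e z" if "r \<in> carrier R" "z \<in> carrier ?F" for r z
    using mod_homD(4)[OF e that] F.smult_closed[OF that] that by (simp del: free_mod_simps)
  have syz2: "carrier (syz2 R M) = free_ker R ?S" by (simp add: syz2_def S.syz1_simps)
  have ker: "?e k = \<zero>\<^bsub>?S\<^esub>" "k \<in> carrier ?F" if "k \<in> free_ker R ?S" for k
    using that by (auto simp: free_ker_def)
  show "Ext1_cocycles R M V \<subseteq> ?B"
  proof
    fix c assume "c \<in> Ext1_cocycles R M V"
    then have c: "c \<in> mod_hom R ?F V"
      and cz: "\<And>z. z \<in> carrier (free_mod R (carrier (syz2 R M))) \<Longrightarrow> c (free_eval R (syz2 R M) z) = \<zero>\<^bsub>V\<^esub>"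
      by (auto simp: Ext1_cocycles_def)
    note cD = mod_homD[OF c]
    \<comment> \<open>Each kernel element k is itself a basis index of F2, and the basis vector at k
      evaluates to k.\<close>
    have c0: "c k = \<zero>\<^bsub>V\<^esub>" if k: "k \<in> free_ker R ?S" for k
    proof -
      have "k \<in> carrier (syz1 R ?S)" using k by (simp add: S.syz1_simps)
      from S2.free_eval_single[OF this] show ?thesis
        using cz[of "free_single R k \<one>"] by (simp add: syz2_def)
    qed
    \<comment> \<open>The map x to its basis vector is a set-theoretic section of the evaluation; d
      is linear because c depends only on the evaluated element.\<close>
    define d where "d = (\<lambda>x\<in>carrier ?S. c (free_single R x \<one>))"
    have single: "?e (free_single R x \<one>) = x" "free_single R x \<one> \<in> carrier ?F" if "x \<in> carrier ?S" for x
      using S.free_eval_single[OF that] by simp_all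
    have eq: "c z = c z'" if z: "z \<in> carrier ?F" "z' \<in> carrier ?F" "?e z = ?e z'" for z z'
    proof -
      have m: "\<ominus>\<^bsub>?F\<^esub> z' = (\<ominus> \<one>) \<odot>\<^bsub>?F\<^esub> z'" using F.smult_l_minus[OF R.one_closed z(2)] F.smult_one[OF z(2)] by (simp only:)
      have mz: "\<ominus>\<^bsub>?F\<^esub> z' \<in> carrier ?F" using z(2) by (rule F.M.a_inv_closed)
      have "?e (z \<oplus>\<^bsub>?F\<^esub> (\<ominus>\<^bsub>?F\<^esub> z')) = ?e z \<oplus>\<^bsub>?S\<^esub> ?e (\<ominus>\<^bsub>?F\<^esub> z')" by (rule e_add(1)[OF z(1) mz])
      also have "?e (\<ominus>\<^bsub>?F\<^esub> z') = (\<ominus> \<one>) \<odot>\<^bsub>?S\<^esub> ?e z'" unfolding m by (rule e_smult) (use z(2) in auto)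
      also have "\<dots> = \<ominus>\<^bsub>?S\<^esub> ?e z'" using S.smult_l_minus[of \<one> "?e z'"] e_add(2)[OF z(2,2)] by (simp del: S.smult_l_minus)
      also have "?e z \<oplus>\<^bsub>?S\<^esub> \<ominus>\<^bsub>?S\<^esub> ?e z' = \<zero>\<^bsub>?S\<^esub>" unfolding z(3) by (rule S.M.r_neg[OF e_add(2)[OF z(2,2)]])
      finally have "z \<oplus>\<^bsub>?F\<^esub> (\<ominus>\<^bsub>?F\<^esub> z') \<in> free_ker R ?S"
        using F.M.a_closed[OF z(1) mz] unfolding free_ker_def by (simp del: free_mod_simps)
      then have "c (z \<oplus>\<^bsub>?F\<^esub> (\<ominus>\<^bsub>?F\<^esub> z')) = \<zero>\<^bsub>V\<^esub>" by (rule c0)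
      then have "c z \<oplus>\<^bsub>V\<^esub> \<ominus>\<^bsub>V\<^esub> c z' = \<zero>\<^bsub>V\<^esub>"
        using cD(3)[OF z(1) mz] mod_hom_minus[OF c F.module_axioms V z(2)] by (simp del: free_mod_simps)
      then show ?thesis using cD(1)[OF z(1)] cD(1)[OF z(2)] V.M.a_minus_eq_zero_iff by (simp add: a_minus_def)
    qed
    have d: "d \<in> mod_hom R ?S V"
    proof (rule mod_homI)
      fix x assume x: "x \<in> carrier ?S"
      then show "d x \<in> carrier V" using single(2) cD(1) by (simp add: d_def)
      show "d (x \<oplus>\<^bsub>?S\<^esub> y) = d x \<oplus>\<^bsub>V\<^esub> d y" if y: "y \<in> carrier ?S" for y
      proof -
        have xy: "x \<oplus>\<^bsub>?S\<^esub> y \<in> carrier ?S" by (rule S.M.a_closed[OF x y])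
        have "c (free_single R (x \<oplus>\<^bsub>?S\<^esub> y) \<one>) = c (free_single R x \<one> \<oplus>\<^bsub>?F\<^esub> free_single R y \<one>)"
          using e_add(1)[OF single(2)[OF x] single(2)[OF y]] single(1)[OF x] single(1)[OF y] single(1)[OF xy]
          by (intro eq single(2)[OF xy] F.M.a_closed[OF single(2)[OF x] single(2)[OF y]]) (simp del: free_mod_simps)
        then show ?thesis
          using cD(3)[OF single(2)[OF x] single(2)[OF y]] x y xy by (simp add: d_def del: free_mod_simps)
      qed
      show "d (r \<odot>\<^bsub>?S\<^esub> x) = r \<odot>\<^bsub>V\<^esub> d x" if r: "r \<in> carrier R" for r
      proof -
        have rx: "r \<odot>\<^bsub>?S\<^esub> x \<in> carrier ?S" by (rule S.smult_closed[OF r x])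
        have "c (free_single R (r \<odot>\<^bsub>?S\<^esub> x) \<one>) = c (r \<odot>\<^bsub>?F\<^esub> free_single R x \<one>)"
          using e_smult[OF r single(2)[OF x]] single(1)[OF x] single(1)[OF rx]
          by (intro eq single(2)[OF rx] F.smult_closed[OF r single(2)[OF x]]) (simp del: free_mod_simps)
        then show ?thesis using cD(4)[OF r single(2)[OF x]] x rx by (simp add: d_def del: free_mod_simps)
      qed
    qed (simp add: d_def)
    have "c = (\<lambda>z\<in>carrier ?F. d (?e z))"
    proof (rule extensionalityI[OF cD(2) restrict_extensional])
      fix z assume z: "z \<in> carrier ?F"
      have ez: "?e z \<in> carrier ?S" by (rule e_add(2)[OF z z])
      have "c z = c (free_single R (?e z) \<one>)" by (rule eq[OF z single(2)[OF ez]]) (simp add: single(1)[OF ez])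
      then show "c z = (\<lambda>z\<in>carrier ?F. d (?e z)) z" using z ez by (simp add: d_def)
    qed
    then show "c \<in> ?B" using d by (rule image_eqI)
  qed
  show "?B \<subseteq> Ext1_cocycles R M V"
  proof
    fix c assume "c \<in> ?B"
    then obtain d where d: "d \<in> mod_hom R ?S V" "c = (\<lambda>z\<in>carrier ?F. d (?e z))" by (rule imageE)
    have "(\<lambda>z\<in>carrier ?F. d ((\<lambda>z\<in>carrier ?F. ?e z) z)) \<in> mod_hom R ?F V"
      by (rule mod_hom_compose[OF e d(1) F.module_axioms])
    then have c: "c \<in> mod_hom R ?F V" unfolding d(2) by (simp cong: restrict_cong)
    have "c (free_eval R (syz2 R M) z) = \<zero>\<^bsub>V\<^esub>" if z: "z \<in> carrier (free_mod R (carrier (syz2 R M)))" for z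
    proof -
      have "free_eval R (syz2 R M) z \<in> carrier (syz2 R M)"
        using S2.lin_ext_closed[of z "carrier (syz2 R M)" "\<lambda>x. x"] z
        by (simp add: free_eval_lin_ext syz2_def)
      then have "free_eval R (syz2 R M) z \<in> free_ker R ?S" unfolding syz2 .
      then show ?thesis using ker[of "free_eval R (syz2 R M) z"] mod_hom_zero[OF d(1) S.module_axioms V]
        by (simp add: d(2))
    qed
    then show "c \<in> Ext1_cocycles R M V" using c by (simp add: Ext1_cocycles_def)
  qed
qed

text \<open>Since F1 maps onto the syzygy, precomposition with the evaluation is injective. A
  cocycle is thus a coboundary exactly when its factor on the kernel extends to F0.\<close>

lemma Ext1_subset_iff:
  assumes V: "module R V"
  shows "Ext1_cocycles R M V \<subseteq> Ext1_coboundaries R M V \<longleftrightarrow>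
    (\<forall>c\<in>mod_hom R (syz1 R M) V. \<exists>g\<in>mod_hom R (free_mod R (carrier M)) V. \<forall>k\<in>free_ker R M. c k = g k)"
proof -
  let ?S = "syz1 R M"
  let ?F = "free_mod R (carrier ?S)"
  let ?e = "free_eval R ?S"
  interpret S: module R ?S by (rule syz1_module)
  have e: "?e z \<in> free_ker R M" if "z \<in> carrier ?F" for z
    using mod_homD(1)[OF free_eval_syz1_hom that] that by (simp add: syz1_simps)
  have single: "?e (free_single R x \<one>) = x" "free_single R x \<one> \<in> carrier ?F" if "x \<in> free_ker R M" for x
    using S.free_eval_single[of x] that by (simp_all add: syz1_simps)
  have eq: "(\<lambda>z\<in>carrier ?F. c (?e z)) = (\<lambda>z\<in>carrier ?F. g (?e z)) \<longleftrightarrow> (\<forall>k\<in>free_ker R M. c k = g k)" for c g :: "_ \<Rightarrow> 'e"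
  proof
    assume a: "(\<lambda>z\<in>carrier ?F. c (?e z)) = (\<lambda>z\<in>carrier ?F. g (?e z))"
    show "\<forall>k\<in>free_ker R M. c k = g k"
    proof
      fix k assume "k \<in> free_ker R M"
      then show "c k = g k" using fun_cong[OF a, of "free_single R k \<one>"] single[of k] by simp
    qed
  next
    assume "\<forall>k\<in>free_ker R M. c k = g k"
    then show "(\<lambda>z\<in>carrier ?F. c (?e z)) = (\<lambda>z\<in>carrier ?F. g (?e z))" using e by (intro restrict_ext) simp
  qed
  show ?thesis unfolding Ext1_cocycles_iff[OF V] Ext1_coboundaries_def
    using eq by (auto simp: image_subset_iff image_iff)
qed

lemma Ext1_trivial_iff:
  assumes V: "module R V"
  shows "carrier (Ext1 R M V) = {\<zero>\<^bsub>Ext1 R M V\<^esub>} \<longleftrightarrow> Ext1_cocycles R M V \<subseteq> Ext1_coboundaries R M V"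
proof -
  let ?S = "syz1 R M"
  let ?F = "free_mod R (carrier ?S)"
  let ?G = "free_mod R (carrier M)"
  let ?e = "free_eval R ?S"
  let ?Z = "Ext1_cocycles R M V" and ?B = "Ext1_coboundaries R M V"
  let ?add = "\<lambda>f g. \<lambda>z\<in>carrier ?F. f z \<oplus>\<^bsub>V\<^esub> g z"
  interpret V: module R V by fact
  interpret S: module R ?S by (rule syz1_module)
  interpret F0: module R ?G by (rule free_mod_module)
  interpret F: module R ?F by (rule free_mod_module)
  have e: "?e z \<in> carrier ?G" if "z \<in> carrier ?F" for z
    using mod_homD(1)[OF free_eval_syz1_hom that] that by (simp add: syz1_simps free_ker_def)
  have zero: "\<zero>\<^bsub>Ext1 R M V\<^esub> = ?B" by (simp add: Ext1_def quot_mod_def)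
  \<comment> \<open>Cosets are unfolded to translates of the coboundaries under pointwise addition,
    which allows a direct comparison with the zero coset.\<close>
  have carrier: "carrier (Ext1 R M V) = (\<lambda>x. (\<lambda>b. ?add b x) ` ?B) ` ?Z"
    by (auto simp: Ext1_def quot_mod_def A_RCOSETS_def' a_r_coset_def' Hom_mod_def)
  define cob where "cob g = (\<lambda>z\<in>carrier ?F. g (?e z))" for g :: "('c \<Rightarrow> 'a) \<Rightarrow> 'e"
  have B: "?B = cob ` mod_hom R ?G V" by (auto simp: Ext1_coboundaries_def cob_def)
  have zeroB: "(\<lambda>z\<in>carrier ?F. \<zero>\<^bsub>V\<^esub>) \<in> ?B"
    unfolding B by (rule image_eqI[OF _ mod_hom_zero_map[OF F0.module_axioms V]]) (auto simp: cob_def e intro!: restrict_ext)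
  have Zext: "x \<in> mod_hom R ?F V" if "x \<in> ?Z" for x using that by (auto simp: Ext1_cocycles_def)
  have zeroZ: "(\<lambda>z\<in>carrier ?F. \<zero>\<^bsub>V\<^esub>) \<in> ?Z"
    unfolding Ext1_cocycles_iff[OF V]
    by (rule image_eqI[OF _ mod_hom_zero_map[OF S.module_axioms V]])
      (use mod_homD(1)[OF free_eval_syz1_hom] in \<open>auto intro!: restrict_ext\<close>)
  show ?thesis
  proof
    assume a: "carrier (Ext1 R M V) = {\<zero>\<^bsub>Ext1 R M V\<^esub>}"
    show "?Z \<subseteq> ?B"
    proof
      fix x assume x: "x \<in> ?Z"
      have "(\<lambda>b. ?add b x) ` ?B \<in> {?B}" using imageI[OF x] a unfolding zero carrier by (rule subst[rotated])
      then have "(\<lambda>b. ?add b x) ` ?B = ?B" by (rule singletonD)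
      then have "?add (\<lambda>z\<in>carrier ?F. \<zero>\<^bsub>V\<^esub>) x \<in> ?B" using zeroB by blast
      moreover have "?add (\<lambda>z\<in>carrier ?F. \<zero>\<^bsub>V\<^esub>) x = x"
        using mod_homD(1)[OF Zext[OF x]] by (intro extensionalityI[OF restrict_extensional mod_homD(2)[OF Zext[OF x]]]) simp
      ultimately show "x \<in> ?B" by simp
    qed
  next
    assume ZB: "?Z \<subseteq> ?B"
    have "(\<lambda>b. ?add b x) ` ?B = ?B" if x: "x \<in> ?Z" for x
    proof -
      obtain g where g: "g \<in> mod_hom R ?G V" "x = cob g" using x ZB unfolding B by blast
      show ?thesis
      proof
        show "(\<lambda>b. ?add b x) ` ?B \<subseteq> ?B"
        proof
          fix y assume "y \<in> (\<lambda>b. ?add b x) ` ?B"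
          then obtain h where h: "h \<in> mod_hom R ?G V" "y = ?add (cob h) x" unfolding B by blast
          have "y = cob (\<lambda>y\<in>carrier ?G. h y \<oplus>\<^bsub>V\<^esub> g y)"
            unfolding h(2) g(2) cob_def using e by (intro restrict_ext) simp
          then show "y \<in> ?B" unfolding B using mod_hom_add[OF h(1) g(1) F0.module_axioms V] by (rule image_eqI)
        qed
        show "?B \<subseteq> (\<lambda>b. ?add b x) ` ?B"
        proof
          fix y assume "y \<in> ?B"
          then obtain h where h: "h \<in> mod_hom R ?G V" "y = cob h" unfolding B by blast
          have "y = ?add (cob (\<lambda>y\<in>carrier ?G. h y \<ominus>\<^bsub>V\<^esub> g y)) x"
            unfolding h(2) g(2) cob_def using e mod_homD(1)[OF h(1)] mod_homD(1)[OF g(1)]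
            by (intro restrict_ext) (simp add: V.M.minus_add_cancel)
          moreover have "cob (\<lambda>y\<in>carrier ?G. h y \<ominus>\<^bsub>V\<^esub> g y) \<in> ?B"
            unfolding B using mod_hom_diff[OF h(1) g(1) F0.module_axioms V] by (rule imageI)
          ultimately show "y \<in> (\<lambda>b. ?add b x) ` ?B" by (rule image_eqI)
        qed
      qed
    qed
    \<comment> \<open>The zero cocycle guarantees that there is a coset at all.\<close>
    then show "carrier (Ext1 R M V) = {\<zero>\<^bsub>Ext1 R M V\<^esub>}" unfolding zero carrier using zeroZ by auto
  qed
qed

text \<open>Independence of the resolution in a special case: the canonical F0 over a cyclic module
  is compared with R itself. The maps \<rho> and s go between F0 and R over M, carry the kernels J
  and \<open>free_ker\<close> into each other, and satisfy \<rho> s = 1.\<close>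

lemma Ext1_cyclic_trivial_iff:
  assumes V: "module R V" and e: "e \<in> carrier M" and gen: "\<And>x. x \<in> carrier M \<Longrightarrow> \<exists>r\<in>carrier R. r \<odot>\<^bsub>M\<^esub> e = x"
    and J: "J = {r \<in> carrier R. r \<odot>\<^bsub>M\<^esub> e = \<zero>\<^bsub>M\<^esub>}"
  shows "carrier (Ext1 R M V) = {\<zero>\<^bsub>Ext1 R M V\<^esub>} \<longleftrightarrow>
    (\<forall>f\<in>mod_hom R ((ring_mod R)\<lparr>carrier := J\<rparr>) V. \<exists>x\<in>carrier V. \<forall>j\<in>J. f j = j \<odot>\<^bsub>V\<^esub> x)"
proof -
  interpret V: module R V by fact
  let ?G = "free_mod R (carrier M)"
  interpret F0: module R ?G by (rule free_mod_module)
  interpret RM: module R "ring_mod R" by (rule ring_mod_module)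
  have JR: "J \<subseteq> carrier R" by (auto simp: J)
  \<comment> \<open>The value at e is forced to be 1, since an arbitrary representative of e would
    only be 1 modulo J and \<rho> would not split s exactly.\<close>
  define rep where "rep x = (if x = e then \<one> else (SOME r. r \<in> carrier R \<and> r \<odot>\<^bsub>M\<^esub> e = x))" for x
  have rep: "rep x \<in> carrier R" "rep x \<odot>\<^bsub>M\<^esub> e = x" if "x \<in> carrier M" for x
    using someI_ex[OF gen[OF that, unfolded Bex_def]] e by (auto simp: rep_def)
  have rep_e: "rep e = \<one>" by (simp add: rep_def)
  \<comment> \<open>a lift to \<open>R\<close> of the evaluation map onto \<open>M \<cong> R/J\<close>\<close>
  define \<rho> where "\<rho> = (\<lambda>y\<in>carrier ?G. lin_ext R (ring_mod R) rep y)"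
  have \<rho>: "\<rho> \<in> mod_hom R ?G (ring_mod R)" unfolding \<rho>_def
    by (rule RM.lin_ext_hom) (simp add: rep(1))
  note \<rho>D = mod_homD[OF \<rho>]
  have \<rho>R: "\<rho> y \<in> carrier R" if "y \<in> carrier ?G" for y using \<rho>D(1)[OF that] by simp
  have u: "(\<lambda>r\<in>carrier R. r \<odot>\<^bsub>M\<^esub> e) \<in> mod_hom R (ring_mod R) M"
    by (rule mod_homI) (use e in \<open>auto simp: smult_l_distr smult_assoc1\<close>)
  have eval: "free_eval R M y = \<rho> y \<odot>\<^bsub>M\<^esub> e" if y: "y \<in> carrier ?G" for y
  proof -
    have "(\<lambda>r\<in>carrier R. r \<odot>\<^bsub>M\<^esub> e) (lin_ext R (ring_mod R) rep y) = lin_ext R M (\<lambda>c. (\<lambda>r\<in>carrier R. r \<odot>\<^bsub>M\<^esub> e) (rep c)) y"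
      by (rule mod_hom_lin_ext[OF u ring_mod_module module_axioms y]) (simp add: rep(1))
    also have "\<dots> = lin_ext R M (\<lambda>c. c) y" unfolding lin_ext_def
      by (rule M.finsum_cong') (use free_mod_carrierD(1,4)[OF y] rep in \<open>auto simp: subset_iff\<close>)
    finally show ?thesis using \<rho>R[OF y] y by (simp add: free_eval_lin_ext \<rho>_def)
  qed
  have ker: "k \<in> free_ker R M \<longleftrightarrow> k \<in> carrier ?G \<and> \<rho> k \<in> J" for k
    using eval[of k] \<rho>R[of k] by (auto simp: free_ker_def J)
  define s where "s j = free_single R e j" for j
  have s: "s j \<in> carrier ?G" "\<rho> (s j) = j" if "j \<in> carrier R" for j
  proof -
    show sj: "s j \<in> carrier ?G" unfolding s_def by (rule free_single_carrier[OF e that])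
    have "lin_ext R (ring_mod R) rep (free_single R e j) = j \<odot>\<^bsub>ring_mod R\<^esub> rep e"
      by (rule RM.lin_ext_single[OF e that]) (simp add: rep(1))
    then show "\<rho> (s j) = j" using that sj by (simp add: \<rho>_def s_def rep_e)
  qed
  have s_add: "s (i \<oplus> j) = s i \<oplus>\<^bsub>?G\<^esub> s j" if "i \<in> carrier R" "j \<in> carrier R" for i j
    using that by (auto simp: s_def free_single_def)
  have s_smult: "s (i \<otimes> j) = i \<odot>\<^bsub>?G\<^esub> s j" if "i \<in> carrier R" "j \<in> carrier R" for i j
    using that by (auto simp: s_def free_single_def)
  have syz: "carrier (syz1 R M) = free_ker R M" "(\<oplus>\<^bsub>syz1 R M\<^esub>) = (\<oplus>\<^bsub>?G\<^esub>)" "(\<odot>\<^bsub>syz1 R M\<^esub>) = (\<odot>\<^bsub>?G\<^esub>)"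
    by (simp_all add: syz1_def)
  show ?thesis unfolding Ext1_trivial_iff[OF V] Ext1_subset_iff[OF V]
  proof (intro iffI ballI)
    fix f assume H: "\<forall>c\<in>mod_hom R (syz1 R M) V. \<exists>g\<in>mod_hom R ?G V. \<forall>k\<in>free_ker R M. c k = g k"
      and f: "f \<in> mod_hom R ((ring_mod R)\<lparr>carrier := J\<rparr>) V"
    note fD = mod_homD[OF f, simplified]
    have "(\<lambda>k\<in>free_ker R M. f (\<rho> k)) \<in> mod_hom R (syz1 R M) V"
    proof (rule mod_homI)
      fix k assume k: "k \<in> carrier (syz1 R M)"
      then have k': "k \<in> free_ker R M" "k \<in> carrier ?G" "\<rho> k \<in> J" using ker syz by auto
      then show "(\<lambda>k\<in>free_ker R M. f (\<rho> k)) k \<in> carrier V" using fD(1) by simp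
      show "(\<lambda>k\<in>free_ker R M. f (\<rho> k)) (k \<oplus>\<^bsub>syz1 R M\<^esub> l) = (\<lambda>k\<in>free_ker R M. f (\<rho> k)) k \<oplus>\<^bsub>V\<^esub> (\<lambda>k\<in>free_ker R M. f (\<rho> k)) l"
        if l: "l \<in> carrier (syz1 R M)" for l
      proof -
        have l': "l \<in> free_ker R M" "l \<in> carrier ?G" "\<rho> l \<in> J" using l ker syz by auto
        have "k \<oplus>\<^bsub>?G\<^esub> l \<in> free_ker R M" using F0.submoduleE(5)[OF free_ker_submodule] k' l' by simp
        then show ?thesis unfolding syz using \<rho>D(3)[OF k'(2) l'(2)] k' l' fD(3) by (simp del: free_mod_simps)
      qed
      show "(\<lambda>k\<in>free_ker R M. f (\<rho> k)) (r \<odot>\<^bsub>syz1 R M\<^esub> k) = r \<odot>\<^bsub>V\<^esub> (\<lambda>k\<in>free_ker R M. f (\<rho> k)) k" if r: "r \<in> carrier R" for r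
      proof -
        have "r \<odot>\<^bsub>?G\<^esub> k \<in> free_ker R M" using F0.submoduleE(4)[OF free_ker_submodule] k' r by simp
        then show ?thesis unfolding syz using \<rho>D(4)[OF r k'(2)] k' r fD(4) by (simp del: free_mod_simps)
      qed
    qed (simp add: syz)
    from bspec[OF H this] obtain g where g: "g \<in> mod_hom R ?G V" "\<forall>k\<in>free_ker R M. (\<lambda>k\<in>free_ker R M. f (\<rho> k)) k = g k"
      by (elim bexE)
    note gD = mod_homD[OF g(1)]
    \<comment> \<open>A homomorphism extended to F0 restricts along s to R, where it is determined
      by its value at 1.\<close>
    have "f j = j \<odot>\<^bsub>V\<^esub> g (s \<one>)" if j: "j \<in> J" for j
    proof -
      have jR: "j \<in> carrier R" using j JR by blast
      have sj: "s j \<in> free_ker R M" using s[OF jR] j by (simp add: ker)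
      have "f j = g (s j)" using g(2)[rule_format, OF sj] sj s(2)[OF jR] by simp
      also have "s j = j \<odot>\<^bsub>?G\<^esub> s \<one>" using s_smult[OF jR R.one_closed] jR by simp
      finally show ?thesis using gD(4)[OF jR s(1)[OF R.one_closed]] by simp
    qed
    then show "\<exists>x\<in>carrier V. \<forall>j\<in>J. f j = j \<odot>\<^bsub>V\<^esub> x" using gD(1)[OF s(1)[OF R.one_closed]] by blast
  next
    fix c assume H: "\<forall>f\<in>mod_hom R ((ring_mod R)\<lparr>carrier := J\<rparr>) V. \<exists>x\<in>carrier V. \<forall>j\<in>J. f j = j \<odot>\<^bsub>V\<^esub> x"
      and c: "c \<in> mod_hom R (syz1 R M) V"
    have cc: "c k \<in> carrier V" if "k \<in> free_ker R M" for k using mod_homD(1)[OF c] that syz by simp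
    have cadd: "c (k \<oplus>\<^bsub>?G\<^esub> l) = c k \<oplus>\<^bsub>V\<^esub> c l" if "k \<in> free_ker R M" "l \<in> free_ker R M" for k l
      using mod_homD(3)[OF c, of k l] that unfolding syz by blast
    have csmult: "c (r \<odot>\<^bsub>?G\<^esub> k) = r \<odot>\<^bsub>V\<^esub> c k" if "r \<in> carrier R" "k \<in> free_ker R M" for r k
      using mod_homD(4)[OF c, of r k] that unfolding syz by blast
    have sJ: "s j \<in> free_ker R M" if "j \<in> J" for j using that JR s[of j] by (auto simp: ker)
    have "(\<lambda>j\<in>J. c (s j)) \<in> mod_hom R ((ring_mod R)\<lparr>carrier := J\<rparr>) V"
    proof (rule mod_homI)
      have Jid: "ideal J R" unfolding J
        using colon_ideal[OF _ e, of "{\<zero>\<^bsub>M\<^esub>}"] submoduleI[of "{\<zero>\<^bsub>M\<^esub>}"] by simp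
      interpret J: ideal J R by (rule Jid)
      fix i assume "i \<in> carrier ((ring_mod R)\<lparr>carrier := J\<rparr>)"
      then have i: "i \<in> J" "i \<in> carrier R" using JR by auto
      then show "(\<lambda>j\<in>J. c (s j)) i \<in> carrier V" using cc sJ by simp
      show "(\<lambda>j\<in>J. c (s j)) (i \<oplus>\<^bsub>(ring_mod R)\<lparr>carrier := J\<rparr>\<^esub> j) = (\<lambda>j\<in>J. c (s j)) i \<oplus>\<^bsub>V\<^esub> (\<lambda>j\<in>J. c (s j)) j"
        if "j \<in> carrier ((ring_mod R)\<lparr>carrier := J\<rparr>)" for j
      proof -
        have j: "j \<in> J" "j \<in> carrier R" using that JR by auto
        show ?thesis using i j J.a_closed[OF i(1) j(1)] s_add[OF i(2) j(2)] cadd[OF sJ[OF i(1)] sJ[OF j(1)]]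
          by (simp del: free_mod_simps)
      qed
      show "(\<lambda>j\<in>J. c (s j)) (r \<odot>\<^bsub>(ring_mod R)\<lparr>carrier := J\<rparr>\<^esub> i) = r \<odot>\<^bsub>V\<^esub> (\<lambda>j\<in>J. c (s j)) i" if r: "r \<in> carrier R" for r
        using i r J.I_l_closed[OF i(1) r] s_smult[OF r i(2)] csmult[OF r sJ[OF i(1)]] by (simp del: free_mod_simps)
    qed simp
    from bspec[OF H this] obtain x where x: "x \<in> carrier V" "\<forall>j\<in>J. (\<lambda>j\<in>J. c (s j)) j = j \<odot>\<^bsub>V\<^esub> x" by (elim bexE)
    have cs: "c (s j) = j \<odot>\<^bsub>V\<^esub> x" if "j \<in> J" for j using x(2) that by simp
    \<comment> \<open>The projection of F0 onto the kernel of \<rho> along the image of s.\<close>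
    define t where "t y = y \<oplus>\<^bsub>?G\<^esub> s (\<ominus> \<rho> y)" for y
    have s_neg: "s (\<ominus> r) = \<ominus>\<^bsub>?G\<^esub> s r" if "r \<in> carrier R" for r
    proof -
      have "s (\<ominus> r) \<oplus>\<^bsub>?G\<^esub> s r = \<zero>\<^bsub>?G\<^esub>"
        using s_add[of "\<ominus> r" r] that by (simp add: R.l_neg s_def free_single_def)
      then show ?thesis using s(1)[OF that] s(1)[of "\<ominus> r"] that F0.M.minus_equality by simp
    qed
    have t: "t y \<in> free_ker R M" if y: "y \<in> carrier ?G" for y
    proof -
      have "\<rho> (t y) = \<zero>" unfolding t_def
        using \<rho>D(3)[OF y s(1)[of "\<ominus> \<rho> y"]] s(2)[of "\<ominus> \<rho> y"] \<rho>R[OF y] by (simp add: R.r_neg del: free_mod_simps)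
      moreover have "t y \<in> carrier ?G" unfolding t_def using y s(1)[of "\<ominus> \<rho> y"] \<rho>R[OF y] by (intro F0.M.a_closed) auto
      moreover have "\<zero> \<in> J" unfolding J using e by simp
      ultimately show ?thesis by (simp add: ker)
    qed
    have t_add: "t (y \<oplus>\<^bsub>?G\<^esub> z) = t y \<oplus>\<^bsub>?G\<^esub> t z" if y: "y \<in> carrier ?G" and z: "z \<in> carrier ?G" for y z
    proof -
      have "\<rho> (y \<oplus>\<^bsub>?G\<^esub> z) = \<rho> y \<oplus> \<rho> z" using \<rho>D(3)[OF y z] by simp
      then have "s (\<ominus> \<rho> (y \<oplus>\<^bsub>?G\<^esub> z)) = s (\<ominus> \<rho> y) \<oplus>\<^bsub>?G\<^esub> s (\<ominus> \<rho> z)"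
        using s_add[of "\<ominus> \<rho> y" "\<ominus> \<rho> z"] \<rho>R[OF y] \<rho>R[OF z] by (simp add: R.minus_add del: free_mod_simps)
      then show ?thesis unfolding t_def
        using y z s(1)[of "\<ominus> \<rho> y"] s(1)[of "\<ominus> \<rho> z"] \<rho>R[OF y] \<rho>R[OF z] by (simp add: F0.M.a_ac del: free_mod_simps)
    qed
    have t_smult: "t (r \<odot>\<^bsub>?G\<^esub> y) = r \<odot>\<^bsub>?G\<^esub> t y" if r: "r \<in> carrier R" and y: "y \<in> carrier ?G" for r y
    proof -
      have "\<rho> (r \<odot>\<^bsub>?G\<^esub> y) = r \<otimes> \<rho> y" using \<rho>D(4)[OF r y] by simp
      then have "s (\<ominus> \<rho> (r \<odot>\<^bsub>?G\<^esub> y)) = r \<odot>\<^bsub>?G\<^esub> s (\<ominus> \<rho> y)"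
        using s_smult[of r "\<ominus> \<rho> y"] \<rho>R[OF y] r by (simp add: R.r_minus del: free_mod_simps)
      then show ?thesis unfolding t_def
        using y r s(1)[of "\<ominus> \<rho> y"] \<rho>R[OF y] by (simp add: F0.smult_r_distr del: free_mod_simps)
    qed
    \<comment> \<open>The extension is glued from the splitting y = t y + s (\<rho> y): c on the
      first part, multiplication of x on the second.\<close>
    define g where "g = (\<lambda>y\<in>carrier ?G. c (t y) \<oplus>\<^bsub>V\<^esub> \<rho> y \<odot>\<^bsub>V\<^esub> x)"
    have "g \<in> mod_hom R ?G V"
    proof (rule mod_homI)
      fix y assume y: "y \<in> carrier ?G"
      show "g y \<in> carrier V" unfolding g_def using y cc[OF t[OF y]] \<rho>R[OF y] x(1) by simp
      show "g (y \<oplus>\<^bsub>?G\<^esub> z) = g y \<oplus>\<^bsub>V\<^esub> g z" if z: "z \<in> carrier ?G" for z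
        using F0.M.a_closed[OF y z] y z t_add[OF y z] cadd[OF t[OF y] t[OF z]] \<rho>D(3)[OF y z] \<rho>R[OF y] \<rho>R[OF z] x(1)
          cc[OF t[OF y]] cc[OF t[OF z]]
        by (simp add: g_def V.smult_l_distr V.M.a_ac del: free_mod_simps)
      show "g (r \<odot>\<^bsub>?G\<^esub> y) = r \<odot>\<^bsub>V\<^esub> g y" if r: "r \<in> carrier R" for r
        using F0.smult_closed[OF r y] y r t_smult[OF r y] csmult[OF r t[OF y]] \<rho>D(4)[OF r y] \<rho>R[OF y] x(1) cc[OF t[OF y]]
        by (simp add: g_def V.smult_r_distr V.smult_assoc1 del: free_mod_simps)
    qed (simp add: g_def)
    moreover have "c k = g k" if k: "k \<in> free_ker R M" for k
    proof -
      have k': "k \<in> carrier ?G" "\<rho> k \<in> J" using k by (simp_all add: ker)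
      have "k = t k \<oplus>\<^bsub>?G\<^esub> s (\<rho> k)" unfolding t_def s_neg[OF \<rho>R[OF k'(1)]]
        using k'(1) s(1)[OF \<rho>R[OF k'(1)]] F0.M.minus_add_cancel(1)[of k "s (\<rho> k)"]
        by (simp add: a_minus_def del: free_mod_simps)
      then have "c k = c (t k) \<oplus>\<^bsub>V\<^esub> c (s (\<rho> k))" using cadd[OF t[OF k'(1)] sJ[OF k'(2)]] by simp
      then show ?thesis using cs[OF k'(2)] k'(1) by (simp add: g_def)
    qed
    ultimately show "\<exists>g\<in>mod_hom R ?G V. \<forall>k\<in>free_ker R M. c k = g k" by blast
  qed
qed

end

text \<open>R/J is generated by the coset of 1, whose annihilator is J.\<close>

lemma (in cring) Ext1_quot_trivial_iff:
  assumes V: "module R V" and J: "ideal J R"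
  shows "(let E = Ext1 R (quot_mod R (ring_mod R) J) V in carrier E = {\<zero>\<^bsub>E\<^esub>}) \<longleftrightarrow>
    (\<forall>f\<in>mod_hom R ((ring_mod R)\<lparr>carrier := J\<rparr>) V. \<exists>x\<in>carrier V. \<forall>j\<in>J. f j = j \<odot>\<^bsub>V\<^esub> x)"
proof -
  interpret RM: module R "ring_mod R" by (rule ring_mod_module)
  have Js: "submodule J R (ring_mod R)" using J ideal_iff_submodule by simp
  note q = RM.quot_mod_coset[OF Js]
  let ?e = "J +>\<^bsub>ring_mod R\<^esub> \<one>"
  have smult: "r \<odot>\<^bsub>quot_mod R (ring_mod R) J\<^esub> ?e = J +>\<^bsub>ring_mod R\<^esub> r" if "r \<in> carrier R" for r
    using q(3)[of r \<one>] that by simp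
  have "module R (quot_mod R (ring_mod R) J)" by (rule RM.quot_mod_module[OF Js])
  then interpret Q: module R "quot_mod R (ring_mod R) J" .
  have minus_zero: "r \<ominus>\<^bsub>ring_mod R\<^esub> \<zero>\<^bsub>ring_mod R\<^esub> = r" if "r \<in> carrier R" for r
    using that by (simp add: a_minus_def)
  have eq: "J = {r \<in> carrier R. r \<odot>\<^bsub>quot_mod R (ring_mod R) J\<^esub> ?e = \<zero>\<^bsub>quot_mod R (ring_mod R) J\<^esub>}"
  proof -
    have "r \<odot>\<^bsub>quot_mod R (ring_mod R) J\<^esub> ?e = \<zero>\<^bsub>quot_mod R (ring_mod R) J\<^esub> \<longleftrightarrow> r \<in> J" if "r \<in> carrier R" for r
      unfolding smult[OF that] q(4) using q(5)[of r "\<zero>\<^bsub>ring_mod R\<^esub>"] that minus_zero[OF that] by simp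
    then show ?thesis using ideal.Icarr[OF J] by blast
  qed
  have e: "?e \<in> carrier (quot_mod R (ring_mod R) J)" unfolding q(1) by simp
  have gen: "\<exists>r\<in>carrier R. r \<odot>\<^bsub>quot_mod R (ring_mod R) J\<^esub> ?e = x"
    if "x \<in> carrier (quot_mod R (ring_mod R) J)" for x
    using that smult unfolding q(1) by auto
  show ?thesis unfolding Let_def
    by (rule Q.Ext1_cyclic_trivial_iff[OF V e gen eq])
qed

section \<open>w-modules by extension of homomorphisms\<close>

lemma (in cring) w_module_iff: "w_module R M \<longleftrightarrow> w_mod R M"
proof (cases "module R M")
  case True
  then interpret module R M .
  have tf: "GV_torsion_free R M \<longleftrightarrow>
      (\<forall>x J. x \<in> carrier M \<longrightarrow> GV_ideal R J \<longrightarrow> (\<forall>j\<in>J. j \<odot>\<^bsub>M\<^esub> x = \<zero>\<^bsub>M\<^esub>) \<longrightarrow> x = \<zero>\<^bsub>M\<^esub>)"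
  proof -
    have "\<zero>\<^bsub>M\<^esub> \<in> tor_GV R M"
      using GV_ideal_carrier by (auto simp: tor_GV_def)
    then show ?thesis unfolding GV_torsion_free_def by (auto simp: tor_GV_def)
  qed
  have ext: "(let E = Ext1 R (quot_mod R (ring_mod R) J) M in carrier E = {\<zero>\<^bsub>E\<^esub>}) \<longleftrightarrow>
      (\<forall>f\<in>mod_hom R ((ring_mod R)\<lparr>carrier := J\<rparr>) M. \<exists>x\<in>carrier M. \<forall>j\<in>J. f j = j \<odot>\<^bsub>M\<^esub> x)"
    if "GV_ideal R J" for J
    by (rule Ext1_quot_trivial_iff[OF True GV_idealD(1)[OF that]])
  show ?thesis
  proof
    assume w: "w_module R M"
    show "w_mod R M"
    proof
      show "x = \<zero>\<^bsub>M\<^esub>" if "x \<in> carrier M" "GV_ideal R J" "\<And>j. j \<in> J \<Longrightarrow> j \<odot>\<^bsub>M\<^esub> x = \<zero>\<^bsub>M\<^esub>" for x J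
        using w that unfolding w_module_def tf by blast
      show "\<exists>x\<in>carrier M. \<forall>j\<in>J. f j = j \<odot>\<^bsub>M\<^esub> x"
        if J: "GV_ideal R J" and f: "f \<in> mod_hom R ((ring_mod R)\<lparr>carrier := J\<rparr>) M" for J f
        using w J f ext[OF J] unfolding w_module_def by blast
    qed
  next
    assume "w_mod R M"
    then interpret w_mod R M .
    show "w_module R M" unfolding w_module_def tf
    proof (intro conjI allI impI True)
      show "x = \<zero>\<^bsub>M\<^esub>" if "x \<in> carrier M" "GV_ideal R J" "\<forall>j\<in>J. j \<odot>\<^bsub>M\<^esub> x = \<zero>\<^bsub>M\<^esub>" for x J
        by (rule torsion_free[OF that(1,2)]) (use that(3) in simp)
      show "let E = Ext1 R (quot_mod R (ring_mod R) J) M in carrier E = {\<zero>\<^bsub>E\<^esub>}" if J: "GV_ideal R J" for J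
        unfolding ext[OF J] using hom_extends[OF J] by simp
    qed
  qed
next
  case False
  then show ?thesis by (auto simp: w_module_def w_mod_def)
qed

text \<open>If J x \<subseteq> N, multiplication of x is a homomorphism from J to N, hence given by
  some y in N, and torsion-freeness yields x = y. Conversely an extension exists in M, and
  closedness puts its element into N.\<close>

lemma (in w_mod) w_mod_submodule_iff:
  assumes N: "submodule N R M"
  shows "w_mod R (M\<lparr>carrier := N\<rparr>) \<longleftrightarrow> gv_closed R M N"
proof
  have c: "x \<in> carrier M" if "x \<in> N" for x using submodule_carrierD[OF N that] .
  assume "w_mod R (M\<lparr>carrier := N\<rparr>)"
  then interpret N: w_mod R "M\<lparr>carrier := N\<rparr>" .
  show "gv_closed R M N"
  proof (rule gv_closedI[OF N])
    fix x J assume x: "x \<in> carrier M" and J: "GV_ideal R J" and Jx: "\<And>j. j \<in> J \<Longrightarrow> j \<odot>\<^bsub>M\<^esub> x \<in> N"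
    note JR = GV_ideal_subset(2)[OF J]
    interpret J: ideal J R by (rule GV_idealD(1)[OF J])
    have "(\<lambda>j\<in>J. j \<odot>\<^bsub>M\<^esub> x) \<in> mod_hom R ((ring_mod R)\<lparr>carrier := J\<rparr>) (M\<lparr>carrier := N\<rparr>)"
      by (rule mod_homI) (use Jx x JR in \<open>auto simp: smult_l_distr smult_assoc1 J.I_l_closed\<close>)
    from N.hom_extends[OF J this] obtain y where y: "y \<in> N" "\<forall>j\<in>J. j \<odot>\<^bsub>M\<^esub> x = j \<odot>\<^bsub>M\<^esub> y" by auto
    have "x \<ominus>\<^bsub>M\<^esub> y = \<zero>\<^bsub>M\<^esub>"
      by (rule torsion_free[OF _ J]) (use x y c JR in \<open>simp_all add: smult_minus_distr M.a_minus_self\<close>)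
    then show "x \<in> N" using y(1) x c[OF y(1)] by (simp add: M.a_minus_eq_zero_iff)
  qed
next
  assume cl: "gv_closed R M N"
  interpret N: module R "M\<lparr>carrier := N\<rparr>" by (rule submodule.submodule_is_module[OF N module_axioms])
  have c: "x \<in> carrier M" if "x \<in> N" for x using submodule_carrierD[OF N that] .
  show "w_mod R (M\<lparr>carrier := N\<rparr>)"
  proof
    show "x = \<zero>\<^bsub>M\<lparr>carrier := N\<rparr>\<^esub>" if "x \<in> carrier (M\<lparr>carrier := N\<rparr>)" "GV_ideal R J"
      "\<And>j. j \<in> J \<Longrightarrow> j \<odot>\<^bsub>M\<lparr>carrier := N\<rparr>\<^esub> x = \<zero>\<^bsub>M\<lparr>carrier := N\<rparr>\<^esub>" for x J
      using torsion_free[of x J] that c[of x] by simp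
    fix J f assume J: "GV_ideal R J" and f: "f \<in> mod_hom R ((ring_mod R)\<lparr>carrier := J\<rparr>) (M\<lparr>carrier := N\<rparr>)"
    note fD = mod_homD[OF f, simplified]
    have "f \<in> mod_hom R ((ring_mod R)\<lparr>carrier := J\<rparr>) M"
      by (rule mod_homI) (use fD c in simp_all)
    from hom_extends[OF J this] obtain x where x: "x \<in> carrier M" "\<forall>j\<in>J. f j = j \<odot>\<^bsub>M\<^esub> x" by (elim bexE)
    have "x \<in> N" by (rule gv_closedD(3)[OF cl x(1) J]) (use x(2) fD(1) in auto)
    then show "\<exists>x\<in>carrier (M\<lparr>carrier := N\<rparr>). \<forall>j\<in>J. f j = j \<odot>\<^bsub>M\<lparr>carrier := N\<rparr>\<^esub> x" using x(2) by auto
  qed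
qed

lemma (in w_mod) w_submodule_iff: "w_submodule R M N \<longleftrightarrow> gv_closed R M N"
  using w_mod_submodule_iff[of N] gv_closedD(1)[of N] w_module_iff unfolding w_submodule_def by blast

text \<open>Injectivity and surjectivity in the definition of a GV-ideal are precisely
  torsion-freeness and extension for the module R.\<close>

lemma (in cring) w_mod_ring_mod: "w_mod R (ring_mod R)"
proof -
  interpret RM: module R "ring_mod R" by (rule ring_mod_module)
  show ?thesis
  proof
    fix x J assume x: "x \<in> carrier (ring_mod R)" and J: "GV_ideal R J"
      and Jx: "\<And>j. j \<in> J \<Longrightarrow> j \<odot>\<^bsub>ring_mod R\<^esub> x = \<zero>\<^bsub>ring_mod R\<^esub>"
    have "x \<otimes> j = \<zero>" if "j \<in> J" for j
      using Jx[OF that] x GV_ideal_subset(2)[OF J that] by (simp add: m_comm)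
    then show "x = \<zero>\<^bsub>ring_mod R\<^esub>" using GV_idealD(3)[OF J] x by simp
  next
    fix J f assume J: "GV_ideal R J" and f: "f \<in> mod_hom R ((ring_mod R)\<lparr>carrier := J\<rparr>) (ring_mod R)"
    obtain r where r: "r \<in> carrier R" "\<forall>x\<in>J. f x = r \<otimes> x" using GV_idealD(4)[OF J f] by (elim bexE)
    have "f j = j \<otimes> r" if "j \<in> J" for j using r that GV_ideal_subset(2)[OF J that] by (simp add: m_comm)
    then show "\<exists>x\<in>carrier (ring_mod R). \<forall>j\<in>J. f j = j \<odot>\<^bsub>ring_mod R\<^esub> x" using r(1) by (intro bexI[of _ r]) simp_all
  qed
qed

lemma (in cring) w_idealI:
  assumes I: "ideal I R" and cl: "\<And>r J. r \<in> carrier R \<Longrightarrow> GV_ideal R J \<Longrightarrow> (\<And>j. j \<in> J \<Longrightarrow> j \<otimes> r \<in> I) \<Longrightarrow> r \<in> I"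
  shows "w_ideal R I"
proof -
  interpret RM: w_mod R "ring_mod R" by (rule w_mod_ring_mod)
  have "gv_closed R (ring_mod R) I"
    by (rule RM.gv_closedI) (use I ideal_iff_submodule cl in auto)
  then show ?thesis using I RM.w_mod_submodule_iff RM.gv_closedD(1) w_module_iff unfolding w_ideal_def by blast
qed

section \<open>The defined notions in terms of closed submodules\<close>

context w_mod
begin

lemma w_cofinitely_generated_iff: "w_cofinitely_generated R M \<longleftrightarrow> gv_cofg R M {\<zero>\<^bsub>M\<^esub>} (carrier M)"
proof -
  have "(\<forall>V\<in>\<F>. gv_closed R M V) \<longleftrightarrow> (\<forall>V\<in>\<F>. gv_closed R M V \<and> {\<zero>\<^bsub>M\<^esub>} \<subseteq> V)" for \<F>
    using zero_in_gv_closed by auto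
  then show ?thesis
    unfolding w_cofinitely_generated_def gv_cofg_def w_submodule_iff w_module_iff using w_mod_axioms by simp
qed

lemma w_Artinian_iff: "w_Artinian R M \<longleftrightarrow> gv_dcc (carrier M)"
proof -
  have "gv_closed R M V \<and> V \<subseteq> carrier M \<longleftrightarrow> gv_closed R M V" for V using gv_closedD(2)[of V] by auto
  then show ?thesis
    unfolding w_Artinian_def gv_dcc_def w_submodule_iff w_module_iff using w_mod_axioms
    by (simp add: all_conj_distrib conj_assoc[symmetric])
qed

text \<open>Needed for the w-envelope, which is a closed submodule W of an injective envelope.
  Closed submodules of W are the closed submodules of the ambient module inside W, and a family
  outside is first intersected with W.\<close>

lemma w_cofinitely_generated_submodule_iff:
  assumes W: "gv_closed R M W"
  shows "w_cofinitely_generated R (M\<lparr>carrier := W\<rparr>) \<longleftrightarrow> gv_cofg R M {\<zero>\<^bsub>M\<^esub>} W"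
proof -
  have Ws: "submodule W R M" by (rule gv_closedD(1)[OF W])
  interpret W: w_mod R "M\<lparr>carrier := W\<rparr>" using W w_mod_submodule_iff[OF Ws] by simp
  have cl: "gv_closed R (M\<lparr>carrier := W\<rparr>) V \<longleftrightarrow> gv_closed R M V \<and> V \<subseteq> W" for V
  proof
    assume V: "gv_closed R (M\<lparr>carrier := W\<rparr>) V"
    have VW: "V \<subseteq> W" using W.gv_closedD(2)[OF V] by auto
    have sub: "submodule V R M"
    proof (rule module_incl_imp_submodule)
      show "V \<subseteq> carrier M" using VW submoduleE(1)[OF Ws] by auto
      have "module R ((M\<lparr>carrier := W\<rparr>)\<lparr>carrier := V\<rparr>)"
        by (rule submodule.submodule_is_module[OF W.gv_closedD(1)[OF V] W.module_axioms])
      then show "module R (M\<lparr>carrier := V\<rparr>)" by simp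
    qed
    have "w_mod R ((M\<lparr>carrier := W\<rparr>)\<lparr>carrier := V\<rparr>)"
      using W.w_mod_submodule_iff[OF W.gv_closedD(1)[OF V]] V by simp
    then show "gv_closed R M V \<and> V \<subseteq> W" using w_mod_submodule_iff[OF sub] VW by simp
  next
    assume V: "gv_closed R M V \<and> V \<subseteq> W"
    then have Vs: "submodule V R M" using gv_closedD(1) by blast
    have sub: "submodule V R (M\<lparr>carrier := W\<rparr>)"
    proof (rule W.module_incl_imp_submodule)
      show "V \<subseteq> carrier (M\<lparr>carrier := W\<rparr>)" using V by simp
      show "module R ((M\<lparr>carrier := W\<rparr>)\<lparr>carrier := V\<rparr>)"
        using submodule.submodule_is_module[OF Vs module_axioms] by simp
    qed
    have "w_mod R ((M\<lparr>carrier := W\<rparr>)\<lparr>carrier := V\<rparr>)"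
      using w_mod_submodule_iff[OF Vs] V by simp
    then show "gv_closed R (M\<lparr>carrier := W\<rparr>) V" using W.w_mod_submodule_iff[OF sub] by simp
  qed
  have zW: "\<zero>\<^bsub>M\<^esub> \<in> W" by (rule zero_in_gv_closed[OF W])
  have "gv_cofg R (M\<lparr>carrier := W\<rparr>) {\<zero>\<^bsub>M\<^esub>} W \<longleftrightarrow> gv_cofg R M {\<zero>\<^bsub>M\<^esub>} W"
  proof
    assume cof: "gv_cofg R (M\<lparr>carrier := W\<rparr>) {\<zero>\<^bsub>M\<^esub>} W"
    show "gv_cofg R M {\<zero>\<^bsub>M\<^esub>} W"
    proof (rule gv_cofgI)
      fix \<F> assume F: "\<And>V. V \<in> \<F> \<Longrightarrow> gv_closed R M V" "\<And>V. V \<in> \<F> \<Longrightarrow> {\<zero>\<^bsub>M\<^esub>} \<subseteq> V" "W \<inter> \<Inter>\<F> = {\<zero>\<^bsub>M\<^esub>}"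
      have 1: "gv_closed R (M\<lparr>carrier := W\<rparr>) V" if "V \<in> (\<lambda>V. W \<inter> V) ` \<F>" for V
        using that F(1) gv_closed_inter[OF W] cl by auto
      have 2: "{\<zero>\<^bsub>M\<^esub>} \<subseteq> V" if "V \<in> (\<lambda>V. W \<inter> V) ` \<F>" for V using that F(2) zW by auto
      have 3: "W \<inter> \<Inter>((\<lambda>V. W \<inter> V) ` \<F>) = {\<zero>\<^bsub>M\<^esub>}" using F(3) by auto
      obtain T' where T': "finite T'" "T' \<subseteq> (\<lambda>V. W \<inter> V) ` \<F>" "W \<inter> \<Inter>T' = {\<zero>\<^bsub>M\<^esub>}"
        by (rule W.gv_cofgD[OF cof 1 2 3])
      obtain T where T: "T \<subseteq> \<F>" "finite T" "T' = (\<lambda>V. W \<inter> V) ` T" using finite_subset_image[OF T'(1,2)] by blast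
      have "W \<inter> \<Inter>T = W \<inter> \<Inter>((\<lambda>V. W \<inter> V) ` T)" by blast
      then have "W \<inter> \<Inter>T = {\<zero>\<^bsub>M\<^esub>}" using T'(3) unfolding T(3) by simp
      then show "\<exists>T. finite T \<and> T \<subseteq> \<F> \<and> W \<inter> \<Inter>T = {\<zero>\<^bsub>M\<^esub>}" using T by blast
    qed
  next
    assume cof: "gv_cofg R M {\<zero>\<^bsub>M\<^esub>} W"
    show "gv_cofg R (M\<lparr>carrier := W\<rparr>) {\<zero>\<^bsub>M\<^esub>} W"
    proof (rule W.gv_cofgI)
      fix \<F> assume F: "\<And>V. V \<in> \<F> \<Longrightarrow> gv_closed R (M\<lparr>carrier := W\<rparr>) V" "\<And>V. V \<in> \<F> \<Longrightarrow> {\<zero>\<^bsub>M\<^esub>} \<subseteq> V" "W \<inter> \<Inter>\<F> = {\<zero>\<^bsub>M\<^esub>}"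
      have 1: "gv_closed R M V" if "V \<in> \<F>" for V using F(1)[OF that] cl by blast
      obtain T where "finite T" "T \<subseteq> \<F>" "W \<inter> \<Inter>T = {\<zero>\<^bsub>M\<^esub>}" by (rule gv_cofgD[OF cof 1 F(2,3)])
      then show "\<exists>T. finite T \<and> T \<subseteq> \<F> \<and> W \<inter> \<Inter>T = {\<zero>\<^bsub>M\<^esub>}" by blast
    qed
  qed
  then show ?thesis using W.w_cofinitely_generated_iff by simp
qed

end

section \<open>The w-envelope of a quotient\<close>

text \<open>The direction of Baer's criterion that is immediate, once R is present among the test
  modules.\<close>

lemma (in cring) injective_module_extends:
  fixes E :: "('a, 'e, 'm) module_scheme"
  assumes E: "injective_module R E" and J: "ideal J R"
    and f: "f \<in> mod_hom R ((ring_mod R)\<lparr>carrier := J\<rparr>) E"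
  shows "\<exists>x\<in>carrier E. \<forall>j\<in>J. f j = j \<odot>\<^bsub>E\<^esub> x"
proof -
  interpret J: ideal J R by (rule J)
  \<comment> \<open>A copy of R over the sum type to which the test modules in
    \<open>injective_module\<close> are confined.\<close>
  define B :: "('a, 'a + 'e) module" where "B =
    \<lparr>carrier = Inl ` carrier R, monoid.mult = undefined, monoid.one = undefined,
     ring.zero = Inl \<zero>, ring.add = (\<lambda>x y. Inl (projl x \<oplus> projl y)), smult = (\<lambda>r x. Inl (r \<otimes> projl x))\<rparr>"
  have B [simp]: "carrier B = Inl ` carrier R" "Inl r \<oplus>\<^bsub>B\<^esub> Inl s = Inl (r \<oplus> s)" "t \<odot>\<^bsub>B\<^esub> Inl r = Inl (t \<otimes> r)"
    "\<zero>\<^bsub>B\<^esub> = Inl \<zero>" for r s t by (simp_all add: B_def)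
  have Bm: "module R B"
  proof (rule moduleI)
    show "abelian_group B"
    proof (rule abelian_groupI)
      show "\<exists>y\<in>carrier B. y \<oplus>\<^bsub>B\<^esub> x = \<zero>\<^bsub>B\<^esub>" if x: "x \<in> carrier B" for x
      proof -
        obtain r where "r \<in> carrier R" "x = Inl r" using x by auto
        then show ?thesis by (intro bexI[of _ "Inl (\<ominus> r)"]) (simp_all add: l_neg)
      qed
    qed (auto simp: a_ac)
  qed (auto simp: is_cring l_distr r_distr m_assoc)
  interpret B: module R B by (rule Bm)
  let ?A = "Inl ` J :: ('a + 'e) set"
  have m1: "\<ominus>\<^bsub>B\<^esub> Inl r = Inl (\<ominus> r)" if "r \<in> carrier R" for r
    by (rule B.M.minus_equality) (use that in \<open>simp_all add: l_neg\<close>)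
  have A: "submodule ?A R B"
    by (rule B.submoduleI) (auto simp: J.I_l_closed m1)
  note fD = mod_homD[OF f, simplified]
  have "(\<lambda>z\<in>?A. f (projl z)) \<in> mod_hom R (B\<lparr>carrier := ?A\<rparr>) E"
    by (rule mod_homI) (auto simp: J.I_l_closed fD(1,3,4))
  with E Bm A have "\<exists>g\<in>mod_hom R B E. \<forall>x\<in>?A. g x = (\<lambda>z\<in>?A. f (projl z)) x"
    unfolding injective_module_def by meson
  then obtain g where g: "g \<in> mod_hom R B E" "\<forall>x\<in>?A. g x = (\<lambda>z\<in>?A. f (projl z)) x" by (elim bexE)
  have "f j = j \<odot>\<^bsub>E\<^esub> g (Inl \<one>)" if j: "j \<in> J" for j
  proof -
    have "f j = g (Inl j)" using g(2) j by simp
    also have "Inl j = j \<odot>\<^bsub>B\<^esub> Inl \<one>" using j by simp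
    also have "g (j \<odot>\<^bsub>B\<^esub> Inl \<one>) = j \<odot>\<^bsub>E\<^esub> g (Inl \<one>)" using j by (intro mod_homD(4)[OF g(1)]) simp_all
    finally show ?thesis .
  qed
  moreover have "g (Inl \<one>) \<in> carrier E" by (rule mod_homD(1)[OF g(1)]) simp
  ultimately show ?thesis by blast
qed

lemma (in module) submodule_mod_hom_image:
  assumes f: "f \<in> mod_hom R M E" and E: "module R E" and V: "submodule V R M"
  shows "submodule (f ` V) R E"
proof -
  interpret E: module R E by fact
  note fD = mod_homD[OF f] and VE = submoduleE[OF V]
  have c: "x \<in> carrier M" if "x \<in> V" for x using VE(1) that by blast
  show ?thesis
  proof (rule E.submoduleI)
    show "f ` V \<subseteq> carrier E" using fD(1) c by blast
    show "\<zero>\<^bsub>E\<^esub> \<in> f ` V" using mod_hom_zero[OF f module_axioms E] submodule_zero[OF V] by force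
    fix a assume "a \<in> f ` V"
    then obtain x where x: "x \<in> V" "a = f x" by blast
    have "\<ominus>\<^bsub>E\<^esub> a = f (\<ominus>\<^bsub>M\<^esub> x)" using mod_hom_minus[OF f module_axioms E c[OF x(1)]] x by simp
    then show "\<ominus>\<^bsub>E\<^esub> a \<in> f ` V" using VE(3)[OF x(1)] by blast
    show "a \<oplus>\<^bsub>E\<^esub> b \<in> f ` V" if b: "b \<in> f ` V" for b
    proof -
      obtain y where y: "y \<in> V" "b = f y" using b by blast
      have "a \<oplus>\<^bsub>E\<^esub> b = f (x \<oplus>\<^bsub>M\<^esub> y)" using fD(3) c x y by simp
      then show ?thesis using VE(5)[OF x(1) y(1)] by blast
    qed
    show "r \<odot>\<^bsub>E\<^esub> a \<in> f ` V" if r: "r \<in> carrier R" for r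
    proof -
      have "r \<odot>\<^bsub>E\<^esub> a = f (r \<odot>\<^bsub>M\<^esub> x)" using fD(4) c x r by simp
      then show ?thesis using VE(4)[OF r x(1)] by blast
    qed
  qed
qed

text \<open>The GV-torsion of E meets the torsion-free module M trivially, so it is zero because M
  is essential in E; homomorphisms extend by injectivity.\<close>

lemma (in module) w_mod_injective_envelope:
  assumes tf: "\<And>x J. x \<in> carrier M \<Longrightarrow> GV_ideal R J \<Longrightarrow> (\<And>j. j \<in> J \<Longrightarrow> j \<odot>\<^bsub>M\<^esub> x = \<zero>\<^bsub>M\<^esub>) \<Longrightarrow> x = \<zero>\<^bsub>M\<^esub>"
    and env: "injective_envelope R M E i"
  shows "w_mod R E"
proof -
  have E: "injective_module R E" and i: "i \<in> mod_hom R M E" and inj: "inj_on i (carrier M)"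
    and ess: "\<And>K. submodule K R E \<Longrightarrow> K \<inter> i ` carrier M = {\<zero>\<^bsub>E\<^esub>} \<Longrightarrow> K = {\<zero>\<^bsub>E\<^esub>}"
    using env unfolding injective_envelope_def by blast+
  interpret E: module R E using E by (simp add: injective_module_def)
  note iD = mod_homD[OF i]
  have i0: "i \<zero>\<^bsub>M\<^esub> = \<zero>\<^bsub>E\<^esub>" by (rule mod_hom_zero[OF i module_axioms E.module_axioms])
  have zero: "submodule {\<zero>\<^bsub>E\<^esub>} R E" by (rule E.submoduleI) auto
  have "w_closure R E {\<zero>\<^bsub>E\<^esub>} \<inter> i ` carrier M = {\<zero>\<^bsub>E\<^esub>}"
  proof (intro equalityI subsetI)
    fix y assume y': "y \<in> w_closure R E {\<zero>\<^bsub>E\<^esub>} \<inter> i ` carrier M"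
    then have y: "y \<in> w_closure R E {\<zero>\<^bsub>E\<^esub>}" by simp
    obtain x where x: "x \<in> carrier M" "y = i x" using y' by blast
    obtain J where J: "GV_ideal R J" "\<And>j. j \<in> J \<Longrightarrow> j \<in> carrier R" "\<And>j. j \<in> J \<Longrightarrow> j \<odot>\<^bsub>E\<^esub> y \<in> {\<zero>\<^bsub>E\<^esub>}"
      using y by (rule E.w_closureE') (rule that)
    have "x = \<zero>\<^bsub>M\<^esub>"
    proof (rule tf[OF x(1) J(1)])
      fix j assume j: "j \<in> J"
      have "i (j \<odot>\<^bsub>M\<^esub> x) = i \<zero>\<^bsub>M\<^esub>" using iD(4)[OF J(2)[OF j] x(1)] J(3)[OF j] x(2) i0 by simp
      then show "j \<odot>\<^bsub>M\<^esub> x = \<zero>\<^bsub>M\<^esub>" using inj_onD[OF inj] J(2)[OF j] x(1) by simp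
    qed
    then show "y \<in> {\<zero>\<^bsub>E\<^esub>}" using x(2) i0 by simp
  next
    fix y assume "y \<in> {\<zero>\<^bsub>E\<^esub>}"
    then show "y \<in> w_closure R E {\<zero>\<^bsub>E\<^esub>} \<inter> i ` carrier M"
      using E.w_closure_incr[OF zero] i0[symmetric] by auto
  qed
  then have T: "w_closure R E {\<zero>\<^bsub>E\<^esub>} = {\<zero>\<^bsub>E\<^esub>}" by (rule ess[OF E.w_closure_submodule[OF zero]])
  show ?thesis
  proof
    fix x J assume "x \<in> carrier E" "GV_ideal R J" "\<And>j. j \<in> J \<Longrightarrow> j \<odot>\<^bsub>E\<^esub> x = \<zero>\<^bsub>E\<^esub>"
    then have "x \<in> w_closure R E {\<zero>\<^bsub>E\<^esub>}" unfolding E.w_closure_iff by blast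
    then show "x = \<zero>\<^bsub>E\<^esub>" unfolding T by simp
  next
    fix J f assume "GV_ideal R J" "f \<in> mod_hom R ((ring_mod R)\<lparr>carrier := J\<rparr>) E"
    then show "\<exists>x\<in>carrier E. \<forall>j\<in>J. f j = j \<odot>\<^bsub>E\<^esub> x"
      using injective_module_extends[OF E GV_idealD(1)] by blast
  qed
qed

text \<open>Closed submodules of M above N and closed submodules of the closure W of the image
  determine each other: V goes to the closure of its image, U to its preimage.\<close>

lemma (in w_mod) gv_cofg_quotient_iff:
  assumes N: "gv_closed R M N" and E: "w_mod R E" and \<phi>: "\<phi> \<in> mod_hom R M E"
    and ker: "\<And>x. x \<in> carrier M \<Longrightarrow> \<phi> x = \<zero>\<^bsub>E\<^esub> \<longleftrightarrow> x \<in> N"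
  shows "gv_cofg R E {\<zero>\<^bsub>E\<^esub>} (w_closure R E (\<phi> ` carrier M)) \<longleftrightarrow> gv_cofg R M N (carrier M)"
proof -
  interpret E: w_mod R E by fact
  note \<phi>D = mod_homD[OF \<phi>]
  let ?W = "w_closure R E (\<phi> ` carrier M)"
  have NM: "N \<subseteq> carrier M" using gv_closedD(2)[OF N] by auto
  have im: "submodule (\<phi> ` V) R E" if "submodule V R M" for V
    by (rule submodule_mod_hom_image[OF \<phi> E.module_axioms that])
  have Is: "submodule (\<phi> ` carrier M) R E" by (rule im[OF carrier_is_submodule])
  have IW: "\<phi> ` carrier M \<subseteq> ?W" by (rule E.w_closure_incr[OF Is])
  \<comment> \<open>Elements of W are only up to a GV-ideal images from M, so their vanishing is
    tested on the multiples that are images.\<close>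
  have zeroW: "x = \<zero>\<^bsub>E\<^esub>" if x: "x \<in> ?W" and H: "\<And>m j. m \<in> carrier M \<Longrightarrow> j \<in> carrier R \<Longrightarrow> \<phi> m = j \<odot>\<^bsub>E\<^esub> x \<Longrightarrow> m \<in> N" for x
  proof -
    obtain J where J: "x \<in> carrier E" "GV_ideal R J" "\<And>j. j \<in> J \<Longrightarrow> j \<in> carrier R" "\<And>j. j \<in> J \<Longrightarrow> j \<odot>\<^bsub>E\<^esub> x \<in> \<phi> ` carrier M"
      using x by (rule E.w_closureE) (rule that)
    show ?thesis
    proof (rule E.torsion_free[OF J(1,2)])
      fix j assume j: "j \<in> J"
      obtain m where m: "m \<in> carrier M" "j \<odot>\<^bsub>E\<^esub> x = \<phi> m" using J(4)[OF j] by (elim imageE)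
      then show "j \<odot>\<^bsub>E\<^esub> x = \<zero>\<^bsub>E\<^esub>" using H[OF m(1) J(3)[OF j] m(2)[symmetric]] ker[OF m(1)] by simp
    qed
  qed
  show ?thesis
  proof
    assume cof: "gv_cofg R E {\<zero>\<^bsub>E\<^esub>} ?W"
    show "gv_cofg R M N (carrier M)"
    proof (rule gv_cofgI)
      fix \<F> assume F: "\<And>V. V \<in> \<F> \<Longrightarrow> gv_closed R M V" "\<And>V. V \<in> \<F> \<Longrightarrow> N \<subseteq> V" "carrier M \<inter> \<Inter>\<F> = N"
      define c where "c V = w_closure R E (\<phi> ` V)" for V
      \<comment> \<open>V is recovered from its image because it contains the kernel N and is
        closed.\<close>
      have c_iff: "x \<in> V" if V: "V \<in> \<F>" and x: "x \<in> carrier M" "\<phi> x \<in> c V" for V x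
      proof -
        note Vs = gv_closedD(1)[OF F(1)[OF V]]
        obtain J where J: "GV_ideal R J" "\<And>j. j \<in> J \<Longrightarrow> j \<in> carrier R" "\<And>j. j \<in> J \<Longrightarrow> j \<odot>\<^bsub>E\<^esub> \<phi> x \<in> \<phi> ` V"
          using x(2) unfolding c_def by (rule E.w_closureE') (rule that)
        show ?thesis
        proof (rule gv_closedD(3)[OF F(1)[OF V] x(1) J(1)])
          fix j assume j: "j \<in> J"
          obtain v where v: "v \<in> V" "j \<odot>\<^bsub>E\<^esub> \<phi> x = \<phi> v" using J(3)[OF j] by (elim imageE)
          have M: "v \<in> carrier M" "j \<odot>\<^bsub>M\<^esub> x \<in> carrier M" using submodule_carrierD[OF Vs v(1)] x(1) J(2)[OF j] by auto
          have "\<phi> (j \<odot>\<^bsub>M\<^esub> x \<ominus>\<^bsub>M\<^esub> v) = \<phi> (j \<odot>\<^bsub>M\<^esub> x) \<oplus>\<^bsub>E\<^esub> \<ominus>\<^bsub>E\<^esub> \<phi> v"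
            using \<phi>D(3)[OF M(2), of "\<ominus>\<^bsub>M\<^esub> v"] mod_hom_minus[OF \<phi> module_axioms E.module_axioms M(1)] M(1)
            by (simp add: a_minus_def)
          also have "\<dots> = \<zero>\<^bsub>E\<^esub>" using \<phi>D(4)[OF J(2)[OF j] x(1)] v(2) \<phi>D(1)[OF M(1)] by (simp add: E.M.r_neg)
          finally have "j \<odot>\<^bsub>M\<^esub> x \<ominus>\<^bsub>M\<^esub> v \<in> N" using ker M by simp
          then have "(j \<odot>\<^bsub>M\<^esub> x \<ominus>\<^bsub>M\<^esub> v) \<oplus>\<^bsub>M\<^esub> v \<in> V" using F(2)[OF V] v(1) submoduleE(5)[OF Vs] by blast
          then show "j \<odot>\<^bsub>M\<^esub> x \<in> V" using M by (simp add: M.minus_add_cancel)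
        qed
      qed
      have cc: "gv_closed R E (c V)" "\<phi> ` V \<subseteq> c V" if "V \<in> \<F>" for V
        unfolding c_def using E.w_closure_closed[OF im[OF gv_closedD(1)[OF F(1)[OF that]]]]
          E.w_closure_incr[OF im[OF gv_closedD(1)[OF F(1)[OF that]]]] by simp_all
      have 1: "gv_closed R E U" if "U \<in> c ` \<F>" for U using that cc(1) by auto
      have 2: "{\<zero>\<^bsub>E\<^esub>} \<subseteq> U" if "U \<in> c ` \<F>" for U using E.zero_in_gv_closed[OF 1[OF that]] by simp
      have Wc: "gv_closed R E ?W" by (rule E.w_closure_closed[OF Is])
      have 3: "?W \<inter> \<Inter>(c ` \<F>) = {\<zero>\<^bsub>E\<^esub>}"
      proof (intro equalityI subsetI)
        fix x assume x: "x \<in> ?W \<inter> \<Inter>(c ` \<F>)"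
        have "x = \<zero>\<^bsub>E\<^esub>"
        proof (rule zeroW)
          show "x \<in> ?W" using x by simp
          fix m j assume m: "m \<in> carrier M" "j \<in> carrier R" "\<phi> m = j \<odot>\<^bsub>E\<^esub> x"
          have "m \<in> V" if V: "V \<in> \<F>" for V
          proof (rule c_iff[OF V m(1)])
            have "x \<in> c V" using x V by blast
            then show "\<phi> m \<in> c V" unfolding m(3) using E.submoduleE(4)[OF E.gv_closedD(1)[OF cc(1)[OF V]] m(2)] by simp
          qed
          then show "m \<in> N" using F(3) m(1) by blast
        qed
        then show "x \<in> {\<zero>\<^bsub>E\<^esub>}" by simp
      next
        fix x assume "x \<in> {\<zero>\<^bsub>E\<^esub>}"
        then show "x \<in> ?W \<inter> \<Inter>(c ` \<F>)" using 2 E.zero_in_gv_closed[OF Wc] by auto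
      qed
      obtain T' where T': "finite T'" "T' \<subseteq> c ` \<F>" "?W \<inter> \<Inter>T' = {\<zero>\<^bsub>E\<^esub>}" by (rule E.gv_cofgD[OF cof 1 2 3])
      obtain T where T: "T \<subseteq> \<F>" "finite T" "T' = c ` T" using finite_subset_image[OF T'(1,2)] by blast
      have "carrier M \<inter> \<Inter>T \<subseteq> N"
      proof
        fix x assume x: "x \<in> carrier M \<inter> \<Inter>T"
        then have "\<phi> x \<in> ?W \<inter> \<Inter>T'" using IW cc(2) T(1,3) by blast
        then have "\<phi> x = \<zero>\<^bsub>E\<^esub>" unfolding T'(3) by simp
        then show "x \<in> N" using ker x by simp
      qed
      moreover have "N \<subseteq> carrier M \<inter> \<Inter>T" using NM F(2) T(1) by blast
      ultimately show "\<exists>T. finite T \<and> T \<subseteq> \<F> \<and> carrier M \<inter> \<Inter>T = N" using T by blast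
    qed
  next
    assume cof: "gv_cofg R M N (carrier M)"
    show "gv_cofg R E {\<zero>\<^bsub>E\<^esub>} ?W"
    proof (rule E.gv_cofgI)
      fix \<F> assume F: "\<And>V. V \<in> \<F> \<Longrightarrow> gv_closed R E V" "\<And>V. V \<in> \<F> \<Longrightarrow> {\<zero>\<^bsub>E\<^esub>} \<subseteq> V" "?W \<inter> \<Inter>\<F> = {\<zero>\<^bsub>E\<^esub>}"
      define c where "c V = {x \<in> carrier M. \<phi> x \<in> V}" for V
      have c1: "gv_closed R M (c V)" if V: "V \<in> \<F>" for V
      proof (rule gv_closedI)
        note Vs = E.gv_closedD(1)[OF F(1)[OF V]]
        show "submodule (c V) R M"
        proof (rule submoduleI)
          show "\<zero>\<^bsub>M\<^esub> \<in> c V" using mod_hom_zero[OF \<phi> module_axioms E.module_axioms] E.submodule_zero[OF Vs] by (simp add: c_def)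
          fix a assume a: "a \<in> c V"
          then have a': "a \<in> carrier M" "\<phi> a \<in> V" by (simp_all add: c_def)
          show "\<ominus>\<^bsub>M\<^esub> a \<in> c V" using a' mod_hom_minus[OF \<phi> module_axioms E.module_axioms a'(1)] E.submoduleE(3)[OF Vs] by (simp add: c_def)
          show "a \<oplus>\<^bsub>M\<^esub> b \<in> c V" if "b \<in> c V" for b using a' that \<phi>D(3) E.submoduleE(5)[OF Vs] by (simp add: c_def)
          show "r \<odot>\<^bsub>M\<^esub> a \<in> c V" if "r \<in> carrier R" for r using a' that \<phi>D(4) E.submoduleE(4)[OF Vs] by (simp add: c_def)
        qed (auto simp: c_def)
        fix x J assume x: "x \<in> carrier M" and J: "GV_ideal R J" and Jx: "\<And>j. j \<in> J \<Longrightarrow> j \<odot>\<^bsub>M\<^esub> x \<in> c V"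
        have "\<phi> x \<in> V"
        proof (rule E.gv_closedD(3)[OF F(1)[OF V] \<phi>D(1)[OF x] J])
          fix j assume j: "j \<in> J"
          show "j \<odot>\<^bsub>E\<^esub> \<phi> x \<in> V" using Jx[OF j] \<phi>D(4)[OF GV_ideal_subset(2)[OF J j] x] by (simp add: c_def)
        qed
        then show "x \<in> c V" using x by (simp add: c_def)
      qed
      have c2: "N \<subseteq> c V" if "V \<in> \<F>" for V
      proof
        fix x assume x: "x \<in> N"
        then have "\<phi> x = \<zero>\<^bsub>E\<^esub>" "x \<in> carrier M" using ker NM by auto
        then show "x \<in> c V" using F(2)[OF that] by (simp add: c_def)
      qed
      have 1: "gv_closed R M U" if "U \<in> c ` \<F>" for U using that c1 by auto
      have 2: "N \<subseteq> U" if "U \<in> c ` \<F>" for U using that c2 by auto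
      have 3: "carrier M \<inter> \<Inter>(c ` \<F>) = N"
      proof (intro equalityI subsetI)
        fix x assume x: "x \<in> carrier M \<inter> \<Inter>(c ` \<F>)"
        then have "\<phi> x \<in> ?W \<inter> \<Inter>\<F>" using IW by (auto simp: c_def)
        then show "x \<in> N" unfolding F(3) using ker x by simp
      qed (use NM 2 in auto)
      obtain T' where T': "finite T'" "T' \<subseteq> c ` \<F>" "carrier M \<inter> \<Inter>T' = N" by (rule gv_cofgD[OF cof 1 2 3])
      obtain T where T: "T \<subseteq> \<F>" "finite T" "T' = c ` T" using finite_subset_image[OF T'(1,2)] by blast
      have "x = \<zero>\<^bsub>E\<^esub>" if x: "x \<in> ?W \<inter> \<Inter>T" for x
      proof (rule zeroW)
        show "x \<in> ?W" using x by simp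
        fix m j assume m: "m \<in> carrier M" "j \<in> carrier R" "\<phi> m = j \<odot>\<^bsub>E\<^esub> x"
        have "m \<in> c V" if V: "V \<in> T" for V
        proof -
          have "x \<in> V" "V \<in> \<F>" using x V T(1) by auto
          then have "\<phi> m \<in> V" unfolding m(3) using E.submoduleE(4)[OF E.gv_closedD(1)[OF F(1)] m(2)] by simp
          then show ?thesis using m(1) by (simp add: c_def)
        qed
        then show "m \<in> N" using T'(3) m(1) unfolding T(3) by blast
      qed
      moreover have "\<zero>\<^bsub>E\<^esub> \<in> ?W \<inter> \<Inter>T" using F(2,3) T(1) by blast
      ultimately have "?W \<inter> \<Inter>T = {\<zero>\<^bsub>E\<^esub>}" by blast
      then show "\<exists>T. finite T \<and> T \<subseteq> \<F> \<and> ?W \<inter> \<Inter>T = {\<zero>\<^bsub>E\<^esub>}" using T by blast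
    qed
  qed
qed

text \<open>\<open>inj_env\<close> is a choice, so its properties depend on the existence of an
  envelope over that very type; \<open>ex_injective_envelope\<close> discharges \<open>env\<close>
  later.\<close>

lemma (in w_mod) w_cofinitely_generated_w_envelope_iff:
  assumes N: "gv_closed R M N"
    and env: "\<exists>(E :: ('a, 'a \<Rightarrow> ('c set \<Rightarrow> rat) set) module) i. injective_envelope R (quot_mod R M N) E i"
  shows "w_cofinitely_generated R (w_envelope R (quot_mod R M N)) \<longleftrightarrow> gv_cofg R M N (carrier M)"
proof -
  let ?Q = "quot_mod R M N"
  define E where "E = fst (inj_env R ?Q)"
  define i where "i = snd (inj_env R ?Q)"
  have "\<exists>p :: ('a, 'a \<Rightarrow> ('c set \<Rightarrow> rat) set) module \<times> ('c set \<Rightarrow> 'a \<Rightarrow> ('c set \<Rightarrow> rat) set).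
      injective_envelope R ?Q (fst p) (snd p)"
    using env by simp
  then have env: "injective_envelope R ?Q E i"
    unfolding E_def i_def inj_env_def by (rule someI_ex)
  note Ns = gv_closedD(1)[OF N] and q = quot_mod_coset[OF gv_closedD(1)[OF N]]
  interpret Q: module R ?Q by (rule quot_mod_module[OF Ns])
  have zero_iff: "N +>\<^bsub>M\<^esub> x = \<zero>\<^bsub>?Q\<^esub> \<longleftrightarrow> x \<in> N" if "x \<in> carrier M" for x
    unfolding q(4) q(5)[OF that M.zero_closed]
    using that M.minus_add_cancel(1)[OF that M.zero_closed] by simp
  have tf: "c = \<zero>\<^bsub>?Q\<^esub>" if c: "c \<in> carrier ?Q" and J: "GV_ideal R J" and Jc: "\<And>j. j \<in> J \<Longrightarrow> j \<odot>\<^bsub>?Q\<^esub> c = \<zero>\<^bsub>?Q\<^esub>" for c J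
  proof -
    obtain x where x: "x \<in> carrier M" "c = N +>\<^bsub>M\<^esub> x" using c unfolding q(1) by (elim imageE)
    have "x \<in> N"
    proof (rule gv_closedD(3)[OF N x(1) J])
      fix j assume j: "j \<in> J"
      note jR = GV_ideal_subset(2)[OF J j]
      have "N +>\<^bsub>M\<^esub> (j \<odot>\<^bsub>M\<^esub> x) = \<zero>\<^bsub>?Q\<^esub>" using Jc[OF j] unfolding x(2) q(3)[OF jR x(1)] .
      then show "j \<odot>\<^bsub>M\<^esub> x \<in> N" using zero_iff jR x(1) by simp
    qed
    then show ?thesis using zero_iff x by simp
  qed
  have "w_mod R E" by (rule Q.w_mod_injective_envelope[OF tf env])
  then interpret E: w_mod R E .
  have i: "i \<in> mod_hom R ?Q E" and inj: "inj_on i (carrier ?Q)"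
    using env unfolding injective_envelope_def by blast+
  have "(\<lambda>x\<in>carrier M. N +>\<^bsub>M\<^esub> x) \<in> mod_hom R M ?Q"
    by (rule mod_homI) (use q in auto)
  from mod_hom_compose[OF this i module_axioms]
  have \<phi>: "(\<lambda>x\<in>carrier M. i (N +>\<^bsub>M\<^esub> x)) \<in> mod_hom R M E" by (simp cong: restrict_cong)
  have im: "(\<lambda>x\<in>carrier M. i (N +>\<^bsub>M\<^esub> x)) ` carrier M = i ` carrier ?Q"
    unfolding q(1) by (auto simp: image_iff)
  have i0: "i \<zero>\<^bsub>?Q\<^esub> = \<zero>\<^bsub>E\<^esub>" by (rule mod_hom_zero[OF i Q.module_axioms E.module_axioms])
  have ker: "(\<lambda>x\<in>carrier M. i (N +>\<^bsub>M\<^esub> x)) x = \<zero>\<^bsub>E\<^esub> \<longleftrightarrow> x \<in> N" if x: "x \<in> carrier M" for x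
  proof -
    have "N +>\<^bsub>M\<^esub> x \<in> carrier ?Q" unfolding q(1) using x by simp
    then have "i (N +>\<^bsub>M\<^esub> x) = i \<zero>\<^bsub>?Q\<^esub> \<longleftrightarrow> N +>\<^bsub>M\<^esub> x = \<zero>\<^bsub>?Q\<^esub>" by (rule inj_on_eq_iff[OF inj _ Q.M.zero_closed])
    then show ?thesis using x zero_iff[OF x] i0 by simp
  qed
  have W: "gv_closed R E (w_closure R E (i ` carrier ?Q))"
    by (rule E.w_closure_closed[OF Q.submodule_mod_hom_image[OF i E.module_axioms Q.carrier_is_submodule]])
  have "w_envelope R ?Q = E\<lparr>carrier := w_closure R E (i ` carrier ?Q)\<rparr>"
    by (simp add: w_envelope_def w_closure_def Let_def E_def i_def)
  then show ?thesis
    using E.w_cofinitely_generated_submodule_iff[OF W] gv_cofg_quotient_iff[OF N E.w_mod_axioms \<phi> ker] unfolding im by simp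
qed

section \<open>Existence of injective envelopes\<close>

definition int_mod :: "('c, 'm) ring_scheme \<Rightarrow> (int, 'c) module"
  where "int_mod G = \<lparr>carrier = carrier G, monoid.mult = undefined, monoid.one = undefined,
    ring.zero = \<zero>\<^bsub>G\<^esub>, ring.add = (\<oplus>\<^bsub>G\<^esub>), smult = (\<lambda>k x. [k] \<cdot>\<^bsub>G\<^esub> x)\<rparr>"

lemma int_mod_simps [simp]:
  "carrier (int_mod G) = carrier G" "\<zero>\<^bsub>int_mod G\<^esub> = \<zero>\<^bsub>G\<^esub>" "(\<oplus>\<^bsub>int_mod G\<^esub>) = (\<oplus>\<^bsub>G\<^esub>)"
  by (simp_all add: int_mod_def)

lemma a_inv_int_mod: "\<ominus>\<^bsub>int_mod G\<^esub> x = \<ominus>\<^bsub>G\<^esub> x"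
  by (simp add: a_inv_def m_inv_def)

lemma (in abelian_group) int_mod_module: "module \<Z> (int_mod G)"
proof (rule moduleI)
  show "abelian_group (int_mod G)"
  proof (rule abelian_groupI)
    show "\<exists>y\<in>carrier (int_mod G). y \<oplus>\<^bsub>int_mod G\<^esub> x = \<zero>\<^bsub>int_mod G\<^esub>" if "x \<in> carrier (int_mod G)" for x
      using that by (intro bexI[of _ "\<ominus> x"]) (simp_all add: l_neg)
  qed (auto simp: a_ac)
qed (auto simp: int_mod_def int_is_cring add.int_pow_mult add.int_pow_distrib add.int_pow_pow mult.commute)

text \<open>Additive maps are automatically linear over the integers, by induction upwards and
  downwards from 0.\<close>

lemma additive_int_hom:
  assumes B: "module \<Z> B" and D: "module \<Z> D"
    and f: "\<And>x. x \<in> carrier B \<Longrightarrow> f x \<in> carrier D" "f \<in> extensional (carrier B)"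
    and add: "\<And>x y. x \<in> carrier B \<Longrightarrow> y \<in> carrier B \<Longrightarrow> f (x \<oplus>\<^bsub>B\<^esub> y) = f x \<oplus>\<^bsub>D\<^esub> f y"
  shows "f \<in> mod_hom \<Z> B D"
proof -
  interpret B: module \<Z> B by fact
  interpret D: module \<Z> D by fact
  have smult_closed: "k \<odot>\<^bsub>B\<^esub> x \<in> carrier B" if "x \<in> carrier B" for k x using that by (intro B.smult_closed) simp_all
  have smult_closed': "k \<odot>\<^bsub>D\<^esub> x \<in> carrier D" if "x \<in> carrier D" for k x using that by (intro D.smult_closed) simp_all
  have succ: "(k + 1) \<odot>\<^bsub>B\<^esub> x = k \<odot>\<^bsub>B\<^esub> x \<oplus>\<^bsub>B\<^esub> x" if "x \<in> carrier B" for k x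
    using B.smult_l_distr[of k 1 x] B.smult_one[OF that] that by simp
  have succ': "(k + 1) \<odot>\<^bsub>D\<^esub> x = k \<odot>\<^bsub>D\<^esub> x \<oplus>\<^bsub>D\<^esub> x" if "x \<in> carrier D" for k x
    using D.smult_l_distr[of k 1 x] D.smult_one[OF that] that by simp
  have f0: "f \<zero>\<^bsub>B\<^esub> = \<zero>\<^bsub>D\<^esub>"
    using add[OF B.M.zero_closed B.M.zero_closed] f(1)[OF B.M.zero_closed] D.M.add.r_cancel_one' by simp
  have "f (k \<odot>\<^bsub>B\<^esub> x) = k \<odot>\<^bsub>D\<^esub> f x" if x: "x \<in> carrier B" for k x
  proof (induct k rule: int_induct[where k = 0])
    case base
    show ?case using B.smult_l_null[OF x] D.smult_l_null[OF f(1)[OF x]] f0 by simp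
  next
    case (step1 i)
    show ?case unfolding succ[OF x] succ'[OF f(1)[OF x]] using add[OF smult_closed[OF x] x] step1(2) by simp
  next
    case (step2 i)
    have "f ((i - 1) \<odot>\<^bsub>B\<^esub> x) \<oplus>\<^bsub>D\<^esub> f x = f (i \<odot>\<^bsub>B\<^esub> x)"
      using add[OF smult_closed[OF x, of "i - 1"] x] succ[OF x, of "i - 1"] by simp
    also have "\<dots> = (i - 1) \<odot>\<^bsub>D\<^esub> f x \<oplus>\<^bsub>D\<^esub> f x" using step2(2) succ'[OF f(1)[OF x], of "i - 1"] by simp
    finally show ?case using f(1)[OF x] f(1)[OF smult_closed[OF x]] smult_closed'[OF f(1)[OF x]] by simp
  qed
  then show ?thesis by (intro mod_homI) (use f add in simp_all)
qed

text \<open>Partial maps are represented by their graphs, so that Zorn's lemma applies to set inclusion.\<close>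

lemma divisible_extends:
  assumes B: "module \<Z> B" and D: "module \<Z> D"
    and div: "\<And>n d. n > 0 \<Longrightarrow> d \<in> carrier D \<Longrightarrow> \<exists>e\<in>carrier D. n \<odot>\<^bsub>D\<^esub> e = d"
    and A: "submodule A \<Z> B" and f: "f \<in> mod_hom \<Z> (B\<lparr>carrier := A\<rparr>) D"
  shows "\<exists>g\<in>mod_hom \<Z> B D. \<forall>x\<in>A. g x = f x"
proof -
  interpret B: module \<Z> B by fact
  interpret D: module \<Z> D by fact
  note fD = mod_homD[OF f, simplified] and AE = B.submoduleE[OF A]
  have sB: "k \<odot>\<^bsub>B\<^esub> x \<in> carrier B" if "x \<in> carrier B" for k x using that by (intro B.smult_closed) simp_all
  have sD: "k \<odot>\<^bsub>D\<^esub> x \<in> carrier D" if "x \<in> carrier D" for k x using that by (intro D.smult_closed) simp_all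
  have lB: "(k + l) \<odot>\<^bsub>B\<^esub> x = k \<odot>\<^bsub>B\<^esub> x \<oplus>\<^bsub>B\<^esub> l \<odot>\<^bsub>B\<^esub> x" "(k * l) \<odot>\<^bsub>B\<^esub> x = k \<odot>\<^bsub>B\<^esub> (l \<odot>\<^bsub>B\<^esub> x)" "1 \<odot>\<^bsub>B\<^esub> x = x" "0 \<odot>\<^bsub>B\<^esub> x = \<zero>\<^bsub>B\<^esub>"
    if "x \<in> carrier B" for k l x
    using that B.smult_l_distr[of k l x] B.smult_assoc1[of k l x] B.smult_one[of x] B.smult_l_null[of x] by simp_all
  have lD: "(k + l) \<odot>\<^bsub>D\<^esub> x = k \<odot>\<^bsub>D\<^esub> x \<oplus>\<^bsub>D\<^esub> l \<odot>\<^bsub>D\<^esub> x" "(k * l) \<odot>\<^bsub>D\<^esub> x = k \<odot>\<^bsub>D\<^esub> (l \<odot>\<^bsub>D\<^esub> x)" "1 \<odot>\<^bsub>D\<^esub> x = x" "0 \<odot>\<^bsub>D\<^esub> x = \<zero>\<^bsub>D\<^esub>"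
    if "x \<in> carrier D" for k l x
    using that D.smult_l_distr[of k l x] D.smult_assoc1[of k l x] D.smult_one[of x] D.smult_l_null[of x] by simp_all
  have rB: "k \<odot>\<^bsub>B\<^esub> (x \<oplus>\<^bsub>B\<^esub> y) = k \<odot>\<^bsub>B\<^esub> x \<oplus>\<^bsub>B\<^esub> k \<odot>\<^bsub>B\<^esub> y" if "x \<in> carrier B" "y \<in> carrier B" for k x y
    using that by (intro B.smult_r_distr) simp_all
  have rD: "k \<odot>\<^bsub>D\<^esub> (x \<oplus>\<^bsub>D\<^esub> y) = k \<odot>\<^bsub>D\<^esub> x \<oplus>\<^bsub>D\<^esub> k \<odot>\<^bsub>D\<^esub> y" if "x \<in> carrier D" "y \<in> carrier D" for k x y
    using that by (intro D.smult_r_distr) simp_all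
  \<comment> \<open>Graphs of partial homomorphisms extending f. Single-valuedness is demanded only
    at 0, where it is equivalent given closure under addition and scalars.\<close>
  define ok where "ok G \<longleftrightarrow> G \<subseteq> carrier B \<times> carrier D \<and> (\<lambda>x. (x, f x)) ` A \<subseteq> G \<and>
      (\<forall>x y x' y'. (x, y) \<in> G \<longrightarrow> (x', y') \<in> G \<longrightarrow> (x \<oplus>\<^bsub>B\<^esub> x', y \<oplus>\<^bsub>D\<^esub> y') \<in> G) \<and>
      (\<forall>k x y. (x, y) \<in> G \<longrightarrow> (k \<odot>\<^bsub>B\<^esub> x, k \<odot>\<^bsub>D\<^esub> y) \<in> G) \<and> (\<forall>y. (\<zero>\<^bsub>B\<^esub>, y) \<in> G \<longrightarrow> y = \<zero>\<^bsub>D\<^esub>)" for G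
  have okD: "\<And>x y. (x, y) \<in> G \<Longrightarrow> x \<in> carrier B \<and> y \<in> carrier D" "\<And>x. x \<in> A \<Longrightarrow> (x, f x) \<in> G"
    "\<And>x y x' y'. (x, y) \<in> G \<Longrightarrow> (x', y') \<in> G \<Longrightarrow> (x \<oplus>\<^bsub>B\<^esub> x', y \<oplus>\<^bsub>D\<^esub> y') \<in> G"
    "\<And>k x y. (x, y) \<in> G \<Longrightarrow> (k \<odot>\<^bsub>B\<^esub> x, k \<odot>\<^bsub>D\<^esub> y) \<in> G" "\<And>y. (\<zero>\<^bsub>B\<^esub>, y) \<in> G \<Longrightarrow> y = \<zero>\<^bsub>D\<^esub>" if "ok G" for G
    using that unfolding ok_def by blast+
  have okI: "ok G" if "\<And>x y. (x, y) \<in> G \<Longrightarrow> x \<in> carrier B \<and> y \<in> carrier D" "\<And>x. x \<in> A \<Longrightarrow> (x, f x) \<in> G"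
    "\<And>x y x' y'. (x, y) \<in> G \<Longrightarrow> (x', y') \<in> G \<Longrightarrow> (x \<oplus>\<^bsub>B\<^esub> x', y \<oplus>\<^bsub>D\<^esub> y') \<in> G"
    "\<And>k x y. (x, y) \<in> G \<Longrightarrow> (k \<odot>\<^bsub>B\<^esub> x, k \<odot>\<^bsub>D\<^esub> y) \<in> G" "\<And>y. (\<zero>\<^bsub>B\<^esub>, y) \<in> G \<Longrightarrow> y = \<zero>\<^bsub>D\<^esub>" for G
    unfolding ok_def using that by (intro conjI allI impI subsetI) auto
  have "\<exists>G\<in>{G. ok G}. \<forall>G'\<in>{G. ok G}. G \<subseteq> G' \<longrightarrow> G' = G"
  proof (rule subset_Zorn_nonempty)
    have "ok ((\<lambda>x. (x, f x)) ` A)"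
    proof (rule okI)
      show "y = \<zero>\<^bsub>D\<^esub>" if "(\<zero>\<^bsub>B\<^esub>, y) \<in> (\<lambda>x. (x, f x)) ` A" for y
        using that mod_hom_zero[OF f submodule.submodule_is_module[OF A B] D] by auto
      show "(x \<oplus>\<^bsub>B\<^esub> x', y \<oplus>\<^bsub>D\<^esub> y') \<in> (\<lambda>x. (x, f x)) ` A"
        if "(x, y) \<in> (\<lambda>x. (x, f x)) ` A" "(x', y') \<in> (\<lambda>x. (x, f x)) ` A" for x y x' y'
        using that fD(3) AE(5) by auto
      show "(k \<odot>\<^bsub>B\<^esub> x, k \<odot>\<^bsub>D\<^esub> y) \<in> (\<lambda>x. (x, f x)) ` A" if "(x, y) \<in> (\<lambda>x. (x, f x)) ` A" for k x y
        using that fD(4) AE(4) by auto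
    qed (use fD(1) AE(1) in auto)
    then show "{G. ok G} \<noteq> {}" by blast
    fix C assume C: "C \<noteq> {}" "subset.chain {G. ok G} C"
    have ok: "ok G" if "G \<in> C" for G using C(2) that by (auto simp: subset_chain_def)
    have "ok (\<Union>C)"
    proof (rule okI)
      show "(x \<oplus>\<^bsub>B\<^esub> x', y \<oplus>\<^bsub>D\<^esub> y') \<in> \<Union>C" if xy: "(x, y) \<in> \<Union>C" "(x', y') \<in> \<Union>C" for x y x' y'
      proof -
        obtain G G' where G: "G \<in> C" "(x, y) \<in> G" "G' \<in> C" "(x', y') \<in> G'" using xy by blast
        then consider "(x, y) \<in> G'" | "(x', y') \<in> G" using C(2) unfolding subset_chain_def by blast
        then show ?thesis using okD(3)[OF ok[OF G(1)]] okD(3)[OF ok[OF G(3)]] G by cases blast+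
      qed
      show "(k \<odot>\<^bsub>B\<^esub> x, k \<odot>\<^bsub>D\<^esub> y) \<in> \<Union>C" if "(x, y) \<in> \<Union>C" for k x y using that okD(4)[OF ok] by blast
      show "y = \<zero>\<^bsub>D\<^esub>" if "(\<zero>\<^bsub>B\<^esub>, y) \<in> \<Union>C" for y using that okD(5)[OF ok] by blast
      show "x \<in> carrier B \<and> y \<in> carrier D" if "(x, y) \<in> \<Union>C" for x y using that okD(1)[OF ok] by blast
      show "(x, f x) \<in> \<Union>C" if "x \<in> A" for x using that C(1) okD(2)[OF ok] by blast
    qed
    then show "\<Union>C \<in> {G. ok G}" by simp
  qed
  then obtain G where G: "ok G" and max: "\<And>G'. ok G' \<Longrightarrow> G \<subseteq> G' \<Longrightarrow> G' = G" by blast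
  note GD = okD[OF G]
  have zero: "(\<zero>\<^bsub>B\<^esub>, \<zero>\<^bsub>D\<^esub>) \<in> G"
    using GD(2)[OF B.submodule_zero[OF A]] mod_hom_zero[OF f submodule.submodule_is_module[OF A B] D] by simp
  have uniq: "y = y'" if "(x, y) \<in> G" "(x, y') \<in> G" for x y y'
  proof -
    have c: "x \<in> carrier B" "y \<in> carrier D" "y' \<in> carrier D" using GD(1) that by blast+
    have m: "(-1) \<odot>\<^bsub>B\<^esub> x = \<ominus>\<^bsub>B\<^esub> x" "(-1) \<odot>\<^bsub>D\<^esub> y' = \<ominus>\<^bsub>D\<^esub> y'"
    proof -
      show "(-1) \<odot>\<^bsub>B\<^esub> x = \<ominus>\<^bsub>B\<^esub> x"
        using lB(1)[OF c(1), of "-1" 1] lB(3,4)[OF c(1)] sB[OF c(1), of "-1"] c(1) by (intro B.M.minus_equality[symmetric]) simp_all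
      show "(-1) \<odot>\<^bsub>D\<^esub> y' = \<ominus>\<^bsub>D\<^esub> y'"
        using lD(1)[OF c(3), of "-1" 1] lD(3,4)[OF c(3)] sD[OF c(3), of "-1"] c(3) by (intro D.M.minus_equality[symmetric]) simp_all
    qed
    have "(x \<oplus>\<^bsub>B\<^esub> (-1) \<odot>\<^bsub>B\<^esub> x, y \<oplus>\<^bsub>D\<^esub> (-1) \<odot>\<^bsub>D\<^esub> y') \<in> G" by (rule GD(3)[OF that(1) GD(4)[OF that(2)]])
    then have "y \<oplus>\<^bsub>D\<^esub> \<ominus>\<^bsub>D\<^esub> y' = \<zero>\<^bsub>D\<^esub>" using GD(5) c unfolding m by (simp add: B.M.r_neg)
    then show ?thesis using D.M.a_minus_eq_zero_iff[OF c(2,3)] by (simp add: a_minus_def)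
  qed
  have total: "\<exists>y. (b, y) \<in> G" if b: "b \<in> carrier B" for b
  proof (rule ccontr)
    assume nb: "\<nexists>y. (b, y) \<in> G"
    \<comment> \<open>The value to assign to b must agree with G on all multiples of b already in
      its domain. If n is the least positive such multiple, divisibility provides d with n d
      prescribed, and division with remainder handles the others; if there is none, 0 will
      do.\<close>
    obtain d where d: "d \<in> carrier D" "\<And>k y. (k \<odot>\<^bsub>B\<^esub> b, y) \<in> G \<Longrightarrow> y = k \<odot>\<^bsub>D\<^esub> d"
    proof (cases "\<exists>n::nat. n > 0 \<and> (\<exists>y. (int n \<odot>\<^bsub>B\<^esub> b, y) \<in> G)")
      case True
      define n where "n = (LEAST n::nat. n > 0 \<and> (\<exists>y. (int n \<odot>\<^bsub>B\<^esub> b, y) \<in> G))"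
      have n: "n > 0" "\<exists>y. (int n \<odot>\<^bsub>B\<^esub> b, y) \<in> G" using LeastI_ex[OF True] unfolding n_def by blast+
      have least: "n \<le> m" if "m > 0" "(int m \<odot>\<^bsub>B\<^esub> b, y) \<in> G" for m y
        unfolding n_def by (rule Least_le) (use that in blast)
      obtain y0 where y0: "(int n \<odot>\<^bsub>B\<^esub> b, y0) \<in> G" using n(2) by blast
      have "y0 \<in> carrier D" using GD(1)[OF y0] by blast
      then obtain d where d: "d \<in> carrier D" "int n \<odot>\<^bsub>D\<^esub> d = y0" using div[of "int n" y0] n(1) by auto
      show ?thesis
      proof (rule that[OF d(1)])
        fix k y assume ky: "(k \<odot>\<^bsub>B\<^esub> b, y) \<in> G"
        define q r where "q = k div int n" and "r = k mod int n"
        have k: "k = q * int n + r" "0 \<le> r" "r < int n" using n(1) by (simp_all add: q_def r_def)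
        have "((-q) \<odot>\<^bsub>B\<^esub> (int n \<odot>\<^bsub>B\<^esub> b), (-q) \<odot>\<^bsub>D\<^esub> y0) \<in> G" by (rule GD(4)[OF y0])
        then have "(((-q) * int n) \<odot>\<^bsub>B\<^esub> b, (-q) \<odot>\<^bsub>D\<^esub> y0) \<in> G" unfolding lB(2)[OF b] .
        from GD(3)[OF ky this] have "((k + (-q) * int n) \<odot>\<^bsub>B\<^esub> b, y \<oplus>\<^bsub>D\<^esub> (-q) \<odot>\<^bsub>D\<^esub> y0) \<in> G" unfolding lB(1)[OF b] .
        moreover have "k + (-q) * int n = int (nat r)" using k(1,2) by simp
        ultimately have mem: "(int (nat r) \<odot>\<^bsub>B\<^esub> b, y \<oplus>\<^bsub>D\<^esub> (-q) \<odot>\<^bsub>D\<^esub> y0) \<in> G" by simp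
        have "\<not> nat r > 0"
        proof
          assume "nat r > 0"
          from least[OF this mem] show False using k(2,3) by linarith
        qed
        then have "r = 0" using k(2) by simp
        then have "k = q * int n" using k(1) by simp
        then have "k \<odot>\<^bsub>B\<^esub> b = q \<odot>\<^bsub>B\<^esub> (int n \<odot>\<^bsub>B\<^esub> b)" "k \<odot>\<^bsub>D\<^esub> d = q \<odot>\<^bsub>D\<^esub> y0" using lB(2)[OF b] lD(2)[OF d(1)] d(2) by simp_all
        then show "y = k \<odot>\<^bsub>D\<^esub> d" using uniq[OF ky] GD(4)[OF y0, of q] by simp
      qed
    next
      case False
      show ?thesis
      proof (rule that[OF D.M.zero_closed])
        fix k y assume ky: "(k \<odot>\<^bsub>B\<^esub> b, y) \<in> G"
        have "((-1) \<odot>\<^bsub>B\<^esub> (k \<odot>\<^bsub>B\<^esub> b), (-1) \<odot>\<^bsub>D\<^esub> y) \<in> G" by (rule GD(4)[OF ky])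
        then have neg: "((- k) \<odot>\<^bsub>B\<^esub> b, (-1) \<odot>\<^bsub>D\<^esub> y) \<in> G" using lB(2)[OF b, of "-1" k] by simp
        have "k = 0"
        proof (rule ccontr)
          assume "k \<noteq> 0"
          then consider "nat k > 0" "int (nat k) = k" | "nat (-k) > 0" "int (nat (-k)) = -k" by linarith
          then show False using False ky neg by cases metis+
        qed
        then have "(\<zero>\<^bsub>B\<^esub>, y) \<in> G" using ky lB(4)[OF b] by simp
        then have "y = \<zero>\<^bsub>D\<^esub>" by (rule GD(5))
        then show "y = k \<odot>\<^bsub>D\<^esub> \<zero>\<^bsub>D\<^esub>" using lD(4)[OF D.M.zero_closed] \<open>k = 0\<close> by simp
      qed
    qed
    \<comment> \<open>The graph on the domain of G plus the multiples of b. The choice of d is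
      exactly what keeps it single-valued.\<close>
    define G' where "G' = {(x \<oplus>\<^bsub>B\<^esub> k \<odot>\<^bsub>B\<^esub> b, y \<oplus>\<^bsub>D\<^esub> k \<odot>\<^bsub>D\<^esub> d) | x y k. (x, y) \<in> G}"
    have memG': "(x \<oplus>\<^bsub>B\<^esub> k \<odot>\<^bsub>B\<^esub> b, y \<oplus>\<^bsub>D\<^esub> k \<odot>\<^bsub>D\<^esub> d) \<in> G'" if "(x, y) \<in> G" for x y k using that unfolding G'_def by blast
    have GG': "G \<subseteq> G'"
    proof
      fix z assume z: "z \<in> G"
      obtain x y where xy: "z = (x, y)" by (cases z)
      show "z \<in> G'" using memG'[of x y 0] z GD(1)[of x y] lB(4)[OF b] lD(4)[OF d(1)] unfolding xy by simp
    qed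
    have "ok G'"
    proof (rule okI)
      show "(x, f x) \<in> G'" if "x \<in> A" for x using GD(2)[OF that] GG' by blast
      show "x \<in> carrier B \<and> y \<in> carrier D" if "(x, y) \<in> G'" for x y
        using that GD(1) sB[OF b] sD[OF d(1)] unfolding G'_def by auto
      show "(u \<oplus>\<^bsub>B\<^esub> u', v \<oplus>\<^bsub>D\<^esub> v') \<in> G'" if uv: "(u, v) \<in> G'" "(u', v') \<in> G'" for u v u' v'
      proof -
        obtain x y k where 1: "u = x \<oplus>\<^bsub>B\<^esub> k \<odot>\<^bsub>B\<^esub> b" "v = y \<oplus>\<^bsub>D\<^esub> k \<odot>\<^bsub>D\<^esub> d" "(x, y) \<in> G" using uv(1) unfolding G'_def by blast
        obtain x' y' k' where 2: "u' = x' \<oplus>\<^bsub>B\<^esub> k' \<odot>\<^bsub>B\<^esub> b" "v' = y' \<oplus>\<^bsub>D\<^esub> k' \<odot>\<^bsub>D\<^esub> d" "(x', y') \<in> G" using uv(2) unfolding G'_def by blast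
        have "u \<oplus>\<^bsub>B\<^esub> u' = (x \<oplus>\<^bsub>B\<^esub> x') \<oplus>\<^bsub>B\<^esub> (k + k') \<odot>\<^bsub>B\<^esub> b"
          unfolding 1(1) 2(1) lB(1)[OF b] using GD(1)[OF 1(3)] GD(1)[OF 2(3)] sB[OF b] by (simp add: B.M.a_ac)
        moreover have "v \<oplus>\<^bsub>D\<^esub> v' = (y \<oplus>\<^bsub>D\<^esub> y') \<oplus>\<^bsub>D\<^esub> (k + k') \<odot>\<^bsub>D\<^esub> d"
          unfolding 1(2) 2(2) lD(1)[OF d(1)] using GD(1)[OF 1(3)] GD(1)[OF 2(3)] sD[OF d(1)] by (simp add: D.M.a_ac)
        ultimately show ?thesis using memG'[OF GD(3)[OF 1(3) 2(3)]] by simp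
      qed
      show "(l \<odot>\<^bsub>B\<^esub> u, l \<odot>\<^bsub>D\<^esub> v) \<in> G'" if uv: "(u, v) \<in> G'" for l u v
      proof -
        obtain x y k where 1: "u = x \<oplus>\<^bsub>B\<^esub> k \<odot>\<^bsub>B\<^esub> b" "v = y \<oplus>\<^bsub>D\<^esub> k \<odot>\<^bsub>D\<^esub> d" "(x, y) \<in> G" using uv unfolding G'_def by blast
        have "l \<odot>\<^bsub>B\<^esub> u = l \<odot>\<^bsub>B\<^esub> x \<oplus>\<^bsub>B\<^esub> (l * k) \<odot>\<^bsub>B\<^esub> b" "l \<odot>\<^bsub>D\<^esub> v = l \<odot>\<^bsub>D\<^esub> y \<oplus>\<^bsub>D\<^esub> (l * k) \<odot>\<^bsub>D\<^esub> d"
          unfolding 1(1,2) using GD(1)[OF 1(3)] sB[OF b] sD[OF d(1)] by (simp_all add: rB rD lB(2)[OF b] lD(2)[OF d(1)])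
        then show ?thesis using memG'[OF GD(4)[OF 1(3)]] by simp
      qed
      show "v = \<zero>\<^bsub>D\<^esub>" if v: "(\<zero>\<^bsub>B\<^esub>, v) \<in> G'" for v
      proof -
        obtain x y k where 1: "\<zero>\<^bsub>B\<^esub> = x \<oplus>\<^bsub>B\<^esub> k \<odot>\<^bsub>B\<^esub> b" "v = y \<oplus>\<^bsub>D\<^esub> k \<odot>\<^bsub>D\<^esub> d" "(x, y) \<in> G" using v unfolding G'_def by blast
        have c: "x \<in> carrier B" "y \<in> carrier D" using GD(1)[OF 1(3)] by simp_all
        have "(-k) \<odot>\<^bsub>B\<^esub> b \<oplus>\<^bsub>B\<^esub> k \<odot>\<^bsub>B\<^esub> b = \<zero>\<^bsub>B\<^esub>" using lB(1)[OF b, of "-k" k] lB(4)[OF b] by simp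
        then have "x = (-k) \<odot>\<^bsub>B\<^esub> b" using 1(1) c(1) sB[OF b] by (metis B.M.add.r_cancel)
        then have "y = (-k) \<odot>\<^bsub>D\<^esub> d" using d(2) 1(3) by simp
        then show ?thesis unfolding 1(2) using lD(1)[OF d(1), of "-k" k] lD(4)[OF d(1)] by simp
      qed
    qed
    then have "G' = G" using max GG' by blast
    moreover have "(b, d) \<in> G'" using memG'[OF zero, of 1] b d(1) lB(3)[OF b] lD(3)[OF d(1)] by simp
    ultimately show False using nb by blast
  qed
  define g where "g = (\<lambda>b\<in>carrier B. SOME y. (b, y) \<in> G)"
  have g: "(b, g b) \<in> G" if "b \<in> carrier B" for b
    using someI_ex[OF total[OF that]] that by (simp add: g_def)
  have "g \<in> mod_hom \<Z> B D"
  proof (rule mod_homI)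
    fix x assume x: "x \<in> carrier B"
    show "g x \<in> carrier D" using GD(1)[OF g[OF x]] by simp
    show "g (x \<oplus>\<^bsub>B\<^esub> y) = g x \<oplus>\<^bsub>D\<^esub> g y" if y: "y \<in> carrier B" for y
      by (rule uniq[OF g GD(3)[OF g[OF x] g[OF y]]]) (use x y in simp)
    show "g (k \<odot>\<^bsub>B\<^esub> x) = k \<odot>\<^bsub>D\<^esub> g x" for k by (rule uniq[OF g[OF sB[OF x]] GD(4)[OF g[OF x]]])
  qed (simp add: g_def)
  moreover have "g x = f x" if "x \<in> A" for x
    by (rule uniq[OF g GD(2)[OF that]]) (use that AE(1) in auto)
  ultimately show ?thesis by blast
qed

text \<open>Every abelian group \<open>M\<close> embeds into the quotient of \<open>M \<Rightarrow> rat\<close> by the integral relations of \<open>M\<close>.\<close>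

lemma (in abelian_group) ex_divisible_embedding:
  "\<exists>(D :: (int, ('a \<Rightarrow> rat) set) module) \<iota>. module \<Z> D \<and>
    (\<forall>n>0. \<forall>d\<in>carrier D. \<exists>e\<in>carrier D. n \<odot>\<^bsub>D\<^esub> e = d) \<and>
    (\<forall>x\<in>carrier G. \<iota> x \<in> carrier D) \<and> (\<forall>x\<in>carrier G. \<forall>y\<in>carrier G. \<iota> (x \<oplus> y) = \<iota> x \<oplus>\<^bsub>D\<^esub> \<iota> y) \<and>
    inj_on \<iota> (carrier G)"
proof -
  let ?Z = "int_mod G"
  interpret Z: module \<Z> ?Z by (rule int_mod_module)
  let ?F = "free_mod \<Z> (carrier ?Z)"
  interpret F: module \<Z> ?F by (rule cring.free_mod_module[OF int_is_cring])
  define V :: "(int, 'a \<Rightarrow> rat) module" where "V = \<lparr>carrier = UNIV, monoid.mult = undefined, monoid.one = undefined,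
    ring.zero = (\<lambda>_. 0), ring.add = (\<lambda>f g x. f x + g x), smult = (\<lambda>k f x. of_int k * f x)\<rparr>"
  have V [simp]: "carrier V = UNIV" "\<zero>\<^bsub>V\<^esub> = (\<lambda>_. 0)" "f \<oplus>\<^bsub>V\<^esub> g = (\<lambda>x. f x + g x)" "k \<odot>\<^bsub>V\<^esub> f = (\<lambda>x. of_int k * f x)"
    for f g k by (simp_all add: V_def)
  have "module \<Z> V"
  proof (rule moduleI)
    show "abelian_group V"
      by (rule abelian_groupI) (auto simp: fun_eq_iff intro!: exI[of _ "\<lambda>x. - _ x"])
  qed (auto simp: int_is_cring fun_eq_iff algebra_simps)
  then interpret V: module \<Z> V .
  \<comment> \<open>Integral families inside rational ones. Injectivity of this inclusion is what
    shows that no new relations arise in the quotient.\<close>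
  define emb :: "('a \<Rightarrow> int) \<Rightarrow> 'a \<Rightarrow> rat" where "emb f = (\<lambda>x. of_int (f x))" for f
  have emb_inj: "f = g" if "emb f = emb g" for f g using that by (simp add: emb_def fun_eq_iff)
  have ker: "submodule (free_ker \<Z> ?Z) \<Z> ?F" by (rule Z.free_ker_submodule)
  have "(\<lambda>f\<in>carrier ?F. emb f) \<in> mod_hom \<Z> ?F V"
    by (rule mod_homI) (use F.M.a_closed F.smult_closed in \<open>auto simp: emb_def\<close>)
  from F.submodule_mod_hom_image[OF this V.module_axioms ker]
  have K': "submodule ((\<lambda>f\<in>carrier ?F. emb f) ` free_ker \<Z> ?Z) \<Z> V" .
  have "(\<lambda>f\<in>carrier ?F. emb f) ` free_ker \<Z> ?Z = emb ` free_ker \<Z> ?Z"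
    by (rule image_cong[OF refl]) (use F.submoduleE(1)[OF ker] in auto)
  with K' have K: "submodule (emb ` free_ker \<Z> ?Z) \<Z> V" by (simp only:)
  define D where "D = quot_mod \<Z> V (emb ` free_ker \<Z> ?Z)"
  note q = V.quot_mod_coset[OF K, folded D_def]
  have D: "module \<Z> D" unfolding D_def by (rule V.quot_mod_module[OF K])
  define s where "s x = free_single \<Z> x (1::int)" for x :: 'a
  define \<iota> where "\<iota> x = emb ` free_ker \<Z> ?Z +>\<^bsub>V\<^esub> emb (s x)" for x
  have s: "s x \<in> carrier ?F" "free_eval \<Z> ?Z (s x) = x" if "x \<in> carrier G" for x
    using Z.free_eval_single[of x] that unfolding s_def by simp_all
  have ev: "(\<lambda>f\<in>carrier ?F. free_eval \<Z> ?Z f) \<in> mod_hom \<Z> ?F ?Z"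
    unfolding free_eval_lin_ext by (rule Z.lin_ext_hom)
  have V_minus: "f \<ominus>\<^bsub>V\<^esub> g = (\<lambda>x. f x - g x)" for f g
  proof -
    have "\<ominus>\<^bsub>V\<^esub> g = (\<lambda>x. - g x)" by (rule V.M.minus_equality) (simp_all add: fun_eq_iff)
    then show ?thesis by (simp add: a_minus_def)
  qed
  have F_minus: "f \<ominus>\<^bsub>?F\<^esub> g = (\<lambda>x. f x - g x)" "f \<ominus>\<^bsub>?F\<^esub> g \<in> carrier ?F" if "f \<in> carrier ?F" "g \<in> carrier ?F" for f g
  proof -
    have m: "(-1) \<odot>\<^bsub>?F\<^esub> g \<in> carrier ?F" by (rule F.smult_closed[OF _ that(2)]) simp
    then have "\<ominus>\<^bsub>?F\<^esub> g = (-1) \<odot>\<^bsub>?F\<^esub> g"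
      by (rule F.M.minus_equality[OF _ that(2), rotated]) (simp add: fun_eq_iff)
    then show "f \<ominus>\<^bsub>?F\<^esub> g = (\<lambda>x. f x - g x)" by (simp add: a_minus_def)
    show "f \<ominus>\<^bsub>?F\<^esub> g \<in> carrier ?F" by (rule F.M.minus_closed[OF that])
  qed
  show ?thesis
  proof (intro exI conjI allI impI ballI)
    show "module \<Z> D" by (rule D)
    show "\<exists>e\<in>carrier D. n \<odot>\<^bsub>D\<^esub> e = d" if n: "n > 0" and d: "d \<in> carrier D" for n d
    proof -
      obtain v where v: "d = emb ` free_ker \<Z> ?Z +>\<^bsub>V\<^esub> v" using d unfolding q(1) by (elim imageE)
      \<comment> \<open>Representatives are divided pointwise by n, which is possible because V
        consists of rational functions.\<close>
      have "n \<odot>\<^bsub>D\<^esub> (emb ` free_ker \<Z> ?Z +>\<^bsub>V\<^esub> (\<lambda>x. v x / of_int n)) = d"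
        unfolding v using n by (subst q(3)) simp_all
      then show ?thesis unfolding q(1) by (intro bexI[rotated]) auto
    qed
    show "\<iota> x \<in> carrier D" for x unfolding \<iota>_def q(1) by simp
    show "\<iota> (x \<oplus> y) = \<iota> x \<oplus>\<^bsub>D\<^esub> \<iota> y" if x: "x \<in> carrier G" and y: "y \<in> carrier G" for x y
    proof -
      have xy: "x \<oplus> y \<in> carrier G" using x y by simp
      let ?f = "s (x \<oplus> y) \<ominus>\<^bsub>?F\<^esub> (s x \<oplus>\<^bsub>?F\<^esub> s y)"
      have sxy: "s x \<oplus>\<^bsub>?F\<^esub> s y \<in> carrier ?F" by (rule F.M.a_closed[OF s(1)[OF x] s(1)[OF y]])
      have eval: "free_eval \<Z> ?Z (s x \<oplus>\<^bsub>?F\<^esub> s y) = x \<oplus> y"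
        using mod_homD(3)[OF ev s(1)[OF x] s(1)[OF y]] sxy s[OF x] s[OF y] by (simp del: free_mod_simps)
      have f: "?f \<in> carrier ?F" by (rule F_minus(2)[OF s(1)[OF xy] sxy])
      have "free_eval \<Z> ?Z (?f \<oplus>\<^bsub>?F\<^esub> (s x \<oplus>\<^bsub>?F\<^esub> s y)) = free_eval \<Z> ?Z ?f \<oplus> (x \<oplus> y)"
        using mod_homD(3)[OF ev f sxy] F.M.a_closed[OF f sxy] f sxy eval by (simp del: free_mod_simps)
      also have "?f \<oplus>\<^bsub>?F\<^esub> (s x \<oplus>\<^bsub>?F\<^esub> s y) = s (x \<oplus> y)" by (rule F.M.minus_add_cancel(1)[OF s(1)[OF xy] sxy])
      finally have "x \<oplus> y = free_eval \<Z> ?Z ?f \<oplus> (x \<oplus> y)" using s(2)[OF xy] by simp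
      moreover have "free_eval \<Z> ?Z ?f \<in> carrier G" using mod_homD(1)[OF ev f] f by simp
      ultimately have "free_eval \<Z> ?Z ?f = \<zero>" using xy add.r_cancel_one' by metis
      then have "?f \<in> free_ker \<Z> ?Z" using f by (simp add: free_ker_def)
      then have "emb ?f \<in> emb ` free_ker \<Z> ?Z" by (rule imageI)
      moreover have "emb ?f = emb (s (x \<oplus> y)) \<ominus>\<^bsub>V\<^esub> (emb (s x) \<oplus>\<^bsub>V\<^esub> emb (s y))"
        unfolding V_minus F_minus(1)[OF s(1)[OF xy] sxy] by (simp add: emb_def fun_eq_iff)
      ultimately have "emb (s (x \<oplus> y)) \<ominus>\<^bsub>V\<^esub> (emb (s x) \<oplus>\<^bsub>V\<^esub> emb (s y)) \<in> emb ` free_ker \<Z> ?Z" by simp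
      then show ?thesis unfolding \<iota>_def by (subst q(2)) (simp_all add: q(5) del: V(3))
    qed
    show "inj_on \<iota> (carrier G)"
    proof (rule inj_onI)
      fix x y assume x: "x \<in> carrier G" and y: "y \<in> carrier G" and eq: "\<iota> x = \<iota> y"
      have "emb (s x) \<ominus>\<^bsub>V\<^esub> emb (s y) \<in> emb ` free_ker \<Z> ?Z"
        using eq q(5)[of "emb (s x)" "emb (s y)"] unfolding \<iota>_def by simp
      then obtain f where f: "f \<in> free_ker \<Z> ?Z" "emb (s x) \<ominus>\<^bsub>V\<^esub> emb (s y) = emb f" by (elim imageE)
      have "emb f = emb (s x \<ominus>\<^bsub>?F\<^esub> s y)"
        unfolding f(2)[symmetric] V_minus F_minus(1)[OF s(1)[OF x] s(1)[OF y]] by (simp add: emb_def fun_eq_iff)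
      then have fe: "f = s x \<ominus>\<^bsub>?F\<^esub> s y" by (rule emb_inj)
      have fF: "f \<in> carrier ?F" "free_eval \<Z> ?Z f = \<zero>" using f(1) by (simp_all add: free_ker_def)
      have "s x = f \<oplus>\<^bsub>?F\<^esub> s y" unfolding fe by (rule F.M.minus_add_cancel(1)[OF s(1)[OF x] s(1)[OF y], symmetric])
      then have "x = free_eval \<Z> ?Z (f \<oplus>\<^bsub>?F\<^esub> s y)" using s(2)[OF x] by simp
      also have "\<dots> = y" using mod_homD(3)[OF ev fF(1) s(1)[OF y]] F.M.a_closed[OF fF(1) s(1)[OF y]] fF s[OF y] y
        by (simp del: free_mod_simps)
      finally show "x = y" .
    qed
  qed
qed

text \<open>The coinduced module of additive maps from R to D, with R acting through the argument.
  Extensional functions make equality of maps equality on R.\<close>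

definition coind :: "('a, 'r) ring_scheme \<Rightarrow> (int, 'd) module \<Rightarrow> ('a, 'a \<Rightarrow> 'd) module"
  where "coind R D = \<lparr>carrier = {h \<in> carrier R \<rightarrow>\<^sub>E carrier D.
      \<forall>r\<in>carrier R. \<forall>s\<in>carrier R. h (r \<oplus>\<^bsub>R\<^esub> s) = h r \<oplus>\<^bsub>D\<^esub> h s},
    monoid.mult = undefined, monoid.one = undefined, ring.zero = (\<lambda>r\<in>carrier R. \<zero>\<^bsub>D\<^esub>),
    ring.add = (\<lambda>f g. \<lambda>r\<in>carrier R. f r \<oplus>\<^bsub>D\<^esub> g r), smult = (\<lambda>s f. \<lambda>r\<in>carrier R. f (r \<otimes>\<^bsub>R\<^esub> s))\<rparr>"

lemma coind_simps [simp]: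
  "\<zero>\<^bsub>coind R D\<^esub> = (\<lambda>r\<in>carrier R. \<zero>\<^bsub>D\<^esub>)" "f \<oplus>\<^bsub>coind R D\<^esub> g = (\<lambda>r\<in>carrier R. f r \<oplus>\<^bsub>D\<^esub> g r)"
  "s \<odot>\<^bsub>coind R D\<^esub> f = (\<lambda>r\<in>carrier R. f (r \<otimes>\<^bsub>R\<^esub> s))"
  by (simp_all add: coind_def)

lemma coind_carrierI:
  assumes "\<And>r. r \<in> carrier R \<Longrightarrow> h r \<in> carrier D" "h \<in> extensional (carrier R)"
    "\<And>r s. r \<in> carrier R \<Longrightarrow> s \<in> carrier R \<Longrightarrow> h (r \<oplus>\<^bsub>R\<^esub> s) = h r \<oplus>\<^bsub>D\<^esub> h s"
  shows "h \<in> carrier (coind R D)"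
  using assms by (auto simp: coind_def PiE_def)

lemma coind_carrierD:
  assumes "h \<in> carrier (coind R D)"
  shows "\<And>r. r \<in> carrier R \<Longrightarrow> h r \<in> carrier D" "h \<in> extensional (carrier R)"
    "\<And>r s. r \<in> carrier R \<Longrightarrow> s \<in> carrier R \<Longrightarrow> h (r \<oplus>\<^bsub>R\<^esub> s) = h r \<oplus>\<^bsub>D\<^esub> h s"
  using assms by (auto simp: coind_def PiE_def)

lemma (in cring) coind_module:
  assumes D: "module \<Z> D"
  shows "module R (coind R D)"
proof -
  interpret D: module \<Z> D by fact
  show ?thesis
  proof (rule moduleI)
    show "abelian_group (coind R D)"
    proof (rule abelian_groupI)
      show "\<zero>\<^bsub>coind R D\<^esub> \<in> carrier (coind R D)" by (rule coind_carrierI) auto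
      fix f assume f: "f \<in> carrier (coind R D)"
      note fD = coind_carrierD[OF f]
      show "\<zero>\<^bsub>coind R D\<^esub> \<oplus>\<^bsub>coind R D\<^esub> f = f"
        by (rule extensionalityI[OF _ fD(2)]) (use fD(1) in auto)
      have "(\<lambda>r\<in>carrier R. \<ominus>\<^bsub>D\<^esub> f r) \<in> carrier (coind R D)"
        by (rule coind_carrierI) (use fD(1,3) in \<open>auto simp: D.M.minus_add D.M.a_ac\<close>)
      moreover have "(\<lambda>r\<in>carrier R. \<ominus>\<^bsub>D\<^esub> f r) \<oplus>\<^bsub>coind R D\<^esub> f = \<zero>\<^bsub>coind R D\<^esub>"
        using fD(1) by (auto simp: D.M.l_neg intro!: restrict_ext)
      ultimately show "\<exists>g\<in>carrier (coind R D). g \<oplus>\<^bsub>coind R D\<^esub> f = \<zero>\<^bsub>coind R D\<^esub>" by - (rule bexI)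
      fix g assume g: "g \<in> carrier (coind R D)"
      note gD = coind_carrierD[OF g]
      show "f \<oplus>\<^bsub>coind R D\<^esub> g \<in> carrier (coind R D)"
        by (rule coind_carrierI) (use fD(1,3) gD(1,3) in \<open>auto simp: D.M.a_ac\<close>)
      show "f \<oplus>\<^bsub>coind R D\<^esub> g = g \<oplus>\<^bsub>coind R D\<^esub> f"
        using fD(1) gD(1) by (auto simp: D.M.a_comm intro!: restrict_ext)
      fix h assume h: "h \<in> carrier (coind R D)"
      note hD = coind_carrierD[OF h]
      show "f \<oplus>\<^bsub>coind R D\<^esub> g \<oplus>\<^bsub>coind R D\<^esub> h = f \<oplus>\<^bsub>coind R D\<^esub> (g \<oplus>\<^bsub>coind R D\<^esub> h)"
        using fD(1) gD(1) hD(1) by (auto simp: D.M.a_assoc intro!: restrict_ext)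
    qed
  next
    fix s f assume s: "s \<in> carrier R" and f: "f \<in> carrier (coind R D)"
    note fD = coind_carrierD[OF f]
    show "s \<odot>\<^bsub>coind R D\<^esub> f \<in> carrier (coind R D)"
      by (rule coind_carrierI) (use fD(1,3) s in \<open>auto simp: l_distr\<close>)
    show "s \<odot>\<^bsub>coind R D\<^esub> (f \<oplus>\<^bsub>coind R D\<^esub> g) = s \<odot>\<^bsub>coind R D\<^esub> f \<oplus>\<^bsub>coind R D\<^esub> s \<odot>\<^bsub>coind R D\<^esub> g" for g
      using s by (auto intro!: restrict_ext)
    fix t assume t: "t \<in> carrier R"
    show "(s \<oplus> t) \<odot>\<^bsub>coind R D\<^esub> f = s \<odot>\<^bsub>coind R D\<^esub> f \<oplus>\<^bsub>coind R D\<^esub> t \<odot>\<^bsub>coind R D\<^esub> f"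
      using s t fD(3) by (auto simp: r_distr intro!: restrict_ext)
    show "(s \<otimes> t) \<odot>\<^bsub>coind R D\<^esub> f = s \<odot>\<^bsub>coind R D\<^esub> (t \<odot>\<^bsub>coind R D\<^esub> f)"
      using s t by (auto simp: m_assoc intro!: restrict_ext)
  next
    fix f assume f: "f \<in> carrier (coind R D)"
    show "\<one> \<odot>\<^bsub>coind R D\<^esub> f = f"
      by (rule extensionalityI[OF _ coind_carrierD(2)[OF f]]) auto
  qed (rule is_cring)
qed

text \<open>The adjunction between R-maps into the coinduced module and additive maps into D:
  evaluate at 1, extend additively by divisibility, and return with g x r = h (r x).\<close>

lemma (in module) coind_extends:
  assumes D: "module \<Z> D"
    and div: "\<And>n d. n > 0 \<Longrightarrow> d \<in> carrier D \<Longrightarrow> \<exists>e\<in>carrier D. n \<odot>\<^bsub>D\<^esub> e = d"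
    and A: "submodule A R M" and f: "f \<in> mod_hom R (M\<lparr>carrier := A\<rparr>) (coind R D)"
  shows "\<exists>g\<in>mod_hom R M (coind R D). \<forall>x\<in>A. g x = f x"
proof -
  interpret D: module \<Z> D by fact
  let ?Z = "int_mod M"
  interpret Z: module \<Z> ?Z by (rule M.int_mod_module)
  note AE = submoduleE[OF A]
  have fD: "\<And>x. x \<in> A \<Longrightarrow> f x \<in> carrier (coind R D)"
    "\<And>x y. x \<in> A \<Longrightarrow> y \<in> A \<Longrightarrow> f (x \<oplus>\<^bsub>M\<^esub> y) = f x \<oplus>\<^bsub>coind R D\<^esub> f y"
    "\<And>r x. r \<in> carrier R \<Longrightarrow> x \<in> A \<Longrightarrow> f (r \<odot>\<^bsub>M\<^esub> x) = r \<odot>\<^bsub>coind R D\<^esub> f x"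
    using mod_homD(1,3,4)[OF f] by simp_all
  have AM: "x \<in> carrier M" if "x \<in> A" for x using AE(1) that by blast
  have AZ: "submodule A \<Z> ?Z"
  proof (rule Z.submoduleI)
    interpret A: module R "M\<lparr>carrier := A\<rparr>" by (rule submodule.submodule_is_module[OF A module_axioms])
    show "k \<odot>\<^bsub>?Z\<^esub> x \<in> A" if "x \<in> A" for k x
    proof -
      have "subgroup A (add_monoid M)" using A by (simp add: submodule_def)
      from group.int_pow_consistent[OF M.a_group this that, of k]
      have "[k] \<cdot>\<^bsub>M\<^esub> x = [k] \<cdot>\<^bsub>M\<lparr>carrier := A\<rparr>\<^esub> x" by (simp add: add_pow_def)
      moreover have "[k] \<cdot>\<^bsub>M\<lparr>carrier := A\<rparr>\<^esub> x \<in> A" using A.M.add.int_pow_closed[of x k] that by simp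
      ultimately show ?thesis by (simp add: int_mod_def)
    qed
  qed (use AE(1,3,5) submodule_zero[OF A] in \<open>simp_all add: a_inv_int_mod\<close>)
  have AZm: "module \<Z> (?Z\<lparr>carrier := A\<rparr>)" by (rule submodule.submodule_is_module[OF AZ Z.module_axioms])
  have "(\<lambda>x\<in>A. f x \<one>) \<in> mod_hom \<Z> (?Z\<lparr>carrier := A\<rparr>) D"
  proof (rule additive_int_hom[OF AZm D])
    show "(\<lambda>x\<in>A. f x \<one>) x \<in> carrier D" if "x \<in> carrier (?Z\<lparr>carrier := A\<rparr>)" for x
      using that coind_carrierD(1)[OF fD(1)] by simp
    show "(\<lambda>x\<in>A. f x \<one>) (x \<oplus>\<^bsub>?Z\<lparr>carrier := A\<rparr>\<^esub> y) = (\<lambda>x\<in>A. f x \<one>) x \<oplus>\<^bsub>D\<^esub> (\<lambda>x\<in>A. f x \<one>) y"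
      if "x \<in> carrier (?Z\<lparr>carrier := A\<rparr>)" "y \<in> carrier (?Z\<lparr>carrier := A\<rparr>)" for x y
      using that fD(2) AE(5) by simp
  qed simp
  from divisible_extends[OF Z.module_axioms D div AZ this]
  obtain h where h: "h \<in> mod_hom \<Z> ?Z D" "\<forall>x\<in>A. h x = (\<lambda>x\<in>A. f x \<one>) x" by auto
  have hD: "h x \<in> carrier D" "y \<in> carrier M \<Longrightarrow> h (x \<oplus>\<^bsub>M\<^esub> y) = h x \<oplus>\<^bsub>D\<^esub> h y" if "x \<in> carrier M" for x y
    using mod_homD(1,3)[OF h(1)] that by simp_all
  define g where "g = (\<lambda>x\<in>carrier M. \<lambda>r\<in>carrier R. h (r \<odot>\<^bsub>M\<^esub> x))"
  have "g \<in> mod_hom R M (coind R D)"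
  proof (rule mod_homI)
    fix x assume x: "x \<in> carrier M"
    show "g x \<in> carrier (coind R D)"
      by (rule coind_carrierI) (use x hD in \<open>auto simp: g_def smult_l_distr\<close>)
    show "g (x \<oplus>\<^bsub>M\<^esub> y) = g x \<oplus>\<^bsub>coind R D\<^esub> g y" if y: "y \<in> carrier M" for y
      using x y hD by (auto simp: g_def smult_r_distr intro!: restrict_ext)
    show "g (s \<odot>\<^bsub>M\<^esub> x) = s \<odot>\<^bsub>coind R D\<^esub> g x" if s: "s \<in> carrier R" for s
      using x s by (auto simp: g_def smult_assoc1 intro!: restrict_ext)
  qed (simp add: g_def)
  moreover have "g x = f x" if x: "x \<in> A" for x
  proof (rule extensionalityI[OF _ coind_carrierD(2)[OF fD(1)[OF x]]])
    show "g x \<in> extensional (carrier R)" using AM[OF x] by (simp add: g_def)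
    fix r assume r: "r \<in> carrier R"
    have "g x r = f (r \<odot>\<^bsub>M\<^esub> x) \<one>" using h(2) AE(4)[OF r x] AM[OF x] r by (simp add: g_def)
    also have "\<dots> = f x r" using fD(3)[OF r x] r by simp
    finally show "g x r = f x r" .
  qed
  ultimately show ?thesis by blast
qed

section \<open>Essential extensions and injective envelopes\<close>

lemma (in module) submodule_of_submodule:
  assumes H: "submodule H R M" and K: "submodule K R (M\<lparr>carrier := H\<rparr>)"
  shows "submodule K R M" "K \<subseteq> H"
proof -
  interpret H: module R "M\<lparr>carrier := H\<rparr>" by (rule submodule.submodule_is_module[OF H module_axioms])
  show "K \<subseteq> H" using H.submoduleE(1)[OF K] by simp
  show "submodule K R M"
  proof (rule module_incl_imp_submodule)
    show "K \<subseteq> carrier M" using \<open>K \<subseteq> H\<close> submoduleE(1)[OF H] by blast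
    show "module R (M\<lparr>carrier := K\<rparr>)" using submodule.submodule_is_module[OF K H.module_axioms] by simp
  qed
qed

lemma (in module) ex_max_essential:
  assumes S: "submodule S R M"
  obtains H where "submodule H R M" "S \<subseteq> H" "\<And>K. submodule K R M \<Longrightarrow> K \<subseteq> H \<Longrightarrow> K \<inter> S = {\<zero>\<^bsub>M\<^esub>} \<Longrightarrow> K = {\<zero>\<^bsub>M\<^esub>}"
    "\<And>H'. submodule H' R M \<Longrightarrow> H \<subseteq> H' \<Longrightarrow>
      (\<And>K. submodule K R M \<Longrightarrow> K \<subseteq> H' \<Longrightarrow> K \<inter> S = {\<zero>\<^bsub>M\<^esub>} \<Longrightarrow> K = {\<zero>\<^bsub>M\<^esub>}) \<Longrightarrow> H' = H"
proof -
  let ?A = "{H. submodule H R M \<and> S \<subseteq> H \<and> (\<forall>K. submodule K R M \<and> K \<subseteq> H \<and> K \<inter> S = {\<zero>\<^bsub>M\<^esub>} \<longrightarrow> K = {\<zero>\<^bsub>M\<^esub>})}"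
  have "\<exists>H\<in>?A. \<forall>H'\<in>?A. H \<subseteq> H' \<longrightarrow> H' = H"
  proof (rule subset_Zorn_nonempty)
    have "S \<in> ?A" using S by auto
    then show "?A \<noteq> {}" by blast
    fix C assume C: "C \<noteq> {}" "subset.chain ?A C"
    have CA: "submodule H R M" "S \<subseteq> H" "\<And>K. submodule K R M \<Longrightarrow> K \<subseteq> H \<Longrightarrow> K \<inter> S = {\<zero>\<^bsub>M\<^esub>} \<Longrightarrow> K = {\<zero>\<^bsub>M\<^esub>}" if "H \<in> C" for H
      using that C(2) unfolding subset_chain_def by blast+
    have "subset.chain {K. submodule K R M} C" using C(2) by (auto simp: subset_chain_def)
    then have "submodule (\<Union>C) R M" by (rule submodule_chain_Union[OF C(1)])
    moreover have "S \<subseteq> \<Union>C" using C(1) CA(2) by blast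
    moreover have "K = {\<zero>\<^bsub>M\<^esub>}" if K: "submodule K R M" "K \<subseteq> \<Union>C" "K \<inter> S = {\<zero>\<^bsub>M\<^esub>}" for K
    proof -
      have "x = \<zero>\<^bsub>M\<^esub>" if x: "x \<in> K" for x
      proof -
        obtain H where H: "H \<in> C" "x \<in> H" using K(2) x by blast
        \<comment> \<open>Essentiality passes to the union of a chain since each element of K lies
          in one member H and can be tested there.\<close>
        have "K \<inter> H = {\<zero>\<^bsub>M\<^esub>}"
        proof (rule CA(3)[OF H(1)])
          show "submodule (K \<inter> H) R M" by (rule submodule_inter[OF K(1) CA(1)[OF H(1)]])
          show "K \<inter> H \<inter> S = {\<zero>\<^bsub>M\<^esub>}" using K(3) CA(2)[OF H(1)] by blast
        qed simp
        then show ?thesis using x H(2) by blast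
      qed
      then show ?thesis using submodule_zero[OF K(1)] by blast
    qed
    ultimately show "\<Union>C \<in> ?A" by blast
  qed
  then obtain H where H: "H \<in> ?A" "\<forall>H'\<in>?A. H \<subseteq> H' \<longrightarrow> H' = H" by (elim bexE)
  show ?thesis
  proof (rule that[of H])
    show "submodule H R M" "S \<subseteq> H" "\<And>K. submodule K R M \<Longrightarrow> K \<subseteq> H \<Longrightarrow> K \<inter> S = {\<zero>\<^bsub>M\<^esub>} \<Longrightarrow> K = {\<zero>\<^bsub>M\<^esub>}"
      using H(1) by auto
    fix H' assume H': "submodule H' R M" "H \<subseteq> H'" "\<And>K. submodule K R M \<Longrightarrow> K \<subseteq> H' \<Longrightarrow> K \<inter> S = {\<zero>\<^bsub>M\<^esub>} \<Longrightarrow> K = {\<zero>\<^bsub>M\<^esub>}"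
    have "S \<subseteq> H" using H(1) by simp
    then have "H' \<in> ?A" using H' by auto
    then show "H' = H" using H(2) H'(2) by simp
  qed
qed

lemma (in module) submodule_preimage_hom:
  assumes f: "f \<in> mod_hom R M E" and E: "module R E" and V: "submodule V R E"
  shows "submodule {x \<in> carrier M. f x \<in> V} R M"
proof -
  interpret E: module R E by fact
  note fD = mod_homD[OF f] and VE = E.submoduleE[OF V]
  show ?thesis
  proof (rule submoduleI)
    show "\<zero>\<^bsub>M\<^esub> \<in> {x \<in> carrier M. f x \<in> V}"
      using mod_hom_zero[OF f module_axioms E] E.submodule_zero[OF V] by simp
    fix a assume a: "a \<in> {x \<in> carrier M. f x \<in> V}"
    then show "\<ominus>\<^bsub>M\<^esub> a \<in> {x \<in> carrier M. f x \<in> V}" using mod_hom_minus[OF f module_axioms E] VE(3) by simp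
    show "a \<oplus>\<^bsub>M\<^esub> b \<in> {x \<in> carrier M. f x \<in> V}" if "b \<in> {x \<in> carrier M. f x \<in> V}" for b
      using a that fD(3) VE(5) by simp
    show "r \<odot>\<^bsub>M\<^esub> a \<in> {x \<in> carrier M. f x \<in> V}" if "r \<in> carrier R" for r using a that fD(4) VE(4) by simp
  qed auto
qed

text \<open>A maximal essential extension inside an injective module is a direct summand: extend the projection
  from \<open>C \<oplus> H\<close>, with \<open>C\<close> a maximal complement of \<open>H\<close>, to an endomorphism \<open>q\<close>. Its kernel is \<open>C\<close>,
  so the image of \<open>q\<close> is again essential over \<open>S\<close>.\<close>

lemma (in module) ex_injective_hull_retraction:
  assumes inj: "\<And>A f. submodule A R M \<Longrightarrow> f \<in> mod_hom R (M\<lparr>carrier := A\<rparr>) M \<Longrightarrow> \<exists>g\<in>mod_hom R M M. \<forall>x\<in>A. g x = f x"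
    and S: "submodule S R M"
  shows "\<exists>H q. submodule H R M \<and> S \<subseteq> H \<and> (\<forall>K. submodule K R M \<and> K \<subseteq> H \<and> K \<inter> S = {\<zero>\<^bsub>M\<^esub>} \<longrightarrow> K = {\<zero>\<^bsub>M\<^esub>}) \<and>
    q \<in> mod_hom R M M \<and> (\<forall>x\<in>carrier M. q x \<in> H) \<and> (\<forall>x\<in>H. q x = x)"
proof -
  obtain H where H: "submodule H R M" "S \<subseteq> H" "\<And>K. submodule K R M \<Longrightarrow> K \<subseteq> H \<Longrightarrow> K \<inter> S = {\<zero>\<^bsub>M\<^esub>} \<Longrightarrow> K = {\<zero>\<^bsub>M\<^esub>}"
    and max: "\<And>H'. submodule H' R M \<Longrightarrow> H \<subseteq> H' \<Longrightarrow>
      (\<And>K. submodule K R M \<Longrightarrow> K \<subseteq> H' \<Longrightarrow> K \<inter> S = {\<zero>\<^bsub>M\<^esub>} \<Longrightarrow> K = {\<zero>\<^bsub>M\<^esub>}) \<Longrightarrow> H' = H"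
    by (rule ex_max_essential[OF S]) blast
  obtain C where C: "submodule C R M" "C \<inter> H = {\<zero>\<^bsub>M\<^esub>}"
    "\<And>K'. submodule K' R M \<Longrightarrow> C \<subseteq> K' \<Longrightarrow> K' \<inter> H = {\<zero>\<^bsub>M\<^esub>} \<Longrightarrow> K' = C"
    by (rule ex_max_complement[OF H(1) carrier_is_submodule]) (metis submoduleE(1))
  note HE = submoduleE[OF H(1)] and CE = submoduleE[OF C(1)]
  have HM: "x \<in> carrier M" if "x \<in> H" for x using HE(1) that by blast
  have CM: "x \<in> carrier M" if "x \<in> C" for x using CE(1) that by blast
  let ?A = "C <+>\<^bsub>M\<^esub> H"
  have A: "submodule ?A R M" by (rule submodule_set_add[OF C(1) H(1)])
  have uniq: "h = h'" if "c \<in> C" "h \<in> H" "c' \<in> C" "h' \<in> H" "c \<oplus>\<^bsub>M\<^esub> h = c' \<oplus>\<^bsub>M\<^esub> h'" for c h c' h'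
  proof -
    have "c \<ominus>\<^bsub>M\<^esub> c' = h' \<ominus>\<^bsub>M\<^esub> h" using that CM HM by (intro M.add_eq_swap) auto
    moreover have "c \<ominus>\<^bsub>M\<^esub> c' \<in> C" "h' \<ominus>\<^bsub>M\<^esub> h \<in> H" using that submodule_minus C(1) H(1) by auto
    ultimately have "h' \<ominus>\<^bsub>M\<^esub> h = \<zero>\<^bsub>M\<^esub>" using C(2) by auto
    then show ?thesis using that HM by (simp add: M.a_minus_eq_zero_iff)
  qed
  define \<pi> where "\<pi> = (\<lambda>z\<in>?A. THE h. h \<in> H \<and> (\<exists>c\<in>C. z = c \<oplus>\<^bsub>M\<^esub> h))"
  have \<pi>: "\<pi> (c \<oplus>\<^bsub>M\<^esub> h) = h" if "c \<in> C" "h \<in> H" for c h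
  proof -
    have "c \<oplus>\<^bsub>M\<^esub> h \<in> ?A" using that unfolding set_add_iff by blast
    moreover have "(THE h'. h' \<in> H \<and> (\<exists>c'\<in>C. c \<oplus>\<^bsub>M\<^esub> h = c' \<oplus>\<^bsub>M\<^esub> h')) = h"
      by (rule the_equality) (use that uniq in blast)+
    ultimately show ?thesis by (simp add: \<pi>_def)
  qed
  have "\<pi> \<in> mod_hom R (M\<lparr>carrier := ?A\<rparr>) M"
  proof (rule mod_homI)
    fix x assume "x \<in> carrier (M\<lparr>carrier := ?A\<rparr>)"
    then obtain c h where x: "c \<in> C" "h \<in> H" "x = c \<oplus>\<^bsub>M\<^esub> h" by (auto simp: set_add_iff)
    show "\<pi> x \<in> carrier M" using \<pi>[OF x(1,2)] HM[OF x(2)] x(3) by simp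
    show "\<pi> (x \<oplus>\<^bsub>M\<lparr>carrier := ?A\<rparr>\<^esub> y) = \<pi> x \<oplus>\<^bsub>M\<^esub> \<pi> y" if y': "y \<in> carrier (M\<lparr>carrier := ?A\<rparr>)" for y
    proof -
      obtain c' h' where y: "c' \<in> C" "h' \<in> H" "y = c' \<oplus>\<^bsub>M\<^esub> h'" using y' by (auto simp: set_add_iff)
      have "x \<oplus>\<^bsub>M\<^esub> y = (c \<oplus>\<^bsub>M\<^esub> c') \<oplus>\<^bsub>M\<^esub> (h \<oplus>\<^bsub>M\<^esub> h')" unfolding x(3) y(3) using x y CM HM by (simp add: M.a_ac)
      then have "\<pi> (x \<oplus>\<^bsub>M\<^esub> y) = h \<oplus>\<^bsub>M\<^esub> h'" using \<pi>[OF CE(5)[OF x(1) y(1)] HE(5)[OF x(2) y(2)]] by simp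
      then show ?thesis using \<pi>[OF x(1,2)] \<pi>[OF y(1,2)] x(3) y(3) by simp
    qed
    show "\<pi> (r \<odot>\<^bsub>M\<lparr>carrier := ?A\<rparr>\<^esub> x) = r \<odot>\<^bsub>M\<^esub> \<pi> x" if r: "r \<in> carrier R" for r
    proof -
      have "r \<odot>\<^bsub>M\<^esub> x = r \<odot>\<^bsub>M\<^esub> c \<oplus>\<^bsub>M\<^esub> r \<odot>\<^bsub>M\<^esub> h" unfolding x(3) using x CM HM r by (simp add: smult_r_distr)
      then have "\<pi> (r \<odot>\<^bsub>M\<^esub> x) = r \<odot>\<^bsub>M\<^esub> h" using \<pi>[OF CE(4)[OF r x(1)] HE(4)[OF r x(2)]] by simp
      then show ?thesis using \<pi>[OF x(1,2)] x(3) by simp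
    qed
  qed (simp add: \<pi>_def)
  from inj[OF A this] obtain q where q: "q \<in> mod_hom R M M" "\<forall>x\<in>?A. q x = \<pi> x" by (elim bexE)
  have qH: "q h = h" if h: "h \<in> H" for h
    using q(2) \<pi>[OF submodule_zero[OF C(1)] h] set_add_incr(2)[OF C(1) H(1)] h HM[OF h] by auto
  have qC: "q c = \<zero>\<^bsub>M\<^esub>" if c: "c \<in> C" for c
    using q(2) \<pi>[OF c submodule_zero[OF H(1)]] set_add_incr(1)[OF C(1) H(1)] c CM[OF c] by auto
  let ?I = "q ` carrier M"
  have I: "submodule ?I R M" by (rule submodule_mod_hom_image[OF q(1) module_axioms carrier_is_submodule])
  have HI: "H \<subseteq> ?I"
  proof
    fix h assume "h \<in> H"
    then show "h \<in> ?I" using qH[of h] HM[of h] by (metis imageI)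
  qed
  have "?I = H"
  proof (rule max[OF I HI])
    fix K assume K: "submodule K R M" "K \<subseteq> ?I" "K \<inter> S = {\<zero>\<^bsub>M\<^esub>}"
    have KH: "K \<inter> H = {\<zero>\<^bsub>M\<^esub>}"
    proof (rule H(3)[OF submodule_inter[OF K(1) H(1)]])
      show "K \<inter> H \<inter> S = {\<zero>\<^bsub>M\<^esub>}" using K(3) H(2) by blast
    qed simp
    let ?C = "{x \<in> carrier M. q x \<in> K}"
    \<comment> \<open>The preimage of K under q meets H in K \<inter> H = 0, because q is the
      identity on H; so it equals the maximal complement C, on which q vanishes, and K is
      zero.\<close>
    have "?C = C"
    proof (rule C(3))
      show "submodule ?C R M" by (rule submodule_preimage_hom[OF q(1) module_axioms K(1)])
      show "C \<subseteq> ?C" using CM qC submodule_zero[OF K(1)] by auto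
      show "?C \<inter> H = {\<zero>\<^bsub>M\<^esub>}"
      proof (intro equalityI subsetI)
        fix x assume x: "x \<in> ?C \<inter> H"
        then have "x \<in> K \<inter> H" using qH[of x] by simp
        then show "x \<in> {\<zero>\<^bsub>M\<^esub>}" unfolding KH .
      next
        fix x assume "x \<in> {\<zero>\<^bsub>M\<^esub>}"
        then show "x \<in> ?C \<inter> H" using submodule_zero[OF H(1)] submodule_zero[OF K(1)] qH[of x] by simp
      qed
    qed
    have "k = \<zero>\<^bsub>M\<^esub>" if k: "k \<in> K" for k
    proof -
      obtain x where x: "x \<in> carrier M" "k = q x" using K(2) k by blast
      have "x \<in> ?C" using x k by simp
      then show ?thesis unfolding \<open>?C = C\<close> using qC x(2) by simp
    qed
    then show "K = {\<zero>\<^bsub>M\<^esub>}" using submodule_zero[OF K(1)] by blast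
  qed
  then have "\<forall>x\<in>carrier M. q x \<in> H" by blast
  moreover have "\<forall>K. submodule K R M \<and> K \<subseteq> H \<and> K \<inter> S = {\<zero>\<^bsub>M\<^esub>} \<longrightarrow> K = {\<zero>\<^bsub>M\<^esub>}" using H(3) by blast
  ultimately show ?thesis using H(1,2) q(1) qH by blast
qed

text \<open>M embeds by x to the map sending r to \<iota> (r x), and evaluation at 1 shows
  injectivity. The hull H found inside is a retract, so extensions into the coinduced module are
  pushed into H by q.\<close>

lemma (in module) ex_injective_envelope:
  "\<exists>(E :: ('a, 'a \<Rightarrow> ('c \<Rightarrow> rat) set) module) i. injective_envelope R M E i"
proof -
  obtain D :: "(int, ('c \<Rightarrow> rat) set) module" and \<iota> where D: "module \<Z> D"
    and div: "\<forall>n>0. \<forall>d\<in>carrier D. \<exists>e\<in>carrier D. n \<odot>\<^bsub>D\<^esub> e = d"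
    and \<iota>: "\<forall>x\<in>carrier M. \<iota> x \<in> carrier D" "\<forall>x\<in>carrier M. \<forall>y\<in>carrier M. \<iota> (x \<oplus>\<^bsub>M\<^esub> y) = \<iota> x \<oplus>\<^bsub>D\<^esub> \<iota> y"
      "inj_on \<iota> (carrier M)"
    using M.ex_divisible_embedding by (elim exE conjE) (rule that)
  have div': "\<exists>e\<in>carrier D. n \<odot>\<^bsub>D\<^esub> e = d" if "n > 0" "d \<in> carrier D" for n d using div that by blast
  let ?E = "coind R D"
  have Em: "module R ?E" by (rule coind_module[OF D])
  then interpret E: module R ?E .
  define i where "i = (\<lambda>x\<in>carrier M. \<lambda>r\<in>carrier R. \<iota> (r \<odot>\<^bsub>M\<^esub> x))"
  have i: "i \<in> mod_hom R M ?E"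
  proof (rule mod_homI)
    fix x assume x: "x \<in> carrier M"
    show "i x \<in> carrier ?E"
      by (rule coind_carrierI) (use x \<iota> in \<open>auto simp: i_def smult_l_distr\<close>)
    show "i (x \<oplus>\<^bsub>M\<^esub> y) = i x \<oplus>\<^bsub>?E\<^esub> i y" if y: "y \<in> carrier M" for y
      using x y \<iota>(2) by (auto simp: i_def smult_r_distr intro!: restrict_ext)
    show "i (s \<odot>\<^bsub>M\<^esub> x) = s \<odot>\<^bsub>?E\<^esub> i x" if s: "s \<in> carrier R" for s
      using x s by (auto simp: i_def smult_assoc1 intro!: restrict_ext)
  qed (simp add: i_def)
  have i_inj: "inj_on i (carrier M)"
  proof (rule inj_onI)
    fix x y assume xy: "x \<in> carrier M" "y \<in> carrier M" "i x = i y"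
    have "\<iota> x = \<iota> y" using fun_cong[OF xy(3), of \<one>] xy(1,2) by (simp add: i_def)
    then show "x = y" using \<iota>(3) xy(1,2) by (simp add: inj_on_def)
  qed
  have S: "submodule (i ` carrier M) R ?E" by (rule submodule_mod_hom_image[OF i Em carrier_is_submodule])
  have ext: "\<exists>g\<in>mod_hom R ?E ?E. \<forall>x\<in>A. g x = f x"
    if "submodule A R ?E" "f \<in> mod_hom R (?E\<lparr>carrier := A\<rparr>) ?E" for A f
    by (rule E.coind_extends[OF D div' that])
  have "\<exists>H q. submodule H R ?E \<and> i ` carrier M \<subseteq> H \<and>
      (\<forall>K. submodule K R ?E \<and> K \<subseteq> H \<and> K \<inter> i ` carrier M = {\<zero>\<^bsub>?E\<^esub>} \<longrightarrow> K = {\<zero>\<^bsub>?E\<^esub>}) \<and>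
      q \<in> mod_hom R ?E ?E \<and> (\<forall>x\<in>carrier ?E. q x \<in> H) \<and> (\<forall>x\<in>H. q x = x)"
    by (rule E.ex_injective_hull_retraction[OF _ S]) (rule ext)
  then obtain H q where H: "submodule H R ?E" "i ` carrier M \<subseteq> H"
    and ess: "\<forall>K. submodule K R ?E \<and> K \<subseteq> H \<and> K \<inter> i ` carrier M = {\<zero>\<^bsub>?E\<^esub>} \<longrightarrow> K = {\<zero>\<^bsub>?E\<^esub>}"
    and q: "q \<in> mod_hom R ?E ?E" "\<forall>x\<in>carrier ?E. q x \<in> H" "\<forall>x\<in>H. q x = x"
    by (elim exE conjE) (rule that)
  let ?H = "?E\<lparr>carrier := H\<rparr>"
  have Hm: "module R ?H" by (rule submodule.submodule_is_module[OF H(1) Em])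
  have HE: "x \<in> carrier ?E" if "x \<in> H" for x using E.submoduleE(1)[OF H(1)] that by blast
  have "injective_module R ?H" unfolding injective_module_def
  proof (intro conjI allI impI ballI Hm)
    fix B :: "('a, 'a + ('a \<Rightarrow> ('c \<Rightarrow> rat) set)) module" and A f
    assume BA: "module R B \<and> submodule A R B" and f: "f \<in> mod_hom R (B\<lparr>carrier := A\<rparr>) ?H"
    interpret B: module R B using BA by simp
    have A: "submodule A R B" using BA by simp
    note fD = mod_homD[OF f]
    have fE: "f \<in> mod_hom R (B\<lparr>carrier := A\<rparr>) ?E"
      by (rule mod_homI) (use fD HE in \<open>simp_all del: coind_simps\<close>)
    have "\<exists>g\<in>mod_hom R B ?E. \<forall>x\<in>A. g x = f x" by (rule B.coind_extends[OF D _ A fE]) (rule div')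
    then obtain g where g: "g \<in> mod_hom R B ?E" "\<forall>x\<in>A. g x = f x" by (elim bexE)
    have qg: "(\<lambda>x\<in>carrier B. q (g x)) \<in> mod_hom R B ?E" by (rule mod_hom_compose[OF g(1) q(1) B.module_axioms])
    note qgD = mod_homD[OF qg]
    have "(\<lambda>x\<in>carrier B. q (g x)) \<in> mod_hom R B ?H"
    proof (rule mod_homI)
      show "(\<lambda>x\<in>carrier B. q (g x)) x \<in> carrier ?H" if "x \<in> carrier B" for x
        using that q(2) mod_homD(1)[OF g(1) that] by simp
    qed (use qgD in \<open>simp_all del: coind_simps restrict_apply\<close>)
    moreover have "(\<lambda>x\<in>carrier B. q (g x)) x = f x" if x: "x \<in> A" for x
    proof -
      have "x \<in> carrier B" using B.submoduleE(1)[OF A] x by blast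
      moreover have "f x \<in> H" using fD(1) x by simp
      ultimately show ?thesis using g(2) q(3) x by simp
    qed
    ultimately show "\<exists>g\<in>mod_hom R B ?H. \<forall>x\<in>A. g x = f x" by blast
  qed
  moreover have "i \<in> mod_hom R M ?H"
    by (rule mod_homI) (use mod_homD[OF i] H(2) in \<open>auto simp del: coind_simps\<close>)
  moreover have "K = {\<zero>\<^bsub>?H\<^esub>}" if K: "submodule K R ?H" "K \<inter> i ` carrier M = {\<zero>\<^bsub>?H\<^esub>}" for K
    using E.submodule_of_submodule[OF H(1) K(1)] ess K(2) by simp
  ultimately have "injective_envelope R M ?H i" unfolding injective_envelope_def using i_inj by blast
  then show ?thesis by blast
qed

section \<open>The main theorem\<close>

context w_mod
begin

text \<open>If no finite subfamily reaches N, each can be enlarged with a strictly smaller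
  intersection, and dependent choice gives a strictly descending chain.\<close>

lemma gv_dcc_imp_cofg:
  assumes dcc: "gv_dcc (carrier M)" and N: "gv_closed R M N"
  shows "gv_cofg R M N (carrier M)"
proof (rule gv_cofgI)
  fix \<F> assume F: "\<And>V. V \<in> \<F> \<Longrightarrow> gv_closed R M V" "\<And>V. V \<in> \<F> \<Longrightarrow> N \<subseteq> V" "carrier M \<inter> \<Inter>\<F> = N"
  have NM: "N \<subseteq> carrier M" using gv_closedD(2)[OF N] by auto
  show "\<exists>T. finite T \<and> T \<subseteq> \<F> \<and> carrier M \<inter> \<Inter>T = N"
  proof (rule ccontr)
    assume none: "\<nexists>T. finite T \<and> T \<subseteq> \<F> \<and> carrier M \<inter> \<Inter>T = N"
    have step: "\<exists>T'. (finite T' \<and> T' \<subseteq> \<F>) \<and> carrier M \<inter> \<Inter>T' \<subset> carrier M \<inter> \<Inter>T" if T: "finite T \<and> T \<subseteq> \<F>" for T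
    proof -
      have "carrier M \<inter> \<Inter>T \<noteq> N" using none T by blast
      moreover have "N \<subseteq> carrier M \<inter> \<Inter>T" using F(2) T NM by blast
      ultimately have "\<not> carrier M \<inter> \<Inter>T \<subseteq> carrier M \<inter> \<Inter>\<F>" unfolding F(3) by (metis subset_antisym)
      then obtain V where V: "V \<in> \<F>" "\<not> carrier M \<inter> \<Inter>T \<subseteq> V" by blast
      then have "carrier M \<inter> \<Inter>(insert V T) \<subset> carrier M \<inter> \<Inter>T" by auto
      then show ?thesis using T V(1) by (intro exI[of _ "insert V T"]) simp
    qed
    have "\<exists>f. \<forall>n. (finite (f n) \<and> f n \<subseteq> \<F>) \<and> carrier M \<inter> \<Inter>(f (Suc n)) \<subset> carrier M \<inter> \<Inter>(f n)"
    proof (rule dependent_nat_choice[where P = "\<lambda>_ T. finite T \<and> T \<subseteq> \<F>"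
          and Q = "\<lambda>_ T T'. carrier M \<inter> \<Inter>T' \<subset> carrier M \<inter> \<Inter>T"])
      show "\<exists>T. finite T \<and> T \<subseteq> \<F>" by blast
    qed (rule step)
    then obtain f where f': "\<forall>n. (finite (f n) \<and> f n \<subseteq> \<F>) \<and> carrier M \<inter> \<Inter>(f (Suc n)) \<subset> carrier M \<inter> \<Inter>(f n)"
      by (elim exE)
    have f: "\<forall>n. finite (f n) \<and> f n \<subseteq> \<F>" "\<forall>n. carrier M \<inter> \<Inter>(f (Suc n)) \<subset> carrier M \<inter> \<Inter>(f n)"
      using f' by blast+
    have "\<exists>n. \<forall>k\<ge>n. carrier M \<inter> \<Inter>(f k) = carrier M \<inter> \<Inter>(f n)"
    proof (rule dcc[unfolded gv_dcc_def, rule_format])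
      fix n
      have "gv_closed R M (carrier M \<inter> \<Inter>(f n))" using f(1) F(1) by (intro gv_closed_Inter) blast
      then show "gv_closed R M (carrier M \<inter> \<Inter>(f n)) \<and> carrier M \<inter> \<Inter>(f n) \<subseteq> carrier M \<and>
          carrier M \<inter> \<Inter>(f (Suc n)) \<subseteq> carrier M \<inter> \<Inter>(f n)"
        using f(2) by blast
    qed
    then obtain n where n: "\<forall>k\<ge>n. carrier M \<inter> \<Inter>(f k) = carrier M \<inter> \<Inter>(f n)" by (elim exE)
    have "carrier M \<inter> \<Inter>(f (Suc n)) = carrier M \<inter> \<Inter>(f n)" using n[rule_format, of "Suc n"] by simp
    then show False using f(2)[rule_format, of n] by blast
  qed
qed

text \<open>A chain without stability has a bad intersection, so bad closed submodules exist; Zorn's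
  lemma then gives a minimal one.\<close>

lemma ex_minimal_bad:
  assumes cof0: "gv_cofg R M {\<zero>\<^bsub>M\<^esub>} (carrier M)" and dcc: "\<not> gv_dcc (carrier M)"
  shows "\<exists>N. minimal_bad R M N"
proof -
  let ?A = "{N. gv_closed R M N \<and> \<not> gv_cofg R M N (carrier M)}"
  obtain A :: "nat \<Rightarrow> 'c set" where A: "\<forall>n. gv_closed R M (A n) \<and> A n \<subseteq> carrier M \<and> A (Suc n) \<subseteq> A n"
    "\<not> (\<exists>n. \<forall>k\<ge>n. A k = A n)"
    using dcc unfolding gv_dcc_def by (auto simp del: not_ex)
  have "gv_closed R M (carrier M \<inter> \<Inter>(range A))" using A(1) by (intro gv_closed_Inter) auto
  moreover have eq: "carrier M \<inter> \<Inter>(range A) = \<Inter>(range A)" using A(1) by blast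
  moreover have "\<not> gv_cofg R M (\<Inter>(range A)) (carrier M)" using gv_chain_stable[of A] A by blast
  ultimately have "\<Inter>(range A) \<in> ?A" by simp
  then have ne: "?A \<noteq> {}" by blast
  have "\<exists>N\<in>?A. \<forall>K\<in>?A. K \<subseteq> N \<longrightarrow> K = N"
  proof (rule Zorn_Inter[OF ne])
    fix C assume C: "C \<noteq> {}" "subset.chain ?A C"
    have CA: "gv_closed R M K" "\<not> gv_cofg R M K (carrier M)" if "K \<in> C" for K
      using that C(2) by (auto simp: subset_chain_def)
    have CM: "K \<subseteq> carrier M" if "K \<in> C" for K using gv_closedD(2)[OF CA(1)[OF that]] by blast
    have eqC: "carrier M \<inter> \<Inter>C = \<Inter>C" using C(1) CM by blast
    have cl: "gv_closed R M (\<Inter>C)" using gv_closed_Inter[of C] CA(1) unfolding eqC by blast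
    have "\<not> gv_cofg R M (\<Inter>C) (carrier M)"
    proof
      assume cof: "gv_cofg R M (\<Inter>C) (carrier M)"
      obtain T where T: "finite T" "T \<subseteq> C" "carrier M \<inter> \<Inter>T = \<Inter>C"
        by (rule gv_cofgD[OF cof CA(1) _ eqC]) auto
      \<comment> \<open>A finite nonempty part of a chain contains its intersection; if the finite
        part is empty, the intersection is all of M and so is every member of C.\<close>
      obtain K where K: "K \<in> C" "\<Inter>C = K"
      proof (cases "T = {}")
        case True
        obtain K where K: "K \<in> C" using C(1) by blast
        have "\<Inter>C = K" using T(3) True K CM[OF K] by blast
        then show ?thesis using that K by blast
      next
        case False
        have "subset.chain ?A T" using T(2) C(2) unfolding subset_chain_def by blast
        then have "\<Inter>T \<in> T" by (rule Inter_in_chain[OF T(1) False])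
        moreover have "\<Inter>C = \<Inter>T" using T(2,3) CM calculation by blast
        ultimately show ?thesis using that T(2) by blast
      qed
      then show False using CA(2)[OF K(1)] cof by simp
    qed
    then show "\<Inter>C \<in> ?A" using cl by simp
  qed
  then obtain N where N: "N \<in> ?A" "\<forall>K\<in>?A. K \<subseteq> N \<longrightarrow> K = N" by (elim bexE)
  have "minimal_bad R M N"
  proof
    show "gv_cofg R M N' (carrier M)" if "gv_closed R M N'" "N' \<subset> N" for N'
    proof (rule ccontr)
      assume "\<not> gv_cofg R M N' (carrier M)"
      then have "N' \<in> ?A" using that(1) by simp
      then show False using N(2) that(2) by blast
    qed
  qed (use cof0 N(1) in auto)
  then show ?thesis by blast
qed

lemma prime_part_subset_ann_mod:
  assumes "primeideal P R"
  shows "prime_part R M P \<subseteq> ann_mod M P"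
proof
  interpret P: primeideal P R by fact
  \<comment> \<open>The index s = 1 contributes the annihilated part itself.\<close>
  have "\<one> \<in> carrier R - P" using P.I_notcarr P.one_imp_carrier by blast
  moreover fix x assume "x \<in> prime_part R M P"
  ultimately have "x \<in> (\<lambda>x. \<one> \<odot>\<^bsub>M\<^esub> x) ` ann_mod M P" unfolding prime_part_def by blast
  then show "x \<in> ann_mod M P" by (auto simp: ann_mod_def)
qed

end

text \<open>Makes p eligible in condition (2), which then supplies the submodule Q between M[p] and
  the annihilated part.\<close>

lemma (in minimal_bad) p_w_prime: "prime_w_ideal R p" "ann_ring R M \<subseteq> p"
proof -
  have "w_ideal R p" by (rule w_idealI[OF p_ideal]) (rule p_closed)
  then show "prime_w_ideal R p" using p_prime by (simp add: prime_w_ideal_def)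
  show "ann_ring R M \<subseteq> p" using NM by (auto simp: ann_ring_def p_def)
qed

theorem theorem2p5:
  fixes R :: "('a, 'r) ring_scheme" and M :: "('a, 'b, 'm) module_scheme"
  assumes "cring R" and "w_module R M"
  shows "w_Artinian R M \<longleftrightarrow>
    w_cofinitely_generated R M \<and>
    (\<forall>P. prime_w_ideal R P \<and> ann_ring R M \<subseteq> P \<longrightarrow>
      (\<exists>N. w_submodule R M N \<and>
        w_cofinitely_generated R (w_envelope R (quot_mod R M N)) \<and>
        w_closure R M (prime_part R M P) \<subseteq> N \<and> N \<subseteq> ann_mod M P))"
proof -
  interpret R: cring R by fact
  interpret w_mod R M by (rule iffD1[OF R.w_module_iff assms(2)])
  \<comment> \<open>The w-envelope disappears here: the existence of an injective envelope of M/N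
    turns the condition into one about closed submodules of M.\<close>
  have env: "w_cofinitely_generated R (w_envelope R (quot_mod R M N)) \<longleftrightarrow> gv_cofg R M N (carrier M)"
    if "gv_closed R M N" for N
    by (rule w_cofinitely_generated_w_envelope_iff[OF that
          module.ex_injective_envelope[OF quot_mod_module[OF gv_closedD(1)[OF that]]]])
  show ?thesis unfolding w_Artinian_iff w_cofinitely_generated_iff w_submodule_iff
  proof (intro iffI conjI allI impI)
    assume dcc: "gv_dcc (carrier M)"
    show "gv_cofg R M {\<zero>\<^bsub>M\<^esub>} (carrier M)" by (rule gv_dcc_imp_cofg[OF dcc gv_closed_zero])
    fix P assume "prime_w_ideal R P \<and> ann_ring R M \<subseteq> P"
    then have P: "primeideal P R" by (simp add: prime_w_ideal_def)
    then have "P \<subseteq> carrier R" by (meson ideal.Icarr primeideal.axioms(1) subsetI)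
    then have cl: "gv_closed R M (ann_mod M P)" by (rule gv_closed_ann_mod)
    moreover have "w_closure R M (prime_part R M P) \<subseteq> ann_mod M P"
      by (rule w_closure_least[OF cl prime_part_subset_ann_mod[OF P]])
    ultimately show "\<exists>N. gv_closed R M N \<and> w_cofinitely_generated R (w_envelope R (quot_mod R M N)) \<and>
        w_closure R M (prime_part R M P) \<subseteq> N \<and> N \<subseteq> ann_mod M P"
      using env[OF cl] gv_dcc_imp_cofg[OF dcc cl] by blast
  next
    assume H: "gv_cofg R M {\<zero>\<^bsub>M\<^esub>} (carrier M) \<and> (\<forall>P. prime_w_ideal R P \<and> ann_ring R M \<subseteq> P \<longrightarrow>
      (\<exists>N. gv_closed R M N \<and> w_cofinitely_generated R (w_envelope R (quot_mod R M N)) \<and>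
        w_closure R M (prime_part R M P) \<subseteq> N \<and> N \<subseteq> ann_mod M P))"
    show "gv_dcc (carrier M)"
    proof (rule ccontr)
      assume "\<not> gv_dcc (carrier M)"
      then obtain N where "minimal_bad R M N" using ex_minimal_bad H by blast
      then interpret N: minimal_bad R M N .
      obtain Q where Q: "gv_closed R M Q" "w_cofinitely_generated R (w_envelope R (quot_mod R M Q))"
        "w_closure R M (prime_part R M N.p) \<subseteq> Q" "Q \<subseteq> ann_mod M N.p"
        using H N.p_w_prime by blast
      show False using N.not_cofg_above[OF Q(1,3,4)] env[OF Q(1)] Q(2) by simp
    qed
  qed
qed

end
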